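(* There exist a smooth projective morphism $\pi\colon\mathcal X\to\Delta$ over a disc $\Delta\subset\mathbf C$ centred at $0$, whose fibres are rational surfaces, an effective line bundle $L$ on $\mathcal X$, and a singular Hermitian metric $h_0=e^{-\varphi_0}$ with semipositive curvature on $L_0:=L|_{X_0}$, where $X_0=\pi^{-1}(0)$, such that $h_0$ has analytic singularities and minimal singularities and the following holds. (1) On no open neighbourhood $U\subset\mathcal X$ of $X_0$ is there a singular Hermitian metric $h$ with semipositive curvature on $L|_U$ whose restriction to $X_0$ is well defined and whose restricted weights $\psi$ satisfy $$\psi\geq\varphi_0-C$$ for some constant $C$, in compatible local trivializations. (2) The singularity of $h_0$ is supported on a smooth rational curve in $X_0$, with divisorial (generic) Lelong number $1/2$ along that curve.
   Context: Conventions. A singular Hermitian metric $h$ on a holomorphic line bundle is described by local weights: for a local holomorphic frame $e$, $|e|_h^2=e^{-\varphi}$ (squared-norm convention). It has semipositive curvature if all its local weights $\varphi$ are plurisubharmonic. The curvature current is $\Theta_h=dd^c\varphi=\frac{i}{2\pi}\partial\bar\partial\varphi$, with $d^c=\frac{\partial-\bar\partial}{4\pi i}$, so that $dd^c\log|w|^2=[w=0]$ (current of integration); Lelong numbers are taken with respect to this normalization, so the weight $\frac12\log|w|^2$ has generic Lelong number $1/2$ along $\{w=0\}$. A metric $h$ on $L|_U$, where $U$ is a neighbourhood of $X_0$, has a well-defined restriction to $X_0$ if the restrictions of its local weights to $X_0$ are defined and not identically $-\infty$. The restricted weights $\psi$ are then the local weights of the restricted metric on $L_0$. Compatible local trivializations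 means that $\psi$ and $\varphi_0$ are expressed in the same local frame of $L_0$ (the restriction to $X_0$ of a local frame of $L$). A line bundle is effective if it has a nonzero global holomorphic section. The metric $h_0$ has analytic singularities if locally $\varphi_0=c\log\sum_j|f_j|^2+O(1)$ with $c>0$ and finitely many holomorphic functions $f_j$. It has minimal singularities if for every singular Hermitian metric with semipositive curvature on $L_0$, with local weights $\varphi_T$ in the same frames, there is a constant $C$ with $\varphi_T\leq\varphi_0+C$. *)

theory Defs
  imports "HOL-Analysis.Analysis"
begin

section \<open>Several complex variables on \<open>\<complex>\<^sup>n\<close>\<close>

definition mv_holomorphic_on :: "(complex^'n \<Rightarrow> complex) \<Rightarrow> (complex^'n) set \<Rightarrow> bool" where
  "mv_holomorphic_on f W \<longleftrightarrow> open W \<and>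
     (\<forall>z\<in>W. \<exists>D. (f has_derivative D) (at z) \<and> (\<forall>c v. D (c *s v) = c * D v))"

text \<open>
  Mean value over the circle \<open>z + \<zeta> w\<close>, \<open>\<bar>\<zeta>\<bar> = 1\<close>, of a function with values in \<open>[-\<infinity>, \<infinity>)\<close>:
  integral of the positive part minus integral of the negative part. For an upper semicontinuous
  function without value \<open>\<infinity>\<close> the first integral is finite, so the difference is never \<open>\<infinity> - \<infinity>\<close>.
\<close>

definition circle_mean :: "(complex^'n \<Rightarrow> ereal) \<Rightarrow> complex^'n \<Rightarrow> complex^'n \<Rightarrow> ereal" where
  "circle_mean u z w =
     (enn2ereal (\<integral>\<^sup>+\<theta>\<in>{0..2*pi}. e2ennreal (u (z + cis \<theta> *s w)) \<partial>lborel)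
      - enn2ereal (\<integral>\<^sup>+\<theta>\<in>{0..2*pi}. e2ennreal (- u (z + cis \<theta> *s w)) \<partial>lborel)) / ereal (2*pi)"

text \<open>As usual for weights of metrics, the function that is \<open>-\<infinity>\<close> on a whole component is excluded.\<close>

definition plurisubharmonic_on :: "(complex^'n \<Rightarrow> ereal) \<Rightarrow> (complex^'n) set \<Rightarrow> bool" where
  "plurisubharmonic_on u W \<longleftrightarrow> open W \<and>
     (\<forall>z\<in>W. u z < \<infinity>) \<and>
     (\<forall>a. open {z\<in>W. u z < a}) \<and>
     (\<forall>K\<in>components W. \<exists>z\<in>K. u z \<noteq> -\<infinity>) \<and>
     (\<forall>z w. (\<forall>\<zeta>. norm \<zeta> \<le> 1 \<longrightarrow> z + \<zeta> *s w \<in> W) \<longrightarrow> u z \<le> circle_mean u z w)"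

text \<open>
  Lelong number of a plurisubharmonic function, that is, of the current
  \<open>dd\<^sup>c u = (i / 2\<pi>) \<partial>\<partial>\<^sup>- u\<close>. The square in the denominator is the normalization for which
  \<open>log \<bar>w\<bar>\<^sup>2\<close> has Lelong number 1 along \<open>w = 0\<close>.
\<close>

definition lelong_number :: "(complex^'n \<Rightarrow> ereal) \<Rightarrow> complex^'n \<Rightarrow> ereal" where
  "lelong_number u a = Liminf (at a) (\<lambda>z. u z / ereal (ln ((norm (z - a))\<^sup>2)))"

definition elog :: "real \<Rightarrow> ereal" where
  "elog r = (if r = 0 then -\<infinity> else ereal (ln r))"


section \<open>Complex manifolds\<close>

text \<open>
  A complex manifold of dimension \<open>CARD('n)\<close> is a topology with an atlas (not necessarily maximal);
  a chart is a domain together with a coordinate map.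
\<close>

type_synonym ('a, 'n) atlas = "('a set \<times> ('a \<Rightarrow> complex^'n)) set"

definition complex_manifold :: "'a topology \<Rightarrow> ('a, 'n::finite) atlas \<Rightarrow> bool" where
  "complex_manifold X A \<longleftrightarrow>
     Hausdorff_space X \<and> second_countable X \<and>
     \<Union>(fst ` A) = topspace X \<and>
     (\<forall>(U,c)\<in>A. openin X U \<and> open (c ` U) \<and>
        homeomorphic_map (subtopology X U) (top_of_set (c ` U)) c) \<and>
     (\<forall>(U,c)\<in>A. \<forall>(V,d)\<in>A. \<forall>j. mv_holomorphic_on (\<lambda>z. d (inv_into U c z) $ j) (c ` (U \<inter> V)))"

definition holomorphic_fun :: "'a topology \<Rightarrow> ('a, 'n::finite) atlas \<Rightarrow> 'a set \<Rightarrow> ('a \<Rightarrow> complex) \<Rightarrow> bool" where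
  "holomorphic_fun X A W f \<longleftrightarrow> openin X W \<and>
     (\<forall>(U,c)\<in>A. mv_holomorphic_on (\<lambda>z. f (inv_into U c z)) (c ` (U \<inter> W)))"

definition psh_fun :: "'a topology \<Rightarrow> ('a, 'n::finite) atlas \<Rightarrow> 'a set \<Rightarrow> ('a \<Rightarrow> ereal) \<Rightarrow> bool" where
  "psh_fun X A W u \<longleftrightarrow> openin X W \<and>
     (\<forall>(U,c)\<in>A. plurisubharmonic_on (\<lambda>z. u (inv_into U c z)) (c ` (U \<inter> W)))"

definition holomorphic_map ::
  "'a topology \<Rightarrow> ('a, 'n::finite) atlas \<Rightarrow> 'b topology \<Rightarrow> ('b, 'm::finite) atlas
     \<Rightarrow> 'a set \<Rightarrow> ('a \<Rightarrow> 'b) \<Rightarrow> bool" where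
  "holomorphic_map X A Y B W f \<longleftrightarrow> openin X W \<and> continuous_map (subtopology X W) Y f \<and>
     (\<forall>(U,c)\<in>A. \<forall>(V,d)\<in>B. \<forall>j.
        mv_holomorphic_on (\<lambda>z. d (f (inv_into U c z)) $ j) (c ` {x \<in> U \<inter> W. f x \<in> V}))"

definition biholomorphic_map ::
  "'a topology \<Rightarrow> ('a, 'n::finite) atlas \<Rightarrow> 'b topology \<Rightarrow> ('b, 'm::finite) atlas
     \<Rightarrow> 'a set \<Rightarrow> 'b set \<Rightarrow> ('a \<Rightarrow> 'b) \<Rightarrow> bool" where
  "biholomorphic_map X A Y B W V f \<longleftrightarrow> bij_betw f W V \<and>
     holomorphic_map X A Y B W f \<and> holomorphic_map Y B X A V (inv_into W f)"

text \<open>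
  Derivative at the point \<open>p\<close>, read in the chart \<open>(U, c)\<close>, of a function, in the coordinate
  direction \<open>v\<close>.
\<close>

definition chart_deriv :: "'a set \<Rightarrow> ('a \<Rightarrow> complex^'n) \<Rightarrow> ('a \<Rightarrow> complex) \<Rightarrow> 'a \<Rightarrow> complex^'n \<Rightarrow> complex" where
  "chart_deriv U c f p v = frechet_derivative (\<lambda>z. f (inv_into U c z)) (at (c p)) v"

text \<open>
  The charts of dimension \<open>CARD('m)\<close> induced on a subset \<open>Y\<close>: maps \<open>c\<close> from relatively open pieces
  of \<open>Y\<close> onto open sets of \<open>\<complex>\<^sup>m\<close> such that \<open>c\<close> extends locally to a holomorphic map on the ambient
  manifold and \<open>c\<^sup>-\<^sup>1\<close> is holomorphic as a map into the ambient manifold. The set \<open>Y\<close> is an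
  (embedded) complex submanifold of dimension \<open>CARD('m)\<close> iff these charts cover it.
\<close>

definition submanifold_atlas ::
  "'a topology \<Rightarrow> ('a, 'n::finite) atlas \<Rightarrow> 'a set \<Rightarrow> ('a, 'm::finite) atlas" where
  "submanifold_atlas X A Y = {(U,c).
     openin (subtopology X Y) U \<and> open (c ` U) \<and>
     homeomorphic_map (subtopology X U) (top_of_set (c ` U)) c \<and>
     (\<forall>(V,d)\<in>A. \<forall>j. mv_holomorphic_on (\<lambda>z. d (inv_into U c z) $ j) (c ` (U \<inter> V))) \<and>
     (\<forall>p\<in>U. \<exists>W f. p \<in> W \<and> (\<forall>j. holomorphic_fun X A W (\<lambda>x. f x $ j)) \<and> (\<forall>x\<in>U \<inter> W. f x = c x))}"

definition analytic_subset :: "'a topology \<Rightarrow> ('a, 'n::finite) atlas \<Rightarrow> 'a set \<Rightarrow> bool" where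
  "analytic_subset X A S \<longleftrightarrow> S \<subseteq> topspace X \<and>
     (\<forall>p\<in>topspace X. \<exists>W (k::nat) f. p \<in> W \<and> openin X W \<and> (\<forall>i<k. holomorphic_fun X A W (f i)) \<and>
        S \<inter> W = {x\<in>W. \<forall>i<k. f i x = 0})"


section \<open>Projective spaces\<close>

text \<open>
  A point of \<open>\<P>\<^sup>N\<close> is the set of all its homogeneous coordinate vectors; these are functions on
  the natural numbers, nonzero, and vanishing beyond \<open>N\<close>.
\<close>

type_synonym hpoint = "(nat \<Rightarrow> complex) set"

definition proj_pt :: "nat \<Rightarrow> (nat \<Rightarrow> complex) \<Rightarrow> hpoint" where
  "proj_pt N v = {w. \<exists>c. c \<noteq> 0 \<and> w = (\<lambda>i. if i \<le> N then c * v i else 0)}"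

definition proj_points :: "nat \<Rightarrow> hpoint set" where
  "proj_points N = {proj_pt N v | v. \<exists>i\<le>N. v i \<noteq> 0}"

text \<open>
  The quotient topology: \<open>\<Union>U\<close> is the preimage of \<open>U\<close> in the space \<open>\<Union>(proj_points N)\<close> of nonzero
  vectors.
\<close>

definition proj_space :: "nat \<Rightarrow> hpoint topology" where
  "proj_space N = topology (\<lambda>U. U \<subseteq> proj_points N \<and> openin (top_of_set (\<Union>(proj_points N))) (\<Union>U))"

lemma proj_points_disjoint:
  assumes "P \<in> proj_points N" "Q \<in> proj_points N" "w \<in> P" "w \<in> Q"
  shows "P = Q"
proof -
  have *: "proj_pt N v = proj_pt N w" if w: "w \<in> proj_pt N v" for v
  proof -
    obtain c where c: "c \<noteq> 0" "w = (\<lambda>i. if i \<le> N then c * v i else 0)"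
      using w by (auto simp: proj_pt_def)
    have "proj_pt N w \<subseteq> proj_pt N v"
    proof
      fix u assume "u \<in> proj_pt N w"
      then obtain d where "d \<noteq> 0" "u = (\<lambda>i. if i \<le> N then d * w i else 0)"
        by (auto simp: proj_pt_def)
      then show "u \<in> proj_pt N v"
        unfolding proj_pt_def using c by (auto intro!: exI[of _ "d * c"])
    qed
    moreover have "proj_pt N v \<subseteq> proj_pt N w"
    proof
      fix u assume "u \<in> proj_pt N v"
      then obtain d where "d \<noteq> 0" "u = (\<lambda>i. if i \<le> N then d * v i else 0)"
        by (auto simp: proj_pt_def)
      then show "u \<in> proj_pt N w"
        unfolding proj_pt_def using c by (auto intro!: exI[of _ "d / c"])
    qed
    ultimately show ?thesis by blast
  qed
  show ?thesis
    using assms * unfolding proj_points_def by (smt (verit) mem_Collect_eq)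
qed

lemma openin_proj_space:
  "openin (proj_space N) U \<longleftrightarrow>
     U \<subseteq> proj_points N \<and> openin (top_of_set (\<Union>(proj_points N))) (\<Union>U)"
proof -
  have "istopology (\<lambda>U. U \<subseteq> proj_points N \<and> openin (top_of_set (\<Union>(proj_points N))) (\<Union>U))"
    unfolding istopology_def
  proof (intro conjI allI impI)
    fix S T
    assume S: "S \<subseteq> proj_points N \<and> openin (top_of_set (\<Union>(proj_points N))) (\<Union>S)"
      and T: "T \<subseteq> proj_points N \<and> openin (top_of_set (\<Union>(proj_points N))) (\<Union>T)"
    then show "S \<inter> T \<subseteq> proj_points N" by blast
    have "\<Union>S \<inter> \<Union>T \<subseteq> \<Union>(S \<inter> T)"
    proof
      fix w assume "w \<in> \<Union>S \<inter> \<Union>T"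
      then obtain P Q where "P \<in> S" "Q \<in> T" "w \<in> P" "w \<in> Q" by blast
      moreover from this have "P = Q"
        using S T proj_points_disjoint[of P N Q w] by blast
      ultimately show "w \<in> \<Union>(S \<inter> T)" by blast
    qed
    then have "\<Union>(S \<inter> T) = \<Union>S \<inter> \<Union>T" by blast
    then show "openin (top_of_set (\<Union>(proj_points N))) (\<Union>(S \<inter> T))"
      using S T by (simp add: openin_Int)
  next
    fix \<K>
    assume K: "\<forall>K\<in>\<K>. K \<subseteq> proj_points N \<and> openin (top_of_set (\<Union>(proj_points N))) (\<Union>K)"
    then show "\<Union>\<K> \<subseteq> proj_points N" by blast
    have "\<Union>(\<Union>\<K>) = \<Union>((\<lambda>K. \<Union>K) ` \<K>)" by blast
    then show "openin (top_of_set (\<Union>(proj_points N))) (\<Union>(\<Union>\<K>))"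
      using K by (metis (mono_tags, lifting) imageE openin_Union)
  qed
  then show ?thesis by (simp add: proj_space_def)
qed

text \<open>The affine coordinate \<open>v\<^sub>j / v\<^sub>i\<close> of a point with \<open>v\<^sub>i \<noteq> 0\<close>.\<close>

definition affine_coord :: "nat \<Rightarrow> nat \<Rightarrow> hpoint \<Rightarrow> complex" where
  "affine_coord i j P = (THE v. v \<in> P \<and> v i = 1) j"

definition affine_piece :: "nat \<Rightarrow> nat \<Rightarrow> hpoint set" where
  "affine_piece N i = {P \<in> proj_points N. \<exists>v\<in>P. v i \<noteq> 0}"

text \<open>
  The affine charts of \<open>\<P>\<^sup>n\<close>, \<open>n = CARD('n)\<close>; the bijection \<open>e\<close> only numbers the \<open>n\<close> remaining
  homogeneous coordinates by the index type.
\<close>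

definition proj_atlas :: "(hpoint, 'n::finite) atlas" where
  "proj_atlas = {(affine_piece CARD('n) i, \<lambda>P. \<chi> k. affine_coord i (e k) P) | i e.
     i \<le> CARD('n) \<and> bij_betw e (UNIV :: 'n set) ({..CARD('n)} - {i})}"

text \<open>
  \<open>F\<close>, of interest outside \<open>S\<close> only, is locally given by homogeneous coordinates that are
  holomorphic also across \<open>S\<close>. For nowhere dense \<open>S\<close> this is a meromorphic map to \<open>\<P>\<^sup>N\<close>, for
  \<open>S = {}\<close> a holomorphic one.
\<close>

definition meromorphic_to_proj ::
  "'a topology \<Rightarrow> ('a, 'n::finite) atlas \<Rightarrow> 'a set \<Rightarrow> nat \<Rightarrow> ('a \<Rightarrow> hpoint) \<Rightarrow> bool" where
  "meromorphic_to_proj X A S N F \<longleftrightarrow>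
     (\<forall>p\<in>topspace X. \<exists>W f. p \<in> W \<and> openin X W \<and> (\<forall>i\<le>N. holomorphic_fun X A W (f i)) \<and>
        (\<forall>x\<in>W - S. (\<exists>i\<le>N. f i x \<noteq> 0) \<and> F x = proj_pt N (\<lambda>i. f i x)))"

text \<open>
  \<open>(\<pi>, F)\<close> is a closed holomorphic embedding of \<open>X\<close> into \<open>D \<times> \<P>\<^sup>N\<close>. The last clause says that the
  differential of \<open>(\<pi>, F)\<close>, in affine coordinates of \<open>\<P>\<^sup>N\<close>, is injective.
\<close>

definition projective_embedding ::
  "'a topology \<Rightarrow> ('a, 'n::finite) atlas \<Rightarrow> complex set \<Rightarrow> ('a \<Rightarrow> complex) \<Rightarrow> nat \<Rightarrow> ('a \<Rightarrow> hpoint) \<Rightarrow> bool" where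
  "projective_embedding X A D \<pi> N F \<longleftrightarrow>
     holomorphic_fun X A (topspace X) \<pi> \<and> meromorphic_to_proj X A {} N F \<and>
     embedding_map X (prod_topology (top_of_set D) (proj_space N)) (\<lambda>x. (\<pi> x, F x)) \<and>
     closedin (prod_topology (top_of_set D) (proj_space N)) ((\<lambda>x. (\<pi> x, F x)) ` topspace X) \<and>
     (\<forall>(U,c)\<in>A. \<forall>p\<in>U. \<forall>i\<le>N. F p \<in> affine_piece N i \<longrightarrow>
        (\<forall>v. v \<noteq> 0 \<longrightarrow> chart_deriv U c \<pi> p v \<noteq> 0 \<or>
           (\<exists>j\<le>N. chart_deriv U c (\<lambda>x. affine_coord i j (F x)) p v \<noteq> 0)))"


section \<open>Smooth projective families and rational surfaces\<close>

definition smooth_projective_morphism ::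
  "'a topology \<Rightarrow> ('a, 'n::finite) atlas \<Rightarrow> complex set \<Rightarrow> ('a \<Rightarrow> complex) \<Rightarrow> bool" where
  "smooth_projective_morphism X A D \<pi> \<longleftrightarrow>
     complex_manifold X A \<and>
     holomorphic_fun X A (topspace X) \<pi> \<and> \<pi> ` topspace X \<subseteq> D \<and>
     (\<forall>(U,c)\<in>A. \<forall>p\<in>U. \<exists>v. chart_deriv U c \<pi> p v \<noteq> 0) \<and>
     (\<exists>N F. projective_embedding X A D \<pi> N F)"

definition fibre :: "'a topology \<Rightarrow> ('a \<Rightarrow> complex) \<Rightarrow> complex \<Rightarrow> 'a set" where
  "fibre X \<pi> t = {x \<in> topspace X. \<pi> x = t}"

text \<open>
  A smooth projective surface bimeromorphic (equivalently, being projective, birational) to the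
  plane: a biholomorphism between complements of proper analytic subsets that is meromorphic in
  both directions. A map into the surface is meromorphic if it is so after composition with a
  projective embedding \<open>F\<close>; an absolute embedding is one relative to a point.
\<close>

definition rational_surface :: "'a topology \<Rightarrow> ('a, 2) atlas \<Rightarrow> bool" where
  "rational_surface X A \<longleftrightarrow>
     complex_manifold X A \<and> compact_space X \<and> connected_space X \<and> topspace X \<noteq> {} \<and>
     (\<exists>N F S T f.
        projective_embedding X A {0} (\<lambda>_. 0) N F \<and>
        analytic_subset X A S \<and> X interior_of S = {} \<and>
        analytic_subset (proj_space 2) (proj_atlas :: (hpoint, 2) atlas) T \<and>
        proj_space 2 interior_of T = {} \<and>
        biholomorphic_map X A (proj_space 2) (proj_atlas :: (hpoint, 2) atlas)
          (topspace X - S) (proj_points 2 - T) f \<and>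
        meromorphic_to_proj X A S 2 f \<and>
        meromorphic_to_proj (proj_space 2) (proj_atlas :: (hpoint, 2) atlas) T N
          (\<lambda>y. F (inv_into (topspace X - S) f y)))"

definition smooth_rational_curve :: "'a topology \<Rightarrow> ('a, 'n::finite) atlas \<Rightarrow> 'a set \<Rightarrow> bool" where
  "smooth_rational_curve X A E \<longleftrightarrow> closedin X E \<and>
     complex_manifold (subtopology X E) (submanifold_atlas X A E :: ('a, 1) atlas) \<and>
     (\<exists>f. biholomorphic_map (proj_space 1) (proj_atlas :: (hpoint, 1) atlas)
            (subtopology X E) (submanifold_atlas X A E :: ('a, 1) atlas) (proj_points 1) E f)"


section \<open>Line bundles and singular Hermitian metrics\<close>

text \<open>
  A holomorphic line bundle given by a countable trivializing cover \<open>U i\<close> (members may be empty) with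
  local frames \<open>e i\<close> and transition functions \<open>e j = g i j \<cdot> e i\<close>. A section is a family \<open>s\<close> with
  \<open>s i = g i j \<cdot> s j\<close>.
\<close>

definition line_bundle ::
  "'a topology \<Rightarrow> ('a, 'n::finite) atlas \<Rightarrow> (nat \<Rightarrow> 'a set) \<Rightarrow> (nat \<Rightarrow> nat \<Rightarrow> 'a \<Rightarrow> complex) \<Rightarrow> bool" where
  "line_bundle X A U g \<longleftrightarrow>
     (\<forall>i. openin X (U i)) \<and> (\<Union>i. U i) = topspace X \<and>
     (\<forall>i j. holomorphic_fun X A (U i \<inter> U j) (g i j) \<and> (\<forall>x\<in>U i \<inter> U j. g i j x \<noteq> 0)) \<and>
     (\<forall>i j k. \<forall>x\<in>U i \<inter> U j \<inter> U k. g i j x * g j k x = g i k x)"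

definition holomorphic_section ::
  "'a topology \<Rightarrow> ('a, 'n::finite) atlas \<Rightarrow> (nat \<Rightarrow> 'a set) \<Rightarrow> (nat \<Rightarrow> nat \<Rightarrow> 'a \<Rightarrow> complex)
     \<Rightarrow> (nat \<Rightarrow> 'a \<Rightarrow> complex) \<Rightarrow> bool" where
  "holomorphic_section X A U g s \<longleftrightarrow>
     (\<forall>i. holomorphic_fun X A (U i) (s i)) \<and>
     (\<forall>i j. \<forall>x\<in>U i \<inter> U j. s i x = g i j x * s j x)"

definition effective ::
  "'a topology \<Rightarrow> ('a, 'n::finite) atlas \<Rightarrow> (nat \<Rightarrow> 'a set) \<Rightarrow> (nat \<Rightarrow> nat \<Rightarrow> 'a \<Rightarrow> complex) \<Rightarrow> bool" where
  "effective X A U g \<longleftrightarrow>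
     (\<exists>s. holomorphic_section X A U g s \<and> (\<exists>i. \<exists>x\<in>U i. s i x \<noteq> 0))"

text \<open>
  A metric \<open>h\<close> is the family of its weights, \<open>\<bar>e i\<bar>\<^sub>h\<^sup>2 = exp (- \<phi> i)\<close>; hence
  \<open>\<phi> j = \<phi> i - log \<bar>g i j\<bar>\<^sup>2\<close>. The weight in any other frame differs from these by a pluriharmonic
  function, so it suffices to require plurisubharmonicity of the \<open>\<phi> i\<close>.
  Restricting a bundle to a subset means intersecting all \<open>U i\<close> with it.
\<close>

definition semipositive_metric ::
  "'a topology \<Rightarrow> ('a, 'n::finite) atlas \<Rightarrow> (nat \<Rightarrow> 'a set) \<Rightarrow> (nat \<Rightarrow> nat \<Rightarrow> 'a \<Rightarrow> complex)
     \<Rightarrow> (nat \<Rightarrow> 'a \<Rightarrow> ereal) \<Rightarrow> bool" where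
  "semipositive_metric X A U g \<phi> \<longleftrightarrow>
     (\<forall>i j. \<forall>x\<in>U i \<inter> U j. \<phi> i x = \<phi> j x + ereal (ln ((norm (g i j x))\<^sup>2))) \<and>
     (\<forall>i. psh_fun X A (U i) (\<phi> i))"

definition analytic_singularities ::
  "'a topology \<Rightarrow> ('a, 'n::finite) atlas \<Rightarrow> (nat \<Rightarrow> 'a set) \<Rightarrow> (nat \<Rightarrow> 'a \<Rightarrow> ereal) \<Rightarrow> bool" where
  "analytic_singularities X A U \<phi> \<longleftrightarrow>
     (\<forall>i. \<forall>p\<in>U i. \<exists>W c (k::nat) f M. p \<in> W \<and> W \<subseteq> U i \<and> openin X W \<and> 0 < c \<and>
        (\<forall>j<k. holomorphic_fun X A W (f j)) \<and>
        (\<forall>x\<in>W. let l = ereal c * elog (\<Sum>j<k. (norm (f j x))\<^sup>2)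
               in \<phi> i x \<le> l + ereal M \<and> l \<le> \<phi> i x + ereal M))"

definition minimal_singularities ::
  "'a topology \<Rightarrow> ('a, 'n::finite) atlas \<Rightarrow> (nat \<Rightarrow> 'a set) \<Rightarrow> (nat \<Rightarrow> nat \<Rightarrow> 'a \<Rightarrow> complex)
     \<Rightarrow> (nat \<Rightarrow> 'a \<Rightarrow> ereal) \<Rightarrow> bool" where
  "minimal_singularities X A U g \<phi> \<longleftrightarrow>
     (\<forall>\<phi>T. semipositive_metric X A U g \<phi>T \<longrightarrow>
        (\<exists>C. \<forall>i. \<forall>x\<in>U i. \<phi>T i x \<le> \<phi> i x + ereal C))"

definition singular_support ::
  "'a topology \<Rightarrow> (nat \<Rightarrow> 'a set) \<Rightarrow> (nat \<Rightarrow> 'a \<Rightarrow> ereal) \<Rightarrow> 'a set" where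
  "singular_support X U \<phi> = {p. \<exists>i. p \<in> U i \<and>
     \<not> (\<exists>W M. p \<in> W \<and> W \<subseteq> U i \<and> openin X W \<and> (\<forall>x\<in>W. \<bar>\<phi> i x\<bar> \<le> ereal M))}"

definition has_lelong_number ::
  "('a, 'n::finite) atlas \<Rightarrow> (nat \<Rightarrow> 'a set) \<Rightarrow> (nat \<Rightarrow> 'a \<Rightarrow> ereal) \<Rightarrow> 'a \<Rightarrow> ereal \<Rightarrow> bool" where
  "has_lelong_number A U \<phi> p \<nu> \<longleftrightarrow>
     (\<forall>i. p \<in> U i \<longrightarrow> (\<forall>(V,c)\<in>A. p \<in> V \<longrightarrow>
        lelong_number (\<lambda>z. \<phi> i (inv_into V c z)) (c p) = \<nu>))"

text \<open>
  The generic Lelong number along \<open>E\<close> is the infimum of the Lelong numbers at the points of \<open>E\<close>.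
\<close>

definition has_generic_lelong_number ::
  "('a, 'n::finite) atlas \<Rightarrow> (nat \<Rightarrow> 'a set) \<Rightarrow> (nat \<Rightarrow> 'a \<Rightarrow> ereal) \<Rightarrow> 'a set \<Rightarrow> ereal \<Rightarrow> bool" where
  "has_generic_lelong_number A U \<phi> E \<nu> \<longleftrightarrow>
     (\<exists>n. (\<forall>p\<in>E. has_lelong_number A U \<phi> p (n p)) \<and> (INF p\<in>E. n p) = \<nu>)"

end

theory Submission
  imports Defs "HOL-Complex_Analysis.Conformal_Mappings"
begin

text \<open>
  The Hirzebruch surface \<open>F\<^sub>2\<close> deforms to \<open>\<P>\<^sup>1 \<times> \<P>\<^sup>1\<close>. Concretely, \<open>\<X>\<close> consists of the pairs
  \<open>(t, [v])\<close>, \<open>\<bar>t\<bar> < 1\<close>, \<open>[v] \<in> \<P>\<^sup>5\<close>, for which the matrix with the columns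
  \<open>(v\<^sub>0, v\<^sub>1)\<close>, \<open>(v\<^sub>2, v\<^sub>3)\<close>, \<open>(v\<^sub>3 + t v\<^sub>0, v\<^sub>4)\<close>, \<open>(v\<^sub>4, v\<^sub>5)\<close> has rank at most 1. The ratio of
  the two rows is a map to \<open>\<P>\<^sup>1\<close>; let \<open>F\<close> be the class of its fibres and \<open>H\<close> the hyperplane class. The
  surface \<open>X\<^sub>0\<close> is \<open>F\<^sub>2\<close>, and the line \<open>E = {v\<^sub>2 = \<dots> = v\<^sub>5 = 0}\<close> in it has \<open>E\<^sup>2 = -2\<close>, \<open>H = E + 3F\<close>.

  The line bundle is \<open>L = H - 2F\<close>. On \<open>X\<^sub>0\<close> it is \<open>E + F\<close>, with \<open>L \<cdot> E = -1\<close>; its Zariski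
  decomposition has the negative part \<open>E/2\<close>, and the positive part \<open>E/2 + F\<close> is half of the base-point
  free class \<open>E + 2F\<close>. So the metric \<open>\<phi>\<^sub>0\<close> is defined by three sections of \<open>2L = E + (E + 2F)\<close>,
  namely \<open>E\<close> plus sections of \<open>E + 2F\<close> without common zeros (\<open>gens\<close>). That it is semipositive with the stated
  singularities is read off from the formula; the plurisubharmonicity of the logarithm of a maximum of
  moduli is Jensen's inequality (\<open>plurisubharmonic_on_log_max\<close>).

  Minimality (\<open>minimal_metric0\<close>): a point at height \<open>y\<close> over \<open>E\<close> is the centre of a horizontal disc of
  radius \<open>R \<approx> \<bar>y\<bar>\<^sup>-\<^sup>1\<^sup>/\<^sup>2\<close> whose boundary lies in a fixed compact part of the opposite chart. There
  every weight is bounded, and the transition function, of degree \<open>L \<cdot> E = -1\<close>, contributes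
  \<open>log R\<^sup>-\<^sup>2 \<approx> log \<bar>y\<bar>\<close>.

  Non-extension (\<open>no_extension\<close>): for \<open>t \<noteq> 0\<close> the fibre \<open>X\<^sub>t\<close> contains a smooth rational curve \<open>C\<^sub>t\<close>
  with \<open>L \<cdot> C\<^sub>t = 0\<close> that for \<open>t \<rightarrow> 0\<close> degenerates to \<open>E\<close> plus a fibre. On \<open>C\<^sub>t\<close> the bundle is trivial,
  so a semipositive metric is constant there and bounded by its values in a fixed compact set
  (\<open>moving_curve_bound\<close>). Averaging over a circle of \<open>t\<close>, one obtains a bound on the limiting fibre that
  is independent of the point. But on this fibre \<open>\<phi>\<^sub>0\<close> is unbounded, as \<open>L \<cdot> F = 1\<close>. Thus no metric
  on a neighbourhood can be bounded below by \<open>\<phi>\<^sub>0 - C\<close> on \<open>X\<^sub>0\<close>.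

  All computations use four charts, the first two over one affine piece of the base \<open>\<P>\<^sup>1\<close>, the last two
  over the other, with coordinates \<open>(t, x, y)\<close>: \<open>x\<close> is a coordinate of the base, \<open>y\<close> one of the fibre.
\<close>

section \<open>Holomorphic functions of several variables\<close>

lemma mv_holomorphic_onD:
  assumes "mv_holomorphic_on f W" "z \<in> W"
  obtains D where "(f has_derivative D) (at z)" "\<And>c v. D (c *s v) = c * D v"
  using assms unfolding mv_holomorphic_on_def by blast

lemma mv_holomorphic_on_open: "mv_holomorphic_on f W \<Longrightarrow> open W"
  by (simp add: mv_holomorphic_on_def)

lemma mv_holomorphic_on_const: "open W \<Longrightarrow> mv_holomorphic_on (\<lambda>_. c) W"
  unfolding mv_holomorphic_on_def by (auto intro!: exI[of _ "\<lambda>_. 0"])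

lemma mv_holomorphic_on_coord: "open W \<Longrightarrow> mv_holomorphic_on (\<lambda>z. z $ i) W"
  unfolding mv_holomorphic_on_def
  by (auto intro!: exI[of _ "\<lambda>v. v $ i"] bounded_linear_imp_has_derivative bounded_linear_vec_nth)

lemma mv_holomorphic_on_add:
  assumes "mv_holomorphic_on f W" "mv_holomorphic_on g W"
  shows "mv_holomorphic_on (\<lambda>z. f z + g z) W"
  unfolding mv_holomorphic_on_def
proof (intro conjI ballI)
  show "open W" using assms by (simp add: mv_holomorphic_on_def)
  fix z assume "z \<in> W"
  obtain D where "(f has_derivative D) (at z)" "\<And>c v. D (c *s v) = c * D v"
    using mv_holomorphic_onD[OF assms(1) \<open>z \<in> W\<close>] by blast
  moreover obtain E where "(g has_derivative E) (at z)" "\<And>c v. E (c *s v) = c * E v"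
    using mv_holomorphic_onD[OF assms(2) \<open>z \<in> W\<close>] by blast
  ultimately show "\<exists>D. ((\<lambda>z. f z + g z) has_derivative D) (at z) \<and> (\<forall>c v. D (c *s v) = c * D v)"
    by (intro exI[of _ "\<lambda>v. D v + E v"]) (auto intro!: has_derivative_add simp: algebra_simps)
qed

lemma mv_holomorphic_on_mult:
  assumes "mv_holomorphic_on f W" "mv_holomorphic_on g W"
  shows "mv_holomorphic_on (\<lambda>z. f z * g z) W"
  unfolding mv_holomorphic_on_def
proof (intro conjI ballI)
  show "open W" using assms by (simp add: mv_holomorphic_on_def)
  fix z assume "z \<in> W"
  obtain D where "(f has_derivative D) (at z)" "\<And>c v. D (c *s v) = c * D v"
    using mv_holomorphic_onD[OF assms(1) \<open>z \<in> W\<close>] by blast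
  moreover obtain E where "(g has_derivative E) (at z)" "\<And>c v. E (c *s v) = c * E v"
    using mv_holomorphic_onD[OF assms(2) \<open>z \<in> W\<close>] by blast
  ultimately show "\<exists>D. ((\<lambda>z. f z * g z) has_derivative D) (at z) \<and> (\<forall>c v. D (c *s v) = c * D v)"
    using has_derivative_mult[of f D z UNIV g E]
    by (intro exI[of _ "\<lambda>v. f z * E v + D v * g z"]) (simp add: algebra_simps)
qed

lemma mv_holomorphic_on_inverse:
  assumes "mv_holomorphic_on f W" "\<And>z. z \<in> W \<Longrightarrow> f z \<noteq> 0"
  shows "mv_holomorphic_on (\<lambda>z. inverse (f z)) W"
  unfolding mv_holomorphic_on_def
proof (intro conjI ballI)
  show "open W" using assms by (simp add: mv_holomorphic_on_def)
  fix z assume "z \<in> W"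
  obtain D where "(f has_derivative D) (at z)" "\<And>c v. D (c *s v) = c * D v"
    using mv_holomorphic_onD[OF assms(1) \<open>z \<in> W\<close>] by blast
  then show "\<exists>D. ((\<lambda>z. inverse (f z)) has_derivative D) (at z) \<and> (\<forall>c v. D (c *s v) = c * D v)"
    using assms(2)[OF \<open>z \<in> W\<close>]
    by (intro exI[of _ "\<lambda>v. - (inverse (f z) * D v * inverse (f z))"])
       (use Deriv.has_derivative_inverse[of f z D UNIV] in \<open>simp add: algebra_simps\<close>)
qed

lemma mv_holomorphic_on_uminus:
  "mv_holomorphic_on f W \<Longrightarrow> mv_holomorphic_on (\<lambda>z. - f z) W"
  using mv_holomorphic_on_mult[OF mv_holomorphic_on_const[of W "-1"], of f]
  by (simp add: mv_holomorphic_on_open)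

lemma mv_holomorphic_on_diff:
  "mv_holomorphic_on f W \<Longrightarrow> mv_holomorphic_on g W \<Longrightarrow> mv_holomorphic_on (\<lambda>z. f z - g z) W"
  using mv_holomorphic_on_add[OF _ mv_holomorphic_on_uminus, of f W g] by simp

lemma mv_holomorphic_on_divide:
  "mv_holomorphic_on f W \<Longrightarrow> mv_holomorphic_on g W \<Longrightarrow> (\<And>z. z \<in> W \<Longrightarrow> g z \<noteq> 0) \<Longrightarrow>
     mv_holomorphic_on (\<lambda>z. f z / g z) W"
  unfolding divide_inverse by (intro mv_holomorphic_on_mult mv_holomorphic_on_inverse)

lemma mv_holomorphic_on_power:
  "mv_holomorphic_on f W \<Longrightarrow> mv_holomorphic_on (\<lambda>z. f z ^ n) W"
  by (induction n) (auto intro!: mv_holomorphic_on_const mv_holomorphic_on_mult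
      simp: mv_holomorphic_on_open)

lemma mv_holomorphic_on_subset:
  "mv_holomorphic_on f W \<Longrightarrow> open V \<Longrightarrow> V \<subseteq> W \<Longrightarrow> mv_holomorphic_on f V"
  unfolding mv_holomorphic_on_def by blast

lemma mv_holomorphic_on_cong:
  assumes "\<And>z. z \<in> W \<Longrightarrow> f z = g z" "W = W'"
  shows "mv_holomorphic_on f W \<longleftrightarrow> mv_holomorphic_on g W'"
proof -
  have *: "mv_holomorphic_on g W" if f: "mv_holomorphic_on f W" and eq: "\<And>z. z \<in> W \<Longrightarrow> f z = g z"
    for f g :: "complex^'a \<Rightarrow> complex"
    unfolding mv_holomorphic_on_def
  proof (intro conjI ballI)
    show W: "open W" using f by (rule mv_holomorphic_on_open)
    fix z assume z: "z \<in> W"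
    obtain D where "(f has_derivative D) (at z)" "\<And>c v. D (c *s v) = c * D v"
      using mv_holomorphic_onD[OF f z] by blast
    moreover from this(1) have "(g has_derivative D) (at z)"
      by (rule has_derivative_transform_within_open[OF _ W z]) (use eq in auto)
    ultimately show "\<exists>D. (g has_derivative D) (at z) \<and> (\<forall>c v. D (c *s v) = c * D v)" by blast
  qed
  show ?thesis using *[of f g] *[of g f] assms by metis
qed

lemma mv_holomorphic_on_transform:
  assumes "mv_holomorphic_on f W" "\<And>z. z \<in> W \<Longrightarrow> f z = g z"
  shows "mv_holomorphic_on g W"
proof -
  have "mv_holomorphic_on f W \<longleftrightarrow> mv_holomorphic_on g W"
    by (rule mv_holomorphic_on_cong[OF assms(2) refl])
  then show ?thesis using assms(1) by simp
qed

lemma mv_holomorphic_on_local: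
  assumes "\<And>z. z \<in> W \<Longrightarrow> \<exists>V. z \<in> V \<and> V \<subseteq> W \<and> mv_holomorphic_on f V"
  shows "mv_holomorphic_on f W"
  unfolding mv_holomorphic_on_def
proof (intro conjI ballI)
  show "open W"
  proof (subst open_subopen, intro ballI)
    fix z assume "z \<in> W"
    from assms[OF this] show "\<exists>T. open T \<and> z \<in> T \<and> T \<subseteq> W"
      using mv_holomorphic_on_open by metis
  qed
  fix z assume "z \<in> W"
  from assms[OF this] obtain V where "z \<in> V" "mv_holomorphic_on f V" by metis
  then show "\<exists>D. (f has_derivative D) (at z) \<and> (\<forall>c v. D (c *s v) = c * D v)"
    unfolding mv_holomorphic_on_def by metis
qed

lemma mv_holomorphic_on_imp_continuous_on: "mv_holomorphic_on f W \<Longrightarrow> continuous_on W f"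
  unfolding mv_holomorphic_on_def
  by (intro continuous_at_imp_continuous_on ballI) (blast intro: has_derivative_continuous)

lemma has_derivative_vec_lambda:
  fixes f :: "'a::real_normed_vector \<Rightarrow> complex^'n"
  assumes "\<And>j. ((\<lambda>x. f x $ j) has_derivative (\<lambda>v. f' v $ j)) (at a within S)"
  shows "(f has_derivative f') (at a within S)"
proof (subst has_derivative_componentwise_within, intro ballI)
  fix i :: "complex^'n" assume "i \<in> Basis"
  then obtain j b where i: "i = axis j b" by (auto simp: Basis_vec_def)
  have "((\<lambda>x. (f x $ j) \<bullet> b) has_derivative (\<lambda>x. (f' x $ j) \<bullet> b)) (at a within S)"
    by (rule has_derivative_inner_left) (rule assms)
  then show "((\<lambda>x. f x \<bullet> i) has_derivative (\<lambda>x. f' x \<bullet> i)) (at a within S)"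
    by (simp add: i inner_axis)
qed

lemma has_derivative_vec_nth:
  fixes f :: "'a::real_normed_vector \<Rightarrow> complex^'n"
  assumes "(f has_derivative f') (at a within S)"
  shows "((\<lambda>x. f x $ j) has_derivative (\<lambda>v. f' v $ j)) (at a within S)"
  using bounded_linear.has_derivative[OF bounded_linear_vec_nth assms] .

lemma mv_holomorphic_vec_derivative:
  fixes G :: "complex^'m \<Rightarrow> complex^'n"
  assumes "\<And>j. mv_holomorphic_on (\<lambda>z. G z $ j) V" "z \<in> V"
  obtains D where "(G has_derivative D) (at z)" "\<And>c v. D (c *s v) = c *s D v"
proof -
  have "\<forall>j. \<exists>D. ((\<lambda>z. G z $ j) has_derivative D) (at z) \<and> (\<forall>c v. D (c *s v) = c * D v)"
    using assms unfolding mv_holomorphic_on_def by blast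
  then obtain D where D: "\<And>j. ((\<lambda>z. G z $ j) has_derivative D j) (at z)"
      "\<And>j c v. D j (c *s v) = c * D j v"
    by metis
  have "(G has_derivative (\<lambda>v. \<chi> j. D j v)) (at z)"
    by (rule has_derivative_vec_lambda) (use D in auto)
  then show thesis by (rule that) (simp add: vec_eq_iff D)
qed

lemma mv_holomorphic_on_compose:
  fixes f :: "complex^'n \<Rightarrow> complex" and G :: "complex^'m \<Rightarrow> complex^'n"
  assumes f: "mv_holomorphic_on f W" and G: "\<And>j. mv_holomorphic_on (\<lambda>z. G z $ j) V"
    and sub: "G ` V \<subseteq> W"
  shows "mv_holomorphic_on (\<lambda>z. f (G z)) V"
  unfolding mv_holomorphic_on_def
proof (intro conjI ballI)
  show "open V" using G mv_holomorphic_on_open by blast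
  fix z assume z: "z \<in> V"
  obtain D where D: "(G has_derivative D) (at z)" "\<And>c v. D (c *s v) = c *s D v"
    by (rule mv_holomorphic_vec_derivative[OF G z]) auto
  obtain E where E: "(f has_derivative E) (at (G z))" "\<And>c v. E (c *s v) = c * E v"
    using f sub z unfolding mv_holomorphic_on_def by blast
  have "((\<lambda>z. f (G z)) has_derivative (\<lambda>v. E (D v))) (at z)"
    using has_derivative_compose[OF D(1) E(1)] .
  then show "\<exists>D. ((\<lambda>z. f (G z)) has_derivative D) (at z) \<and> (\<forall>c v. D (c *s v) = c * D v)"
    by (intro exI[of _ "\<lambda>v. E (D v)"]) (simp add: D(2) E(2))
qed

lemma bounded_linear_scalar_vec: "bounded_linear (\<lambda>\<zeta>. \<zeta> *s (w :: complex^'n))"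
proof -
  have "linear (\<lambda>\<zeta>. \<zeta> *s w)"
    by (rule linearI) (simp_all add: vec_eq_iff distrib_right)
  then show ?thesis by (simp add: linear_conv_bounded_linear)
qed

lemma has_derivative_complex_line:
  "((\<lambda>\<zeta>. z + \<zeta> *s (w :: complex^'n)) has_derivative (\<lambda>h. h *s w)) (at \<zeta>)"
  using has_derivative_add[OF has_derivative_const[of z]
      bounded_linear_imp_has_derivative[OF bounded_linear_scalar_vec[of w]]]
  by simp

lemma continuous_on_complex_line:
  "continuous_on S (\<lambda>\<zeta>. z + \<zeta> *s (w :: complex^'n))"
  by (intro continuous_on_add continuous_on_const linear_continuous_on bounded_linear_scalar_vec)

lemma open_complex_line_vimage: "open W \<Longrightarrow> open {\<zeta>. z + \<zeta> *s (w :: complex^'n) \<in> W}"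
proof -
  assume "open W"
  then have "open ((\<lambda>\<zeta>. z + \<zeta> *s w) -` W)"
    by (rule open_vimage) (rule continuous_on_complex_line)
  then show ?thesis unfolding vimage_def .
qed

lemma mv_holomorphic_on_complex_line:
  assumes "mv_holomorphic_on f W"
  shows "(\<lambda>\<zeta>. f (z + \<zeta> *s w)) holomorphic_on {\<zeta>. z + \<zeta> *s w \<in> W}"
  unfolding holomorphic_on_def
proof
  fix \<zeta> assume "\<zeta> \<in> {\<zeta>. z + \<zeta> *s w \<in> W}"
  then obtain D where D: "(f has_derivative D) (at (z + \<zeta> *s w))" "\<forall>c v. D (c *s v) = c * D v"
    using assms unfolding mv_holomorphic_on_def by auto
  have "((\<lambda>\<zeta>. f (z + \<zeta> *s w)) has_derivative (\<lambda>h. D (h *s w))) (at \<zeta>)"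
    by (rule has_derivative_compose[where f = "\<lambda>\<zeta>. z + \<zeta> *s w" and f' = "\<lambda>h. h *s w"
          and g = f and g' = D, OF has_derivative_complex_line D(1)])
  moreover have "(\<lambda>h. D (h *s w)) = (*) (D w)"
    by (rule ext) (simp only: D(2)[rule_format] mult.commute[of _ "D w"])
  ultimately have "((\<lambda>\<zeta>. f (z + \<zeta> *s w)) has_field_derivative D w) (at \<zeta>)"
    unfolding has_field_derivative_def by simp
  then show "(\<lambda>\<zeta>. f (z + \<zeta> *s w)) field_differentiable at \<zeta> within {\<zeta>. z + \<zeta> *s w \<in> W}"
    unfolding field_differentiable_def by (intro exI) (erule has_field_derivative_at_within)
qed

lemmas mv_holomorphic_intros =
  mv_holomorphic_on_const mv_holomorphic_on_coord mv_holomorphic_on_add mv_holomorphic_on_diff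
  mv_holomorphic_on_mult mv_holomorphic_on_uminus mv_holomorphic_on_power

section \<open>Circle means of plurisubharmonic functions\<close>

lemma enn2ereal_le: "x \<le> y \<Longrightarrow> enn2ereal x \<le> enn2ereal y"
  by (simp add: less_eq_ennreal.rep_eq)

lemma circle_mean_mono:
  assumes "\<And>\<theta>. u (z + cis \<theta> *s w) \<le> v (z + cis \<theta> *s w)"
  shows "circle_mean u z w \<le> circle_mean v z w"
  unfolding circle_mean_def
proof (intro ereal_divide_right_mono ereal_minus_mono)
  show "enn2ereal (\<integral>\<^sup>+\<theta>\<in>{0..2*pi}. e2ennreal (u (z + cis \<theta> *s w)) \<partial>lborel)
      \<le> enn2ereal (\<integral>\<^sup>+\<theta>\<in>{0..2*pi}. e2ennreal (v (z + cis \<theta> *s w)) \<partial>lborel)"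
    by (intro enn2ereal_le nn_integral_mono mult_right_mono e2ennreal_mono assms) auto
  show "enn2ereal (\<integral>\<^sup>+\<theta>\<in>{0..2*pi}. e2ennreal (- v (z + cis \<theta> *s w)) \<partial>lborel)
      \<le> enn2ereal (\<integral>\<^sup>+\<theta>\<in>{0..2*pi}. e2ennreal (- u (z + cis \<theta> *s w)) \<partial>lborel)"
    by (intro enn2ereal_le nn_integral_mono mult_right_mono e2ennreal_mono) (use assms in auto)
qed auto

lemma circle_mean_const: "circle_mean (\<lambda>_. ereal B) z w = ereal B"
proof -
  have *: "(\<integral>\<^sup>+\<theta>\<in>{0..2*pi}. e2ennreal (ereal C) \<partial>lborel) = ennreal (2 * pi * max C 0)" for C
  proof -
    have "e2ennreal (ereal C) = ennreal (max C 0)"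
      by (cases "C \<ge> 0") (auto simp: max_def ennreal_neg)
    then show ?thesis
      by (simp add: nn_integral_cmult_indicator ennreal_mult'' mult.commute flip: ennreal_mult)
  qed
  show ?thesis
    unfolding circle_mean_def uminus_ereal.simps * by (simp add: max_def)
qed

text \<open>
  Apart from boundedness on compact sets, this weak form of the sub-mean-value inequality is all that is
  used of the metrics with which \<open>\<phi>\<^sub>0\<close> is compared; it spares the evaluation of integrals.
\<close>

lemma psh_le_of_circle:
  assumes "plurisubharmonic_on u W" "\<And>\<zeta>. norm \<zeta> \<le> 1 \<Longrightarrow> z + \<zeta> *s w \<in> W"
    and "\<And>\<theta>. u (z + cis \<theta> *s w) \<le> ereal B"
  shows "u z \<le> ereal B"
proof -
  have "u z \<le> circle_mean u z w"
    using assms(1,2) unfolding plurisubharmonic_on_def by blast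
  also have "\<dots> \<le> circle_mean (\<lambda>_. ereal B) z w"
    by (intro circle_mean_mono assms)
  finally show ?thesis by (simp add: circle_mean_const)
qed

text \<open>
  Upper semicontinuity: the open sublevel sets of integers cover \<open>K\<close>.
\<close>

lemma psh_bounded_above_on_compact:
  assumes u: "plurisubharmonic_on u W" and K: "compact K" "K \<subseteq> W"
  obtains M where "\<And>z. z \<in> K \<Longrightarrow> u z \<le> ereal M"
proof -
  have "\<exists>n::nat. u z < ereal (real n)" if "z \<in> K" for z
  proof -
    have "u z < \<infinity>" using u K that unfolding plurisubharmonic_on_def by blast
    then have "u z \<noteq> \<infinity>" by simp
    then show ?thesis unfolding less_PInf_Ex_of_nat[symmetric] .
  qed
  then have cov: "K \<subseteq> (\<Union>n::nat. {z\<in>W. u z < ereal (real n)})" using K by auto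
  obtain C where C: "C \<subseteq> UNIV" "finite C" "K \<subseteq> (\<Union>n\<in>C. {z\<in>W. u z < ereal (real n)})"
    by (rule compactE_image[OF K(1) _ cov]) (use u in \<open>auto simp: plurisubharmonic_on_def\<close>)
  show thesis
  proof (rule that[of "real (Max (insert 0 C))"])
    fix z assume "z \<in> K"
    then obtain n where n: "n \<in> C" "u z < ereal (real n)" using C by auto
    have "real n \<le> real (Max (insert 0 C))" using n C by simp
    then show "u z \<le> ereal (real (Max (insert 0 C)))"
      using n by (metis ereal_less_eq(3) less_le_trans order.strict_implies_order)
  qed
qed

section \<open>Plurisubharmonicity of logarithms of moduli\<close>

text \<open>
  On a disc a function without zeros has a holomorphic logarithm; its real part has the mean value
  property by Cauchy's formula.
\<close>

lemma mean_log_nonvanishing: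
  assumes k: "k holomorphic_on ball 0 R'" and R: "0 < R" "R < R'"
    and nz: "\<And>\<zeta>. \<zeta> \<in> ball 0 R' \<Longrightarrow> k \<zeta> \<noteq> 0"
  shows "((\<lambda>\<theta>. ln (norm (k (of_real R * cis \<theta>)))) has_integral (2 * pi * ln (norm (k 0)))) {0..2*pi}"
proof -
  obtain l where l: "l holomorphic_on ball 0 R'" "\<And>\<zeta>. \<zeta> \<in> ball 0 R' \<Longrightarrow> k \<zeta> = exp (l \<zeta>)"
    using contractible_imp_holomorphic_log[OF k convex_imp_contractible[OF convex_ball] nz] by metis
  have "((\<lambda>u. l u / (u - 0)) has_contour_integral (2 * of_real pi * \<i> * l 0)) (circlepath 0 R)"
    by (rule Cauchy_integral_circlepath_simple)
       (use R in \<open>auto intro: holomorphic_on_subset[OF l(1)]\<close>)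
  then have "((\<lambda>t. l (0 + of_real R * cis t) / (0 + of_real R * cis t - 0) * of_real R * \<i> * cis t)
      has_integral (2 * of_real pi * \<i> * l 0)) {0..2*pi}"
    unfolding circlepath_def by (subst (asm) has_contour_integral_part_circlepath_iff) auto
  then have "((\<lambda>t. l (of_real R * cis t) * \<i>) has_integral (2 * of_real pi * \<i> * l 0)) {0..2*pi}"
    using R by (simp add: cis_neq_zero)
  then have "((\<lambda>t. l (of_real R * cis t) * \<i> * (- \<i>)) has_integral (2 * of_real pi * \<i> * l 0) * (- \<i>)) {0..2*pi}"
    by (rule has_integral_mult_left)
  then have "((\<lambda>t. l (of_real R * cis t)) has_integral (2 * of_real pi * l 0)) {0..2*pi}"
    by (simp add: mult.assoc) (simp add: mult.left_commute[of \<i>])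
  from has_integral_linear[OF this bounded_linear_Re]
  have "((\<lambda>t. Re (l (of_real R * cis t))) has_integral (2 * pi * Re (l 0))) {0..2*pi}"
    by (simp add: o_def)
  moreover have "ln (norm (k \<zeta>)) = Re (l \<zeta>)" if "\<zeta> \<in> ball 0 R'" for \<zeta>
    using l(2)[OF that] by simp
  ultimately show ?thesis
    using R by (simp add: norm_mult)
qed

text \<open>
  If \<open>a\<close> lies inside the circle, the zero is moved outside: \<open>\<bar>\<zeta> - a\<bar>\<close> agrees on the circle with the
  modulus of \<open>R - cnj a * \<zeta> / R\<close>, which has no zero in the disc and the value \<open>R\<close> at 0.
\<close>

lemma mean_log_linear:
  fixes a :: complex
  assumes R: "0 < R" and a: "a \<noteq> 0" "norm a \<noteq> R"
  obtains I where "((\<lambda>\<theta>. ln (norm (of_real R * cis \<theta> - a))) has_integral I) {0..2*pi}"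
    "2 * pi * ln (norm a) \<le> I"
proof (cases "norm a < R")
  case False
  then have "R < norm a" using a by simp
  have "((\<lambda>\<theta>. ln (norm (of_real R * cis \<theta> - a))) has_integral (2 * pi * ln (norm (0 - a)))) {0..2*pi}"
    by (rule mean_log_nonvanishing[where k = "\<lambda>\<zeta>. \<zeta> - a" and R' = "norm a"])
       (use R \<open>R < norm a\<close> in \<open>auto intro!: holomorphic_intros\<close>)
  then show thesis by (intro that) auto
next
  case True
  have eq: "norm (of_real R - cnj a / of_real R * (of_real R * cis \<theta>)) = norm (of_real R * cis \<theta> - a)" for \<theta>
  proof -
    have "of_real R - cnj a / of_real R * (of_real R * cis \<theta>) = cnj (of_real R * cis \<theta> - a) * cis \<theta>"
      using R by (simp add: algebra_simps cis_cnj cis_mult)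
    then show ?thesis by (simp add: norm_mult flip: complex_cnj_diff)
  qed
  have nz: "of_real R - cnj a / of_real R * \<zeta> \<noteq> 0" if "norm \<zeta> < R\<^sup>2 / norm a" for \<zeta>
  proof
    assume "of_real R - cnj a / of_real R * \<zeta> = 0"
    then have "of_real R * of_real R = cnj a * \<zeta>" using R by (simp add: field_simps)
    then have "R * R = norm a * norm \<zeta>"
      by (metis R abs_of_pos complex_mod_cnj norm_mult norm_of_real)
    then show False using that a by (simp add: field_simps power2_eq_square)
  qed
  have "((\<lambda>\<theta>. ln (norm (of_real R - cnj a / of_real R * (of_real R * cis \<theta>)))) has_integral
       (2 * pi * ln (norm (of_real R - cnj a / of_real R * 0)))) {0..2*pi}"
    by (rule mean_log_nonvanishing[where k = "\<lambda>\<zeta>. of_real R - cnj a / of_real R * \<zeta>" and R' = "R\<^sup>2 / norm a"])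
       (use R a nz True in \<open>auto intro!: holomorphic_intros simp: field_simps power2_eq_square\<close>)
  then have "((\<lambda>\<theta>. ln (norm (of_real R * cis \<theta> - a))) has_integral (2 * pi * ln R)) {0..2*pi}"
    unfolding eq using R by simp
  moreover have "2 * pi * ln (norm a) \<le> 2 * pi * ln R" using True a R by simp
  ultimately show thesis by (rule that)
qed

text \<open>
  Split off the zeros one at a time: a linear factor only increases the mean, and the remaining
  zero-free factor satisfies equality.
\<close>

lemma jensen_inequality_circle:
  assumes "finite Z" "h holomorphic_on ball 0 R'" "{\<zeta>\<in>ball 0 R'. h \<zeta> = 0} = Z"
    and "\<And>\<zeta>. \<zeta> \<in> Z \<Longrightarrow> norm \<zeta> \<noteq> R" "0 < R" "R < R'" "h 0 \<noteq> 0"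
  shows "\<exists>I. ((\<lambda>\<theta>. ln (norm (h (of_real R * cis \<theta>)))) has_integral I) {0..2*pi}
     \<and> 2 * pi * ln (norm (h 0)) \<le> I"
  using assms
proof (induction Z arbitrary: h rule: finite_induct)
  case empty
  show ?case
    using mean_log_nonvanishing[OF empty(1) \<open>0 < R\<close> \<open>R < R'\<close>] empty(2) by blast
next
  case (insert a Z)
  have a: "a \<in> ball 0 R'" "h a = 0" using insert.prems(2) by auto
  have "a \<noteq> 0" using a insert.prems by auto
  have aR: "norm a \<noteq> R" using insert.prems by blast
  have nc: "\<not> h constant_on ball 0 R'"
    using a insert.prems(6,4,5) unfolding constant_on_def by fastforce
  obtain g r n where g: "0 < n" "0 < r" "ball a r \<subseteq> ball 0 R'" "g holomorphic_on ball a r"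
     "\<And>w. w \<in> ball a r \<Longrightarrow> h w = (w - a)^n * g w" "\<And>w. w \<in> ball a r \<Longrightarrow> g w \<noteq> 0"
    by (rule holomorphic_factor_zero_nonconstant[OF insert.prems(1) open_ball connected_ball a nc]) blast
  \<comment> \<open>The quotient by the full power of the linear factor has one zero less.\<close>
  define k where "k = (\<lambda>w. if w = a then g a else h w / (w - a)^n)"
  have kg: "k w = g w" if "w \<in> ball a r" for w
    using g(5)[OF that] by (auto simp: k_def)
  have kh: "h w = k w * (w - a)^n" if "w \<in> ball 0 R'" for w
    using a g(1) by (auto simp: k_def)
  have "k holomorphic_on ball a r"
    by (rule holomorphic_transform[OF g(4)]) (rule kg[symmetric])
  moreover have "k holomorphic_on (ball 0 R' - {a})"
  proof -
    have "(\<lambda>w. h w / (w - a)^n) holomorphic_on (ball 0 R' - {a})"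
      by (intro holomorphic_intros holomorphic_on_subset[OF insert.prems(1)]) auto
    then show ?thesis by (rule holomorphic_transform) (auto simp: k_def)
  qed
  ultimately have "k holomorphic_on (ball a r \<union> (ball 0 R' - {a}))"
    by (rule holomorphic_on_Un) auto
  moreover have "ball a r \<union> (ball 0 R' - {a}) = ball 0 R'"
    using g(2,3) a by auto
  ultimately have hol: "k holomorphic_on ball 0 R'" by simp
  have "k a \<noteq> 0" using g(2,6) kg by auto
  then have zeros: "{\<zeta>\<in>ball 0 R'. k \<zeta> = 0} = Z"
  proof -
    have "k \<zeta> = 0 \<longleftrightarrow> h \<zeta> = 0 \<and> \<zeta> \<noteq> a" if "\<zeta> \<in> ball 0 R'" for \<zeta>
      using kh[OF that] \<open>k a \<noteq> 0\<close> by auto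
    then have "{\<zeta>\<in>ball 0 R'. k \<zeta> = 0} = {\<zeta>\<in>ball 0 R'. h \<zeta> = 0} - {a}" by auto
    then show ?thesis using insert.prems(2) insert.hyps(2) by auto
  qed
  have k0: "k 0 \<noteq> 0" using kh[of 0] insert.prems by auto
  obtain I where I: "((\<lambda>\<theta>. ln (norm (k (of_real R * cis \<theta>)))) has_integral I) {0..2*pi}"
      "2 * pi * ln (norm (k 0)) \<le> I"
    using insert.IH[OF hol zeros _ \<open>0 < R\<close> \<open>R < R'\<close> k0] insert.prems(3) by blast
  obtain J where J: "((\<lambda>\<theta>. ln (norm (of_real R * cis \<theta> - a))) has_integral J) {0..2*pi}"
    "2 * pi * ln (norm a) \<le> J"
    using mean_log_linear[OF \<open>0 < R\<close> \<open>a \<noteq> 0\<close> aR] by blast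
  have "((\<lambda>\<theta>. ln (norm (k (of_real R * cis \<theta>))) + real n * ln (norm (of_real R * cis \<theta> - a)))
      has_integral (I + real n * J)) {0..2*pi}"
    by (intro has_integral_add I has_integral_mult_right J)
  moreover have "ln (norm (k (of_real R * cis \<theta>))) + real n * ln (norm (of_real R * cis \<theta> - a))
      = ln (norm (h (of_real R * cis \<theta>)))" for \<theta>
  proof -
    have nn: "norm (of_real R * cis \<theta>) = R" using \<open>0 < R\<close> by (simp add: norm_mult)
    have in': "of_real R * cis \<theta> \<in> ball 0 R'" using nn \<open>R < R'\<close> by simp
    have "h (of_real R * cis \<theta>) \<noteq> 0" using insert.prems(2,3) nn in' by blast
    moreover have "h (of_real R * cis \<theta>) = k (of_real R * cis \<theta>) * (of_real R * cis \<theta> - a)^n"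
      by (rule kh[OF in'])
    ultimately have "k (of_real R * cis \<theta>) \<noteq> 0" "of_real R * cis \<theta> - a \<noteq> 0"
      "norm (h (of_real R * cis \<theta>)) = norm (k (of_real R * cis \<theta>)) * norm (of_real R * cis \<theta> - a)^n"
      using g(1) by (auto simp: norm_mult norm_power)
    then show ?thesis by (simp add: ln_mult ln_realpow)
  qed
  moreover have "2 * pi * ln (norm (h 0)) \<le> I + real n * J"
  proof -
    have "norm (h 0) = norm (k 0) * norm a ^ n"
      using kh[of 0] \<open>0 < R\<close> \<open>R < R'\<close> by (simp add: norm_mult norm_power)
    then have "2 * pi * ln (norm (h 0)) = 2 * pi * ln (norm (k 0)) + real n * (2 * pi * ln (norm a))"
      using k0 \<open>a \<noteq> 0\<close> by (simp add: ln_mult ln_realpow algebra_simps)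
    then show ?thesis using I(2) J(2) by (simp add: add_mono mult_left_mono)
  qed
  ultimately show ?case by auto
qed

text \<open>
  There may be zeros on the unit circle, so Jensen's inequality is applied on slightly larger circles
  that avoid the zeros, and Fatou's lemma gives the limit. An upper bound \<open>M\<close> is subtracted to have
  nonnegative integrands.
\<close>

lemma jensen_inequality_disc:
  assumes h: "h holomorphic_on S" "open S" "cball 0 1 \<subseteq> S" and h0: "h 0 \<noteq> 0"
  obtains M where "\<And>\<theta>. elog (norm (h (cis \<theta>))) \<le> ereal M" "M \<ge> 0" "ln (norm (h 0)) \<le> M"
    "(\<integral>\<^sup>+\<theta>\<in>{0..2*pi}. e2ennreal (ereal M - elog (norm (h (cis \<theta>)))) \<partial>lborel)
       \<le> ennreal (2 * pi * (M - ln (norm (h 0))))"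
proof -
  obtain e where e: "e > 0" "(\<Union>x\<in>cball 0 1. ball x e) \<subseteq> S"
    by (rule compact_subset_open_imp_ball_epsilon_subset[OF compact_cball h(2,3)]) auto
  \<comment> \<open>The function is holomorphic on a disc of radius greater than 1.\<close>
  define R' where "R' = 1 + e / 2"
  have R': "R' > 1" using e by (simp add: R'_def)
  have sub: "cball 0 R' \<subseteq> S"
  proof
    fix x :: complex assume x: "x \<in> cball 0 R'"
    show "x \<in> S"
    proof (cases "norm x \<le> 1")
      case True then show ?thesis using h(3) by auto
    next
      case False
      then have "norm x > 1" by simp
      let ?y = "x / of_real (norm x)"
      have y: "norm ?y = 1" using \<open>norm x > 1\<close> by (auto simp: norm_divide)
      have "x = ?y * of_real (norm x)" using \<open>norm x > 1\<close> by auto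
      then have "x - ?y = ?y * of_real (norm x - 1)"
        unfolding of_real_diff right_diff_distrib by simp
      then have "norm (x - ?y) = norm x - 1"
        using norm_mult[of ?y "of_real (norm x - 1)"] y \<open>norm x > 1\<close>
        by (simp only: norm_of_real mult_1 abs_of_pos diff_gt_0_iff_gt)
      moreover have "norm x - 1 < e" using x e by (simp add: R'_def)
      ultimately have "x \<in> ball ?y e" "?y \<in> cball 0 1" using y by (simp_all only: mem_ball mem_cball dist_norm norm_minus_commute[of ?y x]) auto
      then have "x \<in> (\<Union>x\<in>cball 0 1. ball x e)" by (intro UN_I)
      then show ?thesis using e(2) by (rule subsetD[rotated])
    qed
  qed
  define Z where "Z = {\<zeta>\<in>ball 0 R'. h \<zeta> = 0}"
  have Zfin: "finite Z"
  proof (cases "h constant_on ball 0 (R' + 0)")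
    case True
    then have "Z = {}" using h0 R' unfolding constant_on_def Z_def by force
    then show ?thesis by simp
  next
    case False
    obtain e' where e': "e' > 0" "(\<Union>x\<in>cball 0 R'. ball x e') \<subseteq> S"
      by (rule compact_subset_open_imp_ball_epsilon_subset[OF compact_cball h(2) sub]) auto
    define B where "B = (\<Union>x\<in>cball (0::complex) R'. ball x e')"
    have "open B" unfolding B_def by auto
    moreover have "cball 0 R' \<subseteq> B" using e'(1) unfolding B_def by force
    moreover have "connected B"
    proof -
      have "B = (\<Union>x\<in>cball (0::complex) R'. \<Union>y\<in>ball 0 e'. {x + y})"
      proof (intro set_eqI iffI)
        fix z assume "z \<in> B"
        then obtain x where "x \<in> cball (0::complex) R'" "z \<in> ball x e'" unfolding B_def by blast
        then show "z \<in> (\<Union>x\<in>cball (0::complex) R'. \<Union>y\<in>ball 0 e'. {x + y})"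
          by (intro UN_I[of x] UN_I[of "z - x"]) (auto simp: dist_norm norm_minus_commute)
      next
        fix z assume "z \<in> (\<Union>x\<in>cball (0::complex) R'. \<Union>y\<in>ball 0 e'. {x + y})"
        then obtain x y where xy: "x \<in> cball (0::complex) R'" "y \<in> ball 0 e'" "z = x + y" by blast
        then have "z \<in> ball x e'" by (simp add: dist_norm)
        then show "z \<in> B" unfolding B_def using xy(1) by (rule UN_I[rotated])
      qed
      then show ?thesis using convex_sums[of "cball (0::complex) R'" "ball 0 e'"] convex_connected by auto
    qed
    moreover have "\<not> h constant_on B"
      using False \<open>cball 0 R' \<subseteq> B\<close> unfolding constant_on_def by force
    moreover have "h holomorphic_on B"
      using h(1) by (rule holomorphic_on_subset) (use e'(2) in \<open>simp only: B_def\<close>)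
    ultimately have "finite {\<zeta>\<in>cball 0 R'. h \<zeta> = 0}"
      by (intro holomorphic_compact_finite_zeros[of h B "cball 0 R'"] compact_cball)
    then show ?thesis unfolding Z_def by (rule rev_finite_subset) auto
  qed
  have hR': "h holomorphic_on ball 0 R'"
    by (rule holomorphic_on_subset[OF h(1)]) (use sub in auto)
  obtain M0 where M0: "\<And>\<zeta>. \<zeta> \<in> cball 0 R' \<Longrightarrow> norm (h \<zeta>) \<le> M0"
  proof -
    have "compact (h ` cball 0 R')"
      by (intro compact_continuous_image holomorphic_on_imp_continuous_on holomorphic_on_subset[OF h(1)] sub compact_cball)
    then have "bounded (h ` cball 0 R')" by (rule compact_imp_bounded)
    then show thesis using that unfolding bounded_iff by blast
  qed
  define M where "M = ln (max 1 M0)"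
  have M: "M \<ge> 0" by (simp add: M_def)
  have lnM: "ln (norm (h \<zeta>)) \<le> M" if "\<zeta> \<in> cball 0 R'" "h \<zeta> \<noteq> 0" for \<zeta>
    unfolding M_def using M0[OF that(1)] that(2) by (subst ln_le_cancel_iff) auto
  \<comment> \<open>Radii that decrease to 1 and avoid the finitely many moduli of zeros.\<close>
  have "\<exists>Rn. 1 < Rn \<and> Rn < min R' (1 + 1 / real (Suc n)) \<and> Rn \<notin> norm ` Z" for n
  proof -
    have "infinite {1<..<min R' (1 + 1 / real (Suc n))}"
      using R' by (intro infinite_Ioo) auto
    then have "infinite ({1<..<min R' (1 + 1 / real (Suc n))} - norm ` Z)"
      using Zfin by simp
    then obtain x where "x \<in> {1<..<min R' (1 + 1 / real (Suc n))} - norm ` Z"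
      using infinite_imp_nonempty by blast
    then show ?thesis by auto
  qed
  then have "\<exists>R. \<forall>n. 1 < R n \<and> R n < min R' (1 + 1 / real (Suc n)) \<and> R n \<notin> norm ` Z"
    by (intro choice) blast
  then obtain R where R: "\<And>n. 1 < R n" "\<And>n. R n < R'" "\<And>n. R n < 1 + 1 / real (Suc n)"
      "\<And>n. R n \<notin> norm ` Z"
    by auto
  have Rlim: "R \<longlonglongrightarrow> 1"
  proof (rule tendsto_sandwich[of "\<lambda>_. 1" _ _ "\<lambda>n. 1 + 1 / real (Suc n)"])
    show "(\<lambda>n. 1 + 1 / real (Suc n)) \<longlonglongrightarrow> 1"
      using tendsto_add[OF tendsto_const LIMSEQ_inverse_real_of_nat, of 1] by (simp add: inverse_eq_divide)
  qed (auto intro!: eventuallyI less_imp_le[OF R(1)] less_imp_le[OF R(3)] simp del: of_nat_Suc)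
  define g where "g = (\<lambda>n \<theta>. M - ln (norm (h (of_real (R n) * cis \<theta>))))"
  have inR: "of_real (R n) * cis \<theta> \<in> ball 0 R'" for n \<theta>
    using R(1,2)[of n] by (simp add: norm_mult)
  have nz: "h (of_real (R n) * cis \<theta>) \<noteq> 0" for n \<theta>
  proof
    assume "h (of_real (R n) * cis \<theta>) = 0"
    then have "of_real (R n) * cis \<theta> \<in> Z" using inR by (simp add: Z_def)
    then have "norm (of_real (R n) * cis \<theta>) \<in> norm ` Z" by blast
    then show False using R(1,4)[of n] by (simp add: norm_mult)
  qed
  have g0: "0 \<le> g n \<theta>" for n \<theta>
    using lnM[of "of_real (R n) * cis \<theta>"] nz[of n \<theta>] inR[of n \<theta>] unfolding g_def by auto
  have gint: "(\<integral>\<^sup>+\<theta>\<in>{0..2*pi}. ennreal (g n \<theta>) \<partial>lborel) \<le> ennreal (2 * pi * (M - ln (norm (h 0))))" for n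
  proof -
    obtain I where I: "((\<lambda>\<theta>. ln (norm (h (of_real (R n) * cis \<theta>)))) has_integral I) {0..2*pi}"
       "2 * pi * ln (norm (h 0)) \<le> I"
      using jensen_inequality_circle[OF Zfin hR' Z_def[symmetric], of "R n"] R(1,2,4)[of n] h0 by force
    have "((\<lambda>\<theta>. M) has_integral (2 * pi * M)) {0..2*pi}"
      using has_integral_const_real[of M 0 "2*pi"] by simp
    then have "(g n has_integral (2 * pi * M - I)) {0..2*pi}"
      unfolding g_def by (rule has_integral_diff) (rule I)
    then have "integral\<^sup>N lborel (\<lambda>x. ennreal (indicator {0..2*pi} x * g n x)) = ennreal (2 * pi * M - I)"
      using g0 by (intro nn_integral_has_integral_lebesgue) auto
    moreover have "ennreal (indicator {0..2*pi} x * g n x) = ennreal (g n x) * indicator {0..2*pi} x" for x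
      by (auto simp: indicator_def)
    ultimately have "(\<integral>\<^sup>+\<theta>\<in>{0..2*pi}. ennreal (g n \<theta>) \<partial>lborel) = ennreal (2 * pi * M - I)" by simp
    also have "\<dots> \<le> ennreal (2 * pi * (M - ln (norm (h 0))))"
      using I(2) by (intro ennreal_leI) (simp add: algebra_simps)
    finally show ?thesis .
  qed
  have hcont: "continuous_on (cball 0 R') h"
    by (intro holomorphic_on_imp_continuous_on holomorphic_on_subset[OF h(1)] sub)
  have hlim: "(\<lambda>n. norm (h (of_real (R n) * cis \<theta>))) \<longlonglongrightarrow> norm (h (cis \<theta>))" for \<theta>
  proof -
    have "(\<lambda>n. of_real (R n) * cis \<theta>) \<longlonglongrightarrow> of_real 1 * cis \<theta>"
      by (intro tendsto_intros Rlim)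
    then have "(\<lambda>n. of_real (R n) * cis \<theta>) \<longlonglongrightarrow> cis \<theta>" by simp
    then have "(\<lambda>n. h (of_real (R n) * cis \<theta>)) \<longlonglongrightarrow> h (cis \<theta>)"
    proof (rule continuous_on_tendsto_compose[OF hcont])
      show "cis \<theta> \<in> cball 0 R'" using R' by simp
      show "\<forall>\<^sub>F n in sequentially. of_real (R n) * cis \<theta> \<in> cball 0 R'"
        by (rule always_eventually) (use inR ball_subset_cball in blast)
    qed
    then show ?thesis by (rule tendsto_norm)
  qed
  have glim: "(\<lambda>n. ennreal (g n \<theta>)) \<longlonglongrightarrow> e2ennreal (ereal M - elog (norm (h (cis \<theta>))))" for \<theta>
  proof (cases "h (cis \<theta>) = 0")
    case False
    have "(\<lambda>n. ennreal (g n \<theta>)) \<longlonglongrightarrow> ennreal (M - ln (norm (h (cis \<theta>))))"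
      unfolding g_def by (intro tendsto_intros hlim) (use False in auto)
    then show ?thesis using False by (simp add: elog_def)
  next
    case True
    have "filterlim (\<lambda>n. norm (h (of_real (R n) * cis \<theta>))) (at_right 0) sequentially"
      unfolding filterlim_at using hlim[of \<theta>] True nz by auto
    then have "filterlim (\<lambda>n. ln (norm (h (of_real (R n) * cis \<theta>)))) at_bot sequentially"
      by (rule filterlim_compose[OF ln_at_0])
    then have "filterlim (\<lambda>n. - ln (norm (h (of_real (R n) * cis \<theta>)))) at_top sequentially"
      by (simp add: filterlim_uminus_at_bot)
    then have "filterlim (\<lambda>n. M + - ln (norm (h (of_real (R n) * cis \<theta>)))) at_top sequentially"
      by (rule filterlim_tendsto_add_at_top[OF tendsto_const])
    then have "(\<lambda>n. ennreal (g n \<theta>)) \<longlonglongrightarrow> top"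
      unfolding g_def ennreal_tendsto_top_eq_at_top by simp
    then show ?thesis using True by (simp add: elog_def)
  qed
  have meas: "(\<lambda>\<theta>. ennreal (g n \<theta>) * indicator {0..2*pi} \<theta>) \<in> borel_measurable lborel" for n
  proof -
    have "continuous_on UNIV (\<lambda>\<theta>. h (of_real (R n) * cis \<theta>))"
    proof (rule continuous_on_compose2[OF hcont])
      show "continuous_on UNIV (\<lambda>\<theta>. of_real (R n) * cis \<theta>)" by (intro continuous_intros)
      show "range (\<lambda>\<theta>. of_real (R n) * cis \<theta>) \<subseteq> cball 0 R'"
        using inR[of n] ball_subset_cball by blast
    qed
    then have "(\<lambda>\<theta>. h (of_real (R n) * cis \<theta>)) \<in> borel_measurable borel"
      by (rule borel_measurable_continuous_onI)
    then show ?thesis unfolding g_def by simp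
  qed
  have "(\<integral>\<^sup>+\<theta>\<in>{0..2*pi}. e2ennreal (ereal M - elog (norm (h (cis \<theta>)))) \<partial>lborel)
     \<le> (\<integral>\<^sup>+\<theta>. liminf (\<lambda>n. ennreal (g n \<theta>) * indicator {0..2*pi} \<theta>) \<partial>lborel)"
  proof (intro nn_integral_mono)
    fix \<theta> :: real
    have "liminf (\<lambda>n. ennreal (g n \<theta>)) = e2ennreal (ereal M - elog (norm (h (cis \<theta>))))"
      by (intro lim_imp_Liminf glim) simp
    then show "e2ennreal (ereal M - elog (norm (h (cis \<theta>)))) * indicator {0..2*pi} \<theta>
        \<le> liminf (\<lambda>n. ennreal (g n \<theta>) * indicator {0..2*pi} \<theta>)"
      by (cases "\<theta> \<in> {0..2*pi}") auto
  qed
  also have "\<dots> \<le> liminf (\<lambda>n. \<integral>\<^sup>+\<theta>\<in>{0..2*pi}. ennreal (g n \<theta>) \<partial>lborel)"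
    by (rule nn_integral_liminf) (rule meas)
  also have "\<dots> \<le> ennreal (2 * pi * (M - ln (norm (h 0))))"
    by (rule Liminf_le) (use gint in auto)
  finally have fin: "(\<integral>\<^sup>+\<theta>\<in>{0..2*pi}. e2ennreal (ereal M - elog (norm (h (cis \<theta>)))) \<partial>lborel)
     \<le> ennreal (2 * pi * (M - ln (norm (h 0))))" .
  have up: "elog (norm (h (cis \<theta>))) \<le> ereal M" for \<theta>
    using lnM[of "cis \<theta>"] R' by (auto simp: elog_def)
  show thesis using that[OF up M _ fin] lnM[of 0] h0 R' by simp
qed

text \<open>
  The positive part \<open>P\<close> and the negative part \<open>N\<close> of an integral are tied to the deficit \<open>K\<close> from the bound
  \<open>M\<close> by an equation in which every term is nonnegative; it can be solved for \<open>P - N\<close> since all terms turn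
  out to be finite.
\<close>

lemma ennreal_balance:
  fixes P K N :: ennreal
  assumes eq: "P + K = ennreal (2 * pi * M) + N" and PM: "P \<le> ennreal (2 * pi * M)"
    and int: "K \<le> ennreal (2 * pi * (M - c))" and c: "c \<le> M" "0 \<le> M"
  shows "ereal c \<le> (enn2ereal P - enn2ereal N) / ereal (2 * pi)"
proof -
  have "P < top" using PM by (rule le_less_trans) simp
  obtain p where p: "P = ennreal p" "p \<ge> 0"
    using \<open>P < top\<close> ennreal_cases[of P] by (metis less_irrefl)
  have "P + K \<le> P + ennreal (2 * pi * (M - c))"
    by (rule add_left_mono[OF int])
  then have *: "ennreal (2 * pi * M) + N \<le> P + ennreal (2 * pi * (M - c))"
    by (simp only: eq)
  also have "P + ennreal (2 * pi * (M - c)) < top" using \<open>P < top\<close> by (simp only: ennreal_add_less_top ennreal_less_top conj_commute simp_thms)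
  finally have "N < top" by (simp only: ennreal_add_less_top)
  then obtain n where n: "N = ennreal n" "n \<ge> 0"
    using ennreal_cases[of N] by (metis less_irrefl)
  have pn: "2 * pi * M + n \<le> p + 2 * pi * (M - c)"
  proof -
    have "0 \<le> 2 * pi * M" "0 \<le> 2 * pi * (M - c)" using c by auto
    from * have "ennreal (2 * pi * M + n) \<le> ennreal (p + 2 * pi * (M - c))"
      unfolding p(1) n(1) using ennreal_plus[OF \<open>0 \<le> 2 * pi * M\<close> n(2)] ennreal_plus[OF p(2) \<open>0 \<le> 2 * pi * (M - c)\<close>]
      by (simp only:)
    then show ?thesis
      using p(2) \<open>0 \<le> 2 * pi * (M - c)\<close> ennreal_le_iff[of "p + 2 * pi * (M - c)"] by (simp only: add_nonneg_nonneg simp_thms)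
  qed
  have "2 * pi * c \<le> p - n" using pn by (simp add: right_diff_distrib)
  then show ?thesis
    unfolding p(1) n(1) using p(2) n(2) by (simp add: field_simps)
qed

lemma e2ennreal_pos_neg_parts:
  assumes le: "x \<le> ereal M" and M: "M \<ge> 0"
  shows "e2ennreal x + e2ennreal (ereal M - x) = ennreal M + e2ennreal (- x)"
proof (cases "x")
    case (real r)
    then have "r \<le> M" using le by simp
    have "ennreal r + ennreal (M - r) = ennreal M + ennreal (- r)"
  proof (cases "r \<ge> 0")
      case True
      then have z: "ennreal (- r) = 0" by (intro ennreal_neg) linarith
      have "ennreal (r + (M - r)) = ennreal r + ennreal (M - r)"
        by (rule ennreal_plus) (use True \<open>r \<le> M\<close> in linarith)+
      moreover have "r + (M - r) = M" by linarith
      ultimately show ?thesis by (simp only: z add_0_right)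
    next
      case False
      then have z: "ennreal r = 0" by (intro ennreal_neg) linarith
      have "ennreal (M + - r) = ennreal M + ennreal (- r)"
        by (rule ennreal_plus) (use False M in linarith)+
      then show ?thesis by (simp only: z add_0_left diff_conv_add_uminus)
    qed
    then show ?thesis unfolding real ereal_minus(1) uminus_ereal.simps e2ennreal_ereal .
  next
    case PInf
    have False using le unfolding PInf by simp
    then show ?thesis ..
  next
    case MInf
    have "e2ennreal (- \<infinity>) = 0" by (simp add: e2ennreal_neg)
    moreover have "ereal M - - \<infinity> = \<infinity>" "- (- \<infinity>) = (\<infinity>::ereal)" by simp_all
    moreover have "e2ennreal \<infinity> = top" by simp
    ultimately show ?thesis
      unfolding MInf by (simp only: add_0_left add_top_left_ennreal add_top_right_ennreal)
  qed

lemma nn_integral_const_circle: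
  assumes M: "M \<ge> 0"
  shows "(\<integral>\<^sup>+\<theta>\<in>{0..2*pi}. ennreal M \<partial>lborel) = ennreal (2 * pi * M)"
proof -
  have 1: "(\<integral>\<^sup>+\<theta>\<in>{0..2*pi}. ennreal M \<partial>lborel) = ennreal M * emeasure lborel {0..2*pi}"
    by (rule nn_integral_cmult_indicator) (rule borel_closed[THEN sets_lborel[THEN equalityD2, THEN subsetD]], rule closed_atLeastAtMost)
  have 2: "emeasure lborel {0..2*pi} = ennreal (2 * pi - 0)"
    by (rule emeasure_lborel_Icc) (rule order.strict_implies_order, rule pi_gt_zero[THEN mult_pos_pos[rotated]], simp)
  have 3: "ennreal (M * (2 * pi)) = ennreal M * ennreal (2 * pi)" by (rule ennreal_mult) (use M in auto)
  show ?thesis unfolding 1 2 diff_0_right 3[symmetric] by (rule arg_cong[of _ _ ennreal]) (rule mult.commute)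
qed

lemma measurable_circle_parts:
  fixes V :: "real \<Rightarrow> ereal"
  assumes V: "V \<in> borel_measurable borel"
  shows "(\<lambda>\<theta>. e2ennreal (V \<theta>) * indicator {0..2*pi} \<theta>) \<in> borel_measurable lborel"
    and "(\<lambda>\<theta>. e2ennreal (ereal M - V \<theta>) * indicator {0..2*pi} \<theta>) \<in> borel_measurable lborel"
    and "(\<lambda>\<theta>. e2ennreal (- V \<theta>) * indicator {0..2*pi} \<theta>) \<in> borel_measurable lborel"
    and "(\<lambda>\<theta>::real. ennreal M * indicator {0..2*pi} \<theta>) \<in> borel_measurable lborel"
proof -
  have ind: "(indicator {0..2*pi} :: real \<Rightarrow> ennreal) \<in> borel_measurable lborel"
    by (rule borel_measurable_indicator) simp
  have V': "V \<in> borel_measurable lborel" using V by simp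
  show "(\<lambda>\<theta>. e2ennreal (V \<theta>) * indicator {0..2*pi} \<theta>) \<in> borel_measurable lborel"
    by (rule borel_measurable_times_ennreal[OF measurable_compose[OF V' measurable_e2ennreal] ind])
  show "(\<lambda>\<theta>. e2ennreal (ereal M - V \<theta>) * indicator {0..2*pi} \<theta>) \<in> borel_measurable lborel"
    by (rule borel_measurable_times_ennreal[OF measurable_compose[OF
          borel_measurable_ereal_diff[OF measurable_const V'] measurable_e2ennreal] ind]) simp
  show "(\<lambda>\<theta>. e2ennreal (- V \<theta>) * indicator {0..2*pi} \<theta>) \<in> borel_measurable lborel"
    by (rule borel_measurable_times_ennreal[OF measurable_compose[OF
          borel_measurable_uminus_ereal[OF V'] measurable_e2ennreal] ind])
  show "(\<lambda>\<theta>::real. ennreal M * indicator {0..2*pi} \<theta>) \<in> borel_measurable lborel"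
    by (rule borel_measurable_times_ennreal[OF measurable_const ind]) simp
qed

text \<open>
  Converts an estimate of the integral of \<open>M - u\<close>, which Fatou's lemma provides, into one of the
  difference of two integrals that defines the mean.
\<close>

lemma circle_mean_ge:
  fixes u :: "complex^'n \<Rightarrow> ereal" and M c :: real
  assumes le: "\<And>\<theta>. u (z + cis \<theta> *s w) \<le> ereal M" and M: "M \<ge> 0" and c: "c \<le> M"
    and meas: "(\<lambda>\<theta>. u (z + cis \<theta> *s w)) \<in> borel_measurable borel"
    and int: "(\<integral>\<^sup>+\<theta>\<in>{0..2*pi}. e2ennreal (ereal M - u (z + cis \<theta> *s w)) \<partial>lborel) \<le> ennreal (2 * pi * (M - c))"
  shows "ereal c \<le> circle_mean u z w"
proof -
  let ?U = "\<lambda>\<theta>. u (z + cis \<theta> *s w)"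
  define P where "P = (\<integral>\<^sup>+\<theta>\<in>{0..2*pi}. e2ennreal (?U \<theta>) \<partial>lborel)"
  define N where "N = (\<integral>\<^sup>+\<theta>\<in>{0..2*pi}. e2ennreal (- ?U \<theta>) \<partial>lborel)"
  define K where "K = (\<integral>\<^sup>+\<theta>\<in>{0..2*pi}. e2ennreal (ereal M - ?U \<theta>) \<partial>lborel)"
  note const = nn_integral_const_circle[OF M]
  have pt: "e2ennreal (?U \<theta>) + e2ennreal (ereal M - ?U \<theta>) = ennreal M + e2ennreal (- ?U \<theta>)" for \<theta>
    by (rule e2ennreal_pos_neg_parts[OF le M])
  note m = measurable_circle_parts[OF meas]
  have pt': "e2ennreal (?U \<theta>) * indicator {0..2*pi} \<theta> + e2ennreal (ereal M - ?U \<theta>) * indicator {0..2*pi} \<theta>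
      = ennreal M * indicator {0..2*pi} \<theta> + e2ennreal (- ?U \<theta>) * indicator {0..2*pi} \<theta>" for \<theta>
    unfolding distrib_right[symmetric] pt ..
  have eq: "P + K = ennreal (2 * pi * M) + N"
    unfolding P_def K_def N_def nn_integral_add[OF m(1,2), symmetric] pt' nn_integral_add[OF m(4,3)] const ..
  have le': "e2ennreal (?U \<theta>) * indicator {0..2*pi} \<theta> \<le> ennreal M * indicator {0..2*pi} \<theta>" for \<theta>
    by (rule mult_right_mono[OF e2ennreal_mono[OF le[of \<theta>], unfolded e2ennreal_ereal]]) simp
  have "P \<le> (\<integral>\<^sup>+\<theta>\<in>{0..2*pi}. ennreal M \<partial>lborel)"
    unfolding P_def by (rule nn_integral_mono) (rule le')
  then have "P \<le> ennreal (2 * pi * M)" unfolding const .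
  from ennreal_balance[OF eq this int[folded K_def] c M]
  show ?thesis unfolding circle_mean_def P_def N_def .
qed

lemma elog_less_iff:
  assumes "r \<ge> 0"
  shows "elog r < ereal b \<longleftrightarrow> r < exp b"
proof (cases "r = 0")
  case False
  then have "r > 0" using assms by simp
  then show ?thesis using ln_less_cancel_iff[of r "exp b"] by (simp add: elog_def)
qed (simp add: elog_def)

lemma open_elog_norm_less:
  assumes "mv_holomorphic_on f W"
  shows "open {z\<in>W. elog (norm (f z)) < a}"
proof (cases a)
  case (real b)
  have "open (W \<inter> (\<lambda>z. norm (f z)) -` {..<exp b})"
    by (rule continuous_open_preimage)
      (use assms in \<open>auto intro!: continuous_on_norm mv_holomorphic_on_imp_continuous_on mv_holomorphic_on_open\<close>)
  moreover have "{z\<in>W. elog (norm (f z)) < a} = W \<inter> (\<lambda>z. norm (f z)) -` {..<exp b}"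
    unfolding real by (auto simp: elog_less_iff)
  ultimately show ?thesis by simp
next
  case PInf
  have "{z\<in>W. elog (norm (f z)) < a} = W" unfolding PInf by (auto simp: elog_def)
  then show ?thesis using mv_holomorphic_on_open[OF assms] by simp
next
  case MInf
  then show ?thesis by simp
qed

lemma measurable_elog: "elog \<in> borel_measurable borel"
  unfolding elog_def by measurable

text \<open>
  On the complex line through \<open>z\<close> in the direction \<open>w\<close> this is Jensen's inequality.
\<close>

lemma elog_norm_le_circle_mean:
  fixes f :: "complex^'n \<Rightarrow> complex"
  assumes f: "mv_holomorphic_on f W" and disc: "\<And>\<zeta>. norm \<zeta> \<le> 1 \<Longrightarrow> z + \<zeta> *s w \<in> W"
  shows "elog (norm (f z)) \<le> circle_mean (\<lambda>z. elog (norm (f z))) z w"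
proof (cases "f z = 0")
  case True
  then show ?thesis by (simp add: elog_def)
next
  case False
  define h where "h = (\<lambda>\<zeta>. f (z + \<zeta> *s w))"
  define S where "S = {\<zeta>. z + \<zeta> *s w \<in> W}"
  have hol: "h holomorphic_on S"
    unfolding h_def S_def by (rule mv_holomorphic_on_complex_line[OF f])
  have S: "open S" unfolding S_def by (rule open_complex_line_vimage[OF mv_holomorphic_on_open[OF f]])
  have cS: "cball 0 1 \<subseteq> S" using disc by (auto simp: S_def)
  have h0: "h 0 \<noteq> 0" "h 0 = f z" using False by (auto simp: h_def)
  obtain M where M: "\<And>\<theta>. elog (norm (h (cis \<theta>))) \<le> ereal M" "M \<ge> 0" "ln (norm (h 0)) \<le> M"
    "(\<integral>\<^sup>+\<theta>\<in>{0..2*pi}. e2ennreal (ereal M - elog (norm (h (cis \<theta>)))) \<partial>lborel)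
       \<le> ennreal (2 * pi * (M - ln (norm (h 0))))"
    by (rule jensen_inequality_disc[OF hol S cS h0(1)]) (rule that)
  have "continuous_on UNIV (\<lambda>\<theta>. h (cis \<theta>))"
  proof (rule continuous_on_compose2[OF holomorphic_on_imp_continuous_on[OF hol]])
    show "continuous_on UNIV cis" by (intro continuous_intros)
    show "range cis \<subseteq> S" using cS by auto
  qed
  then have "(\<lambda>\<theta>. norm (h (cis \<theta>))) \<in> borel_measurable borel"
    by (intro borel_measurable_continuous_onI continuous_on_norm)
  then have meas: "(\<lambda>\<theta>. elog (norm (h (cis \<theta>)))) \<in> borel_measurable borel"
    by (rule measurable_compose[OF _ measurable_elog])
  have "ereal (ln (norm (h 0))) \<le> circle_mean (\<lambda>z. elog (norm (f z))) z w"
    by (rule circle_mean_ge[where M = M]) (use M meas in \<open>simp_all only: h_def\<close>)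
  then show ?thesis using h0 by (simp add: elog_def)
qed

text \<open>
  At its centre \<open>u\<close> is one of the \<open>log \<bar>f j\<bar>\<close>, and on the circle it is at least that function.
\<close>

lemma plurisubharmonic_on_log_max:
  fixes f :: "nat \<Rightarrow> complex^'n \<Rightarrow> complex"
  assumes f: "\<And>j. j < k \<Longrightarrow> mv_holomorphic_on (f j) W" and W: "open W"
    and u: "\<And>z j. z \<in> W \<Longrightarrow> j < k \<Longrightarrow> elog (norm (f j z)) \<le> u z"
      "\<And>z. z \<in> W \<Longrightarrow> \<exists>j<k. u z = elog (norm (f j z))"
    and nz: "\<And>K. K \<in> components W \<Longrightarrow> \<exists>z\<in>K. u z \<noteq> -\<infinity>"
  shows "plurisubharmonic_on u W"
  unfolding plurisubharmonic_on_def
proof (intro conjI ballI allI impI)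
  show "open W" by (rule W)
  show "u z < \<infinity>" if "z \<in> W" for z
    using u(2)[OF that] by (auto simp: elog_def split: if_splits)
  show "open {z\<in>W. u z < a}" for a
  proof -
    have "{z\<in>W. u z < a} = W \<inter> (\<Inter>j\<in>{..<k}. {z\<in>W. elog (norm (f j z)) < a})"
    proof (intro set_eqI iffI)
      fix z assume z: "z \<in> {z\<in>W. u z < a}"
      then have "elog (norm (f j z)) < a" if "j < k" for j
        using u(1)[of z j] that by (auto intro: le_less_trans)
      then show "z \<in> W \<inter> (\<Inter>j\<in>{..<k}. {z\<in>W. elog (norm (f j z)) < a})" using z by simp
    next
      fix z assume z: "z \<in> W \<inter> (\<Inter>j\<in>{..<k}. {z\<in>W. elog (norm (f j z)) < a})"
      then obtain j where "j < k" "u z = elog (norm (f j z))" using u(2) by blast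
      then show "z \<in> {z\<in>W. u z < a}" using z by auto
    qed
    then show ?thesis
      using W f by (auto intro!: open_Int open_INT open_elog_norm_less)
  qed
  show "\<exists>z\<in>K. u z \<noteq> -\<infinity>" if "K \<in> components W" for K by (rule nz[OF that])
  fix z w assume disc: "\<forall>\<zeta>. norm \<zeta> \<le> 1 \<longrightarrow> z + \<zeta> *s w \<in> W"
  have "z + 0 *s w \<in> W" using disc by (simp only: norm_zero zero_le_one)
  then have "z \<in> W" by simp
  then obtain j where j: "j < k" "u z = elog (norm (f j z))" using u(2) by blast
  have "u z \<le> circle_mean (\<lambda>z. elog (norm (f j z))) z w"
    unfolding j(2) by (rule elog_norm_le_circle_mean[OF f[OF j(1)]]) (use disc in blast)
  also have "\<dots> \<le> circle_mean u z w"
  proof (rule circle_mean_mono)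
    fix \<theta>
    have "z + cis \<theta> *s w \<in> W" using disc by (simp only: norm_cis order_refl)
    then show "elog (norm (f j (z + cis \<theta> *s w))) \<le> u (z + cis \<theta> *s w)" by (rule u(1)[OF _ j(1)])
  qed
  finally show "u z \<le> circle_mean u z w" .
qed

section \<open>Charts, parametrizations and submanifolds\<close>

text \<open>
  The part of the definition of a manifold that suffices to speak of holomorphic functions. It is
  available before the holomorphy of coordinate changes has been proved, and it helps to prove it.
\<close>

definition chart_atlas :: "'a topology \<Rightarrow> ('a, 'n::finite) atlas \<Rightarrow> bool" where
  "chart_atlas X A \<longleftrightarrow> \<Union>(fst ` A) = topspace X \<and>
     (\<forall>(U,c)\<in>A. openin X U \<and> open (c ` U) \<and>
        homeomorphic_map (subtopology X U) (top_of_set (c ` U)) c)"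

text \<open>
  Holomorphic maps from an open set of coordinates into a manifold. Inverses of charts are examples.
  Unlike charts, they pass to every subset that contains their image, which is how charts of the fibres
  and curves are obtained from explicit formulas.
\<close>

definition hol_param ::
  "'a topology \<Rightarrow> ('a, 'n::finite) atlas \<Rightarrow> (complex^'m) set \<Rightarrow> (complex^'m \<Rightarrow> 'a) \<Rightarrow> bool" where
  "hol_param X A \<Omega> \<psi> \<longleftrightarrow> open \<Omega> \<and> continuous_map (top_of_set \<Omega>) X \<psi> \<and>
     (\<forall>(V,d)\<in>A. \<forall>j. mv_holomorphic_on (\<lambda>z. d (\<psi> z) $ j) {z\<in>\<Omega>. \<psi> z \<in> V})"

lemma complex_manifold_chart_atlas: "complex_manifold X A \<Longrightarrow> chart_atlas X A"
  unfolding complex_manifold_def chart_atlas_def by blast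

lemma complex_manifold_transition:
  assumes "complex_manifold X A" "(U,c) \<in> A" "(V,d) \<in> A"
  shows "mv_holomorphic_on (\<lambda>z. d (inv_into U c z) $ j) (c ` (U \<inter> V))"
proof -
  have "\<forall>(U,c)\<in>A. \<forall>(V,d)\<in>A. \<forall>j. mv_holomorphic_on (\<lambda>z. d (inv_into U c z) $ j) (c ` (U \<inter> V))"
    using assms(1) unfolding complex_manifold_def by blast
  from bspec[OF bspec[OF this assms(2), unfolded prod.case] assms(3), unfolded prod.case]
  show ?thesis by blast
qed

lemma holomorphic_map_charts:
  assumes "holomorphic_map X A Y B W f" "(U,c) \<in> A" "(V,d) \<in> B"
  shows "mv_holomorphic_on (\<lambda>z. d (f (inv_into U c z)) $ j) (c ` {x \<in> U \<inter> W. f x \<in> V})"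
proof -
  have "\<forall>(U,c)\<in>A. \<forall>(V,d)\<in>B. \<forall>j. mv_holomorphic_on (\<lambda>z. d (f (inv_into U c z)) $ j) (c ` {x \<in> U \<inter> W. f x \<in> V})"
    using assms(1) unfolding holomorphic_map_def by blast
  from bspec[OF bspec[OF this assms(2), unfolded prod.case] assms(3), unfolded prod.case]
  show ?thesis by blast
qed

lemma chart_atlasD:
  assumes "chart_atlas X A" "(U,c) \<in> A"
  shows "openin X U" "open (c ` U)" "homeomorphic_map (subtopology X U) (top_of_set (c ` U)) c"
    "inj_on c U" "U \<subseteq> topspace X"
proof -
  show o: "openin X U" and "open (c ` U)"
    and h: "homeomorphic_map (subtopology X U) (top_of_set (c ` U)) c"
    using assms unfolding chart_atlas_def by auto
  show U: "U \<subseteq> topspace X" using o by (rule openin_subset)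
  show "inj_on c U"
    using homeomorphic_imp_injective_map[OF h] U by (simp add: Int_absorb1)
qed

lemma chart_atlas_cover:
  assumes "chart_atlas X A" "p \<in> topspace X"
  obtains V d where "(V,d) \<in> A" "p \<in> V"
proof -
  have "p \<in> \<Union>(fst ` A)" using assms unfolding chart_atlas_def by simp
  then obtain x where "x \<in> A" "p \<in> fst x" by blast
  then show thesis using that[of "fst x" "snd x"] by simp
qed

lemma chart_open_image:
  assumes "chart_atlas X A" "(U,c) \<in> A" "openin X W"
  shows "open (c ` (U \<inter> W))"
proof -
  have "openin (subtopology X U) (U \<inter> W)"
    using assms(3) by (metis inf_commute openin_subtopology_Int)
  then have "openin (top_of_set (c ` U)) (c ` (U \<inter> W))"
    using chart_atlasD(3)[OF assms(1,2)] homeomorphic_imp_open_map open_map_def by blast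
  then show ?thesis
    using chart_atlasD(2)[OF assms(1,2)] openin_open_trans by blast
qed

lemma homeomorphic_inv_into_continuous:
  assumes h: "homeomorphic_map (subtopology X U) (top_of_set (c ` U)) c" and U: "U \<subseteq> topspace X"
  shows "continuous_map (top_of_set (c ` U)) X (inv_into U c)" "inj_on c U"
proof -
  show inj: "inj_on c U"
    using homeomorphic_imp_injective_map[OF h] U by (simp add: Int_absorb1)
  obtain g where g: "homeomorphic_maps (subtopology X U) (top_of_set (c ` U)) c g"
    using h by (auto simp: homeomorphic_map_maps)
  have gc: "g (c x) = x" if "x \<in> U" for x
    using g that U unfolding homeomorphic_maps_def by auto
  have "continuous_map (top_of_set (c ` U)) X g"
    using g unfolding homeomorphic_maps_def continuous_map_in_subtopology by blast
  then show "continuous_map (top_of_set (c ` U)) X (inv_into U c)"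
    by (rule continuous_map_eq) (use gc inj in auto)
qed

lemma chart_inv_continuous:
  assumes "chart_atlas X A" "(U,c) \<in> A"
  shows "continuous_map (top_of_set (c ` U)) X (inv_into U c)"
  by (rule homeomorphic_inv_into_continuous(1)[OF chart_atlasD(3,5)[OF assms]])

lemma chart_image_vimage:
  assumes "inj_on c U"
  shows "{z \<in> c ` U. inv_into U c z \<in> V} = c ` (U \<inter> V)"
  using assms by (auto simp: image_iff)

lemma holomorphic_fun_openin: "holomorphic_fun X A W f \<Longrightarrow> openin X W"
  by (simp add: holomorphic_fun_def)

lemma holomorphic_fun_const: "chart_atlas X A \<Longrightarrow> openin X W \<Longrightarrow> holomorphic_fun X A W (\<lambda>_. k)"
  unfolding holomorphic_fun_def
  by (auto intro!: mv_holomorphic_on_const chart_open_image)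

lemma holomorphic_fun_add:
  "holomorphic_fun X A W f \<Longrightarrow> holomorphic_fun X A W g \<Longrightarrow> holomorphic_fun X A W (\<lambda>x. f x + g x)"
  unfolding holomorphic_fun_def by (auto intro!: mv_holomorphic_on_add)

lemma holomorphic_fun_diff:
  "holomorphic_fun X A W f \<Longrightarrow> holomorphic_fun X A W g \<Longrightarrow> holomorphic_fun X A W (\<lambda>x. f x - g x)"
  unfolding holomorphic_fun_def by (auto intro!: mv_holomorphic_on_diff)

lemma holomorphic_fun_mult:
  "holomorphic_fun X A W f \<Longrightarrow> holomorphic_fun X A W g \<Longrightarrow> holomorphic_fun X A W (\<lambda>x. f x * g x)"
  unfolding holomorphic_fun_def by (auto intro!: mv_holomorphic_on_mult)

lemma holomorphic_fun_power:
  "holomorphic_fun X A W f \<Longrightarrow> holomorphic_fun X A W (\<lambda>x. f x ^ n)"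
  unfolding holomorphic_fun_def by (auto intro!: mv_holomorphic_on_power)

lemma holomorphic_fun_divide:
  assumes "chart_atlas X A" "holomorphic_fun X A W f" "holomorphic_fun X A W g"
    and nz: "\<And>x. x \<in> W \<Longrightarrow> g x \<noteq> 0"
  shows "holomorphic_fun X A W (\<lambda>x. f x / g x)"
  unfolding holomorphic_fun_def
proof (intro conjI ballI, use assms in \<open>simp add: holomorphic_fun_def\<close>, clarify)
  fix U c assume Uc: "(U,c) \<in> A"
  have "inv_into U c z \<in> W" if "z \<in> c ` (U \<inter> W)" for z
    using that chart_atlasD(4)[OF assms(1) Uc] by auto
  then show "mv_holomorphic_on (\<lambda>z. f (inv_into U c z) / g (inv_into U c z)) (c ` (U \<inter> W))"
    using assms(2,3) Uc nz unfolding holomorphic_fun_def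
    by (intro mv_holomorphic_on_divide) auto
qed

lemma holomorphic_fun_subset:
  "chart_atlas X A \<Longrightarrow> holomorphic_fun X A W f \<Longrightarrow> openin X V \<Longrightarrow> V \<subseteq> W \<Longrightarrow> holomorphic_fun X A V f"
  unfolding holomorphic_fun_def
  by (auto intro!: mv_holomorphic_on_subset[OF _ chart_open_image])

lemma holomorphic_fun_cong:
  assumes "chart_atlas X A" "holomorphic_fun X A W f" "\<And>x. x \<in> W \<Longrightarrow> f x = g x"
  shows "holomorphic_fun X A W g"
  unfolding holomorphic_fun_def
proof (intro conjI ballI, use assms in \<open>simp add: holomorphic_fun_def\<close>, clarify)
  fix U c assume Uc: "(U,c) \<in> A"
  have "mv_holomorphic_on (\<lambda>z. f (inv_into U c z)) (c ` (U \<inter> W))"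
    using assms(2) Uc unfolding holomorphic_fun_def by auto
  moreover have "f (inv_into U c z) = g (inv_into U c z)" if "z \<in> c ` (U \<inter> W)" for z
    using that assms(3) chart_atlasD(4)[OF assms(1) Uc] by auto
  ultimately show "mv_holomorphic_on (\<lambda>z. g (inv_into U c z)) (c ` (U \<inter> W))"
    using mv_holomorphic_on_cong[of "c ` (U \<inter> W)" "\<lambda>z. f (inv_into U c z)" "\<lambda>z. g (inv_into U c z)"] by simp
qed

lemma holomorphic_fun_continuous:
  assumes A: "chart_atlas X A" and f: "holomorphic_fun X A W f"
  shows "continuous_map (subtopology X W) euclidean f"
proof -
  have W: "openin X W" by (rule holomorphic_fun_openin[OF f])
  have "\<exists>V. openin (subtopology X W) V \<and> p \<in> V \<and> (\<forall>y\<in>V. f y \<in> T)"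
    if p: "p \<in> W" and T: "open T" "f p \<in> T" for p T
  proof -
    have "p \<in> topspace X" using p openin_subset[OF W] by auto
    then obtain U c where Uc: "(U,c) \<in> A" "p \<in> U" using A chart_atlas_cover by metis
    note ch = chart_atlasD[OF A Uc(1)]
    have "continuous_on (c ` (U \<inter> W)) (\<lambda>z. f (inv_into U c z))"
      using f Uc(1) unfolding holomorphic_fun_def by (auto intro: mv_holomorphic_on_imp_continuous_on)
    then have "open (c ` (U \<inter> W) \<inter> (\<lambda>z. f (inv_into U c z)) -` T)"
      using T(1) chart_open_image[OF A Uc(1) W] continuous_open_preimage by blast
    then have "openin (top_of_set (c ` U)) (c ` (U \<inter> W) \<inter> (\<lambda>z. f (inv_into U c z)) -` T)"
      by (rule open_subset[rotated]) blast
    then have "openin (subtopology X U) {x \<in> topspace (subtopology X U). c x \<in> c ` (U \<inter> W) \<inter> (\<lambda>z. f (inv_into U c z)) -` T}"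
      by (rule openin_continuous_map_preimage[OF homeomorphic_imp_continuous_map[OF ch(3)]])
    moreover have "{x \<in> topspace (subtopology X U). c x \<in> c ` (U \<inter> W) \<inter> (\<lambda>z. f (inv_into U c z)) -` T}
        = {x \<in> U \<inter> W. f x \<in> T}"
    proof (intro set_eqI iffI)
      fix x assume "x \<in> {x \<in> topspace (subtopology X U). c x \<in> c ` (U \<inter> W) \<inter> (\<lambda>z. f (inv_into U c z)) -` T}"
      then have x: "x \<in> U" "c x \<in> c ` (U \<inter> W)" "f (inv_into U c (c x)) \<in> T" by auto
      have "x \<in> W" using x(1,2) inj_on_image_mem_iff[OF ch(4) x(1), of "U \<inter> W"] by simp
      then show "x \<in> {x \<in> U \<inter> W. f x \<in> T}" using x ch(4) by simp
    next
      fix x assume "x \<in> {x \<in> U \<inter> W. f x \<in> T}"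
      then show "x \<in> {x \<in> topspace (subtopology X U). c x \<in> c ` (U \<inter> W) \<inter> (\<lambda>z. f (inv_into U c z)) -` T}"
        using ch(4,5) by auto
    qed
    ultimately have "openin (subtopology X U) {x \<in> U \<inter> W. f x \<in> T}" by simp
    then have "openin X {x \<in> U \<inter> W. f x \<in> T}"
      using ch(1) by (rule openin_trans_full)
    then have "openin (subtopology X W) (W \<inter> {x \<in> U \<inter> W. f x \<in> T})"
      by (rule openin_subtopology_Int2)
    moreover have "W \<inter> {x \<in> U \<inter> W. f x \<in> T} = {x \<in> U \<inter> W. f x \<in> T}" by auto
    ultimately have "openin (subtopology X W) {x \<in> U \<inter> W. f x \<in> T}" by simp
    then show ?thesis using p Uc(2) T(2) by (intro exI[of _ "{x \<in> U \<inter> W. f x \<in> T}"]) auto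
  qed
  then show ?thesis
    unfolding continuous_map_eq_topcontinuous_at topcontinuous_at_def
    using openin_subset[OF W] by (auto simp: Int_absorb1 open_openin[symmetric])
qed

lemma hol_param_preimage_open:
  assumes "hol_param X A \<Omega> \<psi>" "openin X W"
  shows "open {z\<in>\<Omega>. \<psi> z \<in> W}"
proof -
  have "openin (top_of_set \<Omega>) {z\<in>topspace (top_of_set \<Omega>). \<psi> z \<in> W}"
    using assms unfolding hol_param_def by (intro openin_continuous_map_preimage) auto
  then show ?thesis using assms(1) unfolding hol_param_def by (simp add: openin_open_eq)
qed

lemma hol_param_compose:
  assumes A: "chart_atlas X A" and \<psi>: "hol_param X A \<Omega> \<psi>" and f: "holomorphic_fun X A W f"
  shows "mv_holomorphic_on (\<lambda>z. f (\<psi> z)) {z\<in>\<Omega>. \<psi> z \<in> W}"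
proof (rule mv_holomorphic_on_local)
  fix z assume z: "z \<in> {z\<in>\<Omega>. \<psi> z \<in> W}"
  have W: "openin X W" by (rule holomorphic_fun_openin[OF f])
  have "\<psi> z \<in> topspace X" using z openin_subset[OF W] by auto
  then obtain V d where Vd: "(V,d) \<in> A" "\<psi> z \<in> V" using A chart_atlas_cover by metis
  note ch = chart_atlasD[OF A Vd(1)]
  let ?N = "{z\<in>\<Omega>. \<psi> z \<in> V \<inter> W}"
  have N: "open ?N" by (rule hol_param_preimage_open[OF \<psi>]) (use ch W in auto)
  have 1: "mv_holomorphic_on (\<lambda>z. f (inv_into V d z)) (d ` (V \<inter> W))"
    using f Vd(1) unfolding holomorphic_fun_def by auto
  have 2: "mv_holomorphic_on (\<lambda>z. d (\<psi> z) $ j) ?N" for j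
  proof (rule mv_holomorphic_on_subset[OF _ N])
    show "mv_holomorphic_on (\<lambda>z. d (\<psi> z) $ j) {z\<in>\<Omega>. \<psi> z \<in> V}"
      using \<psi> Vd(1) unfolding hol_param_def by auto
  qed auto
  have "mv_holomorphic_on (\<lambda>z. f (inv_into V d (d (\<psi> z)))) ?N"
    by (rule mv_holomorphic_on_compose[OF 1 2]) auto
  then have "mv_holomorphic_on (\<lambda>z. f (\<psi> z)) ?N"
    by (subst (asm) mv_holomorphic_on_cong[where g = "\<lambda>z. f (\<psi> z)" and W' = ?N]) (use ch(4) in auto)
  then show "\<exists>V. z \<in> V \<and> V \<subseteq> {z\<in>\<Omega>. \<psi> z \<in> W} \<and> mv_holomorphic_on (\<lambda>z. f (\<psi> z)) V"
    using z Vd by (intro exI[of _ ?N]) auto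
qed

lemma submanifold_atlasD:
  assumes "(U,c) \<in> submanifold_atlas X A Y"
  shows "openin (subtopology X Y) U" "open (c ` U)"
    "homeomorphic_map (subtopology X U) (top_of_set (c ` U)) c"
    "\<And>V d j. (V,d) \<in> A \<Longrightarrow> mv_holomorphic_on (\<lambda>z. d (inv_into U c z) $ j) (c ` (U \<inter> V))"
    "\<And>p. p \<in> U \<Longrightarrow> \<exists>W f. p \<in> W \<and> (\<forall>j. holomorphic_fun X A W (\<lambda>x. f x $ j)) \<and> (\<forall>x\<in>U \<inter> W. f x = c x)"
  using assms unfolding submanifold_atlas_def by auto

text \<open>
  The charts of \<open>Y\<close> extend holomorphically to \<open>X\<close>, and the extensions can be composed with \<open>\<psi>\<close>.
\<close>

lemma hol_param_into_submanifold:
  assumes A: "chart_atlas X A" and \<psi>: "hol_param X A \<Omega> \<psi>" and Y: "\<psi> ` \<Omega> \<subseteq> Y"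
  shows "hol_param (subtopology X Y) (submanifold_atlas X A Y) \<Omega> \<psi>"
proof -
  have cont: "continuous_map (top_of_set \<Omega>) (subtopology X Y) \<psi>"
    using \<psi> Y unfolding hol_param_def by (auto simp: continuous_map_in_subtopology)
  have "mv_holomorphic_on (\<lambda>z. c (\<psi> z) $ j) {z\<in>\<Omega>. \<psi> z \<in> U}"
    if Uc: "(U,c) \<in> submanifold_atlas X A Y" for U and c :: "'a \<Rightarrow> complex^'k" and j
  proof (rule mv_holomorphic_on_local)
    fix z assume z: "z \<in> {z\<in>\<Omega>. \<psi> z \<in> U}"
    obtain W f where W: "\<psi> z \<in> W" "\<And>j. holomorphic_fun X A W (\<lambda>x. f x $ j)" "\<And>x. x \<in> U \<inter> W \<Longrightarrow> f x = c x"
      using submanifold_atlasD(5)[OF Uc, of "\<psi> z"] z by auto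
    let ?N = "{z\<in>\<Omega>. \<psi> z \<in> U \<inter> W}"
    have "open {z\<in>\<Omega>. \<psi> z \<in> U}"
    proof -
      have "openin (top_of_set \<Omega>) {z\<in>topspace (top_of_set \<Omega>). \<psi> z \<in> U}"
        using cont submanifold_atlasD(1)[OF Uc] by (rule openin_continuous_map_preimage)
      then show ?thesis using \<psi> unfolding hol_param_def by (simp add: openin_open_eq)
    qed
    moreover have "open {z\<in>\<Omega>. \<psi> z \<in> W}"
      by (rule hol_param_preimage_open[OF \<psi> holomorphic_fun_openin[OF W(2)]])
    ultimately have "open ({z\<in>\<Omega>. \<psi> z \<in> U} \<inter> {z\<in>\<Omega>. \<psi> z \<in> W})" by (rule open_Int)
    moreover have "{z\<in>\<Omega>. \<psi> z \<in> U} \<inter> {z\<in>\<Omega>. \<psi> z \<in> W} = ?N" by auto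
    ultimately have N: "open ?N" by simp
    have "mv_holomorphic_on (\<lambda>z. f (\<psi> z) $ j) ?N"
      by (rule mv_holomorphic_on_subset[OF hol_param_compose[OF A \<psi> W(2)] N]) auto
    then have "mv_holomorphic_on (\<lambda>z. c (\<psi> z) $ j) ?N"
      by (subst (asm) mv_holomorphic_on_cong[where g = "\<lambda>z. c (\<psi> z) $ j" and W' = ?N]) (use W(3) in auto)
    then show "\<exists>V. z \<in> V \<and> V \<subseteq> {z\<in>\<Omega>. \<psi> z \<in> U} \<and> mv_holomorphic_on (\<lambda>z. c (\<psi> z) $ j) V"
      using z W(1) by (intro exI[of _ ?N]) auto
  qed
  then show ?thesis
    unfolding hol_param_def using cont \<psi> unfolding hol_param_def by auto
qed

lemma submanifold_chart_param:
  assumes "(U,c) \<in> submanifold_atlas X A Y"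
  shows "hol_param X A (c ` U) (inv_into U c)" "inj_on c U" "U \<subseteq> Y" "U \<subseteq> topspace X"
proof -
  note D = submanifold_atlasD[OF assms]
  show U: "U \<subseteq> topspace X" "U \<subseteq> Y" using openin_subset[OF D(1)] by auto
  note h = homeomorphic_inv_into_continuous[OF D(3) U(1)]
  show "inj_on c U" by (rule h(2))
  show "hol_param X A (c ` U) (inv_into U c)"
    unfolding hol_param_def chart_image_vimage[OF h(2)] using D(2,4) h(1) by auto
qed

lemma manifold_chart_param:
  assumes "complex_manifold X A" "(U,c) \<in> A"
  shows "hol_param X A (c ` U) (inv_into U c)"
proof -
  note D = chart_atlasD[OF complex_manifold_chart_atlas[OF assms(1)] assms(2)]
  have "\<forall>(V,d)\<in>A. \<forall>j. mv_holomorphic_on (\<lambda>z. d (inv_into U c z) $ j) (c ` (U \<inter> V))"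
    using complex_manifold_transition[OF assms] by blast
  then show ?thesis
    unfolding hol_param_def chart_image_vimage[OF D(4)]
    using D(2) chart_inv_continuous[OF complex_manifold_chart_atlas[OF assms(1)] assms(2)] by blast
qed

lemma submanifold_chart_atlas:
  fixes A :: "('a, 'n::finite) atlas"
  assumes "\<Union>(fst ` (submanifold_atlas X A Y :: ('a, 'm::finite) atlas)) = topspace (subtopology X Y)"
  shows "chart_atlas (subtopology X Y) (submanifold_atlas X A Y :: ('a, 'm) atlas)"
  unfolding chart_atlas_def
proof (intro conjI, rule assms, intro ballI, clarify)
  fix U and c :: "'a \<Rightarrow> complex^'m" assume Uc: "(U,c) \<in> submanifold_atlas X A Y"
  have "U \<subseteq> Y" by (rule submanifold_chart_param(3)[OF Uc])
  then have "subtopology (subtopology X Y) U = subtopology X U"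
    by (simp add: subtopology_subtopology Int_absorb1)
  then show "openin (subtopology X Y) U \<and> open (c ` U) \<and>
     homeomorphic_map (subtopology (subtopology X Y) U) (top_of_set (c ` U)) c"
    using submanifold_atlasD(1-3)[OF Uc] by simp
qed

text \<open>
  Only the covering has to be checked. Coordinate changes are holomorphic because the inverse of one
  chart is a holomorphic parametrization and the other chart extends holomorphically.
\<close>

lemma complex_manifold_submanifold:
  fixes A :: "('a, 'n::finite) atlas"
  assumes X: "complex_manifold X A"
    and cov: "\<Union>(fst ` (submanifold_atlas X A Y :: ('a, 'm::finite) atlas)) = topspace (subtopology X Y)"
  shows "complex_manifold (subtopology X Y) (submanifold_atlas X A Y :: ('a, 'm) atlas)"
proof -
  have ca: "chart_atlas X A" by (rule complex_manifold_chart_atlas[OF X])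
  have cs: "chart_atlas (subtopology X Y) (submanifold_atlas X A Y :: ('a, 'm) atlas)"
    by (rule submanifold_chart_atlas[OF cov])
  have "mv_holomorphic_on (\<lambda>z. d (inv_into U c z) $ j) (c ` (U \<inter> V))"
    if Uc: "(U,c) \<in> (submanifold_atlas X A Y :: ('a, 'm) atlas)"
      and Vd: "(V,d) \<in> (submanifold_atlas X A Y :: ('a, 'm) atlas)" for U c V d j
  proof -
    note P = submanifold_chart_param[OF Uc]
    have "hol_param (subtopology X Y) (submanifold_atlas X A Y :: ('a, 'm) atlas) (c ` U) (inv_into U c)"
      by (rule hol_param_into_submanifold[OF ca P(1)]) (use P(2,3) in auto)
    then show ?thesis
      using Vd unfolding hol_param_def chart_image_vimage[OF P(2)] by auto
  qed
  then show ?thesis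
    using X cs unfolding complex_manifold_def chart_atlas_def
    by (auto simp: Hausdorff_space_subtopology second_countable_subtopology)
qed

text \<open>
  The inverse of a chart of \<open>Y\<close> is a holomorphic parametrization in \<open>X\<close>, so it can be composed with
  \<open>f\<close>.
\<close>

lemma holomorphic_fun_restrict:
  assumes A: "chart_atlas X A" and f: "holomorphic_fun X A W f"
  shows "holomorphic_fun (subtopology X Y) (submanifold_atlas X A Y) (W \<inter> Y) f"
  unfolding holomorphic_fun_def
proof (intro conjI ballI, use holomorphic_fun_openin[OF f] openin_subtopology in blast, clarify)
  fix U c assume Uc: "(U,c) \<in> submanifold_atlas X A Y"
  note P = submanifold_chart_param[OF Uc]
  have "mv_holomorphic_on (\<lambda>z. f (inv_into U c z)) (c ` (U \<inter> W))"
    using hol_param_compose[OF A P(1) f] unfolding chart_image_vimage[OF P(2)] .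
  moreover have "U \<inter> (W \<inter> Y) = U \<inter> W" using P(3) by auto
  ultimately show "mv_holomorphic_on (\<lambda>z. f (inv_into U c z)) (c ` (U \<inter> (W \<inter> Y)))" by simp
qed

text \<open>
  The form in which charts of submanifolds are produced: a parametrization together with a holomorphic
  left inverse on the ambient manifold.
\<close>

lemma submanifold_chartI:
  assumes A: "chart_atlas X A" and \<psi>: "hol_param X A \<Omega> \<psi>" and im: "\<psi> ` \<Omega> = U"
    and U: "openin (subtopology X Y) U" and inv: "\<And>z. z \<in> \<Omega> \<Longrightarrow> c (\<psi> z) = z"
    and c: "\<And>j. holomorphic_fun X A W (\<lambda>x. c x $ j)" and UW: "U \<subseteq> W"
  shows "(U,c) \<in> submanifold_atlas X A Y"
proof -
  have UX: "U \<subseteq> topspace X" using openin_subset[OF U] by simp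
  have cU: "c ` U = \<Omega>" unfolding im[symmetric] image_image using inv by simp
  have cont_c: "continuous_map (subtopology X U) euclidean c"
  proof -
    have "continuous_map (subtopology X W) euclidean (\<lambda>x. c x $ j)" for j
      by (rule holomorphic_fun_continuous[OF A c])
    then have *: "continuous_map (subtopology X U) euclidean (\<lambda>x. c x $ j)" for j
      using UW continuous_map_from_subtopology_mono by blast
    show ?thesis
      unfolding continuous_map_atin limitin_canonical_iff
      using * unfolding continuous_map_atin limitin_canonical_iff by (auto intro!: vec_tendstoI)
  qed
  have hm: "homeomorphic_maps (subtopology X U) (top_of_set \<Omega>) c \<psi>"
    unfolding homeomorphic_maps_def
    using cont_c \<psi> inv im cU UX unfolding hol_param_def
    by (auto simp: continuous_map_in_subtopology)
  have inj: "inj_on c U"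
    unfolding im[symmetric] by (rule inj_on_inverseI[of _ \<psi>]) (use inv in auto)
  have invinto: "inv_into U c z = \<psi> z" if z: "z \<in> \<Omega>" for z
  proof -
    have "\<psi> z \<in> U" using z im by blast
    then have "inv_into U c (c (\<psi> z)) = \<psi> z" by (rule inv_into_f_f[OF inj])
    then show ?thesis by (simp only: inv[OF z])
  qed
  have "mv_holomorphic_on (\<lambda>z. d (inv_into U c z) $ j) (c ` (U \<inter> V))" if "(V,d) \<in> A" for V d j
  proof -
    have "c ` (U \<inter> V) = {z\<in>\<Omega>. \<psi> z \<in> V}"
    proof (intro set_eqI iffI)
      fix z assume "z \<in> c ` (U \<inter> V)"
      then obtain y where "y \<in> \<Omega>" "\<psi> y \<in> V" "z = c (\<psi> y)" using im by auto
      then show "z \<in> {z\<in>\<Omega>. \<psi> z \<in> V}" using inv by simp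
    next
      fix z assume "z \<in> {z\<in>\<Omega>. \<psi> z \<in> V}"
      then have "\<psi> z \<in> U \<inter> V" "z = c (\<psi> z)" using im inv by auto
      then show "z \<in> c ` (U \<inter> V)" by blast
    qed
    moreover have "mv_holomorphic_on (\<lambda>z. d (\<psi> z) $ j) {z\<in>\<Omega>. \<psi> z \<in> V}"
      using \<psi> that unfolding hol_param_def by auto
    ultimately show ?thesis
      by (subst mv_holomorphic_on_cong[where g = "\<lambda>z. d (\<psi> z) $ j" and W' = "{z\<in>\<Omega>. \<psi> z \<in> V}"])
        (use invinto in auto)
  qed
  moreover have "open \<Omega>" using \<psi> unfolding hol_param_def by blast
  moreover have "homeomorphic_map (subtopology X U) (top_of_set \<Omega>) c"
    using hm by (rule homeomorphic_maps_imp_map)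
  moreover have "\<exists>W f. p \<in> W \<and> (\<forall>j. holomorphic_fun X A W (\<lambda>x. f x $ j)) \<and> (\<forall>x\<in>U \<inter> W. f x = c x)"
    if "p \<in> U" for p
    by (rule exI[of _ W], rule exI[of _ c]) (use that UW c in blast)
  ultimately show ?thesis
    unfolding submanifold_atlas_def mem_Collect_eq prod.case cU using U by blast
qed

lemma holomorphic_mapI:
  assumes "openin X W" "continuous_map (subtopology X W) Y f"
    and "\<And>V d j. (V,d) \<in> B \<Longrightarrow> holomorphic_fun X A {x\<in>W. f x \<in> V} (\<lambda>x. d (f x) $ j)"
  shows "holomorphic_map X A Y B W f"
proof -
  have eq: "U \<inter> {x\<in>W. f x \<in> V} = {x \<in> U \<inter> W. f x \<in> V}" for U V by auto
  have "mv_holomorphic_on (\<lambda>z. d (f (inv_into U c z)) $ j) (c ` {x \<in> U \<inter> W. f x \<in> V})"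
    if "(U,c) \<in> A" "(V,d) \<in> B" for U c V d j
    using bspec[OF assms(3)[OF that(2), unfolded holomorphic_fun_def, THEN conjunct2] that(1), unfolded prod.case eq] .
  then show ?thesis
    unfolding holomorphic_map_def using assms(1,2) by blast
qed

lemma holomorphic_map_into_submanifold:
  assumes M: "chart_atlas M B" and A: "chart_atlas X A"
    and f: "holomorphic_map M B X A W f" and Y: "f ` W \<subseteq> Y"
  shows "holomorphic_map M B (subtopology X Y) (submanifold_atlas X A Y) W f"
proof -
  have W: "openin M W" and cont: "continuous_map (subtopology M W) X f"
    using f unfolding holomorphic_map_def by auto
  have "mv_holomorphic_on (\<lambda>z. d (f (inv_into U c z)) $ j) (c ` {x \<in> U \<inter> W. f x \<in> V})"
    if Uc: "(U,c) \<in> B" and Vd: "(V,d) \<in> submanifold_atlas X A Y" for U c V and d :: "'c \<Rightarrow> complex^'k" and j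
  proof -
    note ch = chart_atlasD[OF M Uc]
    have sub: "{z \<in> c ` (U \<inter> W). f (inv_into U c z) \<in> V'} = c ` {x \<in> U \<inter> W. f x \<in> V'}" for V'
      using ch(4) by auto
    have "hol_param X A (c ` (U \<inter> W)) (\<lambda>z. f (inv_into U c z))"
      unfolding hol_param_def sub
    proof (intro conjI)
      show "open (c ` (U \<inter> W))" by (rule chart_open_image[OF M Uc W])
      have "continuous_map (top_of_set (c ` (U \<inter> W))) M (inv_into U c)"
        using chart_inv_continuous[OF M Uc] by (rule continuous_map_from_subtopology_mono) auto
      then have "continuous_map (top_of_set (c ` (U \<inter> W))) (subtopology M W) (inv_into U c)"
        using ch(4) by (auto simp: continuous_map_in_subtopology)
      then show "continuous_map (top_of_set (c ` (U \<inter> W))) X (\<lambda>z. f (inv_into U c z))"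
        using continuous_map_compose[OF _ cont] by (auto simp: o_def)
      show "\<forall>(V,d)\<in>A. \<forall>j. mv_holomorphic_on (\<lambda>z. d (f (inv_into U c z)) $ j) (c ` {x \<in> U \<inter> W. f x \<in> V})"
        using holomorphic_map_charts[OF f Uc] by blast
    qed
    then have "hol_param (subtopology X Y) (submanifold_atlas X A Y) (c ` (U \<inter> W)) (\<lambda>z. f (inv_into U c z))"
      by (rule hol_param_into_submanifold[OF A]) (use Y ch(4) in auto)
    then show ?thesis
      using Vd unfolding hol_param_def sub by auto
  qed
  then show ?thesis
    unfolding holomorphic_map_def using W cont Y
    by (auto simp: continuous_map_in_subtopology openin_subset)
qed

text \<open>
  Chain rule for the two coordinate changes, which are inverse to each other.
\<close>

lemma chart_transition_derivative:
  assumes X: "complex_manifold X A" and Uc: "(U,c) \<in> A" and Vd: "(V,d) \<in> A" and p: "p \<in> U" "p \<in> V"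
  obtains T T' where "((\<lambda>z. d (inv_into U c z)) has_derivative T) (at (c p))"
    "((\<lambda>z. c (inv_into V d z)) has_derivative T') (at (d p))"
    "\<And>v. T' (T v) = v" "\<And>v. T (T' v) = v"
proof -
  have ca: "chart_atlas X A" by (rule complex_manifold_chart_atlas[OF X])
  have key: "(\<exists>T. ((\<lambda>z. d (inv_into U c z)) has_derivative T) (at (c p)))"
    if Uc: "(U,c) \<in> A" and Vd: "(V,d) \<in> A" and p: "p \<in> U" "p \<in> V" for U V c d
  proof -
    have "mv_holomorphic_on (\<lambda>z. d (inv_into U c z) $ j) (c ` (U \<inter> V))" for j
      by (rule complex_manifold_transition[OF X Uc Vd])
    moreover have "c p \<in> c ` (U \<inter> V)" using p by auto
    ultimately show ?thesis
      by (rule mv_holomorphic_vec_derivative[of "\<lambda>z. d (inv_into U c z)"]) (rule exI)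
  qed
  from key[OF Uc Vd p]
  obtain T where T: "((\<lambda>z. d (inv_into U c z)) has_derivative T) (at (c p))" ..
  from key[OF Vd Uc p(2,1)]
  obtain T' where T': "((\<lambda>z. c (inv_into V d z)) has_derivative T') (at (d p))" ..
  have inv: "S' (S v) = v"
    if Uc: "(U,c) \<in> A" and Vd: "(V,d) \<in> A" and p: "p \<in> U" "p \<in> V"
      and S: "((\<lambda>z. d (inv_into U c z)) has_derivative S) (at (c p))"
      and S': "((\<lambda>z. c (inv_into V d z)) has_derivative S') (at (d p))" for U V c d S S' v
  proof -
    note chU = chart_atlasD[OF ca Uc] and chV = chart_atlasD[OF ca Vd]
    have "inv_into U c (c p) = p" using chU(4) p by simp
    then have "((\<lambda>z. c (inv_into V d z)) has_derivative S') (at (d (inv_into U c (c p))))"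
      using S' by simp
    from has_derivative_compose[OF S this]
    have "((\<lambda>z. c (inv_into V d (d (inv_into U c z)))) has_derivative (\<lambda>v. S' (S v))) (at (c p))" .
    then have "((\<lambda>z. z) has_derivative (\<lambda>v. S' (S v))) (at (c p))"
    proof (rule has_derivative_transform_within_open)
      show "open (c ` (U \<inter> V))" by (rule chart_open_image[OF ca Uc chV(1)])
      show "c p \<in> c ` (U \<inter> V)" using p by auto
      show "c (inv_into V d (d (inv_into U c z))) = z" if "z \<in> c ` (U \<inter> V)" for z
        using that chU(4) chV(4) by auto
    qed
    then have "(\<lambda>v. S' (S v)) = (\<lambda>v. v)"
      by (rule has_derivative_unique) (rule has_derivative_ident)
    then show ?thesis by (rule fun_cong)
  qed
  show thesis
    by (rule that[OF T T']) (rule inv[OF Uc Vd p T T'], rule inv[OF Vd Uc p(2,1) T' T])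
qed

section \<open>Projective space\<close>

lemma proj_pt_self: "(\<lambda>i. if i \<le> N then v i else 0) \<in> proj_pt N v"
  unfolding proj_pt_def by (auto intro!: exI[of _ 1])

lemma proj_pt_in_points: "i \<le> N \<Longrightarrow> v i \<noteq> 0 \<Longrightarrow> proj_pt N v \<in> proj_points N"
  unfolding proj_points_def by blast

lemma proj_pt_scale:
  assumes "k \<noteq> 0" "\<And>i. i \<le> N \<Longrightarrow> v i = k * w i"
  shows "proj_pt N v = proj_pt N w"
proof -
  have "(\<exists>c. c \<noteq> 0 \<and> u = (\<lambda>i. if i \<le> N then c * v i else 0)) \<longleftrightarrow>
      (\<exists>c. c \<noteq> 0 \<and> u = (\<lambda>i. if i \<le> N then c * w i else 0))" for u
  proof
    assume "\<exists>c. c \<noteq> 0 \<and> u = (\<lambda>i. if i \<le> N then c * v i else 0)"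
    then obtain c where "c \<noteq> 0" "u = (\<lambda>i. if i \<le> N then c * v i else 0)" by blast
    then show "\<exists>c. c \<noteq> 0 \<and> u = (\<lambda>i. if i \<le> N then c * w i else 0)"
      using assms by (intro exI[of _ "c * k"]) auto
  next
    assume "\<exists>c. c \<noteq> 0 \<and> u = (\<lambda>i. if i \<le> N then c * w i else 0)"
    then obtain c where "c \<noteq> 0" "u = (\<lambda>i. if i \<le> N then c * w i else 0)" by blast
    then show "\<exists>c. c \<noteq> 0 \<and> u = (\<lambda>i. if i \<le> N then c * v i else 0)"
      using assms by (intro exI[of _ "c / k"]) auto
  qed
  then show ?thesis unfolding proj_pt_def by simp
qed

lemma proj_points_repr:
  assumes "P \<in> proj_points N" "v \<in> P"
  shows "P = proj_pt N v" "\<exists>i\<le>N. v i \<noteq> 0" "\<And>i. N < i \<Longrightarrow> v i = 0"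
proof -
  obtain u where u: "P = proj_pt N u" "\<exists>i\<le>N. u i \<noteq> 0"
    using assms(1) unfolding proj_points_def by blast
  obtain c where c: "c \<noteq> 0" "v = (\<lambda>i. if i \<le> N then c * u i else 0)"
    using assms(2) unfolding u(1) proj_pt_def by blast
  show "P = proj_pt N v" unfolding u(1)
    by (rule proj_pt_scale[symmetric, OF c(1)]) (simp add: c(2))
  show "\<exists>i\<le>N. v i \<noteq> 0" using u(2) c by auto
  show "N < i \<Longrightarrow> v i = 0" for i using c by simp
qed

lemma proj_points_cases:
  assumes "P \<in> proj_points N"
  obtains v where "v \<in> P" "P = proj_pt N v" "\<exists>i\<le>N. v i \<noteq> 0" "\<And>i. N < i \<Longrightarrow> v i = 0"
proof -
  obtain u where u: "P = proj_pt N u" "\<exists>i\<le>N. u i \<noteq> 0"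
    using assms(1) unfolding proj_points_def by blast
  have m: "(\<lambda>i. if i \<le> N then u i else 0) \<in> P" unfolding u(1) by (rule proj_pt_self)
  show thesis by (rule that[OF m]) (use proj_points_repr[OF assms m] in blast)+
qed

lemma Union_proj_points:
  "\<Union>(proj_points N) = {v. (\<exists>i\<le>N. v i \<noteq> 0) \<and> (\<forall>i>N. v i = 0)}"
proof (intro set_eqI iffI)
  fix v assume "v \<in> \<Union>(proj_points N)"
  then obtain P where "P \<in> proj_points N" "v \<in> P" by blast
  from proj_points_repr[OF this] show "v \<in> {v. (\<exists>i\<le>N. v i \<noteq> 0) \<and> (\<forall>i>N. v i = 0)}" by blast
next
  fix v :: "nat \<Rightarrow> complex" assume v: "v \<in> {v. (\<exists>i\<le>N. v i \<noteq> 0) \<and> (\<forall>i>N. v i = 0)}"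
  then have eq: "(\<lambda>i. if i \<le> N then v i else 0) = v" by (auto simp: fun_eq_iff)
  have "v \<in> proj_pt N v" using proj_pt_self[of N v] unfolding eq .
  moreover have "proj_pt N v \<in> proj_points N" using v proj_pt_in_points by blast
  ultimately show "v \<in> \<Union>(proj_points N)" by blast
qed

lemma affine_piece_proj_pt: "proj_pt N v \<in> affine_piece N i \<longleftrightarrow> i \<le> N \<and> v i \<noteq> 0"
proof
  assume "proj_pt N v \<in> affine_piece N i"
  then obtain w where "w \<in> proj_pt N v" "w i \<noteq> 0" unfolding affine_piece_def by blast
  then show "i \<le> N \<and> v i \<noteq> 0" unfolding proj_pt_def by (auto split: if_splits)
next
  assume v: "i \<le> N \<and> v i \<noteq> 0"
  then show "proj_pt N v \<in> affine_piece N i"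
    unfolding affine_piece_def
    using proj_pt_in_points[of i N v] proj_pt_self[of N v] by (auto intro!: bexI[OF _ proj_pt_self])
qed

lemma affine_coord_proj_pt:
  assumes "i \<le> N" "v i \<noteq> 0"
  shows "affine_coord i j (proj_pt N v) = (if j \<le> N then v j / v i else 0)"
proof -
  have "(THE w. w \<in> proj_pt N v \<and> w i = 1) = (\<lambda>j. if j \<le> N then v j / v i else 0)"
  proof (rule the_equality)
    show "(\<lambda>j. if j \<le> N then v j / v i else 0) \<in> proj_pt N v \<and> (\<lambda>j. if j \<le> N then v j / v i else 0) i = 1"
      unfolding proj_pt_def using assms by (auto intro!: exI[of _ "1 / v i"])
    fix w assume "w \<in> proj_pt N v \<and> w i = 1"
    then obtain c where c: "w = (\<lambda>j. if j \<le> N then c * v j else 0)" "w i = 1"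
      unfolding proj_pt_def by blast
    then have "c = 1 / v i" using assms by (simp add: field_simps)
    then show "w = (\<lambda>j. if j \<le> N then v j / v i else 0)" unfolding c(1) by (auto simp: fun_eq_iff)
  qed
  then show ?thesis unfolding affine_coord_def by simp
qed

lemma affine_pieceD:
  assumes "P \<in> affine_piece N i"
  shows "P = proj_pt N (\<lambda>j. affine_coord i j P)" "affine_coord i i P = 1" "i \<le> N" "P \<in> proj_points N"
proof -
  show P: "P \<in> proj_points N" using assms unfolding affine_piece_def by blast
  obtain v where v: "P = proj_pt N v" using proj_points_cases[OF P] .
  have vi: "i \<le> N" "v i \<noteq> 0" using assms unfolding v affine_piece_proj_pt by auto
  show "i \<le> N" by (rule vi)
  show "affine_coord i i P = 1" unfolding v affine_coord_proj_pt[of i N v, OF vi] using vi by simp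
  show "P = proj_pt N (\<lambda>j. affine_coord i j P)"
    unfolding v affine_coord_proj_pt[of i N v, OF vi]
    by (rule proj_pt_scale[of "v i"]) (use vi in auto)
qed

lemma affine_piece_iff:
  assumes "P \<in> affine_piece N i"
  shows "P \<in> affine_piece N m \<longleftrightarrow> m \<le> N \<and> affine_coord i m P \<noteq> 0"
  by (subst affine_pieceD(1)[OF assms]) (rule affine_piece_proj_pt)

lemma affine_coord_change:
  assumes "P \<in> affine_piece N i" "P \<in> affine_piece N m" "j \<le> N"
  shows "affine_coord m j P = affine_coord i j P / affine_coord i m P"
proof -
  have "m \<le> N" "affine_coord i m P \<noteq> 0" using assms(2) unfolding affine_piece_iff[OF assms(1)] by auto
  from affine_coord_proj_pt[of m N "\<lambda>k. affine_coord i k P" j, OF this] show ?thesis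
    using assms(3) affine_pieceD(1)[OF assms(1)] by simp
qed

lemma proj_points_pieces: "proj_points N = (\<Union>i\<le>N. affine_piece N i)"
proof (intro set_eqI iffI)
  fix P assume "P \<in> proj_points N"
  then obtain v where "P = proj_pt N v" "\<exists>i\<le>N. v i \<noteq> 0" by (rule proj_points_cases)
  then show "P \<in> (\<Union>i\<le>N. affine_piece N i)" by (auto simp: affine_piece_proj_pt)
qed (auto dest: affine_pieceD)

lemma topspace_proj_space [simp]: "topspace (proj_space N) = proj_points N"
proof (rule antisym)
  show "topspace (proj_space N) \<subseteq> proj_points N"
    using openin_topspace[of "proj_space N"] unfolding openin_proj_space by blast
  have "openin (proj_space N) (proj_points N)" unfolding openin_proj_space by simp
  then show "proj_points N \<subseteq> topspace (proj_space N)" by (rule openin_subset)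
qed

lemma vimage_proj_pt:
  assumes "U \<subseteq> proj_points N"
  shows "{v \<in> \<Union>(proj_points N). proj_pt N v \<in> U} = \<Union>U"
proof (intro set_eqI iffI)
  fix v assume "v \<in> {v \<in> \<Union>(proj_points N). proj_pt N v \<in> U}"
  then obtain P where P: "P \<in> proj_points N" "v \<in> P" "proj_pt N v \<in> U" by blast
  then show "v \<in> \<Union>U" using proj_points_repr(1)[OF P(1,2)] by auto
next
  fix v assume "v \<in> \<Union>U"
  then obtain P where P: "P \<in> U" "v \<in> P" by blast
  then have "P \<in> proj_points N" using assms by blast
  then show "v \<in> {v \<in> \<Union>(proj_points N). proj_pt N v \<in> U}"
    using proj_points_repr(1)[of P N v] P by auto
qed

text \<open>
  The definition of the topology of projective space in terms of unions of classes is the quotient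
  topology; so continuity can be checked on homogeneous coordinates.
\<close>

lemma quotient_map_proj_pt: "quotient_map (top_of_set (\<Union>(proj_points N))) (proj_space N) (proj_pt N)"
  unfolding quotient_map_def
proof (intro conjI allI impI)
  show "proj_pt N ` topspace (top_of_set (\<Union>(proj_points N))) = topspace (proj_space N)"
  proof (intro set_eqI iffI)
    fix P assume "P \<in> proj_pt N ` topspace (top_of_set (\<Union>(proj_points N)))"
    then obtain v Q where "Q \<in> proj_points N" "v \<in> Q" "P = proj_pt N v" by auto
    then show "P \<in> topspace (proj_space N)" using proj_points_repr(1)[of Q N v] by simp
  next
    fix P assume "P \<in> topspace (proj_space N)"
    then have P: "P \<in> proj_points N" by simp
    obtain v where "v \<in> P" "P = proj_pt N v" by (rule proj_points_cases[OF P])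
    then show "P \<in> proj_pt N ` topspace (top_of_set (\<Union>(proj_points N)))" using P by auto
  qed
  fix U assume "U \<subseteq> topspace (proj_space N)"
  then have U: "U \<subseteq> proj_points N" by simp
  show "openin (top_of_set (\<Union>(proj_points N))) {v \<in> topspace (top_of_set (\<Union>(proj_points N))). proj_pt N v \<in> U}
     = openin (proj_space N) U"
    unfolding openin_proj_space using vimage_proj_pt[OF U] U by simp
qed

lemma continuous_map_into_fun:
  fixes v :: "'a \<Rightarrow> nat \<Rightarrow> complex"
  assumes "\<And>i. continuous_map T euclidean (\<lambda>x. v x i)"
  shows "continuous_map T euclidean v"
  using assms unfolding euclidean_product_topology[symmetric] continuous_map_componentwise_UNIV by blast

lemma continuous_map_proj_pt:
  assumes "\<And>i. i \<le> N \<Longrightarrow> continuous_map T euclidean (\<lambda>x. v x i)"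
    and nz: "\<And>x. x \<in> topspace T \<Longrightarrow> \<exists>i\<le>N. v x i \<noteq> 0"
  shows "continuous_map T (proj_space N) (\<lambda>x. proj_pt N (v x))"
proof -
  let ?w = "\<lambda>x i. if i \<le> N then v x i else 0"
  have "continuous_map T euclidean (\<lambda>x. ?w x i)" for i
    using assms(1) by (cases "i \<le> N") auto
  then have "continuous_map T euclidean ?w" by (rule continuous_map_into_fun)
  moreover have "?w x \<in> \<Union>(proj_points N)" if "x \<in> topspace T" for x
    unfolding Union_proj_points using nz[OF that] by auto
  ultimately have "continuous_map T (top_of_set (\<Union>(proj_points N))) ?w"
    by (auto simp: continuous_map_in_subtopology)
  then have "continuous_map T (proj_space N) (proj_pt N \<circ> ?w)"
    by (rule continuous_map_compose) (rule quotient_imp_continuous_map[OF quotient_map_proj_pt])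
  moreover have "proj_pt N (?w x) = proj_pt N (v x)" for x
    by (rule proj_pt_scale[of 1]) auto
  ultimately show ?thesis by (simp add: o_def)
qed

lemma continuous_on_fun_coord: "continuous_on S (\<lambda>v :: nat \<Rightarrow> complex. v i)"
  by (rule continuous_on_subset[OF continuous_on_product_coordinates subset_UNIV])

lemma Union_affine_piece:
  assumes "i \<le> N"
  shows "\<Union>(affine_piece N i) = {v \<in> \<Union>(proj_points N). v i \<noteq> 0}"
proof (intro set_eqI iffI)
  fix v assume "v \<in> \<Union>(affine_piece N i)"
  then obtain P where P: "P \<in> affine_piece N i" "v \<in> P" by blast
  have "P = proj_pt N v" by (rule proj_points_repr(1)[OF affine_pieceD(4)[OF P(1)] P(2)])
  then have "v i \<noteq> 0" using P(1) affine_piece_proj_pt by simp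
  then show "v \<in> {v \<in> \<Union>(proj_points N). v i \<noteq> 0}" using P affine_pieceD(4)[OF P(1)] by blast
next
  fix v assume "v \<in> {v \<in> \<Union>(proj_points N). v i \<noteq> 0}"
  then show "v \<in> \<Union>(affine_piece N i)" unfolding affine_piece_def by blast
qed

lemma openin_affine_piece: "openin (proj_space N) (affine_piece N i)"
proof (cases "i \<le> N")
  case True
  have "open {v :: nat \<Rightarrow> complex. v i \<noteq> 0}"
    by (intro open_Collect_neq continuous_on_fun_coord continuous_on_const)
  then have "openin (top_of_set (\<Union>(proj_points N))) (\<Union>(proj_points N) \<inter> {v. v i \<noteq> 0})"
    by (rule openin_open_Int)
  moreover have "\<Union>(proj_points N) \<inter> {v. v i \<noteq> 0} = \<Union>(affine_piece N i)"
    unfolding Union_affine_piece[OF True] by blast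
  ultimately have "openin (top_of_set (\<Union>(proj_points N))) (\<Union>(affine_piece N i))" by simp
  then show ?thesis unfolding openin_proj_space using affine_pieceD(4) by blast
next
  case False
  then have "affine_piece N i = {}" using affine_pieceD(3) by blast
  then show ?thesis by simp
qed

lemma continuous_map_affine_coord:
  "continuous_map (subtopology (proj_space N) (affine_piece N i)) euclidean (affine_coord i j)"
proof (cases "i \<le> N")
  case True
  let ?S = "\<Union>(proj_points N)"
  have q: "quotient_map (subtopology (top_of_set ?S) {v \<in> topspace (top_of_set ?S). proj_pt N v \<in> affine_piece N i})
      (subtopology (proj_space N) (affine_piece N i)) (proj_pt N)"
    by (rule quotient_map_restriction[OF quotient_map_proj_pt refl]) (use openin_affine_piece in blast)
  have "{v \<in> topspace (top_of_set ?S). proj_pt N v \<in> affine_piece N i} = ?S \<inter> {v. v i \<noteq> 0}"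
    using True by (auto simp: affine_piece_proj_pt)
  then have q: "quotient_map (top_of_set (?S \<inter> {v. v i \<noteq> 0}))
      (subtopology (proj_space N) (affine_piece N i)) (proj_pt N)"
    using q by (simp add: subtopology_subtopology)
  have "continuous_on (?S \<inter> {v. v i \<noteq> 0}) (affine_coord i j \<circ> proj_pt N)"
  proof (rule continuous_on_eq)
    show "continuous_on (?S \<inter> {v. v i \<noteq> 0}) (\<lambda>v. if j \<le> N then v j / v i else 0)"
      by (cases "j \<le> N") (auto intro!: continuous_on_divide continuous_on_fun_coord)
    show "(if j \<le> N then v j / v i else 0) = (affine_coord i j \<circ> proj_pt N) v"
      if "v \<in> ?S \<inter> {v. v i \<noteq> 0}" for v
      using affine_coord_proj_pt[OF True, of v j] that by simp
  qed
  then have "continuous_map (top_of_set (?S \<inter> {v. v i \<noteq> 0})) euclidean (affine_coord i j \<circ> proj_pt N)"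
    by simp
  then show ?thesis by (rule continuous_compose_quotient_map[OF q])
next
  case False
  then have "affine_piece N i = {}" using affine_pieceD(3) by blast
  then show ?thesis by (simp add: continuous_map_on_empty)
qed

text \<open>
  Dividing by a coordinate of largest modulus, every point is represented in a finite union of compact
  polydiscs.
\<close>

lemma compact_space_proj_space: "compact_space (proj_space N)"
proof -
  define K where "K = (\<lambda>i. (\<Pi>\<^sub>E j\<in>UNIV. if j = i then {1} else if j \<le> N then cball (0::complex) 1 else {0}))"
  have cK: "compactin euclidean (K i)" for i
    unfolding K_def euclidean_product_topology[symmetric] compactin_PiE by auto
  let ?K = "\<Union>i\<le>N. K i"
  have "compactin euclidean ?K" by (rule compactin_Union) (use cK in auto)
  moreover have KS: "?K \<subseteq> \<Union>(proj_points N)"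
  proof
    fix v assume "v \<in> ?K"
    then obtain i where i: "i \<le> N" "v \<in> K i" by blast
    then have *: "v j \<in> (if j = i then {1} else if j \<le> N then cball (0::complex) 1 else {0})" for j
      unfolding K_def by (auto simp: PiE_iff)
    have "v i = 1" using *[of i] by simp
    moreover have "v j = 0" if "j > N" for j using *[of j] that i(1) by simp
    ultimately show "v \<in> \<Union>(proj_points N)" unfolding Union_proj_points using i(1) by force
  qed
  ultimately have "compactin (top_of_set (\<Union>(proj_points N))) ?K" by (simp add: compactin_subtopology)
  then have "compactin (proj_space N) (proj_pt N ` ?K)"
    by (rule image_compactin) (rule quotient_imp_continuous_map[OF quotient_map_proj_pt])
  moreover have "proj_pt N ` ?K = proj_points N"
  proof (intro set_eqI iffI)
    fix P assume "P \<in> proj_pt N ` ?K"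
    then show "P \<in> proj_points N"
      using KS quotient_imp_surjective_map[OF quotient_map_proj_pt, of N] by auto
  next
    fix P assume P: "P \<in> proj_points N"
    obtain v where v: "P = proj_pt N v" "\<exists>i\<le>N. v i \<noteq> 0" by (rule proj_points_cases[OF P])
    obtain i where i: "i \<le> N" "\<And>j. j \<le> N \<Longrightarrow> norm (v j) \<le> norm (v i)"
    proof -
      have "finite ((\<lambda>j. norm (v j)) ` {..N})" "(\<lambda>j. norm (v j)) ` {..N} \<noteq> {}" by auto
      from Max_in[OF this] obtain i where mx: "Max ((\<lambda>j. norm (v j)) ` {..N}) = norm (v i)" and i: "i \<in> {..N}"
        by (rule imageE) (rule that)
      show thesis
      proof (rule that[of i])
        show "i \<le> N" using i by simp
        show "norm (v j) \<le> norm (v i)" if "j \<le> N" for j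
          unfolding mx[symmetric] by (rule Max_ge) (use that in auto)
      qed
    qed
    have vi: "v i \<noteq> 0" using v(2) i(2) by force
    define w where "w = (\<lambda>j. if j \<le> N then v j / v i else 0)"
    have "w j \<in> (if j = i then {1} else if j \<le> N then cball (0::complex) 1 else {0})" for j
      using i vi by (auto simp: w_def norm_divide divide_le_eq)
    then have "w \<in> K i" unfolding K_def by (auto simp: PiE_iff)
    moreover have "P = proj_pt N w" unfolding v(1)
      by (rule proj_pt_scale[of "v i"]) (use vi in \<open>auto simp: w_def\<close>)
    ultimately show "P \<in> proj_pt N ` ?K" using i(1) by blast
  qed
  ultimately show ?thesis unfolding compact_space_def by simp
qed

lemma openin_affine_vimage:
  assumes "open T"
  shows "openin (proj_space N) {P \<in> affine_piece N i. affine_coord i j P \<in> T}"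
proof -
  have "openin (subtopology (proj_space N) (affine_piece N i))
     {P \<in> topspace (subtopology (proj_space N) (affine_piece N i)). affine_coord i j P \<in> T}"
    by (rule openin_continuous_map_preimage[OF continuous_map_affine_coord]) (rule open_openin[THEN iffD1, OF assms])
  then have "openin (proj_space N) {P \<in> topspace (subtopology (proj_space N) (affine_piece N i)). affine_coord i j P \<in> T}"
    using openin_affine_piece by (rule openin_trans_full)
  moreover have "{P \<in> topspace (subtopology (proj_space N) (affine_piece N i)). affine_coord i j P \<in> T}
     = {P \<in> affine_piece N i. affine_coord i j P \<in> T}"
    using affine_pieceD(4) by auto
  ultimately show ?thesis by simp
qed

text \<open>Two points in a common affine piece are separated by an affine coordinate; otherwise some
  \<open>v\<^sub>j / v\<^sub>i\<close> vanishes at one of them and \<open>v\<^sub>i / v\<^sub>j\<close> at the other.\<close>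

lemma Hausdorff_proj_space: "Hausdorff_space (proj_space N)"
  unfolding Hausdorff_space_def topspace_proj_space
proof (intro allI impI)
  fix P Q assume PQ: "P \<in> proj_points N \<and> Q \<in> proj_points N \<and> P \<noteq> Q"
  show "\<exists>U V. openin (proj_space N) U \<and> openin (proj_space N) V \<and> P \<in> U \<and> Q \<in> V \<and> disjnt U V"
  proof (cases "\<exists>i. P \<in> affine_piece N i \<and> Q \<in> affine_piece N i")
    case True
    then obtain i where i: "P \<in> affine_piece N i" "Q \<in> affine_piece N i" by blast
    have "\<exists>j. affine_coord i j P \<noteq> affine_coord i j Q"
      using affine_pieceD(1)[OF i(1)] affine_pieceD(1)[OF i(2)] PQ by force
    then obtain j where "affine_coord i j P \<noteq> affine_coord i j Q" ..
    from hausdorff[OF this] obtain S T where ST: "open S" "open T"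
      "affine_coord i j P \<in> S" "affine_coord i j Q \<in> T" "S \<inter> T = {}"
      by blast
    let ?U = "{P \<in> affine_piece N i. affine_coord i j P \<in> S}"
    let ?V = "{P \<in> affine_piece N i. affine_coord i j P \<in> T}"
    have d: "disjnt ?U ?V"
      using ST(5) unfolding disjnt_def by blast
    have PQ': "P \<in> ?U" "Q \<in> ?V" using i ST(3,4) by simp_all
    show ?thesis
      by (rule exI[of _ ?U], rule exI[of _ ?V], intro conjI openin_affine_vimage ST(1,2) d PQ')
  next
    case False
    obtain i where i: "P \<in> affine_piece N i" using PQ proj_points_pieces by blast
    obtain j where j: "Q \<in> affine_piece N j" using PQ proj_points_pieces by blast
    have le: "i \<le> N" "j \<le> N" using affine_pieceD(3) i j by auto
    have "P \<notin> affine_piece N j" "Q \<notin> affine_piece N i" using False i j by auto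
    then have z: "affine_coord i j P = 0" "affine_coord j i Q = 0"
      using affine_piece_iff[OF i] affine_piece_iff[OF j] le by auto
    let ?U = "{P \<in> affine_piece N i. affine_coord i j P \<in> ball 0 1}"
    let ?V = "{P \<in> affine_piece N j. affine_coord j i P \<in> ball 0 1}"
    have "R \<notin> ?V" if "R \<in> ?U" for R
    proof
      assume V: "R \<in> ?V"
      then have "affine_coord j i R = affine_coord i i R / affine_coord i j R"
        using that le by (intro affine_coord_change[of _ N]) auto
      also have "affine_coord i i R = 1" using that affine_pieceD(2) by blast
      finally have "norm (affine_coord j i R) * norm (affine_coord i j R) = 1"
        using that V affine_piece_iff[of R N i j] by (simp add: norm_divide)
      moreover have "norm (affine_coord j i R) < 1" "norm (affine_coord i j R) < 1" using that V by auto
      ultimately show False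
        using mult_strict_mono[of "norm (affine_coord j i R)" 1 "norm (affine_coord i j R)" 1] by simp
    qed
    then have d: "disjnt ?U ?V" unfolding disjnt_def by blast
    have PQ': "P \<in> ?U" "Q \<in> ?V" using i j z by simp_all
    show ?thesis
      by (rule exI[of _ ?U], rule exI[of _ ?V], intro conjI openin_affine_vimage open_ball d PQ')
  qed
qed

text \<open>Homogeneous coordinates of the point with affine coordinates \<open>z\<close>, numbered by \<open>e\<close>, in the
  \<open>i\<close>-th piece.\<close>

definition hom_coords :: "nat \<Rightarrow> ('n::finite \<Rightarrow> nat) \<Rightarrow> complex^'n \<Rightarrow> nat \<Rightarrow> complex" where
  "hom_coords i e z j = (if j = i then 1 else z $ (inv_into UNIV e j))"

lemma proj_atlas_inverse:
  fixes e :: "'n::finite \<Rightarrow> nat"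
  assumes i: "i \<le> CARD('n)" and e: "bij_betw e UNIV ({..CARD('n)} - {i})"
  defines "c \<equiv> (\<lambda>P. (\<chi> k. affine_coord i (e k) P) :: complex^'n)"
  shows "proj_pt CARD('n) (hom_coords i e z) \<in> affine_piece CARD('n) i"
    and "c (proj_pt CARD('n) (hom_coords i e z)) = z"
    and "P \<in> affine_piece CARD('n) i \<Longrightarrow> proj_pt CARD('n) (hom_coords i e (c P)) = P"
    and "c ` affine_piece CARD('n) i = UNIV"
    and "inv_into (affine_piece CARD('n) i) c z = proj_pt CARD('n) (hom_coords i e z)"
proof -
  let ?n = "CARD('n)"
  have inj: "inj e" using e by (rule bij_betw_imp_inj_on)
  have ek: "e k \<le> ?n" "e k \<noteq> i" for k using bij_betwE[OF e] by auto
  have h1: "hom_coords i e z i = 1" for z by (simp add: hom_coords_def)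
  have he: "hom_coords i e z (e k) = z $ k" for z k
    using ek inj by (simp add: hom_coords_def)
  show mem: "proj_pt ?n (hom_coords i e z) \<in> affine_piece ?n i" for z
    unfolding affine_piece_proj_pt using i h1 by simp
  show cz: "c (proj_pt ?n (hom_coords i e z)) = z" for z
    unfolding c_def using affine_coord_proj_pt[of i ?n "hom_coords i e z"] i h1 he ek
    by (simp add: vec_eq_iff)
  show Pc: "proj_pt ?n (hom_coords i e (c P)) = P" if "P \<in> affine_piece ?n i" for P
  proof -
    have "hom_coords i e (c P) j = affine_coord i j P" if jn: "j \<le> ?n" for j
    proof (cases "j = i")
      case True then show ?thesis using affine_pieceD(2)[OF \<open>P \<in> affine_piece ?n i\<close>] h1 by simp
    next
      case False
      then have "j \<in> range e" using jn e unfolding bij_betw_def by simp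
      then obtain k where "j = e k" by blast
      then show ?thesis by (simp add: he) (simp add: c_def)
    qed
    then have "proj_pt ?n (hom_coords i e (c P)) = proj_pt ?n (\<lambda>j. affine_coord i j P)"
      by (intro proj_pt_scale[of 1]) auto
    then show ?thesis using affine_pieceD(1)[OF that] by simp
  qed
  show "c ` affine_piece ?n i = UNIV"
  proof -
    have "z \<in> c ` affine_piece ?n i" for z
      by (rule image_eqI[of z c "proj_pt ?n (hom_coords i e z)", OF cz[symmetric] mem])
    then show ?thesis by blast
  qed
  have "inj_on c (affine_piece ?n i)" by (rule inj_on_inverseI[of _ "\<lambda>z. proj_pt ?n (hom_coords i e z)"]) (rule Pc)
  from inv_into_f_f[OF this mem[of z]] show "inv_into (affine_piece ?n i) c z = proj_pt ?n (hom_coords i e z)"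
    by (simp only: cz)
qed

lemma mv_holomorphic_hom_coords: "open W \<Longrightarrow> mv_holomorphic_on (\<lambda>z. hom_coords i e z j) W"
  unfolding hom_coords_def by (cases "j = i") (auto intro: mv_holomorphic_intros)

lemma continuous_map_vec:
  fixes f :: "'a \<Rightarrow> complex^'n"
  assumes "\<And>j. continuous_map T euclidean (\<lambda>x. f x $ j)"
  shows "continuous_map T euclidean f"
  using assms unfolding continuous_map_atin limitin_canonical_iff by (auto intro!: vec_tendstoI)

lemma proj_chart_atlas: "chart_atlas (proj_space CARD('n)) (proj_atlas :: (hpoint, 'n::finite) atlas)"
  unfolding chart_atlas_def
proof (intro conjI ballI)
  let ?n = "CARD('n)"
  have ex: "\<exists>e. bij_betw e (UNIV :: 'n set) ({..?n} - {i})" if "i \<le> ?n" for i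
    by (rule finite_same_card_bij) (use that in auto)
  show "\<Union>(fst ` (proj_atlas :: (hpoint, 'n) atlas)) = topspace (proj_space ?n)"
    unfolding topspace_proj_space
  proof (intro set_eqI iffI)
    fix P assume "P \<in> \<Union>(fst ` (proj_atlas :: (hpoint, 'n) atlas))"
    then show "P \<in> proj_points ?n" unfolding proj_atlas_def by (auto dest: affine_pieceD)
  next
    fix P assume "P \<in> proj_points ?n"
    then obtain i where i: "i \<le> ?n" "P \<in> affine_piece ?n i" unfolding proj_points_pieces by blast
    obtain e :: "'n \<Rightarrow> nat" where e: "bij_betw e UNIV ({..?n} - {i})" using ex[OF i(1)] by blast
    have "(affine_piece ?n i, \<lambda>P. \<chi> k. affine_coord i (e k) P) \<in> (proj_atlas :: (hpoint, 'n) atlas)"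
      unfolding proj_atlas_def using i(1) e by blast
    then show "P \<in> \<Union>(fst ` (proj_atlas :: (hpoint, 'n) atlas))" using i(2) by force
  qed
  fix x assume "x \<in> (proj_atlas :: (hpoint, 'n) atlas)"
  then obtain i and e :: "'n \<Rightarrow> nat" where x: "x = (affine_piece ?n i, \<lambda>P. \<chi> k. affine_coord i (e k) P)"
    and i: "i \<le> ?n" and e: "bij_betw e UNIV ({..?n} - {i})"
    unfolding proj_atlas_def by blast
  let ?c = "\<lambda>P. (\<chi> k. affine_coord i (e k) P) :: complex^'n"
  let ?U = "affine_piece ?n i"
  note inv = proj_atlas_inverse[OF i e]
  have "homeomorphic_maps (subtopology (proj_space ?n) ?U) (top_of_set UNIV) ?c (\<lambda>z. proj_pt ?n (hom_coords i e z))"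
    unfolding homeomorphic_maps_def
  proof (intro conjI ballI)
    show "continuous_map (subtopology (proj_space ?n) ?U) (top_of_set UNIV) ?c"
      unfolding subtopology_UNIV
      by (rule continuous_map_vec) (simp add: continuous_map_affine_coord)
    show "continuous_map (top_of_set UNIV) (subtopology (proj_space ?n) ?U) (\<lambda>z. proj_pt ?n (hom_coords i e z))"
      unfolding subtopology_UNIV continuous_map_in_subtopology
    proof (intro conjI)
      show "continuous_map euclidean (proj_space ?n) (\<lambda>z. proj_pt ?n (hom_coords i e z))"
      proof (rule continuous_map_proj_pt)
        show "continuous_map euclidean euclidean (\<lambda>z. hom_coords i e z j)" for j
          using mv_holomorphic_on_imp_continuous_on[OF mv_holomorphic_hom_coords[OF open_UNIV]] by simp
        show "\<exists>j\<le>?n. hom_coords i e z j \<noteq> 0" for z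
          by (rule exI[of _ i]) (use i in \<open>simp add: hom_coords_def\<close>)
      qed
    qed (use inv(1) in auto)
  qed (use inv in auto)
  then have "homeomorphic_map (subtopology (proj_space ?n) ?U) (top_of_set UNIV) ?c"
    by (rule homeomorphic_maps_imp_map)
  then show "case x of (U, c) \<Rightarrow> openin (proj_space ?n) U \<and> open (c ` U) \<and>
      homeomorphic_map (subtopology (proj_space ?n) U) (top_of_set (c ` U)) c"
    unfolding x prod.case inv(4) using openin_affine_piece by simp
qed

text \<open>
  The numbering of the coordinates in the atlas of projective space is arbitrary. This lemma hides it:
  only ratios of homogeneous coordinates are used from here on.
\<close>

lemma holomorphic_affine_coord_proj:
  "holomorphic_fun (proj_space CARD('n)) (proj_atlas :: (hpoint, 'n::finite) atlas)
     (affine_piece CARD('n) m) (affine_coord m j)"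
  unfolding holomorphic_fun_def
proof (intro conjI ballI, rule openin_affine_piece)
  let ?n = "CARD('n)"
  fix x assume xA: "x \<in> (proj_atlas :: (hpoint, 'n) atlas)"
  then obtain i and e :: "'n \<Rightarrow> nat" where x: "x = (affine_piece ?n i, \<lambda>P. \<chi> k. affine_coord i (e k) P)"
    and i: "i \<le> ?n" and e: "bij_betw e UNIV ({..?n} - {i})"
    unfolding proj_atlas_def by blast
  let ?c = "\<lambda>P. (\<chi> k. affine_coord i (e k) P) :: complex^'n"
  let ?U = "affine_piece ?n i"
  note inv = proj_atlas_inverse[OF i e]
  let ?W = "?c ` (?U \<inter> affine_piece ?n m)"
  have W: "open ?W"
    by (rule chart_open_image[OF proj_chart_atlas xA[unfolded x] openin_affine_piece])
  have nz: "m \<le> ?n \<and> hom_coords i e z m \<noteq> 0" if "z \<in> ?W" for z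
  proof -
    from that obtain P where P: "z = ?c P" "P \<in> ?U \<inter> affine_piece ?n m" by (rule imageE)
    have "proj_pt ?n (hom_coords i e z) = P"
      unfolding P(1) by (rule inv(3)) (use P(2) in blast)
    moreover have "P \<in> affine_piece ?n m" using P(2) by (rule IntD2)
    ultimately have "proj_pt ?n (hom_coords i e z) \<in> affine_piece ?n m" by (rule ssubst)
    then show ?thesis by (rule affine_piece_proj_pt[THEN iffD1])
  qed
  have "mv_holomorphic_on (\<lambda>z. affine_coord m j (inv_into ?U ?c z)) ?W"
  proof (cases "j \<le> ?n")
    case True
    have "mv_holomorphic_on (\<lambda>z. hom_coords i e z j / hom_coords i e z m) ?W"
      by (rule mv_holomorphic_on_divide[OF mv_holomorphic_hom_coords[OF W] mv_holomorphic_hom_coords[OF W]])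
        (rule nz[THEN conjunct2])
    moreover have "hom_coords i e z j / hom_coords i e z m = affine_coord m j (inv_into ?U ?c z)" if "z \<in> ?W" for z
      unfolding inv(5) using affine_coord_proj_pt[of m ?n "hom_coords i e z" j] nz[OF that] True by simp
    ultimately show ?thesis by (rule mv_holomorphic_on_transform)
  next
    case False
    have "0 = affine_coord m j (inv_into ?U ?c z)" if "z \<in> ?W" for z
      unfolding inv(5) using affine_coord_proj_pt[of m ?n "hom_coords i e z" j] nz[OF that] False by simp
    then show ?thesis by (rule mv_holomorphic_on_transform[OF mv_holomorphic_on_const[OF W, of 0]])
  qed
  then show "case x of (U, c) \<Rightarrow> mv_holomorphic_on (\<lambda>z. affine_coord m j (inv_into U c z)) (c ` (U \<inter> affine_piece ?n m))"
    unfolding x prod.case .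
qed

section \<open>The family of rational scrolls\<close>

text \<open>
  The six 2 x 2 minors of the matrix with columns \<open>(v\<^sub>0, v\<^sub>1)\<close>, \<open>(v\<^sub>2, v\<^sub>3)\<close>, \<open>(v\<^sub>3 + t v\<^sub>0, v\<^sub>4)\<close>,
  \<open>(v\<^sub>4, v\<^sub>5)\<close>, numbered by \<open>e\<close>.
\<close>

definition minors :: "nat \<Rightarrow> complex \<Rightarrow> (nat \<Rightarrow> complex) \<Rightarrow> complex" where
  "minors e t v =
     (if e = 0 then v 0 * v 3 - v 1 * v 2
      else if e = 1 then v 0 * v 4 - v 1 * (v 3 + t * v 0)
      else if e = 2 then v 0 * v 5 - v 1 * v 4
      else if e = 3 then v 2 * v 4 - v 3 * (v 3 + t * v 0)
      else if e = 4 then v 2 * v 5 - v 3 * v 4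
      else (v 3 + t * v 0) * v 5 - v 4 * v 4)"

definition on_scroll :: "complex \<Rightarrow> (nat \<Rightarrow> complex) \<Rightarrow> bool" where
  "on_scroll t v \<longleftrightarrow> (\<forall>e<6. minors e t v = 0)"

lemma all_less_6: "(\<forall>e<6. P e) \<longleftrightarrow> P 0 \<and> P 1 \<and> P 2 \<and> P 3 \<and> P 4 \<and> P (5::nat)"
  by (simp add: numeral_eq_Suc All_less_Suc conj_ac)

lemma all_le_5: "(\<forall>i\<le>5. P i) \<longleftrightarrow> P 0 \<and> P 1 \<and> P 2 \<and> P 3 \<and> P 4 \<and> P (5::nat)"
  using all_less_6[of P] by (simp add: le_less_trans[OF _ lessI] less_Suc_eq_le[symmetric] numeral_eq_Suc)

lemma on_scroll_iff:
  "on_scroll t v \<longleftrightarrow> v 0 * v 3 = v 1 * v 2 \<and> v 0 * v 4 = v 1 * (v 3 + t * v 0) \<and> v 0 * v 5 = v 1 * v 4 \<and>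
     v 2 * v 4 = v 3 * (v 3 + t * v 0) \<and> v 2 * v 5 = v 3 * v 4 \<and> (v 3 + t * v 0) * v 5 = v 4 * v 4"
  unfolding on_scroll_def all_less_6 by (simp add: minors_def)

lemma on_scroll_scale:
  assumes "\<And>i. i \<le> 5 \<Longrightarrow> v i = k * w i" "on_scroll t w"
  shows "on_scroll t v"
proof -
  have "minors e t v = k * k * minors e t w" for e
    using assms(1) by (simp add: minors_def algebra_simps)
  then show ?thesis using assms(2) unfolding on_scroll_def by simp
qed

definition scroll_family :: "(complex \<times> hpoint) set" where
  "scroll_family = {(t,P). norm t < 1 \<and> P \<in> proj_points 5 \<and> (\<forall>v\<in>P. on_scroll t v)}"

abbreviation disc_proj :: "(complex \<times> hpoint) topology" where
  "disc_proj \<equiv> prod_topology (top_of_set (ball 0 1)) (proj_space 5)"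

definition famX :: "(complex \<times> hpoint) topology" where
  "famX = subtopology disc_proj scroll_family"

lemma scroll_family_proj_pt:
  "(t, proj_pt 5 v) \<in> scroll_family \<longleftrightarrow> norm t < 1 \<and> (\<exists>i\<le>5. v i \<noteq> 0) \<and> on_scroll t v"
proof
  assume *: "(t, proj_pt 5 v) \<in> scroll_family"
  then have P: "proj_pt 5 v \<in> proj_points 5" and s: "\<forall>w\<in>proj_pt 5 v. on_scroll t w"
    unfolding scroll_family_def by auto
  let ?w = "\<lambda>i. if i \<le> 5 then v i else 0"
  have w: "?w \<in> proj_pt 5 v" by (rule proj_pt_self)
  have "on_scroll t v" by (rule on_scroll_scale[of v 1 ?w]) (use s w in auto)
  moreover have "\<exists>i\<le>5. v i \<noteq> 0" using proj_points_repr(2)[OF P w] by auto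
  ultimately show "norm t < 1 \<and> (\<exists>i\<le>5. v i \<noteq> 0) \<and> on_scroll t v"
    using * unfolding scroll_family_def by auto
next
  assume *: "norm t < 1 \<and> (\<exists>i\<le>5. v i \<noteq> 0) \<and> on_scroll t v"
  have "on_scroll t w" if w: "w \<in> proj_pt 5 v" for w
  proof -
    obtain c where "w = (\<lambda>i. if i \<le> 5 then c * v i else 0)" using w unfolding proj_pt_def by blast
    then show ?thesis using * by (intro on_scroll_scale[of w c v]) auto
  qed
  then show "(t, proj_pt 5 v) \<in> scroll_family"
    using * proj_pt_in_points unfolding scroll_family_def by auto
qed

lemma scroll_familyD:
  assumes "p \<in> scroll_family"
  shows "norm (fst p) < 1" "snd p \<in> proj_points 5"
    "snd p \<in> affine_piece 5 m \<Longrightarrow> on_scroll (fst p) (\<lambda>j. affine_coord m j (snd p))"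
proof -
  show "norm (fst p) < 1" "snd p \<in> proj_points 5" using assms unfolding scroll_family_def by auto
  assume m: "snd p \<in> affine_piece 5 m"
  have "(fst p, proj_pt 5 (\<lambda>j. affine_coord m j (snd p))) \<in> scroll_family"
    using assms affine_pieceD(1)[OF m] by simp
  then show "on_scroll (fst p) (\<lambda>j. affine_coord m j (snd p))"
    unfolding scroll_family_proj_pt by blast
qed

lemma topspace_famX [simp]: "topspace famX = scroll_family"
  unfolding famX_def topspace_subtopology topspace_prod_topology
  by (auto dest: scroll_familyD)

text \<open>
  Chart number \<open>k\<close> normalizes the coordinate \<open>v\<close> with index \<open>piv k\<close> to 1 and uses those with indices
  \<open>co1 k\<close>, \<open>co2 k\<close>: \<open>x = v\<^bsub>co1 k\<^esub>\<close> is the ratio of the rows (for \<open>k = 0, 1\<close>) or its inverse (for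
  \<open>k = 2, 3\<close>), and \<open>y = v\<^bsub>co2 k\<^esub>\<close> is a coordinate of the ruling. The coordinates \<open>y\<close> of the charts 0 and 1
  are inverse to each other, and likewise in the charts 2 and 3. In the central fibre \<open>y = 0\<close> defines the
  curve \<open>E\<close> in the charts 0 and 2, and the section at infinity in the charts 1 and 3.
\<close>

definition piv :: "nat \<Rightarrow> nat" where
  "piv k = (if k = 0 then 0 else if k = 1 then 2 else if k = 2 then 1 else 5)"
definition co1 :: "nat \<Rightarrow> nat" where
  "co1 k = (if k = 0 then 1 else if k = 1 then 3 else if k = 2 then 0 else 4)"
definition co2 :: "nat \<Rightarrow> nat" where
  "co2 k = (if k = 0 then 2 else if k = 1 then 0 else if k = 2 then 5 else 1)"

text \<open>
  Homogeneous coordinates of the point with coordinates \<open>(t, x, y)\<close> in chart \<open>k\<close>: the solution of the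
  equations of the scroll with the three coordinates of chart \<open>k\<close> prescribed.
\<close>

definition hc :: "nat \<Rightarrow> complex \<Rightarrow> complex \<Rightarrow> complex \<Rightarrow> nat \<Rightarrow> complex" where
  "hc k t x y i =
     (if k = 0 then [1, x, y, x*y, x^2*y + t*x, x^3*y + t*x^2] ! i
      else if k = 1 then [y, x*y, 1, x, x^2 + t*x*y, x^3 + t*x^2*y] ! i
      else if k = 2 then [x, 1, x^3*y - t*x^2, x^2*y - t*x, x*y, y] ! i
      else [x*y, y, x^3 - t*x^2*y, x^2 - t*x*y, x, 1] ! i)"

lemma k_cases: "k < 4 \<Longrightarrow> k = 0 \<or> k = 1 \<or> k = 2 \<or> k = (3::nat)" by auto

lemma piv_co_le: "piv k \<le> 5" "co1 k \<le> 5" "co2 k \<le> 5"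
  by (auto simp: piv_def co1_def co2_def)

lemma hc_values: "k < 4 \<Longrightarrow> hc k t x y (piv k) = 1" "k < 4 \<Longrightarrow> hc k t x y (co1 k) = x" "k < 4 \<Longrightarrow> hc k t x y (co2 k) = y"
  by (drule k_cases, auto simp: hc_def piv_def co1_def co2_def)+

lemma on_scroll_hc: "k < 4 \<Longrightarrow> on_scroll t (hc k t x y)"
  by (drule k_cases)
    (auto simp: on_scroll_iff hc_def algebra_simps power2_eq_square power3_eq_cube)

lemma hc_of_on_scroll:
  assumes "k < 4" "on_scroll t v" "v (piv k) = 1" "i \<le> 5"
  shows "v i = hc k t (v (co1 k)) (v (co2 k)) i"
proof -
  have s: "v 0 * v 3 = v 1 * v 2" "v 0 * v 4 = v 1 * (v 3 + t * v 0)" "v 0 * v 5 = v 1 * v 4"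
     "v 2 * v 4 = v 3 * (v 3 + t * v 0)" "v 2 * v 5 = v 3 * v 4" "(v 3 + t * v 0) * v 5 = v 4 * v 4"
    using assms(2) unfolding on_scroll_iff by blast+
  have "\<forall>i\<le>5. v i = hc k t (v (co1 k)) (v (co2 k)) i"
    using k_cases[OF assms(1)]
  proof (elim disjE)
    assume k: "k = 0"
    have v0: "v 0 = 1" using assms(3) k by (simp add: piv_def)
    have v3: "v 3 = v 1 * v 2" using s(1) unfolding v0 by simp
    have v4: "v 4 = v 1 * (v 3 + t)" using s(2) unfolding v0 by simp
    have v5: "v 5 = v 1 * v 4" using s(3) unfolding v0 by simp
    show ?thesis unfolding all_le_5
      by (simp add: k hc_def co1_def co2_def v0 v3 v4 v5 nth_Cons' algebra_simps power2_eq_square power3_eq_cube del: One_nat_def)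
  next
    assume k: "k = 1"
    have v2: "v 2 = 1" using assms(3) k by (simp add: piv_def)
    have v1: "v 1 = v 0 * v 3" using s(1) unfolding v2 by simp
    have v4: "v 4 = v 3 * (v 3 + t * v 0)" using s(4) unfolding v2 by simp
    have v5: "v 5 = v 3 * v 4" using s(5) unfolding v2 by simp
    show ?thesis unfolding all_le_5
      by (simp add: k hc_def co1_def co2_def v1 v2 v4 v5 nth_Cons' algebra_simps power2_eq_square power3_eq_cube del: One_nat_def)
  next
    assume k: "k = 2"
    have v1: "v 1 = 1" using assms(3) k by (simp add: piv_def)
    have v4: "v 4 = v 0 * v 5" using s(3) unfolding v1 by simp
    have v3: "v 3 = v 0 * v 4 - t * v 0" using s(2) unfolding v1 by (simp add: eq_diff_eq)
    have v2: "v 2 = v 0 * v 3" using s(1) unfolding v1 by simp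
    show ?thesis unfolding all_le_5
      by (simp add: k hc_def co1_def co2_def v1 v2 v3 v4 nth_Cons' algebra_simps power2_eq_square power3_eq_cube del: One_nat_def)
  next
    assume k: "k = 3"
    have v5: "v 5 = 1" using assms(3) k by (simp add: piv_def)
    have v0: "v 0 = v 1 * v 4" using s(3) unfolding v5 by simp
    have v3: "v 3 = v 4 * v 4 - t * v 0" using s(6) unfolding v5 by (simp add: eq_diff_eq)
    have v2: "v 2 = v 3 * v 4" using s(5) unfolding v5 by simp
    show ?thesis unfolding all_le_5
      by (simp add: k hc_def co1_def co2_def v0 v2 v3 v5 nth_Cons' algebra_simps power2_eq_square power3_eq_cube del: One_nat_def)
  qed
  then show ?thesis using assms(4) by blast
qed

text \<open>
  With \<open>v\<^sub>0 = v\<^sub>1 = v\<^sub>2 = v\<^sub>5 = 0\<close> two of the minors become \<open>- v\<^sub>3\<^sup>2\<close> and \<open>- v\<^sub>4\<^sup>2\<close>.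
\<close>

lemma on_scroll_pivot:
  assumes "on_scroll t v" "\<exists>i\<le>5. v i \<noteq> 0"
  shows "\<exists>k<4. v (piv k) \<noteq> 0"
proof (rule ccontr)
  assume "\<not> (\<exists>k<4. v (piv k) \<noteq> 0)"
  then have z: "v (piv 0) = 0" "v (piv 1) = 0" "v (piv 2) = 0" "v (piv 3) = 0" by auto
  then have z: "v 0 = 0" "v 2 = 0" "v 1 = 0" "v 5 = 0" by (simp_all add: piv_def)
  note s = assms(1)[unfolded on_scroll_iff]
  have "v 3 = 0" using s z by simp
  moreover have "v 4 = 0" using s z by simp
  ultimately have "\<forall>i\<le>5. v i = 0" unfolding all_le_5 using z by simp
  then show False using assms(2) by blast
qed

definition par :: "nat \<Rightarrow> complex \<Rightarrow> complex \<Rightarrow> complex \<Rightarrow> complex \<times> hpoint" where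
  "par k t x y = (t, proj_pt 5 (hc k t x y))"

definition pieceX :: "nat \<Rightarrow> (complex \<times> hpoint) set" where
  "pieceX m = {p\<in>scroll_family. snd p \<in> affine_piece 5 m}"

text \<open>
  The function \<open>v\<^sub>j / v\<^sub>m\<close> on the piece \<open>v\<^sub>m \<noteq> 0\<close>.
\<close>

definition affX :: "nat \<Rightarrow> nat \<Rightarrow> complex \<times> hpoint \<Rightarrow> complex" where
  "affX m j p = affine_coord m j (snd p)"

definition chX :: "nat \<Rightarrow> complex \<times> hpoint \<Rightarrow> complex^3" where
  "chX k p = vector [fst p, affX (piv k) (co1 k) p, affX (piv k) (co2 k) p]"

definition atlasX :: "(complex \<times> hpoint, 3) atlas" where
  "atlasX = {(pieceX (piv k), chX k) | k. k < 4}"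

definition disc3 :: "(complex^3) set" where "disc3 = {z. norm (z $ 1) < 1}"

lemma open_disc3: "open disc3"
  unfolding disc3_def by (intro open_Collect_less continuous_intros)

lemma par_simps [simp]: "fst (par k t x y) = t" "snd (par k t x y) = proj_pt 5 (hc k t x y)"
  by (simp_all add: par_def)

lemma par_in_pieceX:
  assumes "k < 4" "norm t < 1"
  shows "par k t x y \<in> pieceX m \<longleftrightarrow> m \<le> 5 \<and> hc k t x y m \<noteq> 0"
proof -
  have "\<exists>i\<le>5. hc k t x y i \<noteq> 0" by (rule exI[of _ "piv k"]) (use hc_values(1)[OF assms(1)] piv_co_le in simp)
  then have "par k t x y \<in> scroll_family"
    unfolding par_def scroll_family_proj_pt using assms on_scroll_hc by blast
  then show ?thesis unfolding pieceX_def by (simp add: affine_piece_proj_pt)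
qed

lemma par_in_own_piece: "k < 4 \<Longrightarrow> norm t < 1 \<Longrightarrow> par k t x y \<in> pieceX (piv k)"
  by (simp add: par_in_pieceX hc_values piv_co_le)

lemma affX_par:
  assumes "k < 4" "m \<le> 5" "hc k t x y m \<noteq> 0" "j \<le> 5"
  shows "affX m j (par k t x y) = hc k t x y j / hc k t x y m"
  unfolding affX_def par_simps using affine_coord_proj_pt[of m 5 "hc k t x y" j] assms by simp

lemma affX_par_own: "k < 4 \<Longrightarrow> j \<le> 5 \<Longrightarrow> affX (piv k) j (par k t x y) = hc k t x y j"
  using affX_par[of k "piv k" t x y j] by (simp add: hc_values piv_co_le)

lemma par_affX:
  assumes "k < 4" "p \<in> pieceX (piv k)"
  shows "par k (fst p) (affX (piv k) (co1 k) p) (affX (piv k) (co2 k) p) = p"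
proof -
  have p: "p \<in> scroll_family" "snd p \<in> affine_piece 5 (piv k)" using assms(2) unfolding pieceX_def by auto
  let ?v = "\<lambda>j. affX (piv k) j p"
  have s: "on_scroll (fst p) ?v" unfolding affX_def by (rule scroll_familyD(3)[OF p])
  have 1: "?v (piv k) = 1" unfolding affX_def by (rule affine_pieceD(2)[OF p(2)])
  have "proj_pt 5 (hc k (fst p) (?v (co1 k)) (?v (co2 k))) = proj_pt 5 ?v"
    by (rule proj_pt_scale[of 1]) (use hc_of_on_scroll[OF assms(1) s 1] in auto)
  also have "\<dots> = snd p" unfolding affX_def using affine_pieceD(1)[OF p(2)] by simp
  finally show ?thesis unfolding par_def by simp
qed

lemma chX_par:
  assumes "k < 4"
  shows "chX k (par k t x y) = vector [t, x, y]"
  unfolding chX_def using affX_par_own[OF assms piv_co_le(2)] affX_par_own[OF assms piv_co_le(3)]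
  by (simp add: hc_values assms)

lemma chX_nth: "chX k p $ 1 = fst p" "chX k p $ 2 = affX (piv k) (co1 k) p" "chX k p $ 3 = affX (piv k) (co2 k) p"
  unfolding chX_def by simp_all

lemma scroll_family_pieces: "scroll_family = (\<Union>k<4. pieceX (piv k))"
proof (intro set_eqI iffI)
  fix p assume p: "p \<in> scroll_family"
  obtain v where v: "snd p = proj_pt 5 v" "\<exists>i\<le>5. v i \<noteq> 0" by (rule proj_points_cases[OF scroll_familyD(2)[OF p]])
  have "on_scroll (fst p) v" using p scroll_family_proj_pt[of "fst p" v] by (simp flip: v(1))
  from on_scroll_pivot[OF this v(2)] obtain k where "k < 4" "v (piv k) \<noteq> 0" by blast
  then have "snd p \<in> affine_piece 5 (piv k)" unfolding v(1) affine_piece_proj_pt using piv_co_le by simp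
  then show "p \<in> (\<Union>k<4. pieceX (piv k))" using p \<open>k < 4\<close> unfolding pieceX_def by blast
qed (auto simp: pieceX_def)

lemma continuous_map_mult:
  fixes f g :: "'a \<Rightarrow> complex"
  shows "continuous_map X euclidean f \<Longrightarrow> continuous_map X euclidean g \<Longrightarrow> continuous_map X euclidean (\<lambda>x. f x * g x)"
  by (simp add: continuous_map_atin tendsto_mult)

lemma continuous_snd_famX: "continuous_map famX (proj_space 5) snd"
  unfolding famX_def by (intro continuous_map_from_subtopology continuous_map_snd)

lemma continuous_fst_famX: "continuous_map famX euclidean fst"
proof -
  have "continuous_map disc_proj (top_of_set (ball 0 1)) fst" by (rule continuous_map_fst)
  then have "continuous_map disc_proj euclidean fst" using continuous_map_in_subtopology by blast
  then show ?thesis unfolding famX_def by (rule continuous_map_from_subtopology)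
qed

lemma openin_pieceX: "openin famX (pieceX m)"
proof -
  have "openin famX {p \<in> topspace famX. snd p \<in> affine_piece 5 m}"
    by (rule openin_continuous_map_preimage[OF continuous_snd_famX openin_affine_piece])
  then show ?thesis by (simp add: pieceX_def)
qed

lemma continuous_affX: "continuous_map (subtopology famX (pieceX m)) euclidean (affX m j)"
proof -
  have "continuous_map (subtopology famX (pieceX m)) (subtopology (proj_space 5) (affine_piece 5 m)) snd"
    unfolding continuous_map_in_subtopology
    by (intro conjI continuous_map_from_subtopology[OF continuous_snd_famX]) (auto simp: pieceX_def)
  from continuous_map_compose[OF this continuous_map_affine_coord, of j]
  show ?thesis by (simp add: o_def affX_def[abs_def])
qed

lemma continuous_par:
  assumes k: "k < 4"
    and c: "continuous_map T euclidean f" "continuous_map T euclidean g" "continuous_map T euclidean h"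
    and f: "\<And>x. x \<in> topspace T \<Longrightarrow> norm (f x) < 1"
  shows "continuous_map T famX (\<lambda>x. par k (f x) (g x) (h x))"
  unfolding famX_def continuous_map_in_subtopology
proof (intro conjI)
  have "continuous_map T euclidean (\<lambda>x. hc k (f x) (g x) (h x) i)" if "i \<le> 5" for i
  proof -
    have "i < 6" using that by simp
    have "\<forall>i<6. continuous_map T euclidean (\<lambda>x. hc k (f x) (g x) (h x) i)"
      unfolding all_less_6 using k_cases[OF k]
      by (elim disjE) (auto simp: hc_def power2_eq_square power3_eq_cube
        intro!: continuous_map_mult continuous_map_add continuous_map_diff c)
    then show ?thesis using \<open>i < 6\<close> by blast
  qed
  moreover have "\<exists>i\<le>5. hc k (f x) (g x) (h x) i \<noteq> 0" for x
    by (rule exI[of _ "piv k"]) (use hc_values(1)[OF k] piv_co_le in simp)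
  ultimately have 1: "continuous_map T (proj_space 5) (\<lambda>x. proj_pt 5 (hc k (f x) (g x) (h x)))"
    by (rule continuous_map_proj_pt)
  have 2: "continuous_map T (top_of_set (ball 0 1)) f"
    unfolding continuous_map_in_subtopology using c(1) f by auto
  show "continuous_map T disc_proj (\<lambda>x. par k (f x) (g x) (h x))"
    unfolding par_def continuous_map_pairwise using 1 2 by (simp add: o_def)
  show "(\<lambda>x. par k (f x) (g x) (h x)) \<in> topspace T \<rightarrow> scroll_family"
    using par_in_own_piece[OF k] f unfolding pieceX_def by blast
qed

lemma chX_image: "k < 4 \<Longrightarrow> chX k ` pieceX (piv k) = disc3"
proof (intro set_eqI iffI)
  fix z assume "k < 4" "z \<in> chX k ` pieceX (piv k)"
  then show "z \<in> disc3" using scroll_familyD(1) by (auto simp: disc3_def chX_nth pieceX_def)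
next
  fix z assume k: "k < 4" and z: "z \<in> disc3"
  have "chX k (par k (z$1) (z$2) (z$3)) = z"
    unfolding chX_par[OF k] by (simp add: vec_eq_iff forall_3)
  moreover have "par k (z$1) (z$2) (z$3) \<in> pieceX (piv k)"
    by (rule par_in_own_piece[OF k]) (use z in \<open>simp add: disc3_def\<close>)
  ultimately show "z \<in> chX k ` pieceX (piv k)" by (metis imageI)
qed

lemma chX_inverse:
  assumes k: "k < 4"
  shows "p \<in> pieceX (piv k) \<Longrightarrow> par k (chX k p $ 1) (chX k p $ 2) (chX k p $ 3) = p"
    "chX k (par k (z$1) (z$2) (z$3)) = z"
    "inj_on (chX k) (pieceX (piv k))"
    "z \<in> disc3 \<Longrightarrow> inv_into (pieceX (piv k)) (chX k) z = par k (z$1) (z$2) (z$3)"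
proof -
  show 1: "par k (chX k p $ 1) (chX k p $ 2) (chX k p $ 3) = p" if "p \<in> pieceX (piv k)" for p
    unfolding chX_nth by (rule par_affX[OF k that])
  show 2: "chX k (par k (z$1) (z$2) (z$3)) = z" for z
    unfolding chX_par[OF k] by (simp add: vec_eq_iff forall_3)
  show 3: "inj_on (chX k) (pieceX (piv k))"
    by (rule inj_on_inverseI[of _ "\<lambda>z. par k (z$1) (z$2) (z$3)"]) (rule 1)
  assume "z \<in> disc3"
  then have "par k (z$1) (z$2) (z$3) \<in> pieceX (piv k)" by (intro par_in_own_piece[OF k]) (simp add: disc3_def)
  from inv_into_f_f[OF 3 this] show "inv_into (pieceX (piv k)) (chX k) z = par k (z$1) (z$2) (z$3)"
    unfolding 2 .
qed

lemma atlasX_chart: "k < 4 \<Longrightarrow> (pieceX (piv k), chX k) \<in> atlasX"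
  unfolding atlasX_def by blast

lemma chart_atlasX: "chart_atlas famX atlasX"
  unfolding chart_atlas_def
proof (intro conjI ballI)
  have "fst ` atlasX = (\<lambda>k. pieceX (piv k)) ` {..<4}" unfolding atlasX_def by force
  then show "\<Union>(fst ` atlasX) = topspace famX" using scroll_family_pieces by simp
  fix x assume "x \<in> atlasX"
  then obtain k where k: "k < 4" and x: "x = (pieceX (piv k), chX k)" unfolding atlasX_def by blast
  have "homeomorphic_maps (subtopology famX (pieceX (piv k))) (top_of_set disc3) (chX k) (\<lambda>z. par k (z$1) (z$2) (z$3))"
    unfolding homeomorphic_maps_def
  proof (intro conjI ballI)
    have "continuous_map (subtopology famX (pieceX (piv k))) euclidean (chX k)"
    proof (rule continuous_map_vec)
      fix j :: 3
      show "continuous_map (subtopology famX (pieceX (piv k))) euclidean (\<lambda>x. chX k x $ j)"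
        using exhaust_3[of j] continuous_map_from_subtopology[OF continuous_fst_famX]
        by (elim disjE) (simp_all add: chX_nth continuous_affX)
    qed
    then show "continuous_map (subtopology famX (pieceX (piv k))) (top_of_set disc3) (chX k)"
      unfolding continuous_map_in_subtopology using chX_image[OF k] by auto
    have "continuous_map (top_of_set disc3) famX (\<lambda>z. par k (z$1) (z$2) (z$3))"
      by (rule continuous_par[OF k]) (auto simp: disc3_def intro!: continuous_intros)
    then show "continuous_map (top_of_set disc3) (subtopology famX (pieceX (piv k))) (\<lambda>z. par k (z$1) (z$2) (z$3))"
      unfolding continuous_map_in_subtopology using par_in_own_piece[OF k] by (auto simp: disc3_def)
  qed (use chX_inverse[OF k] in auto)
  then have "homeomorphic_map (subtopology famX (pieceX (piv k))) (top_of_set disc3) (chX k)"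
    by (rule homeomorphic_maps_imp_map)
  then show "case x of (U, c) \<Rightarrow> openin famX U \<and> open (c ` U) \<and>
      homeomorphic_map (subtopology famX U) (top_of_set (c ` U)) c"
    unfolding x prod.case chX_image[OF k] using openin_pieceX open_disc3 by blast
qed

text \<open>
  Pull back a countable base of the coordinate space under each chart.
\<close>

lemma second_countable_chart_atlas:
  fixes A :: "('a, 'n::finite) atlas"
  assumes A: "chart_atlas X A" and cA: "countable A"
  shows "second_countable X"
proof -
  obtain \<B> :: "(complex^'n) set set" where B: "countable \<B>" "\<And>C. C \<in> \<B> \<Longrightarrow> open C"
    "\<And>S. open S \<Longrightarrow> \<exists>U. U \<subseteq> \<B> \<and> S = \<Union>U"
    by (rule univ_second_countable) (rule that)
  define \<C> where "\<C> = (\<lambda>((U,c),C). {x\<in>U. c x \<in> C}) ` (A \<times> \<B>)"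
  have "countable \<C>" unfolding \<C>_def using cA B(1) by blast
  moreover have "openin X V" if VC: "V \<in> \<C>" for V
  proof -
    obtain U c C where V: "(U,c) \<in> A" "C \<in> \<B>" "V = {x\<in>U. c x \<in> C}" using VC unfolding \<C>_def by auto
    note ch = chart_atlasD[OF A V(1)]
    have "openin (subtopology X U) {x \<in> topspace (subtopology X U). c x \<in> c ` U \<inter> C}"
      by (rule openin_continuous_map_preimage[OF homeomorphic_imp_continuous_map[OF ch(3)]
            openin_open_Int[OF B(2)[OF V(2)]]])
    moreover have "{x \<in> topspace (subtopology X U). c x \<in> c ` U \<inter> C} = V" using V(3) ch(5) by auto
    ultimately show ?thesis using openin_trans_full ch(1) by simp
  qed
  moreover have "\<exists>V\<in>\<C>. x \<in> V \<and> V \<subseteq> O'" if Ox: "openin X O'" "x \<in> O'" for O' x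
  proof -
    have "x \<in> topspace X" using openin_subset[OF Ox(1)] Ox(2) by blast
    then obtain U c where Uc: "(U,c) \<in> A" "x \<in> U" by (rule chart_atlas_cover[OF A])
    note ch = chart_atlasD[OF A Uc(1)]
    have "open (c ` (U \<inter> O'))" by (rule chart_open_image[OF A Uc(1) Ox(1)])
    from B(3)[OF this] obtain \<U> where \<U>: "\<U> \<subseteq> \<B>" "c ` (U \<inter> O') = \<Union>\<U>" by blast
    have "c x \<in> \<Union>\<U>" using Ox Uc unfolding \<U>(2)[symmetric] by blast
    then obtain C where C: "C \<in> \<U>" "c x \<in> C" by blast
    have "{x\<in>U. c x \<in> C} \<subseteq> O'"
    proof
      fix y assume y: "y \<in> {x\<in>U. c x \<in> C}"
      then have "c y \<in> C" by simp
      then have "c y \<in> \<Union>\<U>" using C(1) by (rule UnionI[rotated])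
      then have "c y \<in> c ` (U \<inter> O')" unfolding \<U>(2) .
      then have "y \<in> U \<inter> O'" using inj_on_image_mem_iff[OF ch(4), of y "U \<inter> O'"] y by simp
      then show "y \<in> O'" by blast
    qed
    moreover have "{x\<in>U. c x \<in> C} \<in> \<C>"
      unfolding \<C>_def by (rule image_eqI[of _ _ "((U,c),C)"]) (use Uc(1) C(1) \<U>(1) in auto)
    ultimately show ?thesis using C(2) Uc(2) by (intro bexI[of _ "{x\<in>U. c x \<in> C}"]) auto
  qed
  ultimately show ?thesis unfolding second_countable_def by blast
qed

lemma mv_holomorphic_hc:
  assumes "k < 4" "i \<le> 5" "mv_holomorphic_on f W" "mv_holomorphic_on g W" "mv_holomorphic_on h W"
  shows "mv_holomorphic_on (\<lambda>z. hc k (f z) (g z) (h z) i) W"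
proof -
  have W: "open W" by (rule mv_holomorphic_on_open[OF assms(3)])
  have "\<forall>i\<le>5. mv_holomorphic_on (\<lambda>z. hc k (f z) (g z) (h z) i) W"
    unfolding all_le_5 using k_cases[OF assms(1)]
    by (elim disjE) (auto simp: hc_def intro!: mv_holomorphic_on_add mv_holomorphic_on_mult
       mv_holomorphic_on_diff mv_holomorphic_on_power mv_holomorphic_on_const W assms(3-5))
  then show ?thesis using assms(2) by blast
qed

lemma holomorphic_fun_fst: "openin famX W \<Longrightarrow> holomorphic_fun famX atlasX W fst"
  unfolding holomorphic_fun_def
proof (intro conjI ballI)
  fix x assume W: "openin famX W" and xA: "x \<in> atlasX"
  then obtain k where k: "k < 4" and x: "x = (pieceX (piv k), chX k)" unfolding atlasX_def by blast
  have o: "open (chX k ` (pieceX (piv k) \<inter> W))"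
    by (rule chart_open_image[OF chart_atlasX xA[unfolded x] W])
  have "mv_holomorphic_on (\<lambda>z. fst (inv_into (pieceX (piv k)) (chX k) z)) (chX k ` (pieceX (piv k) \<inter> W))"
  proof (rule mv_holomorphic_on_transform[OF mv_holomorphic_on_coord[OF o, of 1]])
    fix z assume "z \<in> chX k ` (pieceX (piv k) \<inter> W)"
    then have "z \<in> disc3" using chX_image[OF k] by blast
    then show "z $ 1 = fst (inv_into (pieceX (piv k)) (chX k) z)" by (simp add: chX_inverse(4)[OF k])
  qed
  then show "case x of (U, c) \<Rightarrow> mv_holomorphic_on (\<lambda>z. fst (inv_into U c z)) (c ` (U \<inter> W))"
    unfolding x by simp
qed

text \<open>
  In chart \<open>k\<close> the function is a quotient of the polynomials \<open>hc k\<close>.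
\<close>

lemma holomorphic_affX:
  assumes "j \<le> 5"
  shows "holomorphic_fun famX atlasX (pieceX m) (affX m j)"
  unfolding holomorphic_fun_def
proof (intro conjI ballI, rule openin_pieceX)
  fix x assume xA: "x \<in> atlasX"
  then obtain k where k: "k < 4" and x: "x = (pieceX (piv k), chX k)" unfolding atlasX_def by blast
  let ?W = "chX k ` (pieceX (piv k) \<inter> pieceX m)"
  have o: "open ?W"
    by (rule chart_open_image[OF chart_atlasX xA[unfolded x] openin_pieceX])
  have D: "z \<in> disc3" "m \<le> 5 \<and> hc k (z$1) (z$2) (z$3) m \<noteq> 0" if z: "z \<in> ?W" for z
  proof -
    from z obtain p where p: "z = chX k p" "p \<in> pieceX (piv k) \<inter> pieceX m" by (rule imageE)
    show zd: "z \<in> disc3" using p chX_image[OF k] by blast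
    have "par k (z$1) (z$2) (z$3) = p" unfolding p(1) by (rule chX_inverse(1)[OF k]) (use p(2) in blast)
    then have "par k (z$1) (z$2) (z$3) \<in> pieceX m" using p(2) by simp
    then show "m \<le> 5 \<and> hc k (z$1) (z$2) (z$3) m \<noteq> 0"
      using par_in_pieceX[OF k, of "z$1"] zd unfolding disc3_def by simp
  qed
  have "mv_holomorphic_on (\<lambda>z. affX m j (inv_into (pieceX (piv k)) (chX k) z)) ?W"
  proof (cases "?W = {}")
    case True then show ?thesis by (simp add: mv_holomorphic_on_def)
  next
    case False
    then have m: "m \<le> 5" using D(2) by blast
    have "mv_holomorphic_on (\<lambda>z. hc k (z$1) (z$2) (z$3) j / hc k (z$1) (z$2) (z$3) m) ?W"
      by (rule mv_holomorphic_on_divide; (rule mv_holomorphic_hc[OF k], fact)?)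
        (intro mv_holomorphic_on_coord o | use D(2) in blast)+
    then show ?thesis
    proof (rule mv_holomorphic_on_transform)
      fix z assume z: "z \<in> ?W"
      show "hc k (z$1) (z$2) (z$3) j / hc k (z$1) (z$2) (z$3) m = affX m j (inv_into (pieceX (piv k)) (chX k) z)"
        unfolding chX_inverse(4)[OF k D(1)[OF z]] using affX_par[OF k m _ assms] D(2)[OF z] by simp
    qed
  qed
  then show "case x of (U, c) \<Rightarrow> mv_holomorphic_on (\<lambda>z. affX m j (inv_into U c z)) (c ` (U \<inter> pieceX m))"
    unfolding x by simp
qed

lemma holomorphic_chX: "holomorphic_fun famX atlasX (pieceX (piv k)) (\<lambda>p. chX k p $ j)"
  using exhaust_3[of j] holomorphic_affX[OF piv_co_le(2)] holomorphic_affX[OF piv_co_le(3)]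
    holomorphic_fun_fst[OF openin_pieceX]
  by (elim disjE) (simp_all add: chX_nth)

lemma complex_manifold_famX: "complex_manifold famX atlasX"
  unfolding complex_manifold_def
proof (intro conjI)
  have "Hausdorff_space disc_proj"
    using Hausdorff_proj_space by (simp add: Hausdorff_space_prod_topology Hausdorff_space_subtopology)
  then show "Hausdorff_space famX" unfolding famX_def by (rule Hausdorff_space_subtopology)
  have "atlasX \<subseteq> (\<lambda>k. (pieceX (piv k), chX k)) ` {..<4}" unfolding atlasX_def by auto
  then have "finite atlasX" by (rule finite_subset) (rule finite_imageI, rule finite_lessThan)
  then have "countable atlasX" by (rule countable_finite)
  then show "second_countable famX" by (rule second_countable_chart_atlas[OF chart_atlasX])
  show "\<Union>(fst ` atlasX) = topspace famX"
    by (rule chart_atlasX[unfolded chart_atlas_def, THEN conjunct1])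
  show "\<forall>(U,c)\<in>atlasX. openin famX U \<and> open (c ` U) \<and> homeomorphic_map (subtopology famX U) (top_of_set (c ` U)) c"
    by (rule chart_atlasX[unfolded chart_atlas_def, THEN conjunct2])
  show "\<forall>(U,c)\<in>atlasX. \<forall>(V,d)\<in>atlasX. \<forall>j. mv_holomorphic_on (\<lambda>z. d (inv_into U c z) $ j) (c ` (U \<inter> V))"
  proof (rule ballI)
    fix x assume x: "x \<in> atlasX"
    obtain U c where Uc: "x = (U,c)" by (cases x)
    have "mv_holomorphic_on (\<lambda>z. d (inv_into U c z) $ j) (c ` (U \<inter> V))" if Vd: "(V,d) \<in> atlasX" for V d j
    proof -
      obtain l where l: "V = pieceX (piv l)" "d = chX l" using Vd unfolding atlasX_def by blast
      show ?thesis
        using bspec[OF holomorphic_chX[of l j, unfolded holomorphic_fun_def, THEN conjunct2] x]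
        unfolding Uc prod.case l .
    qed
    then show "case x of (U,c) \<Rightarrow> \<forall>(V,d)\<in>atlasX.
       \<forall>j. mv_holomorphic_on (\<lambda>z. d (inv_into U c z) $ j) (c ` (U \<inter> V))"
      unfolding Uc prod.case by (intro ballI) (auto simp: split_beta)
  qed
qed

text \<open>
  The source of all charts of fibres and curves below, by specialization of the three arguments.
\<close>

lemma hol_param_par:
  assumes k: "k < 4" and hol: "mv_holomorphic_on f \<Omega>" "mv_holomorphic_on g \<Omega>" "mv_holomorphic_on h \<Omega>"
    and f: "\<And>z. z \<in> \<Omega> \<Longrightarrow> norm (f z) < 1"
  shows "hol_param famX atlasX \<Omega> (\<lambda>z. par k (f z) (g z) (h z))"
proof -
  let ?\<psi> = "\<lambda>z. par k (f z) (g z) (h z)"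
  have \<Omega>: "open \<Omega>" by (rule mv_holomorphic_on_open[OF hol(1)])
  have cont: "continuous_map (top_of_set \<Omega>) famX ?\<psi>"
    by (rule continuous_par[OF k]) (use hol f in \<open>auto intro: mv_holomorphic_on_imp_continuous_on\<close>)
  have "mv_holomorphic_on (\<lambda>z. chX l (?\<psi> z) $ j) {z\<in>\<Omega>. ?\<psi> z \<in> pieceX (piv l)}" if l: "l < 4" for l j
  proof -
    let ?N = "{z\<in>\<Omega>. ?\<psi> z \<in> pieceX (piv l)}"
    have N: "open ?N"
    proof -
      have "openin (top_of_set \<Omega>) {z\<in>topspace (top_of_set \<Omega>). ?\<psi> z \<in> pieceX (piv l)}"
        by (rule openin_continuous_map_preimage[OF cont openin_pieceX])
      then show ?thesis using \<Omega> by (simp add: openin_open_eq)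
    qed
    have nz: "hc k (f z) (g z) (h z) (piv l) \<noteq> 0" if "z \<in> ?N" for z
      using that par_in_pieceX[OF k f, of z] by simp
    have sub: "mv_holomorphic_on f ?N" "mv_holomorphic_on g ?N" "mv_holomorphic_on h ?N"
      by (rule mv_holomorphic_on_subset[OF _ N], rule hol, blast)+
    have q: "mv_holomorphic_on (\<lambda>z. affX (piv l) i (?\<psi> z)) ?N" if i: "i \<le> 5" for i
    proof (rule mv_holomorphic_on_transform)
      show "mv_holomorphic_on (\<lambda>z. hc k (f z) (g z) (h z) i / hc k (f z) (g z) (h z) (piv l)) ?N"
        by (rule mv_holomorphic_on_divide[OF mv_holomorphic_hc[OF k i sub]
              mv_holomorphic_hc[OF k piv_co_le(1) sub]]) (rule nz)
      show "hc k (f z) (g z) (h z) i / hc k (f z) (g z) (h z) (piv l) = affX (piv l) i (?\<psi> z)" if "z \<in> ?N" for z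
        using affX_par[OF k piv_co_le(1) nz[OF that] i] by simp
    qed
    show ?thesis
      using exhaust_3[of j] q[OF piv_co_le(2)] q[OF piv_co_le(3)] sub(1)
      by (elim disjE) (simp_all add: chX_nth)
  qed
  then show ?thesis
    unfolding hol_param_def atlasX_def using \<Omega> cont by blast
qed

section \<open>The projection to the disc\<close>

lemma chart_deriv_eq:
  assumes A: "chart_atlas X A" and Uc: "(U,c) \<in> A" and p: "p \<in> U"
    and W: "openin X W" "p \<in> W" and eq: "\<And>z. z \<in> c ` (U \<inter> W) \<Longrightarrow> f (inv_into U c z) = g z"
    and g: "(g has_derivative D) (at (c p))"
  shows "chart_deriv U c f p v = D v"
proof -
  have "((\<lambda>z. f (inv_into U c z)) has_derivative D) (at (c p))"
  proof (rule has_derivative_transform_within_open[OF g])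
    show "open (c ` (U \<inter> W))" by (rule chart_open_image[OF A Uc W(1)])
    show "c p \<in> c ` (U \<inter> W)" using p W(2) by blast
    show "g z = f (inv_into U c z)" if "z \<in> c ` (U \<inter> W)" for z
      by (rule eq[OF that, symmetric])
  qed
  from frechet_derivative_at[OF this] show ?thesis unfolding chart_deriv_def by simp
qed

lemma holomorphic_fun_chart_derivative:
  assumes A: "chart_atlas X A" and Uc: "(U,c) \<in> A" and p: "p \<in> U" "p \<in> W" and f: "holomorphic_fun X A W f"
  shows "((\<lambda>z. f (inv_into U c z)) has_derivative chart_deriv U c f p) (at (c p))"
proof -
  have "mv_holomorphic_on (\<lambda>z. f (inv_into U c z)) (c ` (U \<inter> W))"
    using bspec[OF f[unfolded holomorphic_fun_def, THEN conjunct2] Uc] by simp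
  moreover have "c p \<in> c ` (U \<inter> W)" using p by blast
  ultimately obtain D where D: "((\<lambda>z. f (inv_into U c z)) has_derivative D) (at (c p))"
    by (rule mv_holomorphic_onD)
  from frechet_derivative_at[OF D] D show ?thesis unfolding chart_deriv_def[abs_def] by simp
qed

text \<open>
  Quotient rule.
\<close>

lemma chart_deriv_divide_zero:
  assumes A: "chart_atlas X A" and Uc: "(U,c) \<in> A" and p: "p \<in> U" "p \<in> W"
    and f: "holomorphic_fun X A W f" "chart_deriv U c f p v = 0"
    and g: "holomorphic_fun X A W g" "chart_deriv U c g p v = 0" "g p \<noteq> 0"
    and q: "\<And>x. x \<in> W \<Longrightarrow> q x = f x / g x"
  shows "chart_deriv U c q p v = 0"
proof -
  note ch = chart_atlasD[OF A Uc]
  have ip: "inv_into U c (c p) = p" using ch(4) p(1) by simp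
  let ?f = "\<lambda>z. f (inv_into U c z)" and ?g = "\<lambda>z. g (inv_into U c z)"
  note df = holomorphic_fun_chart_derivative[OF A Uc p f(1)]
  note dg = holomorphic_fun_chart_derivative[OF A Uc p g(1)]
  have gn: "?g (c p) \<noteq> 0" unfolding ip by (rule g(3))
  have q': "q (inv_into U c z) = ?f z / ?g z" if "z \<in> c ` (U \<inter> W)" for z
  proof -
    from that obtain x where x: "z = c x" "x \<in> U \<inter> W" by (rule imageE)
    then have "inv_into U c z = x" using ch(4) by simp
    then show ?thesis using q x(2) by simp
  qed
  have "((\<lambda>z. ?f z / ?g z) has_derivative
      (\<lambda>h. (chart_deriv U c f p h * ?g (c p) - ?f (c p) * chart_deriv U c g p h) / (?g (c p) * ?g (c p)))) (at (c p))"
    by (rule has_derivative_divide'[OF df dg gn])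
  from chart_deriv_eq[OF A Uc p(1) holomorphic_fun_openin[OF f(1)] p(2) q' this]
  have "chart_deriv U c q p v = (chart_deriv U c f p v * ?g (c p) - ?f (c p) * chart_deriv U c g p v) / (?g (c p) * ?g (c p))" .
  then show ?thesis using f(2) g(2) by simp
qed

lemma continuous_map_If:
  "continuous_map T Y f \<Longrightarrow> continuous_map T Y g \<Longrightarrow> continuous_map T Y (\<lambda>x. if b then f x else g x)"
  by (cases b) simp_all

text \<open>
  The equations are homogeneous and have no meaning as functions on projective space, so they are
  expressed by affine coordinates on each affine piece.
\<close>

lemma closedin_scroll_family: "closedin disc_proj scroll_family"
proof -
  let ?Y = "\<lambda>m. {p \<in> topspace disc_proj. snd p \<in> affine_piece 5 m}"
  have oY: "openin disc_proj (?Y m)" for m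
    by (rule openin_continuous_map_preimage[OF continuous_map_snd openin_affine_piece])
  have caff: "continuous_map (subtopology disc_proj (?Y m)) euclidean (affX m j)" for m j
  proof -
    have "continuous_map (subtopology disc_proj (?Y m)) (subtopology (proj_space 5) (affine_piece 5 m)) snd"
      unfolding continuous_map_in_subtopology
      by (intro conjI continuous_map_from_subtopology[OF continuous_map_snd]) auto
    from continuous_map_compose[OF this continuous_map_affine_coord, of j]
    show ?thesis by (simp add: o_def affX_def[abs_def])
  qed
  have cfst: "continuous_map (subtopology disc_proj (?Y m)) euclidean fst" for m
  proof -
    have "continuous_map disc_proj (top_of_set (ball 0 1)) fst" by (rule continuous_map_fst)
    then have "continuous_map disc_proj euclidean fst" using continuous_map_in_subtopology by blast
    then show ?thesis by (rule continuous_map_from_subtopology)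
  qed
  have cmin: "continuous_map (subtopology disc_proj (?Y m)) euclidean (\<lambda>p. minors e (fst p) (\<lambda>j. affX m j p))" for m e
    unfolding minors_def
    by (intro continuous_map_If continuous_map_mult continuous_map_add continuous_map_diff caff cfst)
  have o: "openin disc_proj {p \<in> ?Y m. minors e (fst p) (\<lambda>j. affX m j p) \<in> - {0}}" for m e
  proof -
    have "openin (subtopology disc_proj (?Y m))
       {p \<in> topspace (subtopology disc_proj (?Y m)). minors e (fst p) (\<lambda>j. affX m j p) \<in> - {0}}"
      by (rule openin_continuous_map_preimage[OF cmin]) (rule open_openin[THEN iffD1], simp add: open_Compl)
    then have "openin disc_proj {p \<in> topspace (subtopology disc_proj (?Y m)). minors e (fst p) (\<lambda>j. affX m j p) \<in> - {0}}"
      using oY by (rule openin_trans_full)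
    moreover have "topspace (subtopology disc_proj (?Y m)) = ?Y m" by auto
    ultimately show ?thesis by simp
  qed
  have "topspace disc_proj - scroll_family = (\<Union>m\<in>{..5}. \<Union>e\<in>{..<6}. {p \<in> ?Y m. minors e (fst p) (\<lambda>j. affX m j p) \<in> - {0}})"
  proof (intro set_eqI iffI)
    fix p assume p: "p \<in> topspace disc_proj - scroll_family"
    then have P: "snd p \<in> proj_points 5" "norm (fst p) < 1" by auto
    then obtain m where m: "m \<le> 5" "snd p \<in> affine_piece 5 m" unfolding proj_points_pieces by blast
    have eq: "p = (fst p, proj_pt 5 (\<lambda>j. affX m j p))"
      unfolding affX_def using affine_pieceD(1)[OF m(2)] by (simp add: prod_eq_iff)
    have "affX m m p \<noteq> 0" unfolding affX_def using affine_pieceD(2)[OF m(2)] by simp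
    then have "\<not> on_scroll (fst p) (\<lambda>j. affX m j p)"
      using p P m(1) eq scroll_family_proj_pt[of "fst p" "\<lambda>j. affX m j p"] by auto
    then obtain e where "e < 6" "minors e (fst p) (\<lambda>j. affX m j p) \<noteq> 0" unfolding on_scroll_def by blast
    then show "p \<in> (\<Union>m\<in>{..5}. \<Union>e\<in>{..<6}. {p \<in> ?Y m. minors e (fst p) (\<lambda>j. affX m j p) \<in> - {0}})"
      using p m by (intro UN_I[of m] UN_I[of e]) auto
  next
    fix p assume "p \<in> (\<Union>m\<in>{..5}. \<Union>e\<in>{..<6}. {p \<in> ?Y m. minors e (fst p) (\<lambda>j. affX m j p) \<in> - {0}})"
    then obtain m e where me: "m \<le> 5" "e < 6" "p \<in> ?Y m" "minors e (fst p) (\<lambda>j. affX m j p) \<noteq> 0" by blast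
    have "p \<notin> scroll_family"
    proof
      assume "p \<in> scroll_family"
      from scroll_familyD(3)[OF this, of m] me show False unfolding on_scroll_def affX_def by blast
    qed
    then show "p \<in> topspace disc_proj - scroll_family" using me(3) by blast
  qed
  moreover have "openin disc_proj (\<Union>m\<in>{..5}. \<Union>e\<in>{..<6}. {p \<in> ?Y m. minors e (fst p) (\<lambda>j. affX m j p) \<in> - {0}})"
    by (intro openin_Union) (use o in auto)
  moreover have "scroll_family \<subseteq> topspace disc_proj" using scroll_familyD(1,2) by auto
  ultimately show ?thesis unfolding closedin_def by (simp only:)
qed

lemma affX_fun: "affX i j = (\<lambda>x. affine_coord i j (snd x))"
  by (rule ext) (simp add: affX_def)

lemma pieceX_iff:
  assumes "p \<in> pieceX i"
  shows "p \<in> pieceX m \<longleftrightarrow> m \<le> 5 \<and> affX i m p \<noteq> 0"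
  using assms affine_piece_iff[of "snd p" 5 i m] unfolding pieceX_def affX_def by blast

lemma affX_change:
  assumes "p \<in> pieceX i" "p \<in> pieceX m" "j \<le> 5"
  shows "affX m j p = affX i j p / affX i m p"
  using assms affine_coord_change[of "snd p" 5 i m j] unfolding pieceX_def affX_def by blast

text \<open>Coordinates \<open>v\<^sub>j / v\<^sub>m\<close> are quotients of the \<open>v\<^sub>j / v\<^sub>i\<close>; a direction in which all of the latter
  are stationary is one in which the former are.\<close>

lemma chart_deriv_affX_change:
  assumes A: "chart_atlas X A" and Uc: "(U,c) \<in> A" and p: "p \<in> U" "p \<in> W" and W: "W \<subseteq> pieceX i \<inter> pieceX m"
    and hol: "\<And>j. j \<le> 5 \<Longrightarrow> holomorphic_fun X A W (affX i j)"
    and z: "\<And>j. j \<le> 5 \<Longrightarrow> chart_deriv U c (affX i j) p v = 0" and j: "j \<le> 5"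
  shows "chart_deriv U c (affX m j) p v = 0"
proof -
  have pi: "p \<in> pieceX i" "p \<in> pieceX m" using p(2) W by auto
  have m: "m \<le> 5" "affX i m p \<noteq> 0" using pieceX_iff[OF pi(1), of m] pi(2) by auto
  show ?thesis
    by (rule chart_deriv_divide_zero[OF A Uc p hol[OF j] z[OF j] hol[OF m(1)] z[OF m(1)] m(2)])
      (rule affX_change, use W j in auto)
qed

lemma meromorphic_famX: "meromorphic_to_proj famX atlasX {} 5 snd"
  unfolding meromorphic_to_proj_def topspace_famX
proof
  fix p assume "p \<in> scroll_family"
  then obtain k where k: "k < 4" "p \<in> pieceX (piv k)" unfolding scroll_family_pieces by blast
  have "(\<exists>i\<le>5. affX (piv k) i x \<noteq> 0) \<and> snd x = proj_pt 5 (\<lambda>i. affX (piv k) i x)"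
    if "x \<in> pieceX (piv k)" for x
  proof -
    have x: "snd x \<in> affine_piece 5 (piv k)" using that unfolding pieceX_def by simp
    show ?thesis unfolding affX_def
      using affine_pieceD(1)[OF x] by (intro conjI exI[of _ "piv k"]) (simp_all add: affine_pieceD(2)[OF x] piv_co_le)
  qed
  then show "\<exists>W f. p \<in> W \<and> openin famX W \<and> (\<forall>i\<le>5. holomorphic_fun famX atlasX W (f i)) \<and>
      (\<forall>x\<in>W - {}. (\<exists>i\<le>5. f i x \<noteq> 0) \<and> snd x = proj_pt 5 (\<lambda>i. f i x))"
    by (intro exI[of _ "pieceX (piv k)"] exI[of _ "affX (piv k)"])
      (simp add: k(2) openin_pieceX holomorphic_affX)
qed

lemma chart_deriv_chX:
  assumes k: "k < 4" and p: "p \<in> pieceX (piv k)"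
  shows "chart_deriv (pieceX (piv k)) (chX k) fst p v = v $ 1"
    "chart_deriv (pieceX (piv k)) (chX k) (affX (piv k) (co1 k)) p v = v $ 2"
    "chart_deriv (pieceX (piv k)) (chX k) (affX (piv k) (co2 k)) p v = v $ 3"
proof -
  have d: "((\<lambda>z :: complex^3. z $ j) has_derivative (\<lambda>v. v $ j)) (at (chX k p))" for j
    by (rule bounded_linear_imp_has_derivative[OF bounded_linear_vec_nth])
  note * = chart_deriv_eq[OF chart_atlasX atlasX_chart[OF k] p openin_pieceX p _ d]
  have in3: "z \<in> disc3" if "z \<in> chX k ` (pieceX (piv k) \<inter> pieceX (piv k))" for z
    using that chX_image[OF k] by simp
  show "chart_deriv (pieceX (piv k)) (chX k) fst p v = v $ 1"
    by (rule *) (simp add: chX_inverse(4)[OF k in3])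
  show "chart_deriv (pieceX (piv k)) (chX k) (affX (piv k) (co1 k)) p v = v $ 2"
    by (rule *) (simp add: chX_inverse(4)[OF k in3] affX_par_own[OF k] piv_co_le hc_values[OF k])
  show "chart_deriv (pieceX (piv k)) (chX k) (affX (piv k) (co2 k)) p v = v $ 3"
    by (rule *) (simp add: chX_inverse(4)[OF k in3] affX_par_own[OF k] piv_co_le hc_values[OF k])
qed

text \<open>
  The inclusion is an embedding by construction. Its differential is injective because the coordinates
  of a chart are themselves among the \<open>t\<close> and \<open>v\<^sub>j / v\<^sub>m\<close>.
\<close>

lemma projective_embedding_famX: "projective_embedding famX atlasX (ball 0 1) fst 5 snd"
  unfolding projective_embedding_def
proof (intro conjI)
  show "holomorphic_fun famX atlasX (topspace famX) fst" by (rule holomorphic_fun_fst[OF openin_topspace])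
  show "meromorphic_to_proj famX atlasX {} 5 snd" by (rule meromorphic_famX)
  have id: "(\<lambda>x. (fst x, snd x)) = (id :: complex \<times> hpoint \<Rightarrow> complex \<times> hpoint)" by (simp add: fun_eq_iff)
  show "embedding_map famX disc_proj (\<lambda>x. (fst x, snd x))"
  proof -
    have "subtopology disc_proj (id ` topspace famX) = famX"
      unfolding image_id id_apply topspace_famX by (rule famX_def[symmetric])
    then show ?thesis unfolding id embedding_map_def homeomorphic_map_id .
  qed
  show "closedin disc_proj ((\<lambda>x. (fst x, snd x)) ` topspace famX)"
    unfolding id image_id id_apply topspace_famX by (rule closedin_scroll_family)
  have "\<exists>j\<le>5. chart_deriv (pieceX (piv k)) (chX k) (\<lambda>x. affine_coord i j (snd x)) p v \<noteq> 0"
    if k: "k < 4" and p: "p \<in> pieceX (piv k)" and i: "i \<le> 5" "snd p \<in> affine_piece 5 i" and v: "v \<noteq> 0"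
      and d0: "chart_deriv (pieceX (piv k)) (chX k) fst p v = 0" for k p i v
  proof (rule ccontr)
    assume "\<not> ?thesis"
    then have "\<forall>j\<le>5. chart_deriv (pieceX (piv k)) (chX k) (affX i j) p v = 0"
      unfolding affX_fun by simp
    then have z: "chart_deriv (pieceX (piv k)) (chX k) (affX i j) p v = 0" if "j \<le> 5" for j
      using that by simp
    have pi: "p \<in> pieceX i" using p i(2) unfolding pieceX_def by simp
    let ?W = "pieceX i \<inter> pieceX (piv k)"
    have oW: "openin famX ?W" by (intro openin_Int openin_pieceX)
    have hol: "holomorphic_fun famX atlasX ?W (affX i j)" if "j \<le> 5" for j
      by (rule holomorphic_fun_subset[OF chart_atlasX holomorphic_affX[OF that] oW]) blast
    have pW: "p \<in> ?W" using pi p by blast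
    have zero: "chart_deriv (pieceX (piv k)) (chX k) (affX (piv k) j) p v = 0" if "j \<le> 5" for j
      by (rule chart_deriv_affX_change[OF chart_atlasX atlasX_chart[OF k] p pW subset_refl hol z that])
    have "v $ 1 = 0" using d0 chart_deriv_chX(1)[OF k p] by simp
    moreover have "v $ 2 = 0" using zero[OF piv_co_le(2)[of k]] chart_deriv_chX(2)[OF k p] by simp
    moreover have "v $ 3 = 0" using zero[OF piv_co_le(3)[of k]] chart_deriv_chX(3)[OF k p] by simp
    ultimately have "v = 0" by (simp add: vec_eq_iff forall_3)
    then show False using v by simp
  qed
  then show "\<forall>(U,c)\<in>atlasX. \<forall>p\<in>U. \<forall>i\<le>5. snd p \<in> affine_piece 5 i \<longrightarrow>
        (\<forall>v. v \<noteq> 0 \<longrightarrow> chart_deriv U c fst p v \<noteq> 0 \<or>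
           (\<exists>j\<le>5. chart_deriv U c (\<lambda>x. affine_coord i j (snd x)) p v \<noteq> 0))"
    unfolding atlasX_def by blast
qed

lemma smooth_projective_famX: "smooth_projective_morphism famX atlasX (ball 0 1) fst"
  unfolding smooth_projective_morphism_def
proof (intro conjI)
  show "complex_manifold famX atlasX" by (rule complex_manifold_famX)
  show "holomorphic_fun famX atlasX (topspace famX) fst" by (rule holomorphic_fun_fst[OF openin_topspace])
  show "fst ` topspace famX \<subseteq> ball 0 1" using scroll_familyD(1) by auto
  have "\<exists>v. chart_deriv (pieceX (piv k)) (chX k) fst p v \<noteq> 0" if "k < 4" "p \<in> pieceX (piv k)" for k p
    by (rule exI[of _ "axis 1 1"]) (simp add: chart_deriv_chX[OF that] axis_def)
  then show "\<forall>(U,c)\<in>atlasX. \<forall>p\<in>U. \<exists>v. chart_deriv U c fst p v \<noteq> 0"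
    unfolding atlasX_def by blast
  show "\<exists>N F. projective_embedding famX atlasX (ball 0 1) fst N F"
    by (intro exI) (rule projective_embedding_famX)
qed

section \<open>The fibres\<close>

abbreviation fib :: "complex \<Rightarrow> (complex \<times> hpoint) set" where "fib t \<equiv> fibre famX fst t"
abbreviation fibT :: "complex \<Rightarrow> (complex \<times> hpoint) topology" where "fibT t \<equiv> subtopology famX (fib t)"
abbreviation fibA :: "complex \<Rightarrow> (complex \<times> hpoint, 2) atlas" where "fibA t \<equiv> submanifold_atlas famX atlasX (fib t)"

lemma fib_iff: "p \<in> fib t \<longleftrightarrow> p \<in> scroll_family \<and> fst p = t"
  by (simp add: fibre_def)

lemma topspace_fibT [simp]: "topspace (fibT t) = fib t"
  by (auto simp: fib_iff)

text \<open>
  The charts of the fibres, induced by those of the family.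
\<close>

definition slice_coord :: "nat \<Rightarrow> complex \<times> hpoint \<Rightarrow> complex^2" where
  "slice_coord k p = vector [affX (piv k) (co1 k) p, affX (piv k) (co2 k) p]"

lemma slice_coord_nth: "slice_coord k p $ 1 = affX (piv k) (co1 k) p" "slice_coord k p $ 2 = affX (piv k) (co2 k) p"
  by (simp_all add: slice_coord_def)

lemma slice_coord_par: "k < 4 \<Longrightarrow> slice_coord k (par k t x y) = vector [x, y]"
  using affX_par_own[of k _ t x y] by (simp add: slice_coord_def piv_co_le hc_values)

lemma par_slice_coord: "k < 4 \<Longrightarrow> p \<in> pieceX (piv k) \<inter> fib t \<Longrightarrow> par k t (slice_coord k p $ 1) (slice_coord k p $ 2) = p"
  using par_affX[of k p] by (auto simp: slice_coord_nth fib_iff)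

lemma par_fib: "k < 4 \<Longrightarrow> norm t < 1 \<Longrightarrow> par k t x y \<in> fib t"
  using par_in_own_piece[of k t x y] by (auto simp: fib_iff pieceX_def)

lemma slice_image: "k < 4 \<Longrightarrow> norm t < 1 \<Longrightarrow> (\<lambda>z :: complex^2. par k t (z $ 1) (z $ 2)) ` UNIV = pieceX (piv k) \<inter> fib t"
proof (intro set_eqI iffI)
  fix p assume "k < 4" "norm t < 1" "p \<in> (\<lambda>z :: complex^2. par k t (z $ 1) (z $ 2)) ` UNIV"
  then show "p \<in> pieceX (piv k) \<inter> fib t" using par_in_own_piece par_fib by blast
next
  fix p assume "k < 4" "norm t < 1" "p \<in> pieceX (piv k) \<inter> fib t"
  then show "p \<in> (\<lambda>z :: complex^2. par k t (z $ 1) (z $ 2)) ` UNIV"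
    by (intro image_eqI[of _ _ "slice_coord k p"]) (simp_all only: par_slice_coord UNIV_I)
qed

lemma openin_fib_piece: "openin (fibT t) (pieceX m \<inter> fib t)"
  by (rule openin_subtopology_Int[OF openin_pieceX])

lemma hol_param_slice:
  assumes "k < 4" "norm t < 1"
  shows "hol_param famX atlasX UNIV (\<lambda>z :: complex^2. par k t (z $ 1) (z $ 2))"
  by (rule hol_param_par[OF assms(1)]) (use assms in \<open>simp_all add: mv_holomorphic_on_const mv_holomorphic_on_coord\<close>)

lemma slice_chart:
  assumes "k < 4" "norm t < 1"
  shows "(pieceX (piv k) \<inter> fib t, slice_coord k) \<in> fibA t"
proof (rule submanifold_chartI[OF chart_atlasX hol_param_slice[OF assms] slice_image[OF assms] openin_fib_piece])
  show "slice_coord k (par k t (z $ 1) (z $ 2)) = z" for z :: "complex^2"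
    unfolding slice_coord_par[OF assms(1)] by (simp add: vec_eq_iff forall_2)
  show "holomorphic_fun famX atlasX (pieceX (piv k)) (\<lambda>x. slice_coord k x $ j)" for j
    using exhaust_2[of j] holomorphic_affX[OF piv_co_le(2)] holomorphic_affX[OF piv_co_le(3)]
    by (elim disjE) (simp_all add: slice_coord_nth)
qed blast

lemma slice_inverse:
  assumes "k < 4" "norm t < 1"
  shows "inv_into (pieceX (piv k) \<inter> fib t) (slice_coord k) z = par k t (z $ 1) (z $ 2)"
    "slice_coord k ` (pieceX (piv k) \<inter> fib t) = UNIV"
proof -
  have s: "slice_coord k (par k t (z $ 1) (z $ 2)) = z" for z
    unfolding slice_coord_par[OF assms(1)] by (simp add: vec_eq_iff forall_2)
  have inj: "inj_on (slice_coord k) (pieceX (piv k) \<inter> fib t)"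
    by (rule inj_on_inverseI[of _ "\<lambda>z. par k t (z $ 1) (z $ 2)"]) (rule par_slice_coord[OF assms(1)])
  have m: "par k t (z $ 1) (z $ 2) \<in> pieceX (piv k) \<inter> fib t" for z :: "complex^2"
    using par_in_own_piece par_fib assms by blast
  from inv_into_f_f[OF inj m[of z]] show "inv_into (pieceX (piv k) \<inter> fib t) (slice_coord k) z = par k t (z $ 1) (z $ 2)"
    unfolding s .
  have "z \<in> slice_coord k ` (pieceX (piv k) \<inter> fib t)" for z
    by (rule image_eqI[of z "slice_coord k" "par k t (z $ 1) (z $ 2)", OF s[symmetric] m])
  then show "slice_coord k ` (pieceX (piv k) \<inter> fib t) = UNIV" by blast
qed

lemma fib_cases:
  assumes "p \<in> fib t"
  obtains k where "k < 4" "p \<in> pieceX (piv k) \<inter> fib t"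
proof -
  have "p \<in> (\<Union>k<4. pieceX (piv k))" using assms unfolding fib_iff scroll_family_pieces by blast
  then obtain k where "k < 4" "p \<in> pieceX (piv k)" by blast
  then show thesis using that assms by blast
qed

lemma fibA_cover:
  assumes "norm t < 1"
  shows "\<Union>(fst ` fibA t) = topspace (fibT t)"
  unfolding topspace_fibT
proof (intro set_eqI iffI)
  fix p assume "p \<in> \<Union>(fst ` fibA t)"
  then obtain x where "x \<in> fibA t" "p \<in> fst x" by blast
  then show "p \<in> fib t" using submanifold_chart_param(3)[of "fst x" "snd x" famX atlasX "fib t"] by auto
next
  fix p assume "p \<in> fib t"
  then obtain k where k: "k < 4" "p \<in> pieceX (piv k) \<inter> fib t" by (rule fib_cases)
  show "p \<in> \<Union>(fst ` fibA t)"
    by (rule UnionI[OF imageI[OF slice_chart[OF k(1) assms]]]) (simp only: fst_conv k(2))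
qed

lemma complex_manifold_fib: "norm t < 1 \<Longrightarrow> complex_manifold (fibT t) (fibA t)"
  by (rule complex_manifold_submanifold[OF complex_manifold_famX fibA_cover])

lemma chart_atlas_fib: "norm t < 1 \<Longrightarrow> chart_atlas (fibT t) (fibA t)"
  by (rule complex_manifold_chart_atlas[OF complex_manifold_fib])

lemma holomorphic_affX_fib:
  "j \<le> 5 \<Longrightarrow> holomorphic_fun (fibT t) (fibA t) (pieceX m \<inter> fib t) (affX m j)"
  by (rule holomorphic_fun_restrict[OF chart_atlasX holomorphic_affX])

lemma compact_fib: "compact_space (fibT t)"
proof -
  have "compactin disc_proj (topspace disc_proj \<inter> ({t} \<times> proj_points 5))"
  proof (cases "norm t < 1")
    case True
    have "compactin (top_of_set (ball 0 1)) {t}" using True by (simp add: compactin_subtopology)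
    moreover have "compactin (proj_space 5) (proj_points 5)"
      using compact_space_proj_space[of 5] unfolding compact_space_def by simp
    ultimately have "compactin disc_proj ({t} \<times> proj_points 5)" by (simp add: compactin_Times)
    moreover have "topspace disc_proj \<inter> ({t} \<times> proj_points 5) = {t} \<times> proj_points 5" using True by auto
    ultimately show ?thesis by simp
  next
    case False
    then have "topspace disc_proj \<inter> ({t} \<times> proj_points 5) = {}" by auto
    then show ?thesis by simp
  qed
  then have "compactin disc_proj (scroll_family \<inter> (topspace disc_proj \<inter> ({t} \<times> proj_points 5)))"
    by (rule closed_Int_compactin[OF closedin_scroll_family])
  moreover have "scroll_family \<inter> (topspace disc_proj \<inter> ({t} \<times> proj_points 5)) = fib t"
    using scroll_familyD(1,2) by (auto simp: fib_iff)
  ultimately have "compactin famX (fib t)" unfolding famX_def compactin_subtopology by (auto simp: fib_iff famX_def[symmetric])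
  then show ?thesis by (rule compact_space_subtopology)
qed

lemma Hausdorff_disc_proj: "Hausdorff_space (prod_topology (top_of_set (D :: complex set)) (proj_space N))"
  using Hausdorff_proj_space Hausdorff_space_subtopology[OF Hausdorff_space_euclidean, of D]
  by (simp add: Hausdorff_space_prod_topology)

text \<open>
  The four slices are images of \<open>\<complex>\<^sup>2\<close> and have the point \<open>x = y = 1\<close> of chart 0 in common; here
  \<open>1 + t \<noteq> 0\<close> is used.
\<close>

lemma connected_fib:
  assumes "norm t < 1"
  shows "connected_space (fibT t)"
proof -
  let ?U = "\<lambda>k. pieceX (piv k) \<inter> fib t"
  have con: "connectedin famX (?U k)" if k: "k < 4" for k
  proof -
    have "continuous_map euclidean famX (\<lambda>z :: complex^2. par k t (z $ 1) (z $ 2))"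
      using hol_param_slice[OF k assms] unfolding hol_param_def by simp
    moreover have "connectedin euclidean (UNIV :: (complex^2) set)"
      using convex_connected[OF convex_UNIV] by simp
    ultimately have "connectedin famX ((\<lambda>z :: complex^2. par k t (z $ 1) (z $ 2)) ` UNIV)"
      by (rule connectedin_continuous_map_image)
    then show ?thesis unfolding slice_image[OF k assms] .
  qed
  have t1: "1 + t \<noteq> 0"
  proof
    assume "1 + t = 0"
    then have "t = -1" by (simp add: eq_neg_iff_add_eq_0 add.commute)
    then show False using assms by simp
  qed
  have com: "par 0 t 1 1 \<in> ?U k" if "k < 4" for k
  proof -
    have "hc 0 t 1 1 (piv k) \<noteq> 0"
      using k_cases[OF that] t1 by (elim disjE) (simp_all add: hc_def piv_def)
    then show ?thesis using par_in_pieceX[of 0 t 1 1 "piv k"] par_fib[of 0 t 1 1] assms piv_co_le(1) by simp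
  qed
  have "connectedin famX (\<Union>(?U ` {..<4}))"
  proof (rule connectedin_Union)
    show "connectedin famX S" if "S \<in> ?U ` {..<4}" for S using that con by auto
    have "par 0 t 1 1 \<in> \<Inter>(?U ` {..<4})"
      by (rule INT_I) (rule com, simp only: lessThan_iff)
    then show "\<Inter>(?U ` {..<4}) \<noteq> {}" by blast
  qed
  moreover have "\<Union>(?U ` {..<4}) = fib t"
  proof (intro set_eqI iffI)
    fix p assume "p \<in> \<Union>(?U ` {..<4})"
    then show "p \<in> fib t" by blast
  next
    fix p assume "p \<in> fib t"
    then obtain k where "k < 4" "p \<in> ?U k" by (rule fib_cases)
    then show "p \<in> \<Union>(?U ` {..<4})" by blast
  qed
  ultimately have "connectedin famX (fib t)" by (simp only:)
  then show ?thesis unfolding connectedin_def by (rule conjunct2)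
qed

text \<open>
  A compact fibre maps homeomorphically to its image in projective space. For the differential, a
  direction that kills all \<open>v\<^sub>j / v\<^sub>i\<close> at a point kills the two coordinates of a slice there.
\<close>

lemma projective_embedding_fib:
  assumes t: "norm t < 1"
  shows "projective_embedding (fibT t) (fibA t) {0} (\<lambda>_. 0) 5 snd"
  unfolding projective_embedding_def
proof (intro conjI)
  let ?Y = "prod_topology (top_of_set {0::complex}) (proj_space 5)"
  note ca = chart_atlas_fib[OF t]
  show "holomorphic_fun (fibT t) (fibA t) (topspace (fibT t)) (\<lambda>_. 0)"
    by (rule holomorphic_fun_const[OF ca openin_topspace])
  show "meromorphic_to_proj (fibT t) (fibA t) {} 5 snd"
    unfolding meromorphic_to_proj_def topspace_fibT
  proof
    fix p assume "p \<in> fib t"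
    then have "p \<in> topspace famX" by (simp add: fib_iff)
    then obtain W f where W: "p \<in> W" "openin famX W" "\<And>i. i \<le> 5 \<Longrightarrow> holomorphic_fun famX atlasX W (f i)"
      "\<And>x. x \<in> W \<Longrightarrow> (\<exists>i\<le>5. f i x \<noteq> 0) \<and> snd x = proj_pt 5 (\<lambda>i. f i x)"
      using meromorphic_famX unfolding meromorphic_to_proj_def by (metis Diff_empty)
    show "\<exists>W f. p \<in> W \<and> openin (fibT t) W \<and> (\<forall>i\<le>5. holomorphic_fun (fibT t) (fibA t) W (f i)) \<and>
      (\<forall>x\<in>W - {}. (\<exists>i\<le>5. f i x \<noteq> 0) \<and> snd x = proj_pt 5 (\<lambda>i. f i x))"
      by (intro exI[of _ "W \<inter> fib t"] exI[of _ f])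
        (use W \<open>p \<in> fib t\<close> holomorphic_fun_restrict[OF chart_atlasX W(3)] openin_subtopology_Int in auto)
  qed
  let ?f = "\<lambda>x :: complex \<times> hpoint. (0 :: complex, snd x)"
  have cont: "continuous_map (fibT t) ?Y ?f"
    unfolding continuous_map_pairwise
    using continuous_map_from_subtopology[OF continuous_snd_famX] by (simp add: o_def)
  have hausY: "Hausdorff_space ?Y" by (rule Hausdorff_disc_proj)
  have cpt: "compactin ?Y (?f ` topspace (fibT t))"
    by (rule image_compactin[OF _ cont]) (use compact_fib in \<open>simp only: compact_space_def\<close>)
  have subY: "?f ` topspace (fibT t) \<subseteq> topspace ?Y"
    using cpt by (rule compactin_subset_topspace)
  show "embedding_map (fibT t) ?Y ?f"
    unfolding embedding_map_def
  proof (rule continuous_imp_homeomorphic_map[OF _ compact_fib])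
    show "continuous_map (fibT t) (subtopology ?Y (?f ` topspace (fibT t))) ?f"
      unfolding continuous_map_in_subtopology using cont by auto
    show "Hausdorff_space (subtopology ?Y (?f ` topspace (fibT t)))"
      by (rule Hausdorff_space_subtopology[OF hausY])
    show "?f ` topspace (fibT t) = topspace (subtopology ?Y (?f ` topspace (fibT t)))"
      by (rule topspace_subtopology_subset[OF subY, symmetric])
    show "inj_on ?f (topspace (fibT t))"
      by (rule inj_onI) (simp add: fib_iff prod_eq_iff)
  qed
  show "closedin ?Y (?f ` topspace (fibT t))"
    by (rule compactin_imp_closedin[OF hausY cpt])
  have "\<exists>j\<le>5. chart_deriv U c (\<lambda>x. affine_coord i j (snd x)) p v \<noteq> 0"
    if Uc: "(U,c) \<in> fibA t" and p: "p \<in> U" and i: "snd p \<in> affine_piece 5 i" and v: "v \<noteq> 0" for U c p i v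
  proof (rule ccontr)
    assume "\<not> ?thesis"
    then have "\<forall>j\<le>5. chart_deriv U c (affX i j) p v = 0"
      unfolding affX_fun by simp
    then have z: "chart_deriv U c (affX i j) p v = 0" if "j \<le> 5" for j
      using that by simp
    have pf: "p \<in> fib t" using submanifold_chart_param(3)[OF Uc] p by blast
    obtain k where k: "k < 4" "p \<in> pieceX (piv k) \<inter> fib t" by (rule fib_cases[OF pf])
    have pi: "p \<in> pieceX i" using k(2) i unfolding pieceX_def by simp
    let ?W = "pieceX i \<inter> pieceX (piv k) \<inter> fib t"
    have oW: "openin (fibT t) ?W"
      by (rule openin_subtopology_Int) (intro openin_Int openin_pieceX)
    have hol: "holomorphic_fun (fibT t) (fibA t) ?W (affX i j)" if "j \<le> 5" for j
      by (rule holomorphic_fun_subset[OF ca holomorphic_affX_fib[OF that, of t i] oW]) blast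
    have pW: "p \<in> ?W" using pi k by blast
    have sub: "?W \<subseteq> pieceX i \<inter> pieceX (piv k)" by blast
    have zero: "chart_deriv U c (affX (piv k) j) p v = 0" if "j \<le> 5" for j
      by (rule chart_deriv_affX_change[OF ca Uc p pW sub hol z that])
    obtain T T' where T: "((\<lambda>z. slice_coord k (inv_into U c z)) has_derivative T) (at (c p))"
      "((\<lambda>z. c (inv_into (pieceX (piv k) \<inter> fib t) (slice_coord k) z)) has_derivative T') (at (slice_coord k p))"
      "\<And>v. T' (T v) = v" "\<And>v. T (T' v) = v"
      by (rule chart_transition_derivative[OF complex_manifold_fib[OF t] Uc slice_chart[OF k(1) t] p k(2)]) (rule that)
    have Tn: "chart_deriv U c (\<lambda>x. slice_coord k x $ j) p v = T v $ j" for j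
      unfolding chart_deriv_def frechet_derivative_at[OF has_derivative_vec_nth[OF T(1), of j], symmetric] ..
    have "T v $ 1 = 0" using zero[OF piv_co_le(2)[of k]] unfolding Tn[of 1, symmetric] slice_coord_nth by simp
    moreover have "T v $ 2 = 0" using zero[OF piv_co_le(3)[of k]] unfolding Tn[of 2, symmetric] slice_coord_nth by simp
    ultimately have "T v = 0" by (simp add: vec_eq_iff forall_2)
    then have "v = T' 0" using T(3)[of v] by simp
    also have "T' 0 = 0" using has_derivative_linear[OF T(2)] by (rule linear_0)
    finally show False using v by simp
  qed
  then show "\<forall>(U,c)\<in>fibA t. \<forall>p\<in>U. \<forall>i\<le>5. snd p \<in> affine_piece 5 i \<longrightarrow>
        (\<forall>v. v \<noteq> 0 \<longrightarrow> chart_deriv U c (\<lambda>_. 0) p v \<noteq> 0 \<or>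
           (\<exists>j\<le>5. chart_deriv U c (\<lambda>x. affine_coord i j (snd x)) p v \<noteq> 0))"
    by (auto simp: split_beta)
qed

section \<open>Rationality of the fibres\<close>

lemma open_complex_infinite:
  assumes "open (S :: complex set)" "S \<noteq> {}" "finite F"
  shows "\<exists>d\<in>S. d \<notin> F"
proof (rule ccontr)
  assume "\<not> ?thesis"
  then have "S \<subseteq> F" by blast
  then have "finite S" using assms(3) by (rule finite_subset)
  then show False using finite_imp_not_open assms(1,2) by blast
qed

lemma open_contains_nonzero_coords:
  fixes W :: "(complex^'n) set"
  assumes W: "open W" "z \<in> W"
  shows "\<exists>y\<in>W. \<forall>j. y $ j \<noteq> 0"
proof -
  \<comment> \<open>On the diagonal line through \<open>z\<close> each coordinate vanishes at one point only.\<close>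
  let ?one = "\<chi> j. 1 :: complex^'n"
  let ?S = "{\<zeta>. z + \<zeta> *s ?one \<in> W}"
  have "open ?S" by (rule open_complex_line_vimage[OF W(1)])
  moreover have "0 \<in> ?S" using W(2) by simp
  then have "?S \<noteq> {}" by blast
  moreover have "finite (range (\<lambda>j. - (z $ j)))" by simp
  ultimately obtain d where d: "d \<in> ?S" "d \<notin> range (\<lambda>j. - (z $ j))" using open_complex_infinite by metis
  have "(z + d *s ?one) $ j \<noteq> 0" for j
  proof
    assume "(z + d *s ?one) $ j = 0"
    then have "d = - (z $ j)" by (simp add: eq_neg_iff_add_eq_0 add.commute)
    then show False using d(2) by blast
  qed
  then show ?thesis using d(1) by (intro bexI[of _ "z + d *s ?one"]) auto
qed

text \<open>
  The functions in question below are monomials in the coordinates of a slice, hence nonzero at such a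
  point.
\<close>

lemma fib_open_generic_point:
  assumes t: "norm t < 1" and O: "openin (fibT t) W" "p \<in> W"
  obtains k x y where "k < 4" "par k t x y \<in> W" "x \<noteq> 0" "y \<noteq> 0"
proof -
  have "p \<in> fib t" using O openin_subset by fastforce
  then obtain k where k: "k < 4" "p \<in> pieceX (piv k) \<inter> fib t" by (rule fib_cases)
  have "open (slice_coord k ` (pieceX (piv k) \<inter> fib t \<inter> W))"
    by (rule chart_open_image[OF chart_atlas_fib[OF t] slice_chart[OF k(1) t] O(1)])
  moreover have "slice_coord k p \<in> slice_coord k ` (pieceX (piv k) \<inter> fib t \<inter> W)" using k(2) O(2) by blast
  ultimately obtain z where z: "z \<in> slice_coord k ` (pieceX (piv k) \<inter> fib t \<inter> W)" "\<forall>j. z $ j \<noteq> 0"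
    using open_contains_nonzero_coords by blast
  from z(1) obtain q where q: "z = slice_coord k q" "q \<in> pieceX (piv k) \<inter> fib t \<inter> W" by (rule imageE)
  have "par k t (slice_coord k q $ 1) (slice_coord k q $ 2) = q" by (rule par_slice_coord[OF k(1)]) (use q(2) in blast)
  then show thesis using that[OF k(1), of "z $ 1" "z $ 2"] z(2) q by simp
qed

lemma holomorphic_fun_hc:
  assumes A: "chart_atlas X A" and k: "k < 4" "i \<le> 5"
    and hol: "holomorphic_fun X A W f" "holomorphic_fun X A W g" "holomorphic_fun X A W h"
  shows "holomorphic_fun X A W (\<lambda>x. hc k (f x) (g x) (h x) i)"
proof -
  have W: "openin X W" by (rule holomorphic_fun_openin[OF hol(1)])
  have "\<forall>i\<le>5. holomorphic_fun X A W (\<lambda>x. hc k (f x) (g x) (h x) i)"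
    unfolding all_le_5 using k_cases[OF k(1)]
    by (elim disjE) (auto simp: hc_def intro!: holomorphic_fun_add holomorphic_fun_mult
       holomorphic_fun_diff holomorphic_fun_power holomorphic_fun_const A W hol)
  then show ?thesis using k(2) by blast
qed

lemma holomorphic_map_cong:
  assumes M: "chart_atlas M B" and f: "holomorphic_map M B X A W f" and eq: "\<And>x. x \<in> W \<Longrightarrow> f x = g x"
  shows "holomorphic_map M B X A W g"
proof -
  have W: "openin M W" and cont: "continuous_map (subtopology M W) X f"
    using f unfolding holomorphic_map_def by blast+
  have cont': "continuous_map (subtopology M W) X g"
    by (rule continuous_map_eq[OF cont]) (use eq in simp)
  have "mv_holomorphic_on (\<lambda>z. d (g (inv_into U c z)) $ j) (c ` {x \<in> U \<inter> W. g x \<in> V})"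
    if Uc: "(U,c) \<in> B" and Vd: "(V,d) \<in> A" for U c V d j
  proof -
    note ch = chart_atlasD[OF M Uc]
    have s: "{x \<in> U \<inter> W. f x \<in> V} = {x \<in> U \<inter> W. g x \<in> V}" using eq by auto
    have "mv_holomorphic_on (\<lambda>z. d (f (inv_into U c z)) $ j) (c ` {x \<in> U \<inter> W. g x \<in> V})"
      using holomorphic_map_charts[OF f Uc Vd, of j] unfolding s .
    then show ?thesis
    proof (rule mv_holomorphic_on_transform)
      fix z assume "z \<in> c ` {x \<in> U \<inter> W. g x \<in> V}"
      then obtain x where x: "z = c x" "x \<in> {x \<in> U \<inter> W. g x \<in> V}" by (rule imageE)
      then have "inv_into U c z = x" using ch(4) by simp
      then show "d (f (inv_into U c z)) $ j = d (g (inv_into U c z)) $ j" using eq x(2) by simp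
    qed
  qed
  then show ?thesis unfolding holomorphic_map_def using W cont' by blast
qed

text \<open>
  The projection \<open>[v] \<mapsto> [v\<^sub>0 : v\<^sub>1 : v\<^sub>2]\<close>, birational because \<open>v\<^sub>1 / v\<^sub>0\<close> and \<open>v\<^sub>2 / v\<^sub>0\<close> are the
  coordinates of chart 0. Outside the piece \<open>v\<^sub>0 \<noteq> 0\<close> its values have no meaning.
\<close>

definition to_plane :: "complex \<times> hpoint \<Rightarrow> hpoint" where
  "to_plane p = proj_pt 2 (\<lambda>i. affX 0 i p)"

definition from_plane :: "complex \<Rightarrow> hpoint \<Rightarrow> complex \<times> hpoint" where
  "from_plane t Q = par 0 t (affine_coord 0 1 Q) (affine_coord 0 2 Q)"

lemma piv_0: "piv 0 = 0" "co1 0 = 1" "co2 0 = 2"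
  by (simp_all add: piv_def co1_def co2_def)

lemma affX_0_0: "p \<in> pieceX 0 \<Longrightarrow> affX 0 0 p = 1"
  unfolding affX_def pieceX_def by (rule affine_pieceD(2)[of _ 5]) simp

lemma to_plane_piece:
  assumes "p \<in> pieceX 0" shows "to_plane p \<in> affine_piece 2 0"
  unfolding to_plane_def affine_piece_proj_pt by (simp add: affX_0_0[OF assms])

lemma affine_coord_to_plane:
  assumes "p \<in> pieceX 0" "i \<le> 2" "affX 0 i p \<noteq> 0" "j \<le> 2"
  shows "affine_coord i j (to_plane p) = affX 0 j p / affX 0 i p"
  unfolding to_plane_def using affine_coord_proj_pt[of i 2 "\<lambda>i. affX 0 i p" j] assms(2-4) by simp

lemma from_plane_to_plane:
  assumes "p \<in> pieceX 0 \<inter> fib t" shows "from_plane t (to_plane p) = p"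
proof -
  have p: "p \<in> pieceX 0" "fst p = t" using assms by (auto simp: fib_iff)
  have "affine_coord 0 j (to_plane p) = affX 0 j p" if "j \<le> 2" for j
    using affine_coord_to_plane[OF p(1), of 0 j] that affX_0_0[OF p(1)] by simp
  then show ?thesis
    unfolding from_plane_def using par_affX[of 0 p] p by (simp add: piv_0)
qed

lemma from_plane_in:
  assumes "norm t < 1" shows "from_plane t Q \<in> pieceX 0 \<inter> fib t"
  unfolding from_plane_def using par_in_own_piece[of 0 t] par_fib[of 0 t] assms by (simp add: piv_0)

lemma to_plane_from_plane:
  assumes Q: "Q \<in> affine_piece 2 0" shows "to_plane (from_plane t Q) = Q"
proof -
  have "affX 0 i (from_plane t Q) = affine_coord 0 i Q" if "i \<le> 2" for i
  proof -
    have "affX 0 i (from_plane t Q) = hc 0 t (affine_coord 0 1 Q) (affine_coord 0 2 Q) i"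
      unfolding from_plane_def using affX_par_own[of 0 i t] that by (simp add: piv_0)
    moreover have "i = 0 \<or> i = 1 \<or> i = 2" using that by auto
    ultimately show ?thesis using affine_pieceD(2)[OF Q] by (auto simp: hc_def)
  qed
  then have "to_plane (from_plane t Q) = proj_pt 2 (\<lambda>i. affine_coord 0 i Q)"
    unfolding to_plane_def by (intro proj_pt_scale[of 1]) auto
  then show ?thesis using affine_pieceD(1)[OF Q] by simp
qed

abbreviation planeA :: "(hpoint, 2) atlas" where "planeA \<equiv> proj_atlas"

lemma plane_atlas: "chart_atlas (proj_space 2) planeA"
  using proj_chart_atlas[where 'n = 2] by simp

lemma holomorphic_affine_coord_plane:
  "holomorphic_fun (proj_space 2) planeA (affine_piece 2 m) (affine_coord m j)"
  using holomorphic_affine_coord_proj[where 'n = 2] by simp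

lemma holomorphic_to_plane:
  assumes t: "norm t < 1"
  shows "holomorphic_map (fibT t) (fibA t) (proj_space 2) planeA (pieceX 0 \<inter> fib t) to_plane"
proof (rule holomorphic_mapI)
  let ?W = "pieceX 0 \<inter> fib t"
  show oW: "openin (fibT t) ?W" by (rule openin_fib_piece)
  have ca: "continuous_map (subtopology (fibT t) ?W) euclidean (affX 0 j)" for j
  proof -
    have "subtopology (fibT t) ?W = subtopology (subtopology famX (pieceX 0)) (fib t)"
      by (simp add: subtopology_subtopology Int_ac)
    then show ?thesis using continuous_map_from_subtopology[OF continuous_affX] by simp
  qed
  show cont: "continuous_map (subtopology (fibT t) ?W) (proj_space 2) to_plane"
    unfolding to_plane_def[abs_def]
  proof (rule continuous_map_proj_pt[OF ca])
    fix x assume "x \<in> topspace (subtopology (fibT t) ?W)"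
    then show "\<exists>i\<le>2. affX 0 i x \<noteq> 0" by (intro exI[of _ 0]) (simp add: affX_0_0)
  qed
  fix V d and j :: 2 assume "(V,d) \<in> planeA"
  then obtain i e where Vd: "V = affine_piece 2 i" "d = (\<lambda>P. \<chi> k. affine_coord i (e k) P)"
    and i: "i \<le> 2" and e: "bij_betw e (UNIV :: 2 set) ({..2} - {i})"
    unfolding proj_atlas_def by auto
  have ej: "e j \<le> 2" using bij_betwE[OF e] by auto
  let ?N = "{x \<in> ?W. to_plane x \<in> V}"
  have N: "openin (fibT t) ?N"
  proof -
    have "openin (subtopology (fibT t) ?W) {x \<in> topspace (subtopology (fibT t) ?W). to_plane x \<in> V}"
      by (rule openin_continuous_map_preimage[OF cont]) (simp only: Vd openin_affine_piece)
    then have "openin (fibT t) {x \<in> topspace (subtopology (fibT t) ?W). to_plane x \<in> V}"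
      using oW by (rule openin_trans_full)
    moreover have "{x \<in> topspace (subtopology (fibT t) ?W). to_plane x \<in> V} = ?N"
      using openin_subset[OF oW] by auto
    ultimately show ?thesis by simp
  qed
  have nz: "affX 0 i x \<noteq> 0" if "x \<in> ?N" for x
    using that unfolding Vd to_plane_def affine_piece_proj_pt by simp
  have h: "holomorphic_fun (fibT t) (fibA t) ?N (affX 0 l)" if "l \<le> 2" for l
    by (rule holomorphic_fun_subset[OF chart_atlas_fib[OF t] holomorphic_affX_fib[of l t 0] N])
      (use that in auto)
  have "holomorphic_fun (fibT t) (fibA t) ?N (\<lambda>x. affX 0 (e j) x / affX 0 i x)"
    by (rule holomorphic_fun_divide[OF chart_atlas_fib[OF t] h[OF ej] h[OF i] nz])
  then show "holomorphic_fun (fibT t) (fibA t) ?N (\<lambda>x. d (to_plane x) $ j)"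
  proof (rule holomorphic_fun_cong[OF chart_atlas_fib[OF t]])
    fix x assume x: "x \<in> ?N"
    then have "x \<in> pieceX 0" by blast
    from affine_coord_to_plane[OF this i nz[OF x] ej]
    show "affX 0 (e j) x / affX 0 i x = d (to_plane x) $ j" unfolding Vd by simp
  qed
qed

lemma holomorphic_from_plane:
  assumes t: "norm t < 1"
  shows "holomorphic_map (proj_space 2) planeA (fibT t) (fibA t) (affine_piece 2 0) (from_plane t)"
proof (rule holomorphic_map_into_submanifold[OF plane_atlas chart_atlasX])
  let ?W = "affine_piece 2 0"
  let ?a = "affine_coord 0 1" and ?b = "affine_coord 0 2"
  have hab: "holomorphic_fun (proj_space 2) planeA ?W (affine_coord 0 j)" for j
    by (rule holomorphic_affine_coord_plane)
  show "from_plane t ` ?W \<subseteq> fib t" using from_plane_in[OF t] by blast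
  show "holomorphic_map (proj_space 2) planeA famX atlasX ?W (from_plane t)"
  proof (rule holomorphic_mapI)
    show oW: "openin (proj_space 2) ?W" by (rule openin_affine_piece)
    show cont: "continuous_map (subtopology (proj_space 2) ?W) famX (from_plane t)"
      unfolding from_plane_def[abs_def]
      by (rule continuous_par) (use t in \<open>simp_all add: continuous_map_affine_coord\<close>)
    fix V d and j :: 3 assume "(V,d) \<in> atlasX"
    then obtain l where l: "l < 4" "V = pieceX (piv l)" "d = chX l" unfolding atlasX_def by blast
    let ?N = "{Q \<in> ?W. from_plane t Q \<in> V}"
    have N: "openin (proj_space 2) ?N"
    proof -
      have "openin (subtopology (proj_space 2) ?W) {x \<in> topspace (subtopology (proj_space 2) ?W). from_plane t x \<in> V}"
        by (rule openin_continuous_map_preimage[OF cont]) (simp only: l openin_pieceX)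
      then have "openin (proj_space 2) {x \<in> topspace (subtopology (proj_space 2) ?W). from_plane t x \<in> V}"
        using oW by (rule openin_trans_full)
      moreover have "{x \<in> topspace (subtopology (proj_space 2) ?W). from_plane t x \<in> V} = ?N"
        using openin_subset[OF oW] by auto
      ultimately show ?thesis by simp
    qed
    have nz: "hc 0 t (?a Q) (?b Q) (piv l) \<noteq> 0" if "Q \<in> ?N" for Q
      using that par_in_pieceX[of 0 t "?a Q" "?b Q" "piv l"] t unfolding from_plane_def l by simp
    have hN: "holomorphic_fun (proj_space 2) planeA ?N (affine_coord 0 i)" for i
      by (rule holomorphic_fun_subset[OF plane_atlas hab N]) blast
    have tN: "holomorphic_fun (proj_space 2) planeA ?N (\<lambda>_. t)"
      by (rule holomorphic_fun_const[OF plane_atlas N])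
    have q: "holomorphic_fun (proj_space 2) planeA ?N (\<lambda>Q. affX (piv l) i (from_plane t Q))" if i: "i \<le> 5" for i
    proof (rule holomorphic_fun_cong[OF plane_atlas])
      show "holomorphic_fun (proj_space 2) planeA ?N (\<lambda>Q. hc 0 t (?a Q) (?b Q) i / hc 0 t (?a Q) (?b Q) (piv l))"
        by (rule holomorphic_fun_divide[OF plane_atlas holomorphic_fun_hc[OF plane_atlas _ i tN hN hN]
              holomorphic_fun_hc[OF plane_atlas _ piv_co_le(1) tN hN hN]]) (use nz in simp_all)
      show "hc 0 t (?a Q) (?b Q) i / hc 0 t (?a Q) (?b Q) (piv l) = affX (piv l) i (from_plane t Q)" if "Q \<in> ?N" for Q
        unfolding from_plane_def using affX_par[of 0 "piv l" t "?a Q" "?b Q" i] nz[OF that] i piv_co_le(1) by simp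
    qed
    show "holomorphic_fun (proj_space 2) planeA ?N (\<lambda>x. d (from_plane t x) $ j)"
      using exhaust_3[of j] q[OF piv_co_le(2)] q[OF piv_co_le(3)] tN
      unfolding l by (elim disjE) (simp_all add: chX_nth from_plane_def)
  qed
qed

text \<open>
  The complement of chart 0, a hyperplane section of the fibre; the projection to the plane is
  biholomorphic between the complements of this curve and of the line at infinity.
\<close>

definition infinity_curve :: "complex \<Rightarrow> (complex \<times> hpoint) set" where
  "infinity_curve t = fib t - pieceX 0"

definition infinity_line :: "hpoint set" where
  "infinity_line = proj_points 2 - affine_piece 2 0"

lemma analytic_infinity_curve:
  assumes t: "norm t < 1"
  shows "analytic_subset (fibT t) (fibA t) (infinity_curve t)"
  unfolding analytic_subset_def topspace_fibT
proof (intro conjI ballI)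
  show "infinity_curve t \<subseteq> fib t" unfolding infinity_curve_def by blast
  fix p assume "p \<in> fib t"
  then obtain k where k: "k < 4" "p \<in> pieceX (piv k) \<inter> fib t" by (rule fib_cases)
  have "infinity_curve t \<inter> (pieceX (piv k) \<inter> fib t) = {x \<in> pieceX (piv k) \<inter> fib t. affX (piv k) 0 x = 0}"
    unfolding infinity_curve_def using pieceX_iff[of _ "piv k" 0] by auto
  then show "\<exists>W (n::nat) f. p \<in> W \<and> openin (fibT t) W \<and> (\<forall>i<n. holomorphic_fun (fibT t) (fibA t) W (f i)) \<and>
        infinity_curve t \<inter> W = {x\<in>W. \<forall>i<n. f i x = 0}"
    using k holomorphic_affX_fib[of 0 t "piv k"] openin_fib_piece
    by (intro exI[of _ "pieceX (piv k) \<inter> fib t"] exI[of _ "1::nat"] exI[of _ "\<lambda>_. affX (piv k) 0"]) simp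
qed

lemma infinity_curve_nowhere_dense:
  assumes t: "norm t < 1"
  shows "fibT t interior_of infinity_curve t = {}"
proof (rule ccontr)
  assume "\<not> ?thesis"
  then obtain p where p: "p \<in> fibT t interior_of infinity_curve t" by blast
  obtain k x y where k: "k < 4" "par k t x y \<in> fibT t interior_of infinity_curve t" "x \<noteq> 0" "y \<noteq> 0"
    by (rule fib_open_generic_point[OF t openin_interior_of p]) (rule that)
  have "par k t x y \<in> infinity_curve t" by (rule subsetD[OF interior_of_subset k(2)])
  then have "hc k t x y 0 = 0" using par_in_pieceX[OF k(1) t, of x y 0] unfolding infinity_curve_def by simp
  then show False using k_cases[OF k(1)] k(3,4) by (elim disjE) (simp_all add: hc_def)
qed

lemma analytic_infinity_line: "analytic_subset (proj_space 2) planeA infinity_line"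
  unfolding analytic_subset_def topspace_proj_space
proof (intro conjI ballI)
  show "infinity_line \<subseteq> proj_points 2" unfolding infinity_line_def by blast
  fix P assume "P \<in> proj_points 2"
  then obtain m where m: "m \<le> 2" "P \<in> affine_piece 2 m" unfolding proj_points_pieces by blast
  have "infinity_line \<inter> affine_piece 2 m = {Q \<in> affine_piece 2 m. affine_coord m 0 Q = 0}"
    unfolding infinity_line_def using affine_piece_iff[of _ 2 m 0] affine_pieceD(4)[of _ 2 m] by auto
  then show "\<exists>W (n::nat) f. P \<in> W \<and> openin (proj_space 2) W \<and> (\<forall>i<n. holomorphic_fun (proj_space 2) planeA W (f i)) \<and>
        infinity_line \<inter> W = {x\<in>W. \<forall>i<n. f i x = 0}"
    using m holomorphic_affine_coord_plane openin_affine_piece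
    by (intro exI[of _ "affine_piece 2 m"] exI[of _ "1::nat"] exI[of _ "\<lambda>_. affine_coord m 0"]) simp
qed

lemma infinity_line_nowhere_dense: "proj_space 2 interior_of infinity_line = {}"
proof (rule ccontr)
  let ?I = "proj_space 2 interior_of infinity_line"
  assume "?I \<noteq> {}"
  then obtain P where P: "P \<in> ?I" by blast
  have "P \<in> topspace (proj_space 2)" by (rule subsetD[OF interior_of_subset_topspace P])
  then obtain U and c :: "hpoint \<Rightarrow> complex^2" where Uc: "(U,c) \<in> planeA" "P \<in> U"
    by (rule chart_atlas_cover[OF plane_atlas])
  obtain i e where i: "U = affine_piece 2 i" "c = (\<lambda>P. \<chi> k. affine_coord i (e k) P)" "i \<le> 2"
    and e: "bij_betw e (UNIV :: 2 set) ({..2} - {i})"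
    using Uc(1) unfolding proj_atlas_def by auto
  have "open (c ` (U \<inter> ?I))" by (rule chart_open_image[OF plane_atlas Uc(1) openin_interior_of])
  moreover have "c P \<in> c ` (U \<inter> ?I)" using P Uc by blast
  ultimately obtain z where z: "z \<in> c ` (U \<inter> ?I)" "\<forall>j. z $ j \<noteq> 0" using open_contains_nonzero_coords by blast
  from z(1) obtain Q where Q: "z = c Q" "Q \<in> U \<inter> ?I" by (rule imageE)
  have QU: "Q \<in> affine_piece 2 i" using Q(2) i(1) by blast
  have "affine_coord i 0 Q \<noteq> 0"
  proof (cases "i = 0")
    case True then show ?thesis using affine_pieceD(2)[OF QU] by simp
  next
    case False
    then have "0 \<in> range e" using e unfolding bij_betw_def by auto
    then obtain j where "0 = e j" by blast
    then show ?thesis using z(2) unfolding Q(1) i(2) by (metis vec_lambda_beta)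
  qed
  then have "Q \<in> affine_piece 2 0" unfolding affine_piece_iff[OF QU] by simp
  moreover have "Q \<in> infinity_line" by (rule subsetD[OF interior_of_subset]) (rule IntD2[OF Q(2)])
  ultimately show False unfolding infinity_line_def by blast
qed

lemma rational_fib:
  assumes t: "norm t < 1"
  shows "rational_surface (fibT t) (fibA t)"
  unfolding rational_surface_def
proof (intro conjI)
  show "complex_manifold (fibT t) (fibA t)" by (rule complex_manifold_fib[OF t])
  show "compact_space (fibT t)" by (rule compact_fib)
  show "connected_space (fibT t)" by (rule connected_fib[OF t])
  show "topspace (fibT t) \<noteq> {}" unfolding topspace_fibT using par_fib[of 0 t 0 0] t by auto
  let ?W = "pieceX 0 \<inter> fib t"
  have W: "topspace (fibT t) - infinity_curve t = ?W" unfolding topspace_fibT infinity_curve_def by blast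
  have V: "proj_points 2 - infinity_line = affine_piece 2 0"
    unfolding infinity_line_def using affine_pieceD(4)[of _ 2 0] by blast
  have inj: "inj_on to_plane ?W" by (rule inj_on_inverseI[of _ "from_plane t"]) (rule from_plane_to_plane)
  have inv: "inv_into ?W to_plane Q = from_plane t Q" if "Q \<in> affine_piece 2 0" for Q
    using inv_into_f_f[OF inj from_plane_in[OF t, of Q]] unfolding to_plane_from_plane[OF that] .
  have bih: "biholomorphic_map (fibT t) (fibA t) (proj_space 2) planeA ?W (affine_piece 2 0) to_plane"
    unfolding biholomorphic_map_def
  proof (intro conjI)
    show "bij_betw to_plane ?W (affine_piece 2 0)"
      by (rule bij_betw_byWitness[of _ "from_plane t"])
        (use from_plane_to_plane to_plane_from_plane to_plane_piece from_plane_in[OF t] in blast)+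
    show "holomorphic_map (fibT t) (fibA t) (proj_space 2) planeA ?W to_plane" by (rule holomorphic_to_plane[OF t])
    show "holomorphic_map (proj_space 2) planeA (fibT t) (fibA t) (affine_piece 2 0) (inv_into ?W to_plane)"
      by (rule holomorphic_map_cong[OF plane_atlas holomorphic_from_plane[OF t]]) (rule inv[symmetric])
  qed
  have mer1: "meromorphic_to_proj (fibT t) (fibA t) (infinity_curve t) 2 to_plane"
    unfolding meromorphic_to_proj_def topspace_fibT
  proof
    fix p assume "p \<in> fib t"
    then obtain k where k: "k < 4" "p \<in> pieceX (piv k) \<inter> fib t" by (rule fib_cases)
    have "(\<exists>i\<le>2. affX (piv k) i x \<noteq> 0) \<and> to_plane x = proj_pt 2 (\<lambda>i. affX (piv k) i x)"
      if x: "x \<in> pieceX (piv k) \<inter> fib t - infinity_curve t" for x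
    proof -
      have xp: "x \<in> pieceX (piv k)" "x \<in> pieceX 0" using x unfolding infinity_curve_def by auto
      have n0: "affX (piv k) 0 x \<noteq> 0" using pieceX_iff[OF xp(1), of 0] xp(2) by simp
      have "to_plane x = proj_pt 2 (\<lambda>i. affX (piv k) i x)"
        unfolding to_plane_def
        by (rule proj_pt_scale[of "1 / affX (piv k) 0 x"]) (use n0 affX_change[OF xp] in auto)
      then show ?thesis using n0 by (intro conjI exI[of _ 0]) auto
    qed
    then show "\<exists>W f. p \<in> W \<and> openin (fibT t) W \<and> (\<forall>i\<le>2. holomorphic_fun (fibT t) (fibA t) W (f i)) \<and>
        (\<forall>x\<in>W - infinity_curve t. (\<exists>i\<le>2. f i x \<noteq> 0) \<and> to_plane x = proj_pt 2 (\<lambda>i. f i x))"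
      using k holomorphic_affX_fib[of _ t "piv k"] openin_fib_piece
      by (intro exI[of _ "pieceX (piv k) \<inter> fib t"] exI[of _ "affX (piv k)"]) simp
  qed
  have mer2: "meromorphic_to_proj (proj_space 2) planeA infinity_line 5 (\<lambda>y. snd (inv_into ?W to_plane y))"
    unfolding meromorphic_to_proj_def topspace_proj_space
  proof
    fix P assume "P \<in> proj_points 2"
    then obtain m where m: "m \<le> 2" "P \<in> affine_piece 2 m" unfolding proj_points_pieces by blast
    \<comment> \<open>The coordinates of the inverse, made homogeneous of degree 4.\<close>
    define F where "F = (\<lambda>i Q. [affine_coord m 0 Q^4, affine_coord m 1 Q * affine_coord m 0 Q^3,
      affine_coord m 2 Q * affine_coord m 0 Q^3,
      affine_coord m 1 Q * affine_coord m 2 Q * affine_coord m 0 Q^2,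
      affine_coord m 1 Q^2 * affine_coord m 2 Q * affine_coord m 0 Q + t * affine_coord m 1 Q * affine_coord m 0 Q^3,
      affine_coord m 1 Q^3 * affine_coord m 2 Q + t * affine_coord m 1 Q^2 * affine_coord m 0 Q^2] ! i)"
    have hol: "\<forall>i\<le>5. holomorphic_fun (proj_space 2) planeA (affine_piece 2 m) (F i)"
      unfolding all_le_5 F_def
      by (simp add: nth_Cons' , intro conjI holomorphic_fun_add holomorphic_fun_mult holomorphic_fun_power
          holomorphic_fun_const[OF plane_atlas openin_affine_piece] holomorphic_affine_coord_plane)
    have "(\<exists>i\<le>5. F i Q \<noteq> 0) \<and> snd (inv_into ?W to_plane Q) = proj_pt 5 (\<lambda>i. F i Q)"
      if Q: "Q \<in> affine_piece 2 m - infinity_line" for Q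
    proof -
      have Qm: "Q \<in> affine_piece 2 m" "Q \<in> affine_piece 2 0"
        using Q affine_pieceD(4)[of Q 2 m] unfolding infinity_line_def by auto
      have n0: "affine_coord m 0 Q \<noteq> 0" using affine_piece_iff[OF Qm(1), of 0] Qm(2) by simp
      have ch: "affine_coord 0 j Q = affine_coord m j Q / affine_coord m 0 Q" if "j \<le> 2" for j
        by (rule affine_coord_change[OF Qm that])
      have "\<forall>i\<le>5. hc 0 t (affine_coord 0 1 Q) (affine_coord 0 2 Q) i = (1 / affine_coord m 0 Q^4) * F i Q"
        unfolding all_le_5 using n0
        by (simp add: hc_def F_def ch nth_Cons' field_simps power2_eq_square power3_eq_cube power4_eq_xxxx)
      then have "proj_pt 5 (hc 0 t (affine_coord 0 1 Q) (affine_coord 0 2 Q)) = proj_pt 5 (\<lambda>i. F i Q)"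
        using n0 by (intro proj_pt_scale[of "1 / affine_coord m 0 Q^4"]) auto
      moreover have "F 0 Q \<noteq> 0" using n0 by (simp add: F_def)
      ultimately show ?thesis
        unfolding inv[OF Qm(2)] from_plane_def par_simps by (intro conjI exI[of _ 0]) auto
    qed
    then show "\<exists>W f. P \<in> W \<and> openin (proj_space 2) W \<and> (\<forall>i\<le>5. holomorphic_fun (proj_space 2) planeA W (f i)) \<and>
        (\<forall>x\<in>W - infinity_line. (\<exists>i\<le>5. f i x \<noteq> 0) \<and> snd (inv_into ?W to_plane x) = proj_pt 5 (\<lambda>i. f i x))"
      using m hol openin_affine_piece by (intro exI[of _ "affine_piece 2 m"] exI[of _ F]) simp
  qed
  show "\<exists>N F S T f. projective_embedding (fibT t) (fibA t) {0} (\<lambda>_. 0) N F \<and>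
        analytic_subset (fibT t) (fibA t) S \<and> fibT t interior_of S = {} \<and>
        analytic_subset (proj_space 2) planeA T \<and> proj_space 2 interior_of T = {} \<and>
        biholomorphic_map (fibT t) (fibA t) (proj_space 2) planeA (topspace (fibT t) - S) (proj_points 2 - T) f \<and>
        meromorphic_to_proj (fibT t) (fibA t) S 2 f \<and>
        meromorphic_to_proj (proj_space 2) planeA T N (\<lambda>y. F (inv_into (topspace (fibT t) - S) f y))"
    apply (rule exI[of _ 5], rule exI[of _ snd], rule exI[of _ "infinity_curve t"],
           rule exI[of _ infinity_line], rule exI[of _ to_plane])
    unfolding W V
    by (intro conjI projective_embedding_fib[OF t] analytic_infinity_curve[OF t] infinity_curve_nowhere_dense[OF t]
         analytic_infinity_line infinity_line_nowhere_dense bih mer1 mer2)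
qed

section \<open>The curve of self-intersection -2 in the central fibre\<close>

abbreviation F2 :: "(complex \<times> hpoint) set" where "F2 \<equiv> fib 0"
abbreviation F2T :: "(complex \<times> hpoint) topology" where "F2T \<equiv> fibT 0"
abbreviation F2A :: "(complex \<times> hpoint, 2) atlas" where "F2A \<equiv> fibA 0"

text \<open>
  The line \<open>E\<close> of the central fibre. A point of \<open>\<P>\<^sup>1\<close> is a set of vectors that vanish beyond index 1,
  and this same set is the corresponding point of \<open>\<P>\<^sup>5\<close>; so the inclusion of \<open>\<P>\<^sup>1\<close> into \<open>\<P>\<^sup>5\<close> as this
  line is the identity.
\<close>

definition negcurve :: "(complex \<times> hpoint) set" where
  "negcurve = {0} \<times> proj_points 1"

abbreviation lineA :: "(hpoint, 1) atlas" where "lineA \<equiv> proj_atlas"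
abbreviation negcurveT :: "(complex \<times> hpoint) topology" where "negcurveT \<equiv> subtopology F2T negcurve"
abbreviation negcurveA :: "(complex \<times> hpoint, 1) atlas" where "negcurveA \<equiv> submanifold_atlas F2T F2A negcurve"

lemma proj_pt_1_5: "proj_pt 1 v = proj_pt 5 (\<lambda>i. if i \<le> 1 then v i else 0)"
proof -
  have "(\<lambda>i. if i \<le> 1 then c * v i else 0) = (\<lambda>i. if i \<le> 5 then c * (if i \<le> 1 then v i else 0) else 0)" for c
    by (auto simp: fun_eq_iff)
  then show ?thesis unfolding proj_pt_def by simp
qed

lemma negcurve_subset: "negcurve \<subseteq> F2"
proof
  fix p assume "p \<in> negcurve"
  then obtain P where P: "p = (0, P)" "P \<in> proj_points 1" unfolding negcurve_def by auto
  obtain v where v: "P = proj_pt 1 v" "\<exists>i\<le>1. v i \<noteq> 0" by (rule proj_points_cases[OF P(2)])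
  let ?w = "\<lambda>i. if i \<le> 1 then v i else 0 :: complex"
  have "\<exists>i\<le>5. ?w i \<noteq> 0" using v(2) by (metis (full_types) dual_order.trans one_le_numeral)
  moreover have "on_scroll 0 ?w" by (simp add: on_scroll_iff)
  ultimately have "(0, proj_pt 5 ?w) \<in> scroll_family" unfolding scroll_family_proj_pt by simp
  then show "p \<in> F2" unfolding P(1) v(1) proj_pt_1_5 by (simp add: fib_iff)
qed

lemma negcurve_piece_iff: "(0, P) \<in> pieceX m \<longleftrightarrow> P \<in> affine_piece 1 m" if P: "P \<in> proj_points 1"
proof -
  have "(0, P) \<in> negcurve" using P by (simp add: negcurve_def)
  then have "(0, P) \<in> F2" by (rule subsetD[OF negcurve_subset])
  then have "(0, P) \<in> scroll_family" by (simp add: fib_iff)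
  then have "(0, P) \<in> pieceX m \<longleftrightarrow> (\<exists>v\<in>P. v m \<noteq> 0)"
    using scroll_familyD(2) unfolding pieceX_def affine_piece_def by auto
  then show ?thesis unfolding affine_piece_def using P by simp
qed

lemma affX_negcurve:
  assumes p: "p \<in> negcurve" "p \<in> pieceX m" and j: "1 < j"
  shows "affX m j p = 0"
proof -
  obtain P where P: "p = (0, P)" "P \<in> proj_points 1" using p(1) unfolding negcurve_def by auto
  have m: "P \<in> affine_piece 1 m" using p(2) negcurve_piece_iff[OF P(2)] P(1) by simp
  obtain v where v: "P = proj_pt 1 v" by (rule proj_points_cases[OF P(2)])
  have vm: "m \<le> 1" "v m \<noteq> 0" using m unfolding v affine_piece_proj_pt by auto
  have "affine_coord m j P = 0" unfolding v using affine_coord_proj_pt[of m 1 v j, OF vm] j by simp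
  then show ?thesis unfolding affX_def P(1) by simp
qed

lemma negcurve_pieces:
  assumes "p \<in> negcurve"
  shows "p \<notin> pieceX (piv 1)" "p \<notin> pieceX (piv 3)" "p \<in> pieceX (piv 0) \<or> p \<in> pieceX (piv 2)"
proof -
  obtain P where P: "p = (0, P)" "P \<in> proj_points 1" using assms unfolding negcurve_def by auto
  show "p \<notin> pieceX (piv 1)" "p \<notin> pieceX (piv 3)"
    unfolding P(1) negcurve_piece_iff[OF P(2)] using affine_pieceD(3)[of P 1] by (force simp: piv_def)+
  have "P \<in> affine_piece 1 0 \<or> P \<in> affine_piece 1 1"
    using P(2) unfolding proj_points_pieces by (auto simp: atMost_Suc)
  then show "p \<in> pieceX (piv 0) \<or> p \<in> pieceX (piv 2)"
    unfolding P(1) negcurve_piece_iff[OF P(2)] by (simp add: piv_def)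
qed

lemma par_negcurve:
  assumes "k = 0 \<or> k = 2" shows "par k 0 x 0 \<in> negcurve"
proof -
  have "\<forall>i\<le>5. hc k 0 x 0 i = 1 * (if i \<le> 1 then hc k 0 x 0 i else 0)"
    unfolding all_le_5 using assms by (auto simp: hc_def)
  then have "proj_pt 5 (hc k 0 x 0) = proj_pt 5 (\<lambda>i. if i \<le> 1 then hc k 0 x 0 i else 0)"
    by (intro proj_pt_scale[of 1]) auto
  also have "\<dots> = proj_pt 1 (hc k 0 x 0)" by (rule proj_pt_1_5[symmetric])
  finally have eq: "proj_pt 5 (hc k 0 x 0) = proj_pt 1 (hc k 0 x 0)" .
  have "piv k \<le> 1" "hc k 0 x 0 (piv k) \<noteq> 0" using assms hc_values(1)[of k] by (auto simp: piv_def hc_def)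
  then have "proj_pt 1 (hc k 0 x 0) \<in> proj_points 1" by (rule proj_pt_in_points)
  then show ?thesis unfolding negcurve_def par_def eq by simp
qed

lemma negcurve_par:
  assumes k: "k = 0 \<or> k = 2" and p: "p \<in> negcurve" "p \<in> pieceX (piv k)"
  shows "par k 0 (affX (piv k) (co1 k) p) 0 = p"
proof -
  have "affX (piv k) (co2 k) p = 0" by (rule affX_negcurve[OF p]) (use k in \<open>auto simp: co2_def\<close>)
  moreover have "fst p = 0" using p(1) unfolding negcurve_def by auto
  moreover have "k < 4" using k by auto
  ultimately show ?thesis using par_affX[of k p] p(2) by simp
qed

definition lineC :: "nat \<Rightarrow> complex \<times> hpoint \<Rightarrow> complex^1" where
  "lineC k p = vector [affX (piv k) (co1 k) p]"

lemma negcurve_chart: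
  assumes k: "k = 0 \<or> k = 2"
  shows "(pieceX (piv k) \<inter> negcurve, lineC k) \<in> negcurveA"
proof (rule submanifold_chartI[where W = "pieceX (piv k) \<inter> F2" and \<Omega> = UNIV and \<psi> = "\<lambda>z. par k 0 (z $ 1) 0"])
  have k4: "k < 4" using k by auto
  show "chart_atlas F2T F2A" by (rule chart_atlas_fib) simp
  have "hol_param famX atlasX UNIV (\<lambda>z :: complex^1. par k 0 (z $ 1) 0)"
    by (rule hol_param_par[OF k4]) (simp_all add: mv_holomorphic_on_const mv_holomorphic_on_coord)
  then show "hol_param F2T F2A UNIV (\<lambda>z :: complex^1. par k 0 (z $ 1) 0)"
    by (rule hol_param_into_submanifold[OF chart_atlasX]) (use par_negcurve[OF k] negcurve_subset in blast)
  show "range (\<lambda>z :: complex^1. par k 0 (z $ 1) 0) = pieceX (piv k) \<inter> negcurve"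
  proof (intro set_eqI iffI)
    fix p assume "p \<in> range (\<lambda>z :: complex^1. par k 0 (z $ 1) 0)"
    then obtain z :: "complex^1" where z: "p = par k 0 (z $ 1) 0" by blast
    have "p \<in> pieceX (piv k)" unfolding z by (rule par_in_own_piece[OF k4]) simp
    then show "p \<in> pieceX (piv k) \<inter> negcurve" using par_negcurve[OF k] unfolding z by blast
  next
    fix p assume "p \<in> pieceX (piv k) \<inter> negcurve"
    then have "par k 0 (lineC k p $ 1) 0 = p" using negcurve_par[OF k, of p] by (simp add: lineC_def)
    then show "p \<in> range (\<lambda>z :: complex^1. par k 0 (z $ 1) 0)" by (metis rangeI)
  qed
  have "pieceX (piv k) \<inter> negcurve = (pieceX (piv k) \<inter> F2) \<inter> negcurve" using negcurve_subset by blast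
  then show "openin negcurveT (pieceX (piv k) \<inter> negcurve)"
    using openin_subtopology_Int[OF openin_fib_piece[of 0 "piv k"], of negcurve] by (simp only:)
  show "lineC k (par k 0 (z $ 1) 0) = z" for z
    using affX_par_own[OF k4 piv_co_le(2)] by (simp add: lineC_def hc_values[OF k4] vec_eq_iff forall_1)
  show "holomorphic_fun F2T F2A (pieceX (piv k) \<inter> F2) (\<lambda>x. lineC k x $ j)" for j
  proof -
    have j: "j = 1" by (rule num1_eq1)
    have "(\<lambda>x. lineC k x $ j) = affX (piv k) (co1 k)"
      unfolding j lineC_def by (rule ext) (rule vector_1)
    then show ?thesis using holomorphic_affX_fib[OF piv_co_le(2), of 0 "piv k" k] by (simp only:)
  qed
  show "pieceX (piv k) \<inter> negcurve \<subseteq> pieceX (piv k) \<inter> F2" using negcurve_subset by blast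
qed

lemma topspace_negcurveT: "topspace negcurveT = negcurve"
proof -
  have "topspace negcurveT = topspace F2T \<inter> negcurve" by (rule topspace_subtopology)
  then show ?thesis unfolding topspace_fibT Int_absorb1[OF negcurve_subset] .
qed

lemma complex_manifold_negcurve: "complex_manifold negcurveT negcurveA"
proof (rule complex_manifold_submanifold)
  show "complex_manifold F2T F2A" by (rule complex_manifold_fib) simp
  show "\<Union>(fst ` negcurveA) = topspace negcurveT"
    unfolding topspace_negcurveT
  proof (intro set_eqI iffI)
    fix p assume "p \<in> \<Union>(fst ` negcurveA)"
    then obtain x where "x \<in> negcurveA" "p \<in> fst x" by blast
    then show "p \<in> negcurve" using submanifold_chart_param(3)[of "fst x" "snd x" F2T F2A negcurve] by auto
  next
    fix p assume p: "p \<in> negcurve"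
    have "\<exists>k. (k = 0 \<or> k = 2) \<and> p \<in> pieceX (piv k)"
      using negcurve_pieces(3)[OF p] by (elim disjE) (rule exI[of _ 0], simp, rule exI[of _ 2], simp)
    then obtain k where k: "k = 0 \<or> k = 2" "p \<in> pieceX (piv k)" by blast
    show "p \<in> \<Union>(fst ` negcurveA)"
      by (rule UnionI[OF imageI[OF negcurve_chart[OF k(1)]]]) (use k(2) p in simp)
  qed
qed

lemma line_atlas: "chart_atlas (proj_space 1) lineA"
  using proj_chart_atlas[where 'n = 1] by simp

lemma holomorphic_affine_coord_line:
  "holomorphic_fun (proj_space 1) lineA (affine_piece 1 m) (affine_coord m j)"
  using holomorphic_affine_coord_proj[where 'n = 1] by simp

lemma continuous_line_to_famX: "continuous_map (proj_space 1) famX (\<lambda>P. (0, P))"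
proof -
  have "continuous_map (top_of_set (\<Union>(proj_points 1))) (proj_space 5) (\<lambda>v. proj_pt 5 (\<lambda>i. if i \<le> 1 then v i else 0))"
  proof (rule continuous_map_proj_pt)
    show "continuous_map (top_of_set (\<Union>(proj_points 1))) euclidean (\<lambda>v. if i \<le> 1 then v i else 0 :: complex)" for i
      by (cases "i \<le> 1") (simp_all add: continuous_on_fun_coord)
    fix v assume "v \<in> topspace (top_of_set (\<Union>(proj_points 1)))"
    then have "\<exists>i\<le>1. v i \<noteq> 0" unfolding Union_proj_points by simp
    then obtain i where "i \<le> 1" "v i \<noteq> 0" by blast
    then show "\<exists>i\<le>5. (if i \<le> 1 then v i else 0) \<noteq> 0" by (intro exI[of _ i]) simp
  qed
  then have "continuous_map (top_of_set (\<Union>(proj_points 1))) (proj_space 5) ((\<lambda>P. P) \<circ> proj_pt 1)"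
    unfolding o_def proj_pt_1_5[symmetric] .
  then have "continuous_map (proj_space 1) (proj_space 5) (\<lambda>P. P)"
    by (rule continuous_compose_quotient_map[OF quotient_map_proj_pt])
  then have "continuous_map (proj_space 1) disc_proj (\<lambda>P. (0, P))"
    unfolding continuous_map_pairwise by (simp add: o_def)
  moreover have "(\<lambda>P. (0, P)) \<in> topspace (proj_space 1) \<rightarrow> scroll_family"
  proof
    fix P assume "P \<in> topspace (proj_space 1)"
    then have "(0, P) \<in> negcurve" unfolding negcurve_def by simp
    then have "(0, P) \<in> F2" by (rule subsetD[OF negcurve_subset])
    then show "(0, P) \<in> scroll_family" by (simp add: fib_iff)
  qed
  ultimately show ?thesis unfolding famX_def continuous_map_in_subtopology by (rule conjI)
qed

lemma continuous_line_to_negcurve: "continuous_map (proj_space 1) negcurveT (\<lambda>P. (0, P))"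
proof -
  have e: "(\<lambda>P. (0, P)) \<in> topspace (proj_space 1) \<rightarrow> negcurve"
    unfolding negcurve_def by simp
  then have "(\<lambda>P. (0, P)) \<in> topspace (proj_space 1) \<rightarrow> F2"
    by (rule subsetD[OF Pi_mono, rotated]) (rule negcurve_subset)
  with e continuous_line_to_famX show ?thesis
    unfolding continuous_map_in_subtopology by (intro conjI)
qed

lemma Hausdorff_F2T: "Hausdorff_space F2T"
  using complex_manifold_fib[of 0] unfolding complex_manifold_def by simp

text \<open>
  A continuous bijection from a compact space to a Hausdorff space.
\<close>

lemma homeomorphic_line_negcurve: "homeomorphic_map (proj_space 1) negcurveT (\<lambda>P. (0, P))"
proof (rule continuous_imp_homeomorphic_map[OF continuous_line_to_negcurve compact_space_proj_space])
  show "Hausdorff_space negcurveT" by (rule Hausdorff_space_subtopology[OF Hausdorff_F2T])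
  show "(\<lambda>P. (0, P)) ` topspace (proj_space 1) = topspace negcurveT"
    unfolding topspace_negcurveT by (auto simp: negcurve_def)
  show "inj_on (\<lambda>P. (0 :: complex, P)) (topspace (proj_space 1))" by (rule inj_onI) simp
qed

lemma continuous_negcurve_snd: "continuous_map negcurveT (proj_space 1) snd"
proof -
  obtain g where g: "homeomorphic_maps (proj_space 1) negcurveT (\<lambda>P. (0, P)) g"
    using homeomorphic_line_negcurve unfolding homeomorphic_map_maps by blast
  have "continuous_map negcurveT (proj_space 1) g" using g unfolding homeomorphic_maps_def by blast
  then show ?thesis
  proof (rule continuous_map_eq)
    fix p assume "p \<in> topspace negcurveT"
    then obtain P where "p = (0, P)" "P \<in> proj_points 1" unfolding topspace_negcurveT negcurve_def by auto
    then show "g p = snd p" using g unfolding homeomorphic_maps_def by simp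
  qed
qed

lemma smooth_rational_negcurve: "smooth_rational_curve F2T F2A negcurve"
  unfolding smooth_rational_curve_def
proof (intro conjI exI)
  have c0: "chart_atlas F2T F2A" by (rule chart_atlas_fib) simp
  have "compactin F2T negcurve"
  proof -
    have "compactin negcurveT ((\<lambda>P. (0, P)) ` proj_points 1)"
      by (rule image_compactin[OF _ continuous_line_to_negcurve])
        (use compact_space_proj_space[of 1] in \<open>simp add: compact_space_def\<close>)
    moreover have "(\<lambda>P. (0, P)) ` proj_points 1 = negcurve" unfolding negcurve_def by auto
    ultimately show ?thesis by (simp add: compactin_subtopology)
  qed
  then show "closedin F2T negcurve" by (rule compactin_imp_closedin[OF Hausdorff_F2T])
  show "complex_manifold negcurveT negcurveA" by (rule complex_manifold_negcurve)
  let ?f = "\<lambda>P. (0 :: complex, P)"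
  show "biholomorphic_map (proj_space 1) lineA negcurveT negcurveA (proj_points 1) negcurve ?f"
    unfolding biholomorphic_map_def
  proof (intro conjI)
    show bij: "bij_betw ?f (proj_points 1) negcurve" unfolding bij_betw_def negcurve_def by (auto simp: inj_on_def)
    have im: "?f ` proj_points 1 \<subseteq> negcurve" unfolding negcurve_def by blast
    have "holomorphic_map (proj_space 1) lineA famX atlasX (proj_points 1) ?f"
    proof (rule holomorphic_mapI)
      show "openin (proj_space 1) (proj_points 1)" using openin_topspace[of "proj_space 1"] by simp
      show "continuous_map (subtopology (proj_space 1) (proj_points 1)) famX ?f"
        by (rule continuous_map_from_subtopology[OF continuous_line_to_famX])
      fix V d and j :: 3 assume "(V,d) \<in> atlasX"
      then obtain l where l: "l < 4" "V = pieceX (piv l)" "d = chX l" unfolding atlasX_def by blast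
      have s: "{x \<in> proj_points 1. ?f x \<in> V} = affine_piece 1 (piv l)"
        unfolding l using negcurve_piece_iff affine_pieceD(4)[of _ 1 "piv l"] by auto
      have "holomorphic_fun (proj_space 1) lineA (affine_piece 1 (piv l)) (\<lambda>_. 0)"
        by (rule holomorphic_fun_const[OF line_atlas openin_affine_piece])
      then show "holomorphic_fun (proj_space 1) lineA {x \<in> proj_points 1. ?f x \<in> V} (\<lambda>x. d (?f x) $ j)"
        unfolding s l(3) using exhaust_3[of j] holomorphic_affine_coord_line[of "piv l"]
        by (elim disjE) (simp_all add: chX_nth affX_def)
    qed
    then have "holomorphic_map (proj_space 1) lineA F2T F2A (proj_points 1) ?f"
      by (rule holomorphic_map_into_submanifold[OF line_atlas chart_atlasX]) (use im negcurve_subset in blast)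
    then show "holomorphic_map (proj_space 1) lineA negcurveT negcurveA (proj_points 1) ?f"
      by (rule holomorphic_map_into_submanifold[OF line_atlas c0 _ im])
    have "holomorphic_map negcurveT negcurveA (proj_space 1) lineA negcurve snd"
    proof (rule holomorphic_mapI)
      show "openin negcurveT negcurve" using openin_topspace[of negcurveT] unfolding topspace_negcurveT .
      show "continuous_map (subtopology negcurveT negcurve) (proj_space 1) snd"
        by (rule continuous_map_from_subtopology[OF continuous_negcurve_snd])
      fix V d and j :: 1 assume "(V,d) \<in> lineA"
      then obtain i e where Vd: "V = affine_piece 1 i" "d = (\<lambda>P. \<chi> k. affine_coord i (e k) P)"
        and e: "bij_betw e (UNIV :: 1 set) ({..1} - {i})"
        unfolding proj_atlas_def by auto
      have "e j \<in> {..1}" by (rule DiffD1[OF bspec[OF bij_betwE[OF e] UNIV_I]])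
      then have ej: "e j \<le> 5" unfolding atMost_iff by linarith
      have s: "{x \<in> negcurve. snd x \<in> V} = (pieceX i \<inter> F2) \<inter> negcurve"
        unfolding Vd using negcurve_piece_iff[of _ i] negcurve_subset by (auto simp: negcurve_def)
      have "holomorphic_fun negcurveT negcurveA ((pieceX i \<inter> F2) \<inter> negcurve) (affX i (e j))"
        by (rule holomorphic_fun_restrict[OF c0 holomorphic_affX_fib[OF ej]])
      then show "holomorphic_fun negcurveT negcurveA {x \<in> negcurve. snd x \<in> V} (\<lambda>x. d (snd x) $ j)"
        unfolding s Vd(2) affX_fun by simp
    qed
    then show "holomorphic_map negcurveT negcurveA (proj_space 1) lineA negcurve (inv_into (proj_points 1) ?f)"
    proof (rule holomorphic_map_cong[OF complex_manifold_chart_atlas[OF complex_manifold_negcurve]])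
      fix p assume "p \<in> negcurve"
      then obtain P where P: "p = ?f P" "P \<in> proj_points 1" unfolding negcurve_def by auto
      have "inv_into (proj_points 1) ?f (?f P) = P"
        by (rule inv_into_f_f[OF bij_betw_imp_inj_on[OF bij] P(2)])
      then show "snd p = inv_into (proj_points 1) ?f p" unfolding P(1) by simp
    qed
  qed
qed

section \<open>The line bundle\<close>

text \<open>
  The bundle is trivialized on the four charts; the remaining members of the cover are empty.
\<close>

definition Lcover :: "nat \<Rightarrow> (complex \<times> hpoint) set" where
  "Lcover i = (if i < 4 then pieceX (piv i) else {})"

abbreviation cf :: "nat \<Rightarrow> nat \<Rightarrow> complex \<times> hpoint \<Rightarrow> complex" where
  "cf i j \<equiv> affX (piv i) j"

definition base :: "nat \<Rightarrow> complex \<times> hpoint \<Rightarrow> complex" where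
  "base i = cf i (co1 i)"

text \<open>
  The transition functions of \<open>H\<close> are \<open>v\<^bsub>piv j\<^esub> / v\<^bsub>piv i\<^esub>\<close>. Those of \<open>-2F\<close> are 1 between charts over
  the same affine piece of the base and \<open>x\<^sup>-\<^sup>2\<close> between charts over different ones.
\<close>

definition Ltrans :: "nat \<Rightarrow> nat \<Rightarrow> complex \<times> hpoint \<Rightarrow> complex" where
  "Ltrans i j p = cf i (piv j) p * (if (i < 2) = (j < 2) then 1 else inverse (base i p ^ 2))"

lemma Lcover_less: "p \<in> Lcover i \<Longrightarrow> i < 4" and Lcover_piece: "p \<in> Lcover i \<Longrightarrow> p \<in> pieceX (piv i)"
  by (auto simp: Lcover_def split: if_splits)

lemma openin_Lcover: "openin famX (Lcover i)"
  unfolding Lcover_def using openin_pieceX by simp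

lemma cf_change:
  assumes "p \<in> Lcover i" "p \<in> Lcover j" "l \<le> 5"
  shows "cf i l p = cf i (piv j) p * cf j l p" "cf i (piv j) p \<noteq> 0"
proof -
  note pc = Lcover_piece[OF assms(1)] Lcover_piece[OF assms(2)]
  show n: "cf i (piv j) p \<noteq> 0" using pieceX_iff[OF pc(1), of "piv j"] pc(2) by blast
  show "cf i l p = cf i (piv j) p * cf j l p" using affX_change[OF pc assms(3)] n by simp
qed

lemma Lcover_par:
  assumes "p \<in> Lcover i"
  shows "i < 4" "l \<le> 5 \<Longrightarrow> cf i l p = hc i (fst p) (base i p) (cf i (co2 i) p) l" "norm (fst p) < 1"
proof -
  show i: "i < 4" by (rule Lcover_less[OF assms])
  have pp: "p \<in> pieceX (piv i)" by (rule Lcover_piece[OF assms])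
  then show "norm (fst p) < 1" using scroll_familyD(1) unfolding pieceX_def by blast
  assume l: "l \<le> 5"
  have "cf i l p = cf i l (par i (fst p) (cf i (co1 i) p) (cf i (co2 i) p))"
    unfolding par_affX[OF i pp] ..
  also have "\<dots> = hc i (fst p) (base i p) (cf i (co2 i) p) l"
    unfolding base_def by (rule affX_par_own[OF i l])
  finally show "cf i l p = hc i (fst p) (base i p) (cf i (co2 i) p) l" .
qed

lemma hc_base:
  assumes "i < 4" "j < 4" "hc i t x y (piv j) \<noteq> 0"
  shows "if (i < 2) = (j < 2) then hc i t x y (co1 j) = x * hc i t x y (piv j)
     else x \<noteq> 0 \<and> x * hc i t x y (co1 j) = hc i t x y (piv j)"
  using k_cases[OF assms(1)] k_cases[OF assms(2)] assms(3)
  by (elim disjE) (auto simp: hc_def piv_def co1_def algebra_simps power2_eq_square power3_eq_cube)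

text \<open>
  The function \<open>base i\<close> is the ratio of the rows of the matrix or its inverse, depending on the side.
\<close>

lemma base_change:
  assumes "p \<in> Lcover i" "p \<in> Lcover j"
  shows "(i < 2) = (j < 2) \<Longrightarrow> base i p = base j p"
    "(i < 2) \<noteq> (j < 2) \<Longrightarrow> base i p \<noteq> 0 \<and> base i p * base j p = 1"
proof -
  let ?x = "base i p" and ?y = "cf i (co2 i) p" and ?t = "fst p"
  note I = Lcover_par[OF assms(1)] and J = Lcover_par[OF assms(2)]
  have n: "hc i ?t ?x ?y (piv j) \<noteq> 0"
    using cf_change(2)[OF assms, of 0] I(2)[OF piv_co_le(1)] by simp
  have b: "base j p = hc i ?t ?x ?y (co1 j) / hc i ?t ?x ?y (piv j)"
  proof -
    have "cf i (co1 j) p = cf i (piv j) p * base j p"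
      unfolding base_def by (rule cf_change(1)[OF assms piv_co_le(2)])
    then have "hc i ?t ?x ?y (co1 j) = hc i ?t ?x ?y (piv j) * base j p"
      unfolding I(2)[OF piv_co_le(1)] I(2)[OF piv_co_le(2)] .
    then show ?thesis using n by simp
  qed
  note h = hc_base[OF I(1) J(1) n]
  show "(i < 2) = (j < 2) \<Longrightarrow> base i p = base j p"
    unfolding b using h n by simp
  show "(i < 2) \<noteq> (j < 2) \<Longrightarrow> base i p \<noteq> 0 \<and> base i p * base j p = 1"
    unfolding b using h n by simp
qed

lemma Ltrans_nz: "p \<in> Lcover i \<Longrightarrow> p \<in> Lcover j \<Longrightarrow> Ltrans i j p \<noteq> 0"
  using cf_change(2)[of p i j 0] base_change(2)[of p i j] unfolding Ltrans_def by auto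

lemma line_bundle_L: "line_bundle famX atlasX Lcover Ltrans"
  unfolding line_bundle_def
proof (intro conjI allI)
  show "openin famX (Lcover i)" for i by (rule openin_Lcover)
  show "(\<Union>i. Lcover i) = topspace famX"
    unfolding topspace_famX scroll_family_pieces by (auto simp: Lcover_def split: if_splits)
  fix i j
  let ?W = "Lcover i \<inter> Lcover j"
  have W: "openin famX ?W" by (intro openin_Int openin_Lcover)
  have sub: "?W \<subseteq> pieceX (piv i)" using Lcover_piece by blast
  have h: "holomorphic_fun famX atlasX ?W (cf i l)" if "l \<le> 5" for l
    by (rule holomorphic_fun_subset[OF chart_atlasX holomorphic_affX[OF that] W sub])
  show "\<forall>x\<in>?W. Ltrans i j x \<noteq> 0" using Ltrans_nz by blast
  show "holomorphic_fun famX atlasX ?W (Ltrans i j)"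
  proof (cases "(i < 2) = (j < 2)")
    case True
    then have "Ltrans i j = cf i (piv j)" by (simp add: fun_eq_iff Ltrans_def)
    then show ?thesis using h[OF piv_co_le(1)] by simp
  next
    case False
    then have e: "Ltrans i j = (\<lambda>x. cf i (piv j) x / base i x ^ 2)"
      by (simp add: fun_eq_iff Ltrans_def divide_inverse)
    show ?thesis unfolding e
      by (rule holomorphic_fun_divide[OF chart_atlasX h[OF piv_co_le(1)]])
        (use h[OF piv_co_le(2)[of i]] base_change(2)[of _ i j] False in \<open>auto simp: base_def intro!: holomorphic_fun_power\<close>)
  qed
next
  fix i j k
  show "\<forall>x\<in>Lcover i \<inter> Lcover j \<inter> Lcover k. Ltrans i j x * Ltrans j k x = Ltrans i k x"
  proof
    fix x assume "x \<in> Lcover i \<inter> Lcover j \<inter> Lcover k"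
    then have x: "x \<in> Lcover i" "x \<in> Lcover j" "x \<in> Lcover k" by auto
    have c: "cf i (piv k) x = cf i (piv j) x * cf j (piv k) x" by (rule cf_change(1)[OF x(1,2) piv_co_le(1)])
    have s: "(i < 2) = (j < 2) \<Longrightarrow> base j x = base i x" using base_change(1)[OF x(1,2)] by simp
    have m: "(i < 2) \<noteq> (j < 2) \<Longrightarrow> base i x \<noteq> 0 \<and> base j x = inverse (base i x)"
    proof -
      assume "(i < 2) \<noteq> (j < 2)"
      from base_change(2)[OF x(1,2) this] have b: "base i x \<noteq> 0" "base i x * base j x = 1" by blast+
      from inverse_unique[OF b(2)] b(1) show "base i x \<noteq> 0 \<and> base j x = inverse (base i x)" by simp
    qed
    show "Ltrans i j x * Ltrans j k x = Ltrans i k x"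
    proof (cases "(i < 2) = (j < 2)")
      case True
      then show ?thesis unfolding Ltrans_def c using s[OF True] by simp
    next
      case False
      then show ?thesis unfolding Ltrans_def c using m[OF False]
        by (cases "(j < 2) = (k < 2)") (auto simp: power_inverse)
    qed
  qed
qed

text \<open>
  On the family \<open>v\<^sub>4 - t v\<^sub>1 = x\<^sup>2 v\<^sub>2\<close>, where \<open>x\<close> is the ratio of the rows; so \<open>v\<^sub>2\<close> over the first affine
  piece of the base and \<open>v\<^sub>4 - t v\<^sub>1\<close> over the second one are the same section.
\<close>

definition Lsection :: "nat \<Rightarrow> complex \<times> hpoint \<Rightarrow> complex" where
  "Lsection i p = (if i < 2 then cf i 2 p else cf i 4 p - fst p * cf i 1 p)"

lemma hc_section:
  assumes "i < 4"
  shows "if i < 2 then hc i t x y 4 - t * hc i t x y 1 = x ^ 2 * hc i t x y 2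
    else hc i t x y 2 = x ^ 2 * (hc i t x y 4 - t * hc i t x y 1)"
  using k_cases[OF assms]
  by (elim disjE) (simp_all add: hc_def algebra_simps power2_eq_square power3_eq_cube)

lemma effective_L: "effective famX atlasX Lcover Ltrans"
  unfolding effective_def holomorphic_section_def
proof (intro exI[of _ Lsection] conjI allI ballI)
  fix i
  have h: "holomorphic_fun famX atlasX (Lcover i) (cf i l)" if "l \<le> 5" for l
    by (rule holomorphic_fun_subset[OF chart_atlasX holomorphic_affX[OF that] openin_Lcover])
      (use Lcover_piece in blast)
  have f: "holomorphic_fun famX atlasX (Lcover i) fst" by (rule holomorphic_fun_fst[OF openin_Lcover])
  show "holomorphic_fun famX atlasX (Lcover i) (Lsection i)"
  proof (cases "i < 2")
    case True
    then have "Lsection i = cf i 2" by (simp add: fun_eq_iff Lsection_def)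
    then show ?thesis using h[of 2] by simp
  next
    case False
    then have "Lsection i = (\<lambda>p. cf i 4 p - fst p * cf i 1 p)" by (simp add: fun_eq_iff Lsection_def)
    then show ?thesis by (simp only:) (intro holomorphic_fun_diff holomorphic_fun_mult h f, simp_all)
  qed
next
  fix i j x assume "x \<in> Lcover i \<inter> Lcover j"
  then have x: "x \<in> Lcover i" "x \<in> Lcover j" by auto
  note c = cf_change(1)[OF x] and I = Lcover_par[OF x(1)]
  have l: "(1::nat) \<le> 5" "(2::nat) \<le> 5" "(4::nat) \<le> 5" by auto
  have s: "if i < 2 then cf i 4 x - fst x * cf i 1 x = base i x ^ 2 * cf i 2 x
    else cf i 2 x = base i x ^ 2 * (cf i 4 x - fst x * cf i 1 x)"
    using hc_section[OF I(1), of "fst x" "base i x" "cf i (co2 i) x"] unfolding I(2)[OF l(1)] I(2)[OF l(2)] I(2)[OF l(3)] .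
  have d: "cf i 4 x - fst x * cf i 1 x = cf i (piv j) x * (cf j 4 x - fst x * cf j 1 x)"
    unfolding c[OF l(1)] c[OF l(3)] by (simp add: algebra_simps)
  show "Lsection i x = Ltrans i j x * Lsection j x"
  proof (cases "(i < 2) = (j < 2)")
    case True
    then show ?thesis unfolding Lsection_def Ltrans_def using c[OF l(2)] d by simp
  next
    case False
    then have "base i x \<noteq> 0" using base_change(2)[OF x] by blast
    then show ?thesis using s c[OF l(2)] d False
      unfolding Lsection_def Ltrans_def by (cases "i < 2") (auto simp: field_simps)
  qed
next
  show "\<exists>i. \<exists>x\<in>Lcover i. Lsection i x \<noteq> 0"
  proof (intro exI bexI)
    show "Lsection 0 (par 0 0 1 1) \<noteq> 0"
      using affX_par_own[of 0 2 0 1 1] by (simp add: Lsection_def hc_def)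
    show "par 0 0 1 1 \<in> Lcover 0" using par_in_own_piece[of 0 0 1 1] by (simp add: Lcover_def)
  qed
qed

section \<open>The metric with minimal singularities\<close>

definition fcoord :: "nat \<Rightarrow> complex \<times> hpoint \<Rightarrow> complex" where
  "fcoord i = cf i (co2 i)"

text \<open>
  Three sections of \<open>2L\<close> over the central fibre, in the coordinates of the charts. In homogeneous
  coordinates they are \<open>v\<^sub>0 v\<^sub>2\<close>, \<open>v\<^sub>2\<^sup>2\<close>, \<open>v\<^sub>3\<^sup>2\<close> over the first affine piece of the base and
  \<open>v\<^sub>1 v\<^sub>5\<close>, \<open>v\<^sub>5\<^sup>2\<close>, \<open>v\<^sub>4\<^sup>2\<close> over the second; the last two are interchanged by the transition.
  They have no common zero in the charts 1 and 3, and in the charts 0 and 2 they vanish together where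
  \<open>y = 0\<close>, that is, on \<open>E\<close>.
\<close>

definition gens :: "nat \<Rightarrow> nat \<Rightarrow> complex \<Rightarrow> complex \<Rightarrow> complex" where
  "gens i j x y = (if j = 0 then y
     else if i = 0 \<or> i = 2 then (if j = 1 then y^2 else (x * y)^2)
     else (if j = 1 then 1 else x^2))"

definition wt :: "nat \<Rightarrow> complex \<Rightarrow> complex \<Rightarrow> real" where
  "wt i x y = max (norm (gens i 0 x y)) (max (norm (gens i 1 x y)) (norm (gens i 2 x y)))"

text \<open>
  Sections \<open>s\<close> of \<open>2L\<close> define the weight \<open>1/2 log max \<bar>s\<bar>\<^sup>2 = log max \<bar>s\<bar>\<close> of a metric on \<open>L\<close>.
\<close>

definition metric0 :: "nat \<Rightarrow> complex \<times> hpoint \<Rightarrow> ereal" where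
  "metric0 i p = elog (wt i (base i p) (fcoord i p))"

lemma wt_even: "i = 0 \<or> i = 2 \<Longrightarrow> wt i x y = max (norm y) (max ((norm y)\<^sup>2) ((norm x)\<^sup>2 * (norm y)\<^sup>2))"
  and wt_odd: "\<not> (i = 0 \<or> i = 2) \<Longrightarrow> wt i x y = max (norm y) (max 1 ((norm x)\<^sup>2))"
  by (simp_all add: wt_def gens_def norm_power norm_mult power_mult_distrib)

text \<open>
  The three sections are permuted by the transition and multiplied by the square of that of \<open>L\<close>.
\<close>

lemma wt_change:
  assumes "i < 4" "j < 4" "hc i 0 x y (piv j) \<noteq> 0"
  shows "wt i x y = (norm (hc i 0 x y (piv j) * (if (i < 2) = (j < 2) then 1 else inverse (x ^ 2))))\<^sup>2
    * wt j (hc i 0 x y (co1 j) / hc i 0 x y (piv j)) (hc i 0 x y (co2 j) / hc i 0 x y (piv j))"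
proof -
  have ev: "max a (max b c) = max a (max c b)" for a b c :: real by (simp add: max.commute)
  have e: "wt k = (\<lambda>x y. if k = 0 \<or> k = 2 then max (norm y) (max ((norm y)\<^sup>2) ((norm x)\<^sup>2 * (norm y)\<^sup>2))
    else max (norm y) (max 1 ((norm x)\<^sup>2)))" for k
    using wt_even[of k] wt_odd[of k] by (intro ext) auto
  have p6: "a ^ 6 = a * (a * (a * (a * (a * a))))" for a :: real by (simp add: numeral_eq_Suc)
  show ?thesis
    unfolding e using k_cases[OF assms(1)] k_cases[OF assms(2)] assms(3)
    apply (elim disjE)
    apply (simp_all add: hc_def piv_def co1_def co2_def norm_mult norm_divide norm_power norm_inverse
        max_mult_distrib_left power_mult_distrib power_divide)
    apply (simp_all add: field_simps max.commute max.left_commute power2_eq_square power3_eq_cube power4_eq_xxxx p6)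
    done
qed

lemma coords_par: "k < 4 \<Longrightarrow> base k (par k t x y) = x" "k < 4 \<Longrightarrow> fcoord k (par k t x y) = y"
  by (simp_all add: base_def fcoord_def affX_par_own piv_co_le hc_values)

lemma par_coords: "p \<in> Lcover i \<Longrightarrow> par i (fst p) (base i p) (fcoord i p) = p"
  unfolding base_def fcoord_def by (rule par_affX[OF Lcover_less Lcover_piece])

lemma par_Lcover: "k < 4 \<Longrightarrow> norm t < 1 \<Longrightarrow> par k t x y \<in> Lcover k"
  using par_in_own_piece by (simp add: Lcover_def)

lemma coords_change:
  assumes "p \<in> Lcover i" "p \<in> Lcover j"
  defines "h \<equiv> hc i (fst p) (base i p) (fcoord i p)"
  shows "h (piv j) \<noteq> 0" "base j p = h (co1 j) / h (piv j)" "fcoord j p = h (co2 j) / h (piv j)"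
    "Ltrans i j p = h (piv j) * (if (i < 2) = (j < 2) then 1 else inverse (base i p ^ 2))"
proof -
  have h: "cf i l p = h l" if "l \<le> 5" for l
    unfolding h_def fcoord_def by (rule Lcover_par(2)[OF assms(1) that])
  show n: "h (piv j) \<noteq> 0" using cf_change(2)[OF assms(1,2), of 0] h[OF piv_co_le(1)] by simp
  have c: "h l = h (piv j) * cf j l p" if "l \<le> 5" for l
    using cf_change(1)[OF assms(1,2) that] unfolding h[OF that] h[OF piv_co_le(1)] .
  show "base j p = h (co1 j) / h (piv j)" unfolding base_def using c[OF piv_co_le(2)[of j]] n by simp
  show "fcoord j p = h (co2 j) / h (piv j)" unfolding fcoord_def using c[OF piv_co_le(3)[of j]] n by simp
  show "Ltrans i j p = h (piv j) * (if (i < 2) = (j < 2) then 1 else inverse (base i p ^ 2))"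
    unfolding Ltrans_def h[OF piv_co_le(1)] ..
qed

lemma wt_Ltrans:
  assumes "p \<in> Lcover i" "p \<in> Lcover j" "fst p = 0"
  shows "wt i (base i p) (fcoord i p) = (norm (Ltrans i j p))\<^sup>2 * wt j (base j p) (fcoord j p)"
  using wt_change[OF Lcover_less[OF assms(1)] Lcover_less[OF assms(2)], of "base i p" "fcoord i p"]
    coords_change[OF assms(1,2)] assms(3) by simp

lemma elog_mult: "0 < a \<Longrightarrow> elog (a * b) = elog b + ereal (ln a)"
  if "0 \<le> b" for a b
  using that by (auto simp: elog_def ln_mult)

lemma wt_nonneg: "0 \<le> wt i x y" by (simp add: wt_def le_max_iff_disj)

lemma wt_zero_iff: "wt i x y = 0 \<longleftrightarrow> (i = 0 \<or> i = 2) \<and> y = 0"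
proof -
  have "wt i x y > 0" if "\<not> ((i = 0 \<or> i = 2) \<and> y = 0)"
    using that by (auto simp: wt_def gens_def less_max_iff_disj)
  moreover have "wt i x y = 0" if "(i = 0 \<or> i = 2) \<and> y = 0"
    using that by (auto simp: wt_even)
  ultimately show ?thesis by (metis less_irrefl)
qed

lemma metric0_transition:
  assumes "p \<in> Lcover i" "p \<in> Lcover j" "fst p = 0"
  shows "metric0 i p = metric0 j p + ereal (ln ((norm (Ltrans i j p))\<^sup>2))"
  unfolding metric0_def wt_Ltrans[OF assms]
  by (rule elog_mult[OF wt_nonneg]) (use Ltrans_nz[OF assms(1,2)] in simp)

lemma openin_Lcover_F2: "openin F2T (Lcover i \<inter> F2)"
  using openin_fib_piece[of 0 "piv i"] unfolding Lcover_def by simp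

lemma F2_fst: "p \<in> F2 \<Longrightarrow> fst p = 0" by (simp add: fib_iff)

definition gen_fun :: "nat \<Rightarrow> nat \<Rightarrow> complex \<times> hpoint \<Rightarrow> complex" where
  "gen_fun i j p = gens i j (base i p) (fcoord i p)"

lemma holomorphic_gen_fun: "holomorphic_fun F2T F2A (Lcover i \<inter> F2) (gen_fun i j)"
proof -
  have c0: "chart_atlas F2T F2A" by (rule chart_atlas_fib) simp
  have h: "holomorphic_fun F2T F2A (Lcover i \<inter> F2) (cf i l)" if "l \<le> 5" for l
    by (rule holomorphic_fun_subset[OF c0 holomorphic_affX_fib[OF that] openin_Lcover_F2])
      (use Lcover_piece in blast)
  have b: "holomorphic_fun F2T F2A (Lcover i \<inter> F2) (base i)"
    and f: "holomorphic_fun F2T F2A (Lcover i \<inter> F2) (fcoord i)"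
    unfolding base_def fcoord_def by (rule h[OF piv_co_le(2)], rule h[OF piv_co_le(3)])
  note one = holomorphic_fun_const[OF c0 openin_Lcover_F2, of i 1]
  consider "j = 0" | "j \<noteq> 0" "i = 0 \<or> i = 2" "j = 1" | "j \<noteq> 0" "i = 0 \<or> i = 2" "j \<noteq> 1"
    | "j \<noteq> 0" "\<not> (i = 0 \<or> i = 2)" "j = 1" | "j \<noteq> 0" "\<not> (i = 0 \<or> i = 2)" "j \<noteq> 1" by blast
  then show ?thesis
  proof cases
    case 1
    then have "gen_fun i j = fcoord i" by (simp add: fun_eq_iff gen_fun_def gens_def)
    then show ?thesis using f by (simp only:)
  next
    case 2
    then have "gen_fun i j = (\<lambda>p. fcoord i p ^ 2)" by (simp only: fun_eq_iff gen_fun_def gens_def if_True if_False refl) simp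
    then show ?thesis using holomorphic_fun_power[OF f, of 2] by (simp only:)
  next
    case 3
    then have "gen_fun i j = (\<lambda>p. (base i p * fcoord i p) ^ 2)" by (simp only: fun_eq_iff gen_fun_def gens_def if_True if_False refl) simp
    then show ?thesis using holomorphic_fun_power[OF holomorphic_fun_mult[OF b f], of 2] by (simp only:)
  next
    case 4
    then have "gen_fun i j = (\<lambda>p. 1)" by (simp only: fun_eq_iff gen_fun_def gens_def if_True if_False refl) simp
    then show ?thesis using one by (simp only:)
  next
    case 5
    then have "gen_fun i j = (\<lambda>p. base i p ^ 2)" by (simp only: fun_eq_iff gen_fun_def gens_def if_True if_False refl) simp
    then show ?thesis using holomorphic_fun_power[OF b, of 2] by (simp only:)
  qed
qed

lemma metric0_generators:
  "j < 3 \<Longrightarrow> elog (norm (gen_fun i j p)) \<le> metric0 i p"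
  "\<exists>j<3. metric0 i p = elog (norm (gen_fun i j p))"
proof -
  have mono: "elog a \<le> elog b" if "0 \<le> a" "a \<le> b" for a b
    using that by (auto simp: elog_def)
  let ?n = "\<lambda>j. norm (gen_fun i j p)"
  have m: "wt i (base i p) (fcoord i p) = max (?n 0) (max (?n 1) (?n 2))" by (simp add: wt_def gen_fun_def)
  have three: "j = 0 \<or> j = 1 \<or> j = 2" if "j < 3" for j :: nat using that by auto
  show "elog (norm (gen_fun i j p)) \<le> metric0 i p" if "j < 3"
    unfolding metric0_def m
  proof (rule mono[OF norm_ge_zero])
    show "?n j \<le> max (?n 0) (max (?n 1) (?n 2))" using three[OF that] by (elim disjE) simp_all
  qed
  have "max a (max b c) = a \<or> max a (max b c) = b \<or> max a (max b c) = c" for a b c :: real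
    by (simp add: max_def)
  from this[of "?n 0" "?n 1" "?n 2"] show "\<exists>j<3. metric0 i p = elog (norm (gen_fun i j p))"
    unfolding metric0_def m
    by (elim disjE) (rule exI[of _ 0], simp, rule exI[of _ 1], simp, rule exI[of _ 2], simp)
qed

text \<open>
  Excludes the weight that is \<open>-\<infinity>\<close> on a whole component of a chart.
\<close>

lemma metric0_generic:
  assumes p: "par k 0 x y \<in> Lcover i" and k: "k < 4" and y: "y \<noteq> 0"
  shows "metric0 i (par k 0 x y) \<noteq> -\<infinity>"
proof -
  have pk: "par k 0 x y \<in> Lcover k" by (rule par_Lcover[OF k]) simp
  have "wt i (base i (par k 0 x y)) (fcoord i (par k 0 x y)) \<noteq> 0"
    unfolding wt_Ltrans[OF p pk par_simps(1)] coords_par[OF k]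
    using Ltrans_nz[OF p pk] y by (simp add: wt_zero_iff)
  then show ?thesis by (simp add: metric0_def elog_def)
qed

lemma psh_metric0: "psh_fun F2T F2A (Lcover i \<inter> F2) (metric0 i)"
  unfolding psh_fun_def
proof (intro conjI ballI openin_Lcover_F2)
  fix x assume "x \<in> F2A"
  then obtain V c where x: "x = (V,c)" "(V,c) \<in> F2A" by (cases x) blast
  have c0: "chart_atlas F2T F2A" by (rule chart_atlas_fib) simp
  let ?W = "c ` (V \<inter> (Lcover i \<inter> F2))"
  have W: "open ?W" by (rule chart_open_image[OF c0 x(2) openin_Lcover_F2])
  have "plurisubharmonic_on (\<lambda>z. metric0 i (inv_into V c z)) ?W"
  proof (rule plurisubharmonic_on_log_max[where k = 3 and f = "\<lambda>j z. gen_fun i j (inv_into V c z)"])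
    fix j :: nat
    show "mv_holomorphic_on (\<lambda>z. gen_fun i j (inv_into V c z)) ?W"
      using holomorphic_gen_fun[of i j] x(2) unfolding holomorphic_fun_def by blast
  next
    fix K assume K: "K \<in> components ?W"
    then have oK: "open K" "K \<subseteq> ?W" "K \<noteq> {}"
      using open_components[OF W K] in_components_subset[OF K] in_components_nonempty[OF K] by blast+
    have hp: "hol_param F2T F2A (c ` V) (inv_into V c)"
      by (rule manifold_chart_param[OF complex_manifold_fib x(2)]) simp
    have ci: "continuous_map (subtopology F2T V) (top_of_set (c ` V)) c"
      using chart_atlasD(3)[OF c0 x(2)] homeomorphic_imp_continuous_map by blast
    note chartsub = chart_atlasD(5)[OF c0 x(2)]
    have KV: "K \<subseteq> c ` V" using oK(2) by blast
    have "openin (top_of_set (c ` V)) K" by (rule open_subset[OF KV oK(1)])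
    from openin_continuous_map_preimage[OF ci this]
    have "openin (subtopology F2T V) {q \<in> topspace (subtopology F2T V). c q \<in> K}" .
    then have "openin (subtopology F2T V) {q\<in>V. c q \<in> K}"
      unfolding topspace_subtopology_subset[OF chartsub] .
    then have O: "openin F2T {q\<in>V. c q \<in> K}"
      by (rule openin_trans_full[OF _ chart_atlasD(1)[OF c0 x(2)]])
    obtain z where z: "z \<in> K" using oK(3) unfolding ex_in_conv[symmetric] by (rule exE)
    from subsetD[OF KV z] obtain q where q: "z = c q" "q \<in> V" by (rule imageE)
    have qi: "q \<in> {q\<in>V. c q \<in> K}" using q(2) z unfolding q(1) by (intro CollectI conjI)
    obtain k a b where kab: "k < 4" "par k 0 a b \<in> {q\<in>V. c q \<in> K}" "a \<noteq> 0" "b \<noteq> 0"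
      by (rule fib_open_generic_point[OF _ O qi]) (simp, rule that)
    then have pp: "par k 0 a b \<in> V" "c (par k 0 a b) \<in> K" by auto
    have inv: "inv_into V c (c (par k 0 a b)) = par k 0 a b"
      by (rule inv_into_f_f[OF chart_atlasD(4)[OF c0 x(2)] pp(1)])
    have "c (par k 0 a b) \<in> ?W" by (rule subsetD[OF oK(2) pp(2)])
    then obtain q' where q'': "c (par k 0 a b) = c q'" "q' \<in> V \<inter> (Lcover i \<inter> F2)" by (rule imageE)
    then have q': "q' \<in> V" "q' \<in> Lcover i" "c (par k 0 a b) = c q'" by simp_all
    have "par k 0 a b = q'" by (rule inj_onD[OF chart_atlasD(4)[OF c0 x(2)] q'(3) pp(1) q'(1)])
    then have pL: "par k 0 a b \<in> Lcover i" using q'(2) by (simp only:)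
    show "\<exists>z\<in>K. metric0 i (inv_into V c z) \<noteq> -\<infinity>"
      by (rule bexI[OF _ pp(2)]) (unfold inv, rule metric0_generic[OF pL kab(1,4)])
  qed (use W metric0_generators in auto)
  then show "case x of (V,c) \<Rightarrow> plurisubharmonic_on (\<lambda>z. metric0 i (inv_into V c z)) (c ` (V \<inter> (Lcover i \<inter> F2)))"
    unfolding x(1) by simp
qed

abbreviation L0cover :: "nat \<Rightarrow> (complex \<times> hpoint) set" where "L0cover i \<equiv> Lcover i \<inter> F2"

lemma semipositive_metric0: "semipositive_metric F2T F2A L0cover Ltrans metric0"
  unfolding semipositive_metric_def
  using metric0_transition F2_fst psh_metric0 by blast

lemma wt_negcurve:
  assumes p: "p \<in> L0cover i"
  shows "wt i (base i p) (fcoord i p) = 0 \<longleftrightarrow> p \<in> negcurve"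
proof
  have p': "p \<in> Lcover i" "fst p = 0" using p F2_fst by blast+
  assume "wt i (base i p) (fcoord i p) = 0"
  then have z: "i = 0 \<or> i = 2" "fcoord i p = 0" unfolding wt_zero_iff by auto
  show "p \<in> negcurve" using par_negcurve[OF z(1), of "base i p"] par_coords[OF p'(1)] unfolding p'(2) z(2) by simp
next
  assume e: "p \<in> negcurve"
  have pp: "p \<in> pieceX (piv i)" "i < 4" using p Lcover_piece Lcover_less by blast+
  have i: "i = 0 \<or> i = 2"
    using negcurve_pieces(1,2)[OF e] pp k_cases[OF pp(2)] by blast
  have "fcoord i p = 0" unfolding fcoord_def
    by (rule affX_negcurve[OF e pp(1)]) (use i in \<open>auto simp: co2_def\<close>)
  then show "wt i (base i p) (fcoord i p) = 0" using i by (simp add: wt_zero_iff)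
qed

text \<open>
  The maximum of three moduli and the square root of the sum of their squares differ at most by the factor
  \<open>sqrt 3\<close>; the cruder constant \<open>ln 3\<close> is sufficient.
\<close>

lemma analytic_metric0: "analytic_singularities F2T F2A L0cover metric0"
  unfolding analytic_singularities_def
proof (intro allI ballI)
  fix i p assume p: "p \<in> L0cover i"
  let ?S = "\<lambda>x. \<Sum>j<3. (norm (gen_fun i j x))\<^sup>2"
  have "let l = ereal (1/2) * elog (?S x) in metric0 i x \<le> l + ereal (ln 3) \<and> l \<le> metric0 i x + ereal (ln 3)" for x
  proof -
    let ?n = "\<lambda>j. norm (gen_fun i j x)"
    let ?m = "wt i (base i x) (fcoord i x)"
    have m: "?m = max (?n 0) (max (?n 1) (?n 2))" by (simp add: wt_def gen_fun_def)
    have S: "?S x = (?n 0)\<^sup>2 + (?n 1)\<^sup>2 + (?n 2)\<^sup>2" by (simp add: numeral_3_eq_3 numeral_2_eq_2)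
    have le: "?n 0 \<le> ?m" "?n 1 \<le> ?m" "?n 2 \<le> ?m" unfolding m by auto
    have up: "?S x \<le> 3 * ?m\<^sup>2" unfolding S
      using power_mono[OF le(1), of 2] power_mono[OF le(2), of 2] power_mono[OF le(3), of 2] by simp
    have lo: "?m\<^sup>2 \<le> ?S x" unfolding S m by (auto simp: max_def)
    have m0: "0 \<le> ?m" by (rule wt_nonneg)
    show ?thesis
    proof (cases "?m = 0")
      case True
      then have "?S x = 0" using up lo by simp
      then show ?thesis using True by (simp add: metric0_def elog_def)
    next
      case False
      then have mp: "0 < ?m" using m0 by simp
      then have Sp: "0 < ?S x" using lo by (meson less_le_trans zero_less_power)
      have l1: "2 * ln ?m \<le> ln (?S x)"
        using ln_mono[OF lo] mp by (simp add: ln_realpow)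
      have "ln (?S x) \<le> ln (3 * ?m\<^sup>2)" by (rule ln_mono[OF up Sp])
      then have l2: "ln (?S x) \<le> ln 3 + 2 * ln ?m" using mp by (simp add: ln_mult ln_realpow)
      have l3: "(0::real) \<le> ln 3" by simp
      have e: "elog (?S x) = ereal (ln (?S x))" "metric0 i x = ereal (ln ?m)"
        using Sp mp by (auto simp: metric0_def elog_def)
      show ?thesis unfolding e Let_def using l1 l2 l3 by simp
    qed
  qed
  then show "\<exists>W c (k::nat) f M. p \<in> W \<and> W \<subseteq> L0cover i \<and> openin F2T W \<and> 0 < c \<and>
        (\<forall>j<k. holomorphic_fun F2T F2A W (f j)) \<and>
        (\<forall>x\<in>W. let l = ereal c * elog (\<Sum>j<k. (norm (f j x))\<^sup>2)
               in metric0 i x \<le> l + ereal M \<and> l \<le> metric0 i x + ereal M)"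
    by (intro exI[of _ "L0cover i"] exI[of _ "1/2"] exI[of _ 3] exI[of _ "gen_fun i"] exI[of _ "ln 3"] conjI)
      (use p openin_Lcover_F2 holomorphic_gen_fun in \<open>auto\<close>)
qed

section \<open>Support and Lelong numbers\<close>

lemma continuous_wt: "continuous_map (subtopology F2T (L0cover i)) euclideanreal (\<lambda>p. wt i (base i p) (fcoord i p))"
proof -
  have g: "continuous_map (subtopology F2T (L0cover i)) euclideanreal (\<lambda>p. norm (gen_fun i j p))" for j
    by (intro continuous_map_norm holomorphic_fun_continuous[OF _ holomorphic_gen_fun] chart_atlas_fib) simp
  show ?thesis unfolding wt_def gen_fun_def[symmetric]
    by (intro continuous_map_real_max g)
qed

text \<open>
  Outside \<open>E\<close> the weight is a continuous real function, on \<open>E\<close> it is \<open>-\<infinity>\<close>.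
\<close>

lemma singular_support_metric0: "singular_support F2T L0cover metric0 = negcurve"
proof (intro set_eqI iffI)
  fix p assume "p \<in> singular_support F2T L0cover metric0"
  then obtain i where p: "p \<in> L0cover i"
    and n: "\<not> (\<exists>W M. p \<in> W \<and> W \<subseteq> L0cover i \<and> openin F2T W \<and> (\<forall>x\<in>W. \<bar>metric0 i x\<bar> \<le> ereal M))"
    unfolding singular_support_def by blast
  let ?m = "\<lambda>p. wt i (base i p) (fcoord i p)"
  show "p \<in> negcurve"
  proof (rule ccontr)
    assume "p \<notin> negcurve"
    then have "?m p \<noteq> 0" using wt_negcurve[OF p] by blast
    then have mp: "0 < ?m p" using wt_nonneg[of i "base i p" "fcoord i p"] by simp
    \<comment> \<open>A neighbourhood on which the weight stays between two real constants.\<close>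
    let ?W = "{x \<in> L0cover i. ?m x \<in> {?m p / 2 <..< 2 * ?m p}}"
    have "openin (subtopology F2T (L0cover i)) {x \<in> topspace (subtopology F2T (L0cover i)). ?m x \<in> {?m p / 2 <..< 2 * ?m p}}"
      by (rule openin_continuous_map_preimage[OF continuous_wt]) simp
    moreover have ts: "topspace (subtopology F2T (L0cover i)) = L0cover i"
      by (rule topspace_subtopology_subset[OF openin_subset[OF openin_Lcover_F2]])
    ultimately have "openin (subtopology F2T (L0cover i)) ?W" by (simp only:)
    then have W: "openin F2T ?W" by (rule openin_trans_full[OF _ openin_Lcover_F2])
    define M where "M = max \<bar>ln (?m p / 2)\<bar> \<bar>ln (2 * ?m p)\<bar>"
    have bd: "\<bar>metric0 i x\<bar> \<le> ereal M" if x: "x \<in> ?W" for x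
    proof -
      have b: "?m p / 2 < ?m x" "?m x < 2 * ?m p" using x by auto
      then have mx: "0 < ?m x" using mp by linarith
      have "ln (?m p / 2) \<le> ln (?m x)" by (rule ln_mono) (use b mp in auto)
      moreover have "ln (?m x) \<le> ln (2 * ?m p)" by (rule ln_mono) (use b mx in auto)
      ultimately have "\<bar>ln (?m x)\<bar> \<le> M" unfolding M_def by linarith
      then show ?thesis using mx by (simp add: metric0_def elog_def)
    qed
    have "p \<in> ?W" using p mp by simp
    moreover have "?W \<subseteq> L0cover i" by (rule Collect_restrict)
    ultimately have "p \<in> ?W \<and> ?W \<subseteq> L0cover i \<and> openin F2T ?W \<and> (\<forall>x\<in>?W. \<bar>metric0 i x\<bar> \<le> ereal M)"
      using W bd by (intro conjI ballI)
    then have "\<exists>W M. p \<in> W \<and> W \<subseteq> L0cover i \<and> openin F2T W \<and> (\<forall>x\<in>W. \<bar>metric0 i x\<bar> \<le> ereal M)"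
      by (intro exI)
    with n show False by (rule notE)
  qed
next
  fix p assume e: "p \<in> negcurve"
  obtain i where "i < 4" "p \<in> pieceX (piv i)"
    using negcurve_pieces(3)[OF e] by (elim disjE) (rule that[of 0], simp, simp, rule that[of 2], simp, simp)
  then have p: "p \<in> L0cover i" using subsetD[OF negcurve_subset e] by (simp add: Lcover_def)
  have "metric0 i p = -\<infinity>" unfolding metric0_def using wt_negcurve[OF p] e by (simp add: elog_def)
  then show "p \<in> singular_support F2T L0cover metric0"
    unfolding singular_support_def using p by (force intro!: exI[of _ i])
qed

lemma ereal_half: "(1/2 :: ereal) = ereal (1/2)"
  unfolding one_ereal_def numeral_eq_ereal ereal_divide by simp

lemma log_ratio_tendsto: "((\<lambda>r :: real. (C + ln r) / (2 * ln r)) \<longlongrightarrow> 1/2) (at_right 0)"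
proof -
  have "((\<lambda>r :: real. inverse (ln r)) \<longlongrightarrow> 0) (at_right 0)"
    by (rule filterlim_compose[OF tendsto_inverse_0 filterlim_mono[OF ln_at_0 at_bot_le_at_infinity order_refl]])
  then have "((\<lambda>r :: real. C / 2 * inverse (ln r) + 1/2) \<longlongrightarrow> C / 2 * 0 + 1/2) (at_right 0)"
    by (intro tendsto_intros)
  moreover have "eventually (\<lambda>r :: real. C / 2 * inverse (ln r) + 1/2 = (C + ln r) / (2 * ln r)) (at_right 0)"
    using eventually_at_right_less[of 0] eventually_at_right_real[of 0 "1 :: real", OF zero_less_one]
  proof eventually_elim
    case (elim r)
    then have "ln r \<noteq> 0" by (simp add: ln_eq_zero_iff)
    then show ?case by (simp add: field_simps)
  qed
  ultimately show ?thesis by (simp add: filterlim_cong)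
qed

text \<open>
  Since \<open>G\<close> vanishes at \<open>a\<close>, \<open>\<bar>G z\<bar> \<le> (K + 1) \<bar>z - a\<bar>\<close> nearby, which bounds the lower limit from below.
  Along the direction \<open>v0\<close> there is a reverse inequality with a smaller constant. Both constants
  disappear in the limit, see \<open>log_ratio_tendsto\<close>; the denominator contains \<open>\<bar>z - a\<bar>\<^sup>2\<close>, which gives
  \<open>1/2\<close>.
\<close>

lemma lelong_number_log_norm:
  fixes G :: "complex^'n \<Rightarrow> complex"
  assumes D: "(G has_derivative D) (at a)" and G0: "G a = 0" and v0: "D v0 \<noteq> 0"
    and u: "eventually (\<lambda>z. u z = elog (norm (G z))) (at a)"
  shows "lelong_number u a = 1/2"
proof -
  interpret D: bounded_linear D by (rule has_derivative_bounded_linear[OF D])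
  let ?q = "\<lambda>C r :: real. (C + ln r) / (2 * ln r)"
  have small: "eventually (\<lambda>z. norm (z - a) < \<epsilon> \<and> 0 < norm (z - a)) (at a)" if "\<epsilon> > 0" for \<epsilon> :: real
    unfolding eventually_at using that by (intro exI[of _ \<epsilon>]) (auto simp: dist_norm)
  have lim: "filterlim (\<lambda>z. norm (z - a)) (at_right 0) (at a)"
    unfolding filterlim_at
  proof (intro conjI)
    show "eventually (\<lambda>z. norm (z - a) \<in> {0<..} \<and> norm (z - a) \<noteq> 0) (at a)"
      using small[of 1, OF zero_less_one] by eventually_elim auto
    have "((\<lambda>z. norm (z - a)) \<longlongrightarrow> norm (a - a)) (at a)" by (intro tendsto_intros)
    then show "((\<lambda>z. norm (z - a)) \<longlongrightarrow> 0) (at a)" by simp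
  qed
  have q: "((\<lambda>z. ?q C (norm (z - a))) \<longlongrightarrow> 1/2) (at a)" for C
    by (rule filterlim_compose[OF log_ratio_tendsto lim])
  have err: "eventually (\<lambda>z. norm (G z - D (z - a)) \<le> e * norm (z - a)) (at a)" if e: "e > 0" for e
  proof -
    obtain d where d: "d > 0" "\<forall>y. norm (y - a) < d \<longrightarrow> norm (G y - G a - D (y - a)) \<le> e * norm (y - a)"
      using D[unfolded has_derivative_at_alt, THEN conjunct2, rule_format, OF e] by (elim exE conjE) (rule that)
    show ?thesis using small[OF d(1)] by eventually_elim (use d(2) G0 in simp)
  qed
  have lower: "1/2 \<le> lelong_number u a"
    unfolding lelong_number_def le_Liminf_iff
  proof (intro allI impI)
    fix y :: ereal assume "y < 1/2"
    then have "y < ereal (1/2)" unfolding ereal_half .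
    from ereal_dense2[OF this] obtain y' :: real where "y < ereal y' \<and> ereal y' < ereal (1/2)" by (rule exE)
    then have y': "y < ereal y'" "y' < 1/2" unfolding less_ereal.simps by (rule conjunct1, rule conjunct2)
    obtain K where K: "K > 0" "\<And>v. norm (D v) \<le> norm v * K" using D.pos_bounded by blast
    have "eventually (\<lambda>z. y' < ?q (ln (K + 1)) (norm (z - a))) (at a)"
      by (rule order_tendstoD(1)[OF q y'(2)])
    then show "eventually (\<lambda>z. y < u z / ereal (ln ((norm (z - a))\<^sup>2))) (at a)"
      using err[of 1, OF zero_less_one] small[of 1, OF zero_less_one] u
    proof eventually_elim
      case (elim z)
      let ?r = "norm (z - a)"
      have r: "0 < ?r" "?r < 1" using elim by auto
      then have lr: "ln ?r < 0" by simp
      have l2: "ln (?r\<^sup>2) = 2 * ln ?r" using r by (simp add: ln_realpow)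
      show "y < u z / ereal (ln (?r\<^sup>2))"
      proof (cases "G z = 0")
        case True
        then have "u z / ereal (ln (?r\<^sup>2)) = \<infinity>"
          unfolding elim(4) l2 using lr by (simp add: elog_def divide_ereal_def)
        moreover have "y < \<infinity>" by (rule less_trans[OF y'(1)]) simp
        ultimately show ?thesis by (simp only:)
      next
        case False
        have "norm (G z) \<le> norm (D (z - a)) + norm (G z - D (z - a))"
          by (metis add.commute diff_add_cancel norm_triangle_ineq)
        also have "\<dots> \<le> (K + 1) * ?r" using K(2)[of "z - a"] elim(2) by (simp add: algebra_simps)
        finally have "ln (norm (G z)) \<le> ln ((K + 1) * ?r)" by (rule ln_mono) (use False in simp)
        also have "\<dots> = ln (K + 1) + ln ?r" using K(1) r by (simp add: ln_mult)
        finally have "?q (ln (K + 1)) ?r \<le> ln (norm (G z)) / (2 * ln ?r)"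
          by (rule divide_right_mono_neg) (use lr in simp)
        with elim(1) have "y' < ln (norm (G z)) / (2 * ln ?r)" by linarith
        then have "ereal y' < u z / ereal (ln (?r\<^sup>2))"
          unfolding elim(4) l2 using False lr by (simp add: elog_def)
        with y'(1) show ?thesis by (rule less_trans)
      qed
    qed
  qed
  have upper: "lelong_number u a \<le> 1/2"
  proof (rule ccontr)
    assume "\<not> lelong_number u a \<le> 1/2"
    then have "ereal (1/2) < lelong_number u a" unfolding ereal_half not_le .
    from dense[OF this] obtain y where y: "ereal (1/2) < y" "y < lelong_number u a" by (elim exE conjE) (rule that)
    from ereal_dense2[OF y(1)] obtain y' :: real where "ereal (1/2) < ereal y' \<and> ereal y' < y" by (rule exE)
    then have y': "1/2 < y'" "ereal y' < y" unfolding less_ereal.simps by (rule conjunct1, rule conjunct2)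
    have n0: "v0 \<noteq> 0" using v0 D.zero by metis
    \<comment> \<open>With this error constant half of the linear growth along \<open>v0\<close> remains.\<close>
    define e where "e = norm (D v0) / (2 * norm v0)"
    have e: "e > 0" using v0 n0 by (simp add: e_def)
    have "filterlim (\<lambda>s. a + s *\<^sub>R v0) (at a) (at_right 0)"
      unfolding filterlim_at
    proof (intro conjI)
      show "eventually (\<lambda>s. a + s *\<^sub>R v0 \<in> UNIV \<and> a + s *\<^sub>R v0 \<noteq> a) (at_right 0)"
        using eventually_at_right_less[of 0] by eventually_elim (use n0 in auto)
      have "((\<lambda>s. a + s *\<^sub>R v0) \<longlongrightarrow> a + 0 *\<^sub>R v0) (at_right 0)" by (intro tendsto_intros)
      then show "((\<lambda>s. a + s *\<^sub>R v0) \<longlongrightarrow> a) (at_right 0)" by simp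
    qed
    note along = filterlim_iff[THEN iffD1, OF this, rule_format]
    have "eventually (\<lambda>z. y < u z / ereal (ln ((norm (z - a))\<^sup>2))) (at a)"
      using less_LiminfD[OF y(2)[unfolded lelong_number_def]] .
    then have "eventually (\<lambda>z. y < u z / ereal (ln ((norm (z - a))\<^sup>2)) \<and> norm (G z - D (z - a)) \<le> e * norm (z - a)
        \<and> ?q (ln e) (norm (z - a)) < y' \<and> (norm (z - a) < 1 \<and> 0 < norm (z - a)) \<and> u z = elog (norm (G z))) (at a)"
      using err[OF e] order_tendstoD(2)[OF q y'(1), of "ln e"] small[of 1, OF zero_less_one] u
      by eventually_elim blast
    from eventually_happens[OF eventually_conj[OF along[OF this] eventually_at_right_less[of 0]]]
    obtain s :: real where s0: "0 < s" and s: "y < u (a + s *\<^sub>R v0) / ereal (ln ((norm (a + s *\<^sub>R v0 - a))\<^sup>2))"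
      "norm (G (a + s *\<^sub>R v0) - D (a + s *\<^sub>R v0 - a)) \<le> e * norm (a + s *\<^sub>R v0 - a)"
      "?q (ln e) (norm (a + s *\<^sub>R v0 - a)) < y'" "norm (a + s *\<^sub>R v0 - a) < 1" "0 < norm (a + s *\<^sub>R v0 - a)"
      "u (a + s *\<^sub>R v0) = elog (norm (G (a + s *\<^sub>R v0)))" by auto
    define g r where "g = norm (G (a + s *\<^sub>R v0))" and "r = norm (a + s *\<^sub>R v0 - a)"
    have r: "0 < r" "r < 1" using s unfolding r_def by auto
    then have lr: "ln r < 0" by simp
    have l2: "ln (r\<^sup>2) = 2 * ln r" using r by (simp add: ln_realpow)
    have rs: "r = s * norm v0" unfolding r_def using s0 by simp
    have "norm (D (a + s *\<^sub>R v0 - a)) = 2 * e * r" unfolding rs e_def using s0 n0 by (simp add: D.scaleR)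
    moreover have "norm (D (a + s *\<^sub>R v0 - a)) \<le> g + norm (G (a + s *\<^sub>R v0) - D (a + s *\<^sub>R v0 - a))"
      unfolding g_def by (metis norm_triangle_sub norm_minus_commute)
    ultimately have ge: "e * r \<le> g" using s(2) unfolding r_def[symmetric] by linarith
    then have gp: "0 < g" using e r by (meson less_le_trans mult_pos_pos)
    have "ln e + ln r \<le> ln g" using ln_mono[OF ge] e r by (simp add: ln_mult)
    then have "ln g / (2 * ln r) \<le> ?q (ln e) r" by (rule divide_right_mono_neg) (use lr in simp)
    then have lt: "ln g / (2 * ln r) < y'" using s(3) unfolding r_def[symmetric] by linarith
    have "u (a + s *\<^sub>R v0) / ereal (ln (r\<^sup>2)) = ereal (ln g / (2 * ln r))"
      unfolding s(6) g_def[symmetric] l2 using gp lr by (simp add: elog_def)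
    then have "y < ereal (ln g / (2 * ln r))" using s(1) unfolding r_def[symmetric] by simp
    also have "\<dots> < ereal y'" using lt by simp
    finally show False using y'(2) by (rule less_asym)
  qed
  show ?thesis by (rule antisym[OF upper lower])
qed

text \<open>
  Near a point of \<open>E\<close> the first generator dominates, so the weight is exactly \<open>log \<bar>y\<bar>\<close>. In an arbitrary chart
  \<open>y\<close> still has a nonzero derivative.
\<close>

lemma lelong_metric0:
  assumes e: "p \<in> negcurve"
  shows "has_lelong_number F2A L0cover metric0 p (1/2)"
proof -
  have "lelong_number (\<lambda>z. metric0 i (inv_into V c z)) (c p) = 1/2"
    if p: "p \<in> L0cover i" and Vc: "(V,c) \<in> F2A" and pV: "p \<in> V" for i V c
  proof -
    have cm: "complex_manifold F2T F2A" and c0: "chart_atlas F2T F2A"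
      by (rule complex_manifold_fib, simp, rule chart_atlas_fib, simp)
    have i4: "i < 4" and pp: "p \<in> pieceX (piv i)" using p Lcover_less Lcover_piece by blast+
    have L: "Lcover i = pieceX (piv i)" using i4 by (simp add: Lcover_def)
    have i: "i = 0 \<or> i = 2" and w0: "fcoord i p = 0"
      using wt_negcurve[OF p] e unfolding wt_zero_iff by auto
    have sc: "(pieceX (piv i) \<inter> F2, slice_coord i) \<in> F2A" by (rule slice_chart[OF i4]) simp
    have ps: "p \<in> pieceX (piv i) \<inter> F2" using p unfolding L .
    obtain T T' where T: "((\<lambda>z. slice_coord i (inv_into V c z)) has_derivative T) (at (c p))"
      and TT: "\<And>v. T (T' v) = v"
      by (rule chart_transition_derivative[OF cm Vc sc pV ps]) (rule that)
    let ?G = "\<lambda>z. fcoord i (inv_into V c z)" and ?B = "\<lambda>z. base i (inv_into V c z)"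
    have G: "(?G has_derivative (\<lambda>v. T v $ 2)) (at (c p))"
      using has_derivative_vec_nth[OF T, of 2] unfolding slice_coord_nth fcoord_def .
    have B: "(?B has_derivative (\<lambda>v. T v $ 1)) (at (c p))"
      using has_derivative_vec_nth[OF T, of 1] unfolding slice_coord_nth base_def .
    have inv: "inv_into V c (c p) = p" by (rule inv_into_f_f[OF chart_atlasD(4)[OF c0 Vc] pV])
    have tG: "(?G \<longlongrightarrow> 0) (at (c p))" and tB: "(?B \<longlongrightarrow> base i p) (at (c p))"
      using has_derivative_continuous[OF G] has_derivative_continuous[OF B]
      unfolding continuous_at isCont_def inv w0 by simp_all
    have "((\<lambda>z. (norm (?B z))\<^sup>2 * norm (?G z)) \<longlongrightarrow> (norm (base i p))\<^sup>2 * norm (0 :: complex)) (at (c p))"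
      by (intro tendsto_intros tG tB)
    then have e1: "eventually (\<lambda>z. (norm (?B z))\<^sup>2 * norm (?G z) < 1) (at (c p))"
      using order_tendstoD(2)[of _ "(norm (base i p))\<^sup>2 * norm (0 :: complex)" _ 1] by simp
    have e2: "eventually (\<lambda>z. norm (?G z) < 1) (at (c p))"
      using order_tendstoD(2)[OF tendsto_norm[OF tG], of 1] by simp
    have ev: "eventually (\<lambda>z. metric0 i (inv_into V c z) = elog (norm (?G z))) (at (c p))"
      using e1 e2
    proof eventually_elim
      case (elim z)
      let ?b = "norm (?G z)"
      have "?b\<^sup>2 \<le> ?b" unfolding power2_eq_square by (rule mult_left_le_one_le) (use elim in auto)
      moreover have "(norm (?B z))\<^sup>2 * ?b\<^sup>2 \<le> ?b"
      proof -
        have "((norm (?B z))\<^sup>2 * ?b) * ?b \<le> 1 * ?b" by (rule mult_right_mono) (use elim in auto)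
        then show ?thesis by (simp add: power2_eq_square mult.assoc)
      qed
      ultimately have "wt i (?B z) (?G z) = ?b" unfolding wt_even[OF i] by simp
      then show ?case unfolding metric0_def by simp
    qed
    have G0: "?G (c p) = 0" unfolding inv by (rule w0)
    have "T (T' (axis 2 1)) $ 2 \<noteq> 0" unfolding TT by (simp add: axis_def)
    from lelong_number_log_norm[OF G G0 this ev] show ?thesis .
  qed
  then show ?thesis unfolding has_lelong_number_def by blast
qed

lemma generic_lelong_metric0: "has_generic_lelong_number F2A L0cover metric0 negcurve (1/2)"
  unfolding has_generic_lelong_number_def
proof (intro exI[of _ "\<lambda>_. 1/2"] conjI ballI)
  show "has_lelong_number F2A L0cover metric0 p (1/2)" if "p \<in> negcurve" for p by (rule lelong_metric0[OF that])
  have "negcurve \<noteq> {}" using par_negcurve[of 0, OF disjI1[OF refl]] by blast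
  then show "(INF p\<in>negcurve. 1/2 :: ereal) = 1/2" by (rule cINF_const)
qed

section \<open>Minimality\<close>

lemma compact_polydisc: "compact {z :: complex^'n. \<forall>j. norm (z $ j) \<le> r j}"
proof -
  have "closed {z :: complex^'n. \<forall>j. norm (z $ j) \<le> r j}"
    by (intro closed_Collect_all closed_Collect_le continuous_intros)
  moreover have "bounded {z :: complex^'n. \<forall>j. norm (z $ j) \<le> r j}"
  proof (rule boundedI)
    fix z :: "complex^'n" assume "z \<in> {z. \<forall>j. norm (z $ j) \<le> r j}"
    then have "(\<Sum>j\<in>UNIV. norm (z $ j)) \<le> (\<Sum>j\<in>UNIV. r j)" by (intro sum_mono) simp
    moreover have "norm z \<le> (\<Sum>j\<in>UNIV. norm (z $ j))"
      unfolding norm_vec_def by (rule L2_set_le_sum) simp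
    ultimately show "norm z \<le> (\<Sum>j\<in>UNIV. r j)" by linarith
  qed
  ultimately show ?thesis unfolding compact_eq_bounded_closed by simp
qed

text \<open>
  A change of charts in homogeneous coordinates: divide by the new pivot.
\<close>

lemma par_change:
  assumes k: "k < 4" and j: "j < 4" and t: "norm t < 1" and n: "hc k t x y (piv j) \<noteq> 0"
  shows "par k t x y = par j t (hc k t x y (co1 j) / hc k t x y (piv j)) (hc k t x y (co2 j) / hc k t x y (piv j))"
    "par k t x y \<in> Lcover j"
    "Ltrans k j (par k t x y) = hc k t x y (piv j) * (if (k < 2) = (j < 2) then 1 else inverse (x ^ 2))"
proof -
  let ?p = "par k t x y"
  have pk: "?p \<in> Lcover k" by (rule par_Lcover[OF k t])
  show pj: "?p \<in> Lcover j" using par_in_pieceX[OF k t, of x y "piv j"] n piv_co_le(1)[of j] j by (simp add: Lcover_def)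
  note c = coords_change[OF pk pj, unfolded coords_par[OF k] par_simps]
  show "?p = par j t (hc k t x y (co1 j) / hc k t x y (piv j)) (hc k t x y (co2 j) / hc k t x y (piv j))"
    using par_coords[OF pj] unfolding c(2,3) par_simps(1) by (rule sym)
  show "Ltrans k j ?p = hc k t x y (piv j) * (if (k < 2) = (j < 2) then 1 else inverse (x ^ 2))" by (rule c(4))
qed

text \<open>
  Make \<open>\<bar>x\<bar> \<le> 1\<close> by passing to the other affine piece of the base if necessary, then \<open>\<bar>y\<bar> \<le> 1\<close> by passing
  to the other chart over the same piece. So estimates on the unit bidiscs of the four charts are global.
\<close>

lemma fib0_unit_bidisc:
  assumes p: "p \<in> F2"
  obtains k x y where "k < 4" "p = par k 0 x y" "norm x \<le> 1" "norm y \<le> 1"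
proof -
  have base: "\<exists>k x y. k < 4 \<and> p = par k 0 x y \<and> norm x \<le> 1"
  proof -
    obtain k where k: "k < 4" "p \<in> pieceX (piv k) \<inter> F2" by (rule fib_cases[OF p])
    define x y where "x = slice_coord k p $ 1" and "y = slice_coord k p $ 2"
    have e: "p = par k 0 x y" unfolding x_def y_def using par_slice_coord[OF k] by (rule sym)
    show ?thesis
    proof (cases "norm x \<le> 1")
      case True
      with k e show ?thesis by (intro exI conjI)
    next
      case False
      then have x: "x \<noteq> 0" "norm (inverse x) \<le> 1" by (auto simp: norm_inverse intro!: inverse_le_1_iff[THEN iffD2])
      define j where "j = (if k < 2 then k + 2 else k - 2)"
      have j: "j < 4" using k_cases[OF k(1)] by (elim disjE) (simp_all add: j_def)
      have h: "hc k 0 x y (piv j) \<noteq> 0"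
        using k_cases[OF k(1)] x(1) by (elim disjE) (simp_all add: j_def hc_def piv_def)
      have b: "hc k 0 x y (co1 j) / hc k 0 x y (piv j) = inverse x"
        using k_cases[OF k(1)] x(1)
        by (elim disjE) (simp_all add: j_def hc_def piv_def co1_def field_simps power2_eq_square power3_eq_cube)
      show ?thesis
      proof (intro exI conjI)
        show "p = par j 0 (inverse x) (hc k 0 x y (co2 j) / hc k 0 x y (piv j))"
          unfolding e b[symmetric] by (rule par_change(1)[OF k(1) j _ h]) simp
      qed (use j x(2) in auto)
    qed
  qed
  then obtain k x y where k: "k < 4" and e: "p = par k 0 x y" and x: "norm x \<le> 1" by (elim exE conjE) (rule that)
  show ?thesis
  proof (cases "norm y \<le> 1")
    case True
    then show ?thesis by (rule that[OF k e x])
  next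
    case False
    then have y: "y \<noteq> 0" "norm (inverse y) \<le> 1" by (auto simp: norm_inverse intro!: inverse_le_1_iff[THEN iffD2])
    define j where "j = (if k = 0 then 1 else if k = 1 then 0 else if k = 2 then 3 else 2 :: nat)"
    have j: "j < 4" by (simp add: j_def)
    have h: "hc k 0 x y (piv j) = y" "hc k 0 x y (co1 j) = x * y" "hc k 0 x y (co2 j) = 1"
      using k_cases[OF k] by (auto simp: j_def hc_def piv_def co1_def co2_def)
    have "p = par j 0 x (inverse y)"
      unfolding e using par_change(1)[OF k j, of 0 x y] y unfolding h by (simp add: inverse_eq_divide)
    then show ?thesis by (rule that[OF j _ x y(2)])
  qed
qed

lemma semipositive_transition:
  assumes "semipositive_metric X A U g \<phi>" "p \<in> U i" "p \<in> U j"
  shows "\<phi> i p = \<phi> j p + ereal (ln ((norm (g i j p))\<^sup>2))"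
  using assms unfolding semipositive_metric_def by blast

lemma psh_slice:
  assumes \<phi>: "semipositive_metric F2T F2A L0cover Ltrans \<phi>" and k: "k < 4"
  shows "plurisubharmonic_on (\<lambda>z :: complex^2. \<phi> k (par k 0 (z $ 1) (z $ 2))) UNIV"
proof -
  have sc: "(pieceX (piv k) \<inter> F2, slice_coord k) \<in> F2A" by (rule slice_chart[OF k]) simp
  have "psh_fun F2T F2A (L0cover k) (\<phi> k)" using \<phi> unfolding semipositive_metric_def by blast
  then have "plurisubharmonic_on (\<lambda>z. \<phi> k (inv_into (pieceX (piv k) \<inter> F2) (slice_coord k) z))
      (slice_coord k ` ((pieceX (piv k) \<inter> F2) \<inter> L0cover k))"
    using sc unfolding psh_fun_def by blast
  moreover have "(pieceX (piv k) \<inter> F2) \<inter> L0cover k = pieceX (piv k) \<inter> F2" using k by (auto simp: Lcover_def)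
  ultimately show ?thesis using slice_inverse[OF k, of 0] by simp
qed

lemma psh_slice_bounded:
  assumes \<phi>: "semipositive_metric F2T F2A L0cover Ltrans \<phi>" and k: "k < 4"
  obtains M where "\<And>x y. norm x \<le> 1 \<Longrightarrow> norm y \<le> 1 \<Longrightarrow> \<phi> k (par k 0 x y) \<le> ereal M"
proof -
  obtain M where M: "\<And>z :: complex^2. z \<in> {z. \<forall>j. norm (z $ j) \<le> 1} \<Longrightarrow> \<phi> k (par k 0 (z $ 1) (z $ 2)) \<le> ereal M"
    by (rule psh_bounded_above_on_compact[OF psh_slice[OF \<phi> k] compact_polydisc subset_UNIV]) (rule that)
  show ?thesis
  proof (rule that)
    fix x y :: complex assume "norm x \<le> 1" "norm y \<le> 1"
    then have "(vector [x, y] :: complex^2) \<in> {z. \<forall>j. norm (z $ j) \<le> 1}" by (simp add: forall_2)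
    from M[OF this] show "\<phi> k (par k 0 x y) \<le> ereal M" by simp
  qed
qed

text \<open>
  The disc with centre \<open>(x, y)\<close> and radius \<open>R\<close> in the direction of the base. Its boundary circle has
  \<open>R - 1 \<le> \<bar>\<xi>\<bar> \<le> R + 1\<close>; in the opposite chart these points are \<open>(1/\<xi>, \<xi>\<^sup>2 y)\<close>, in the unit
  bidisc, and the transition function is \<open>1/\<xi>\<close>.
\<close>

lemma horizontal_disc_bound:
  assumes \<phi>: "semipositive_metric F2T F2A L0cover Ltrans \<phi>" and k: "k = 0 \<or> k = 2"
    and M: "\<And>x y. norm x \<le> 1 \<Longrightarrow> norm y \<le> 1 \<Longrightarrow> \<phi> (2 - k) (par (2 - k) 0 x y) \<le> ereal M"
    and x: "norm x \<le> 1" and R: "2 \<le> R" and y: "norm y * (R + 1)\<^sup>2 \<le> 1"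
  shows "\<phi> k (par k 0 x y) \<le> ereal (M - 2 * ln (R - 1))"
proof -
  have k4: "k < 4" "2 - k < 4" using k by auto
  have "(\<lambda>z :: complex^2. \<phi> k (par k 0 (z $ 1) (z $ 2))) (vector [x, y]) \<le> ereal (M - 2 * ln (R - 1))"
  proof (rule psh_le_of_circle[OF psh_slice[OF \<phi> k4(1)], where w = "vector [of_real R, 0]"])
    fix \<theta>
    define \<xi> where "\<xi> = x + cis \<theta> * of_real R"
    have nR: "norm (cis \<theta> * of_real R) = R" using R by (simp add: norm_mult)
    have lo: "R - 1 \<le> norm \<xi>" using norm_diff_ineq[of "cis \<theta> * of_real R" x] nR x unfolding \<xi>_def by (simp add: add.commute)
    have hi: "norm \<xi> \<le> R + 1" using norm_triangle_ineq[of x "cis \<theta> * of_real R"] nR x unfolding \<xi>_def by simp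
    have \<xi>: "\<xi> \<noteq> 0" "1 \<le> norm \<xi>" using lo R by auto
    have h: "hc k 0 \<xi> y (piv (2 - k)) = \<xi>" "hc k 0 \<xi> y (co1 (2 - k)) = 1" "hc k 0 \<xi> y (co2 (2 - k)) = \<xi> ^ 3 * y"
      using k by (auto simp: hc_def piv_def co1_def co2_def)
    have n: "hc k 0 \<xi> y (piv (2 - k)) \<noteq> 0" unfolding h by (rule \<xi>(1))
    have z0: "norm (0 :: complex) < 1" by simp
    note ch = par_change[OF k4 z0 n, unfolded h]
    let ?p = "par k 0 \<xi> y"
    have pF: "?p \<in> F2" by (rule par_fib[OF k4(1) z0])
    have side: "\<not> ((k < 2) = (2 - k < 2))" using k by auto
    have lt: "Ltrans k (2 - k) ?p = inverse \<xi>"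
      unfolding ch(3) if_not_P[OF side] using \<xi>(1) by (simp add: power2_eq_square)
    have "\<phi> k ?p = \<phi> (2 - k) ?p + ereal (ln ((norm (Ltrans k (2 - k) ?p))\<^sup>2))"
      by (rule semipositive_transition[OF \<phi>]) (use par_Lcover[OF k4(1) z0] ch(2) pF in auto)
    also have "ln ((norm (Ltrans k (2 - k) ?p))\<^sup>2) = - 2 * ln (norm \<xi>)"
      unfolding lt using \<xi> by (simp add: norm_inverse ln_realpow ln_inverse power_inverse)
    finally have tr: "\<phi> k ?p = \<phi> (2 - k) ?p + ereal (- 2 * ln (norm \<xi>))" .
    have "norm (1 / \<xi>) \<le> 1" using \<xi> by (simp add: norm_divide)
    moreover have "norm (\<xi> ^ 3 * y / \<xi>) \<le> 1"
    proof -
      have "norm (\<xi> ^ 3 * y / \<xi>) = norm y * (norm \<xi>)\<^sup>2"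
        using \<xi>(1) by (simp add: norm_mult norm_divide norm_power power2_eq_square power3_eq_cube)
      also have "\<dots> \<le> norm y * (R + 1)\<^sup>2" by (intro mult_left_mono power_mono hi) auto
      finally show ?thesis using y by linarith
    qed
    ultimately have "\<phi> (2 - k) ?p \<le> ereal M" unfolding ch(1) by (rule M)
    then have "\<phi> k ?p \<le> ereal M + ereal (- 2 * ln (norm \<xi>))" unfolding tr by (rule add_right_mono)
    also have "\<dots> \<le> ereal (M - 2 * ln (R - 1))" using ln_mono[OF lo] R by simp
    finally show "\<phi> k (par k 0 ((vector [x, y] + cis \<theta> *s vector [of_real R, 0] :: complex^2) $ 1)
        ((vector [x, y] + cis \<theta> *s vector [of_real R, 0] :: complex^2) $ 2)) \<le> ereal (M - 2 * ln (R - 1))"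
      by (simp add: \<xi>_def)
  qed simp
  then show ?thesis by simp
qed

text \<open>
  For \<open>y \<noteq> 0\<close> close to 0 the best radius is given by \<open>\<bar>y\<bar> (R + 1)\<^sup>2 = 1\<close>. For \<open>y = 0\<close> every radius is
  admissible, and the weight is \<open>-\<infinity>\<close>. Away from 0 a bound on the compact bidisc suffices.
\<close>

lemma minimal_even_chart:
  assumes \<phi>: "semipositive_metric F2T F2A L0cover Ltrans \<phi>" and k: "k = 0 \<or> k = 2"
  obtains C where "\<And>x y. norm x \<le> 1 \<Longrightarrow> norm y \<le> 1 \<Longrightarrow> \<phi> k (par k 0 x y) \<le> metric0 k (par k 0 x y) + ereal C"
proof -
  have k4: "k < 4" "2 - k < 4" using k by auto
  obtain M1 where M1: "\<And>x y. norm x \<le> 1 \<Longrightarrow> norm y \<le> 1 \<Longrightarrow> \<phi> k (par k 0 x y) \<le> ereal M1"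
    by (rule psh_slice_bounded[OF \<phi> k4(1)]) (rule that)
  obtain M where M: "\<And>x y. norm x \<le> 1 \<Longrightarrow> norm y \<le> 1 \<Longrightarrow> \<phi> (2 - k) (par (2 - k) 0 x y) \<le> ereal M"
    by (rule psh_slice_bounded[OF \<phi> k4(2)]) (rule that)
  have vb: "\<phi> k (par k 0 x y) \<le> ereal (M - 2 * ln (R - 1))"
    if "norm x \<le> 1" "2 \<le> R" "norm y * (R + 1)\<^sup>2 \<le> 1" for x y R
    by (rule horizontal_disc_bound[OF \<phi> k M that])
  let ?C = "max (M1 + ln 9) (M + 2 * ln 3)"
  show ?thesis
  proof (rule that[of ?C])
    fix x y :: complex assume x: "norm x \<le> 1" and y: "norm y \<le> 1"
    let ?p = "par k 0 x y"
    have m: "metric0 k ?p = elog (wt k x y)" unfolding metric0_def coords_par[OF k4(1)] ..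
    show "\<phi> k ?p \<le> metric0 k ?p + ereal ?C"
    proof (cases "y = 0")
      case True
      have "\<phi> k ?p \<le> ereal B" for B
      proof -
        \<comment> \<open>Chosen so that \<open>M - 2 ln (R - 1) \<le> B\<close>.\<close>
        define R where "R = max 2 (1 + exp ((M - B) / 2))"
        have R: "2 \<le> R" "exp ((M - B) / 2) \<le> R - 1" unfolding R_def by auto
        have "\<phi> k ?p \<le> ereal (M - 2 * ln (R - 1))" by (rule vb[OF x R(1)]) (simp add: True)
        also have "(M - B) / 2 \<le> ln (R - 1)" using R by (subst ln_ge_iff) auto
        then have "ereal (M - 2 * ln (R - 1)) \<le> ereal B" by simp
        finally show ?thesis .
      qed
      then have "\<phi> k ?p = -\<infinity>" by (rule ereal_bot)
      then show ?thesis by simp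
    next
      case False
      then have yp: "0 < norm y" by simp
      have w: "norm y \<le> wt k x y" unfolding wt_even[OF k] by simp
      then have wp: "0 < wt k x y" using yp by linarith
      have me: "metric0 k ?p = ereal (ln (wt k x y))" unfolding m using wp by (simp add: elog_def)
      have lw: "ln (norm y) \<le> ln (wt k x y)" by (rule ln_mono[OF w yp])
      show ?thesis
      proof (cases "norm y \<le> 1/9")
        case True
        \<comment> \<open>The radius \<open>1/s - 1\<close> is at least 2 precisely because \<open>\<bar>y\<bar> \<le> 1/9\<close>.\<close>
        define s where "s = sqrt (norm y)"
        have s: "0 < s" "s\<^sup>2 = norm y" unfolding s_def using yp by auto
        have s3: "s \<le> 1/3" unfolding s_def by (rule real_le_lsqrt) (use True in \<open>auto simp: power2_eq_square\<close>)
        have R: "2 \<le> 1 / s - 1" using s s3 by (simp add: field_simps)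
        have "norm y * (1 / s - 1 + 1)\<^sup>2 \<le> 1" unfolding s(2)[symmetric] using s(1) by (simp add: field_simps)
        then have b: "\<phi> k ?p \<le> ereal (M - 2 * ln (1 / s - 1 - 1))" by (rule vb[OF x R])
        have "1 / (3 * s) \<le> 1 / s - 1 - 1" using s(1) s3 by (simp add: field_simps)
        then have "ln (1 / (3 * s)) \<le> ln (1 / s - 1 - 1)" by (rule ln_mono) (use s in simp)
        moreover have "ln (1 / (3 * s)) = - ln 3 - ln s" using s(1) by (simp add: ln_div ln_mult)
        moreover have "ln (norm y) = 2 * ln s" unfolding s(2)[symmetric] using s(1) by (simp add: ln_realpow)
        ultimately have "M - 2 * ln (1 / s - 1 - 1) \<le> ln (wt k x y) + ?C" using lw by linarith
        then show ?thesis using b unfolding me plus_ereal.simps by (meson ereal_less_eq(3) order_trans)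
      next
        case False
        have "- ln 9 \<le> ln (norm y)"
          using ln_mono[of "1/9" "norm y"] False by (simp add: ln_div)
        then have "M1 \<le> ln (wt k x y) + ?C" using lw by linarith
        then show ?thesis using M1[OF x y] unfolding me plus_ereal.simps by (meson ereal_less_eq(3) order_trans)
      qed
    qed
  qed
qed

text \<open>
  These charts do not meet \<open>E\<close>, and the weight of the metric is nonnegative in them.
\<close>

lemma minimal_odd_chart:
  assumes \<phi>: "semipositive_metric F2T F2A L0cover Ltrans \<phi>" and k: "k < 4" "\<not> (k = 0 \<or> k = 2)"
  obtains C where "\<And>x y. norm x \<le> 1 \<Longrightarrow> norm y \<le> 1 \<Longrightarrow> \<phi> k (par k 0 x y) \<le> metric0 k (par k 0 x y) + ereal C"
proof -
  obtain M where M: "\<And>x y. norm x \<le> 1 \<Longrightarrow> norm y \<le> 1 \<Longrightarrow> \<phi> k (par k 0 x y) \<le> ereal M"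
    by (rule psh_slice_bounded[OF \<phi> k(1)]) (rule that)
  show ?thesis
  proof (rule that[of M])
    fix x y :: complex assume x: "norm x \<le> 1" and y: "norm y \<le> 1"
    have w: "1 \<le> wt k x y" unfolding wt_odd[OF k(2)] by simp
    then have "metric0 k (par k 0 x y) = ereal (ln (wt k x y))"
      unfolding metric0_def coords_par[OF k(1)] by (simp add: elog_def)
    moreover have "0 \<le> ln (wt k x y)" using w by simp
    ultimately have "ereal M \<le> metric0 k (par k 0 x y) + ereal M" by simp
    with M[OF x y] show "\<phi> k (par k 0 x y) \<le> metric0 k (par k 0 x y) + ereal M" by (rule order_trans)
  qed
qed

text \<open>
  The estimates on the unit bidiscs of the four charts carry over to all charts, since the two metrics have the
  same transition functions.
\<close>

lemma minimal_metric0: "minimal_singularities F2T F2A L0cover Ltrans metric0"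
  unfolding minimal_singularities_def
proof (intro allI impI)
  fix \<phi> assume \<phi>: "semipositive_metric F2T F2A L0cover Ltrans \<phi>"
  have "\<exists>C. \<forall>x y. norm x \<le> 1 \<longrightarrow> norm y \<le> 1 \<longrightarrow> \<phi> k (par k 0 x y) \<le> metric0 k (par k 0 x y) + ereal C"
    if k: "k < 4" for k
  proof (cases "k = 0 \<or> k = 2")
    case True
    obtain C where "\<And>x y. norm x \<le> 1 \<Longrightarrow> norm y \<le> 1 \<Longrightarrow> \<phi> k (par k 0 x y) \<le> metric0 k (par k 0 x y) + ereal C"
      by (rule minimal_even_chart[OF \<phi> True]) (rule that)
    then show ?thesis by (intro exI[of _ C] allI impI)
  next
    case False
    obtain C where "\<And>x y. norm x \<le> 1 \<Longrightarrow> norm y \<le> 1 \<Longrightarrow> \<phi> k (par k 0 x y) \<le> metric0 k (par k 0 x y) + ereal C"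
      by (rule minimal_odd_chart[OF \<phi> k False]) (rule that)
    then show ?thesis by (intro exI[of _ C] allI impI)
  qed
  then obtain C where C: "\<And>k x y. k < 4 \<Longrightarrow> norm x \<le> 1 \<Longrightarrow> norm y \<le> 1 \<Longrightarrow>
      \<phi> k (par k 0 x y) \<le> metric0 k (par k 0 x y) + ereal (C k)" by metis
  let ?C = "Max (C ` {..<4})"
  have "\<phi> i p \<le> metric0 i p + ereal ?C" if p: "p \<in> L0cover i" for i p
  proof -
    obtain k x y where k: "k < 4" "p = par k 0 x y" "norm x \<le> 1" "norm y \<le> 1"
      by (rule fib0_unit_bidisc[of p]) (use p in blast, rule that)
    have pk: "p \<in> L0cover k" using par_Lcover[OF k(1), of 0 x y] p unfolding k(2) by simp
    let ?e = "ereal (ln ((norm (Ltrans i k p))\<^sup>2))"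
    have "C k \<le> ?C" by (rule Max_ge) (use k(1) in auto)
    have "\<phi> k p \<le> metric0 k p + ereal (C k)" using C[OF k(1,3,4)] unfolding k(2) .
    also have "\<dots> \<le> metric0 k p + ereal ?C" by (rule add_left_mono) (use \<open>C k \<le> ?C\<close> in simp)
    finally have le: "\<phi> k p \<le> metric0 k p + ereal ?C" .
    have "\<phi> i p = \<phi> k p + ?e" by (rule semipositive_transition[OF \<phi> p pk])
    also have "\<dots> \<le> (metric0 k p + ereal ?C) + ?e" by (rule add_right_mono[OF le])
    also have "\<dots> = (metric0 k p + ?e) + ereal ?C" by (simp only: ac_simps)
    also have "metric0 k p + ?e = metric0 i p" by (rule semipositive_transition[OF semipositive_metric0 p pk, symmetric])
    finally show ?thesis .
  qed
  then show "\<exists>C. \<forall>i. \<forall>x\<in>L0cover i. \<phi> i x \<le> metric0 i x + ereal C" by (intro exI[of _ ?C] allI ballI)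
qed

section \<open>No extension to a neighbourhood\<close>

text \<open>
  The projection is proper, projective space being compact.
\<close>

lemma fibres_near_0:
  assumes W: "openin famX W" "F2 \<subseteq> W"
  obtains \<epsilon> where "0 < \<epsilon>" "\<epsilon> < 1" "\<And>p. p \<in> scroll_family \<Longrightarrow> norm (fst p) \<le> \<epsilon> \<Longrightarrow> p \<in> W"
proof -
  have "closedin famX (scroll_family - W)"
    using closedin_diff[OF closedin_topspace W(1)] by simp
  then have "closedin disc_proj (scroll_family - W)"
    unfolding famX_def by (rule closedin_trans_full[OF _ closedin_scroll_family])
  moreover have "closed_map disc_proj (top_of_set (ball 0 1)) fst"
    by (rule closed_map_fst[OF compact_space_proj_space])
  ultimately have "closedin (top_of_set (ball 0 1)) (fst ` (scroll_family - W))"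
    unfolding closed_map_def by blast
  then have "openin (top_of_set (ball 0 1)) (ball 0 1 - fst ` (scroll_family - W))"
    by (rule openin_diff[OF openin_topspace[of "top_of_set (ball 0 1)", unfolded topspace_euclidean_subtopology]])
  then have "open (ball 0 1 - fst ` (scroll_family - W))"
    by (rule openin_open_trans) simp
  moreover have "0 \<in> ball 0 1 - fst ` (scroll_family - W)"
  proof -
    have "0 \<notin> fst ` (scroll_family - W)"
    proof
      assume "0 \<in> fst ` (scroll_family - W)"
      then obtain p where "p \<in> scroll_family" "p \<notin> W" "fst p = 0" by auto
      then show False using W(2) by (auto simp: fib_iff)
    qed
    then show ?thesis by simp
  qed
  ultimately obtain e where e: "0 < e" "ball 0 e \<subseteq> ball 0 1 - fst ` (scroll_family - W)"
    unfolding open_contains_ball by blast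
  show ?thesis
  proof (rule that[of "min (e/2) (1/2)"])
    fix p assume p: "p \<in> scroll_family" "norm (fst p) \<le> min (e/2) (1/2)"
    then have "fst p \<in> ball 0 e" using e(1) by simp
    then have "fst p \<notin> fst ` (scroll_family - W)" using e(2) by blast
    then show "p \<in> W" using p(1) by blast
  qed (use e(1) in auto)
qed

lemma psh_family_chart:
  assumes \<phi>: "semipositive_metric famX atlasX (\<lambda>i. Lcover i \<inter> W) Ltrans \<phi>" and k: "k < 4"
  shows "plurisubharmonic_on (\<lambda>z. \<phi> k (inv_into (pieceX (piv k)) (chX k) z)) (chX k ` (pieceX (piv k) \<inter> (Lcover k \<inter> W)))"
proof -
  have "psh_fun famX atlasX (Lcover k \<inter> W) (\<phi> k)" using \<phi> unfolding semipositive_metric_def by blast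
  then show ?thesis using atlasX_chart[OF k] unfolding psh_fun_def by blast
qed

lemma family_chart_mem:
  assumes k: "k < 4" and z: "norm (z $ 1) < 1" and W: "par k (z $ 1) (z $ 2) (z $ 3) \<in> W"
  shows "z \<in> chX k ` (pieceX (piv k) \<inter> (Lcover k \<inter> W))"
proof (rule image_eqI)
  show "z = chX k (par k (z $ 1) (z $ 2) (z $ 3))" by (rule chX_inverse(2)[OF k, symmetric])
  show "par k (z $ 1) (z $ 2) (z $ 3) \<in> pieceX (piv k) \<inter> (Lcover k \<inter> W)"
    using par_in_own_piece[OF k z] par_Lcover[OF k z] W by blast
qed

lemma family_circle_bound:
  assumes \<phi>: "semipositive_metric famX atlasX (\<lambda>i. Lcover i \<inter> W) Ltrans \<phi>" and k: "k < 4"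
    and disc: "\<And>\<zeta>. norm \<zeta> \<le> 1 \<Longrightarrow> norm (t + \<zeta> * a) < 1 \<and> par k (t + \<zeta> * a) (x + \<zeta> * b) (y + \<zeta> * c) \<in> W"
    and circle: "\<And>\<theta>. \<phi> k (par k (t + cis \<theta> * a) (x + cis \<theta> * b) (y + cis \<theta> * c)) \<le> ereal B"
  shows "\<phi> k (par k t x y) \<le> ereal B"
proof -
  let ?z = "vector [t, x, y] :: complex^3" and ?w = "vector [a, b, c] :: complex^3"
  let ?u = "\<lambda>z. \<phi> k (inv_into (pieceX (piv k)) (chX k) z)"
  have c: "(?z + \<zeta> *s ?w) $ 1 = t + \<zeta> * a" "(?z + \<zeta> *s ?w) $ 2 = x + \<zeta> * b" "(?z + \<zeta> *s ?w) $ 3 = y + \<zeta> * c" for \<zeta>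
    by simp_all
  have d3: "?z + \<zeta> *s ?w \<in> disc3" if "norm \<zeta> \<le> 1" for \<zeta>
    unfolding disc3_def mem_Collect_eq c using disc[OF that] by (rule conjunct1)
  have u: "?u (?z + \<zeta> *s ?w) = \<phi> k (par k (t + \<zeta> * a) (x + \<zeta> * b) (y + \<zeta> * c))" if "norm \<zeta> \<le> 1" for \<zeta>
    unfolding chX_inverse(4)[OF k d3[OF that]] c ..
  have "?u ?z \<le> ereal B"
  proof (rule psh_le_of_circle[OF psh_family_chart[OF \<phi> k]])
    show "?z + \<zeta> *s ?w \<in> chX k ` (pieceX (piv k) \<inter> (Lcover k \<inter> W))" if "norm \<zeta> \<le> 1" for \<zeta>
      using disc[OF that] by (intro family_chart_mem[OF k]) (unfold c, elim conjunct1, elim conjunct2)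
    show "?u (?z + cis \<theta> *s ?w) \<le> ereal B" for \<theta>
      using circle[of \<theta>] unfolding u[of "cis \<theta>", OF eq_refl[OF norm_cis]] .
  qed
  moreover have "?z + 0 *s ?w = ?z" by simp
  ultimately show ?thesis using u[of 0] by simp
qed

lemma family_polydisc_bound:
  assumes \<phi>: "semipositive_metric famX atlasX (\<lambda>i. Lcover i \<inter> W) Ltrans \<phi>" and k: "k < 4" and \<epsilon>: "\<epsilon> < 1"
    and W: "\<And>p. p \<in> scroll_family \<Longrightarrow> norm (fst p) \<le> \<epsilon> \<Longrightarrow> p \<in> W"
  obtains M where "\<And>t x y. norm t \<le> \<epsilon> \<Longrightarrow> norm x \<le> 1 \<Longrightarrow> norm y \<le> 1 \<Longrightarrow> \<phi> k (par k t x y) \<le> ereal M"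
proof -
  let ?K = "{z :: complex^3. \<forall>j. norm (z $ j) \<le> (if j = 1 then \<epsilon> else 1)}"
  have K1: "norm (z $ 1) \<le> \<epsilon>" "norm (z $ 1) < 1" if "z \<in> ?K" for z
  proof -
    have "\<forall>j. norm (z $ j) \<le> (if j = 1 then \<epsilon> else 1)" using that by (rule CollectD)
    from spec[OF this, of 1] show "norm (z $ 1) \<le> \<epsilon>" by simp
    then show "norm (z $ 1) < 1" using \<epsilon> by linarith
  qed
  have sub: "?K \<subseteq> chX k ` (pieceX (piv k) \<inter> (Lcover k \<inter> W))"
  proof
    fix z assume z: "z \<in> ?K"
    have "par k (z $ 1) (z $ 2) (z $ 3) \<in> pieceX (piv k)" by (rule par_in_own_piece[OF k K1(2)[OF z]])
    then have "par k (z $ 1) (z $ 2) (z $ 3) \<in> scroll_family" unfolding pieceX_def by blast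
    then have "par k (z $ 1) (z $ 2) (z $ 3) \<in> W" by (rule W) (simp add: K1(1)[OF z])
    then show "z \<in> chX k ` (pieceX (piv k) \<inter> (Lcover k \<inter> W))" by (rule family_chart_mem[OF k K1(2)[OF z]])
  qed
  obtain M where M: "\<And>z. z \<in> ?K \<Longrightarrow> \<phi> k (inv_into (pieceX (piv k)) (chX k) z) \<le> ereal M"
    by (rule psh_bounded_above_on_compact[OF psh_family_chart[OF \<phi> k] compact_polydisc sub]) (rule that)
  show ?thesis
  proof (rule that)
    fix t x y :: complex assume a: "norm t \<le> \<epsilon>" "norm x \<le> 1" "norm y \<le> 1"
    have z: "vector [t, x, y] \<in> ?K" using a by (simp add: forall_3)
    have d: "vector [t, x, y] \<in> disc3" unfolding disc3_def using a(1) \<epsilon> by simp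
    show "\<phi> k (par k t x y) \<le> ereal M" using M[OF z] unfolding chX_inverse(4)[OF k d] by simp
  qed
qed

text \<open>
  The curve \<open>C\<^sub>t\<close>, given by \<open>v\<^sub>4 = v\<^sub>5 = 0\<close>: it is \<open>y = 0\<close> in chart 2 and \<open>x = - t y\<close> in chart 1. As
  \<open>Ltrans 2 1\<close> is constant along it, the bundle is trivial on it.
\<close>

lemma moving_curve_point:
  assumes t: "norm t < 1" "t \<noteq> 0" and x: "x \<noteq> 0"
  shows "par 2 t x 0 = par 1 t (1 / x) (- 1 / (t * x))" "par 2 t x 0 \<in> Lcover 1" "Ltrans 2 1 (par 2 t x 0) = - t"
proof -
  have h: "hc 2 t x 0 (piv 1) = - (t * x ^ 2)" "hc 2 t x 0 (co1 1) = - (t * x)" "hc 2 t x 0 (co2 1) = x"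
    by (simp_all add: hc_def piv_def co1_def co2_def nth_Cons' del: One_nat_def)
  have n: "hc 2 t x 0 (piv 1) \<noteq> 0" unfolding h using t x by simp
  have l: "(2::nat) < 4" "(1::nat) < 4" by auto
  note ch = par_change[OF l t(1) n, unfolded h]
  show "par 2 t x 0 \<in> Lcover 1" by (rule ch(2))
  have "- (t * x) / - (t * x ^ 2) = 1 / x" "x / - (t * x ^ 2) = - 1 / (t * x)"
    using t x by (simp_all add: field_simps power2_eq_square)
  then show "par 2 t x 0 = par 1 t (1 / x) (- 1 / (t * x))" using ch(1) by (simp only:)
  show "Ltrans 2 1 (par 2 t x 0) = - t" unfolding ch(3) using x by simp
qed

text \<open>
  The maximum principle on \<open>C\<^sub>t\<close>. In chart 2 the point in question has the base coordinate \<open>-1/(t y)\<close>; on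
  the circle of radius \<open>2/\<bar>t\<bar>\<close> around it the coordinates of chart 1 have modulus at most 1, so the weight there is at most the bound \<open>M\<close> of a fixed polydisc.
\<close>

lemma moving_curve_bound:
  assumes \<phi>: "semipositive_metric famX atlasX (\<lambda>i. Lcover i \<inter> W) Ltrans \<phi>" and \<epsilon>: "\<epsilon> < 1"
    and W: "\<And>p. p \<in> scroll_family \<Longrightarrow> norm (fst p) \<le> \<epsilon> \<Longrightarrow> p \<in> W"
    and M: "\<And>t x y. norm t \<le> \<epsilon> \<Longrightarrow> norm x \<le> 1 \<Longrightarrow> norm y \<le> 1 \<Longrightarrow> \<phi> 1 (par 1 t x y) \<le> ereal M"
    and t: "t \<noteq> 0" "norm t \<le> \<epsilon>" and y: "1 \<le> norm y"
  shows "\<phi> 1 (par 1 t (- t * y) y) \<le> ereal M"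
proof -
  have t1: "norm t < 1" using t(2) \<epsilon> by linarith
  have y0: "y \<noteq> 0" using y by auto
  have l: "(2::nat) < 4" by simp
  have tp: "0 < norm t" using t(1) by simp
  have inW: "par 2 t x 0 \<in> W" for x
  proof (rule W)
    have "par 2 t x 0 \<in> pieceX (piv 2)" by (rule par_in_own_piece[OF l t1])
    then show "par 2 t x 0 \<in> scroll_family" unfolding pieceX_def by blast
  qed (simp add: t(2))
  have tr: "\<phi> 2 (par 2 t x 0) = \<phi> 1 (par 1 t (1 / x) (- 1 / (t * x))) + ereal (ln ((norm t)\<^sup>2))" if x: "x \<noteq> 0" for x
  proof -
    note mc = moving_curve_point[OF t1 t(1) x]
    have "\<phi> 2 (par 2 t x 0) = \<phi> 1 (par 2 t x 0) + ereal (ln ((norm (Ltrans 2 1 (par 2 t x 0)))\<^sup>2))"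
      by (rule semipositive_transition[OF \<phi>]) (use inW[of x] mc(2) par_Lcover[OF l t1] in auto)
    then show ?thesis unfolding mc(3) norm_minus_cancel unfolding mc(1) .
  qed
  \<comment> \<open>The centre has modulus at most \<open>1 / \<bar>t\<bar>\<close>, hence \<open>\<bar>x\<bar> \<ge> 1 / \<bar>t\<bar>\<close> on the circle of radius \<open>2 / \<bar>t\<bar>\<close>.\<close>
  let ?x = "- 1 / (t * y)" and ?r = "of_real (2 / norm t) :: complex"
  have x0: "?x \<noteq> 0" using t(1) y0 by simp
  have nx: "norm ?x \<le> 1 / norm t" using frac_le[of 1 1 "norm t" "norm t * norm y"] y tp by (simp add: norm_divide norm_mult)
  have "\<phi> 2 (par 2 t ?x 0) \<le> ereal (M + ln ((norm t)\<^sup>2))"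
  proof (rule family_circle_bound[OF \<phi> l, where a = 0 and b = ?r and c = 0])
    show "norm (t + \<zeta> * 0) < 1 \<and> par 2 (t + \<zeta> * 0) (?x + \<zeta> * ?r) (0 + \<zeta> * 0) \<in> W" for \<zeta>
      using inW t1 by simp
    fix \<theta>
    define x where "x = ?x + cis \<theta> * ?r"
    have nr: "norm (cis \<theta> * ?r) = 2 / norm t" using tp by (simp add: norm_mult norm_divide)
    have "2 / norm t - 1 / norm t \<le> norm x"
      using norm_diff_ineq[of "cis \<theta> * ?r" ?x] nr nx unfolding x_def by (simp add: add.commute)
    then have x1: "1 / norm t \<le> norm x" using tp by (simp add: field_simps)
    have xp: "0 < norm x" by (rule less_le_trans[OF _ x1]) (use tp in simp)
    then have xn: "x \<noteq> 0" by simp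
    have tx: "1 \<le> norm t * norm x" using x1 tp by (simp add: field_simps)
    have "norm t * norm x \<le> 1 * norm x" by (rule mult_right_mono) (use t1 in auto)
    then have "1 \<le> norm x" using tx by linarith
    then have "norm (1 / x) \<le> 1" using xp by (simp add: norm_divide divide_le_eq)
    moreover have "norm (- 1 / (t * x)) \<le> 1" using tx tp xp by (simp add: norm_divide norm_mult divide_le_eq)
    ultimately have "\<phi> 1 (par 1 t (1 / x) (- 1 / (t * x))) \<le> ereal M" by (rule M[OF t(2)])
    then have "\<phi> 2 (par 2 t x 0) \<le> ereal M + ereal (ln ((norm t)\<^sup>2))" unfolding tr[OF xn] by (rule add_right_mono)
    then show "\<phi> 2 (par 2 (t + cis \<theta> * 0) (?x + cis \<theta> * ?r) (0 + cis \<theta> * 0)) \<le> ereal (M + ln ((norm t)\<^sup>2))"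
      unfolding x_def mult_zero_right add_0_right plus_ereal.simps .
  qed
  moreover have "1 / ?x = - t * y" "- 1 / (t * ?x) = y" using t(1) y0 by (simp_all add: field_simps)
  ultimately have "\<phi> 1 (par 1 t (- t * y) y) + ereal (ln ((norm t)\<^sup>2)) \<le> ereal M + ereal (ln ((norm t)\<^sup>2))"
    using tr[OF x0] by (simp only: plus_ereal.simps)
  then show ?thesis by (cases "\<phi> 1 (par 1 t (- t * y) y)") auto
qed

text \<open>
  The circle in \<open>t\<close> is taken in the disc \<open>x = - t y\<close>, with \<open>y\<close> constant: for each \<open>t \<noteq> 0\<close> its point lies on
  \<open>C\<^sub>t\<close>, and the centre is a point of the fibre \<open>x = 0\<close> of the central surface.
\<close>

lemma no_extension:
  assumes W: "openin famX W" "F2 \<subseteq> W"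
    and \<phi>: "semipositive_metric famX atlasX (\<lambda>i. Lcover i \<inter> W) Ltrans \<phi>"
    and C: "\<And>i x. x \<in> L0cover i \<Longrightarrow> metric0 i x - ereal C \<le> \<phi> i x"
  shows False
proof -
  obtain \<epsilon> where \<epsilon>: "0 < \<epsilon>" "\<epsilon> < 1" and inW: "\<And>p. p \<in> scroll_family \<Longrightarrow> norm (fst p) \<le> \<epsilon> \<Longrightarrow> p \<in> W"
    by (rule fibres_near_0[OF W]) (rule that)
  have l: "(1::nat) < 4" by simp
  obtain M where M: "\<And>t x y. norm t \<le> \<epsilon> \<Longrightarrow> norm x \<le> 1 \<Longrightarrow> norm y \<le> 1 \<Longrightarrow> \<phi> 1 (par 1 t x y) \<le> ereal M"
    by (rule family_polydisc_bound[OF \<phi> l \<epsilon>(2) inW]) (assumption, assumption, rule that)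
  \<comment> \<open>\<open>\<phi>\<^sub>0\<close> is \<open>log \<bar>y\<bar>\<close> at the point \<open>(0, y)\<close>, and this choice makes it exceed \<open>M + C\<close>.\<close>
  define y :: complex where "y = of_real (exp (\<bar>M\<bar> + \<bar>C\<bar> + 1))"
  have ny: "norm y = exp (\<bar>M\<bar> + \<bar>C\<bar> + 1)" by (simp add: y_def)
  then have y1: "1 \<le> norm y" by simp
  have mc: "\<phi> 1 (par 1 t (- t * y) y) \<le> ereal M" if t: "t \<noteq> 0" "norm t \<le> \<epsilon>" for t
  proof (rule moving_curve_bound[OF \<phi> \<epsilon>(2) _ _ t y1])
    show "p \<in> W" if "p \<in> scroll_family" "norm (fst p) \<le> \<epsilon>" for p by (rule inW[OF that])
    show "\<phi> 1 (par 1 t x y) \<le> ereal M" if "norm t \<le> \<epsilon>" "norm x \<le> 1" "norm y \<le> 1" for t x y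
      by (rule M[OF that])
  qed
  have up: "\<phi> 1 (par 1 0 0 y) \<le> ereal M"
  proof (rule family_circle_bound[OF \<phi> l, where a = "of_real \<epsilon>" and b = "- of_real \<epsilon> * y" and c = 0])
    fix \<zeta> :: complex assume \<zeta>: "norm \<zeta> \<le> 1"
    have n: "norm (0 + \<zeta> * of_real \<epsilon>) \<le> \<epsilon>" using \<zeta> \<epsilon>(1) by (simp add: norm_mult)
    then have n1: "norm (0 + \<zeta> * of_real \<epsilon>) < 1" using \<epsilon>(2) by linarith
    have "par 1 (0 + \<zeta> * of_real \<epsilon>) (0 + \<zeta> * (- of_real \<epsilon> * y)) (y + \<zeta> * 0) \<in> pieceX (piv 1)"
      by (rule par_in_own_piece[OF l n1])
    then have "par 1 (0 + \<zeta> * of_real \<epsilon>) (0 + \<zeta> * (- of_real \<epsilon> * y)) (y + \<zeta> * 0) \<in> scroll_family"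
      unfolding pieceX_def by blast
    then show "norm (0 + \<zeta> * of_real \<epsilon>) < 1 \<and> par 1 (0 + \<zeta> * of_real \<epsilon>) (0 + \<zeta> * (- of_real \<epsilon> * y)) (y + \<zeta> * 0) \<in> W"
      using n1 inW n by simp
  next
    fix \<theta>
    let ?t = "cis \<theta> * of_real \<epsilon>"
    have "?t \<noteq> 0" using \<epsilon>(1) by simp
    moreover have "norm ?t \<le> \<epsilon>" using \<epsilon>(1) by (simp add: norm_mult)
    ultimately have "\<phi> 1 (par 1 ?t (- ?t * y) y) \<le> ereal M" by (rule mc)
    then show "\<phi> 1 (par 1 (0 + cis \<theta> * of_real \<epsilon>) (0 + cis \<theta> * (- of_real \<epsilon> * y)) (y + cis \<theta> * 0)) \<le> ereal M"
      by (simp add: mult.assoc)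
  qed
  have "par 1 0 0 y \<in> L0cover 1" using par_Lcover[OF l, of 0 0 y] par_fib[OF l, of 0 0 y] by simp
  from C[OF this] have "metric0 1 (par 1 0 0 y) - ereal C \<le> ereal M" using up by (rule order_trans)
  moreover have "metric0 1 (par 1 0 0 y) = ereal (\<bar>M\<bar> + \<bar>C\<bar> + 1)"
  proof -
    have "wt 1 0 y = norm y" using wt_odd[of 1 0 y] y1 by simp
    then show ?thesis unfolding metric0_def coords_par[OF l] elog_def using y1 by (simp add: ny)
  qed
  ultimately have "\<bar>M\<bar> + \<bar>C\<bar> + 1 - C \<le> M" by simp
  then show False by linarith
qed

theorem theorem1:
  shows "\<exists>(r::real) (X :: (complex \<times> hpoint) topology) (A :: (complex \<times> hpoint, 3) atlas) \<pi> U g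
     (X0 :: (complex \<times> hpoint) set) (A0 :: (complex \<times> hpoint, 2) atlas) \<phi>0.
     0 < r \<and>
     smooth_projective_morphism X A (ball 0 r) \<pi> \<and>
     (\<forall>t\<in>ball 0 r.
        rational_surface (subtopology X (fibre X \<pi> t)) (submanifold_atlas X A (fibre X \<pi> t))) \<and>
     line_bundle X A U g \<and> effective X A U g \<and>
     X0 = fibre X \<pi> 0 \<and> A0 = submanifold_atlas X A X0 \<and>
     semipositive_metric (subtopology X X0) A0 (\<lambda>i. U i \<inter> X0) g \<phi>0 \<and>
     analytic_singularities (subtopology X X0) A0 (\<lambda>i. U i \<inter> X0) \<phi>0 \<and>
     minimal_singularities (subtopology X X0) A0 (\<lambda>i. U i \<inter> X0) g \<phi>0 \<and>
     \<not> (\<exists>W \<phi>. openin X W \<and> X0 \<subseteq> W \<and>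
          semipositive_metric X A (\<lambda>i. U i \<inter> W) g \<phi> \<and>
          (\<forall>i. U i \<inter> X0 \<noteq> {} \<longrightarrow> (\<exists>x\<in>U i \<inter> X0. \<phi> i x \<noteq> -\<infinity>)) \<and>
          (\<exists>C. \<forall>i. \<forall>x\<in>U i \<inter> X0. \<phi> i x \<ge> \<phi>0 i x - ereal C)) \<and>
     (\<exists>E. E \<subseteq> X0 \<and> smooth_rational_curve (subtopology X X0) A0 E \<and>
          singular_support (subtopology X X0) (\<lambda>i. U i \<inter> X0) \<phi>0 = E \<and>
          has_generic_lelong_number A0 (\<lambda>i. U i \<inter> X0) \<phi>0 E (1/2))"
proof (rule exI[of _ 1], rule exI[of _ famX], rule exI[of _ atlasX], rule exI[of _ fst], rule exI[of _ Lcover],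
    rule exI[of _ Ltrans], rule exI[of _ F2], rule exI[of _ F2A], rule exI[of _ metric0], intro conjI)
  show "\<forall>t\<in>ball 0 1. rational_surface (fibT t) (fibA t)" by (intro ballI rational_fib) simp
  show "\<exists>E. E \<subseteq> F2 \<and> smooth_rational_curve F2T F2A E \<and> singular_support F2T L0cover metric0 = E \<and>
      has_generic_lelong_number F2A L0cover metric0 E (1/2)"
    by (intro exI[of _ negcurve] conjI negcurve_subset smooth_rational_negcurve singular_support_metric0 generic_lelong_metric0)
  show "\<not> (\<exists>W \<phi>. openin famX W \<and> F2 \<subseteq> W \<and>
          semipositive_metric famX atlasX (\<lambda>i. Lcover i \<inter> W) Ltrans \<phi> \<and>
          (\<forall>i. L0cover i \<noteq> {} \<longrightarrow> (\<exists>x\<in>L0cover i. \<phi> i x \<noteq> -\<infinity>)) \<and>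
          (\<exists>C. \<forall>i. \<forall>x\<in>L0cover i. \<phi> i x \<ge> metric0 i x - ereal C))"
  proof (intro notI, elim exE conjE)
    fix W \<phi> C
    assume W: "openin famX W" "F2 \<subseteq> W" and \<phi>: "semipositive_metric famX atlasX (\<lambda>i. Lcover i \<inter> W) Ltrans \<phi>"
      and C: "\<forall>i. \<forall>x\<in>L0cover i. \<phi> i x \<ge> metric0 i x - ereal C"
    show False by (rule no_extension[OF W \<phi>]) (rule C[rule_format])
  qed
qed (rule zero_less_one smooth_projective_famX line_bundle_L effective_L refl semipositive_metric0
    analytic_metric0 minimal_metric0)+

end
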